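(* Let $s_\wedge:\Omega\otimes_{\mathcal{B}}\Omega\to\Omega\otimes_{\mathcal{B}}\Omega$ be a map of the form $$s_\wedge|_{\Omega_x\otimes_{\mathcal{B}}\Omega_y}=c_{xy}\,\mathrm{id}-c'_{xy}\,\sigma_{xy},\qquad x,y\in\{+,-\},$$ with scalars $c_{xy},c'_{xy}$, where $\sigma_{xy}$ is the restriction of the generalized braiding $\sigma$ to $\Omega_x\otimes_{\mathcal{B}}\Omega_y$. Suppose that: (1) $s_\wedge$ descends to a map $\Omega^2\to\Omega\otimes_{\mathcal{B}}\Omega$ (i.e. it vanishes on $\ker\wedge$); (2) $\wedge\circ s_\wedge=\wedge$. Then $s_\wedge$ must be of the form $$s_\wedge(\partial p\otimes\partial p)=\frac{1}{1+q^{-(\alpha_s,\alpha_s)}}(\mathrm{id}-q^{-(\alpha_s,\alpha_s)}\sigma_{++})(\partial p\otimes\partial p),$$ $$s_\wedge(\bar\partial p\otimes\bar\partial p)=\frac{1}{1+q^{(\alpha_s,\alpha_s)}}(\mathrm{id}-q^{(\alpha_s,\alpha_s)}\sigma_{--})(\bar\partial p\otimes\bar\partial p),$$ $$s_\wedge(\partial p\otimes\bar\partial p)=(c_{+-}\,\mathrm{id}-c_{-+}\,\sigma_{+-})(\partial p\otimes\bar\partial p),$$ $$s_\wedge(\bar\partial p\otimes\partial p)=(c_{-+}\,\mathrm{id}-c_{+-}\,\sigma_{-+})(\bar\partial p\otimes\partial p).$$ In addition, $c_{+-}+c_{-+}=1$.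
   Context: **Quantum group data.** Fix an integer $r\ge 1$, a real number $0<q<1$ and $s\in\{1,r\}$. $U_q(\mathfrak{sl}_{r+1})$ is the quantized enveloping algebra with generators $K_i^{\pm1},E_i,F_i$, $1\le i\le r$ (Klimyk–Schmüdgen conventions: $\Delta(K_i)=K_i\otimes K_i$, $\Delta(E_i)=E_i\otimes K_i+1\otimes E_i$, $\Delta(F_i)=F_i\otimes 1+K_i^{-1}\otimes F_i$; $K_i$ acts on a vector of weight $\mu$ by $q^{(\alpha_i,\mu)}$). Here $\alpha_i$ are the simple roots, $\omega_i$ the fundamental weights, $\rho=\sum_i\omega_i$, $w_0$ the longest Weyl group element, $(\cdot,\cdot)$ the invariant form with $(\alpha_i,\alpha_i)=2$. Put $a=(\alpha_s,\alpha_s)=2$, $w=(\omega_s,\omega_s)$, $m=(\omega_s,2\rho)=r$. $V(\lambda)$ is the simple type 1 module of highest weight $\lambda$, $V=V(\omega_s)$, and $V^*$ is its dual with $(Xf)(v)=f(S(X)v)$, $S$ the antipode. $\hat{R}_{X,Y}:X\otimes Y\to Y\otimes X$ is the braiding on finite-dimensional type 1 modules determined by being a module map with $\hat{R}_{V(\lambda),V(\mu)}(v\otimes u)=q^{(\lambda,w_0\mu)}u\otimes v$ for $v$ a highest weight vector of $V(\lambda)$ and $u$ a lowest weight vector of $V(\mu)$. Let $(v_i)$ be a weight basis of $V$ with weights $\lambda_i$ and dual basis $(f^i)$ of $V^*$. Define $\mathsf{E}:V^*\otimes V\to\mathbb{C}$, $\mathsf{E}(f^i\otimes v_j)=\delta_{ij}$,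 and $\mathsf{E}':V\otimes V^*\to\mathbb{C}$, $\mathsf{E}'(v_i\otimes f^j)=q^{(\lambda_i,2\rho)}\delta_{ij}$. Subscripts indicate the tensor legs on which a map acts; products of maps are compositions (rightmost first), legs being renumbered after each contraction. Put $$\mathsf{S}_{123}=(\hat{R}_{V,V^*})_{23}(\hat{R}_{V,V})_{12}(\hat{R}_{V,V^*}^{-1})_{23},\quad \tilde{\mathsf{S}}_{234}=(\hat{R}_{V,V^*})_{23}(\hat{R}_{V^*,V^*}^{-1})_{34}(\hat{R}_{V,V^*}^{-1})_{23},\quad \mathsf{T}_{1234}=\mathsf{S}_{123}\tilde{\mathsf{S}}_{234}=\tilde{\mathsf{S}}_{234}\mathsf{S}_{123}$$ (acting on $V\otimes V^*\otimes V$, $V^*\otimes V\otimes V^*$, $V\otimes V^*\otimes V\otimes V^*$ at the indicated legs). **Index-free notation.** A family $x=(x^{ij})_{1\le i,j\le r+1}$ is identified with $\sum_{i,j}v_i\otimes f^j\otimes x^{ij}$; products of families $xy$ (also $x\otimes y$, $x\wedge y$) denote $\sum v_i\otimes f^j\otimes v_k\otimes f^l\otimes x^{ij}y^{kl}$ (resp. with $\otimes_{\mathcal{B}}$, $\wedge$), and similarly for more factors. The maps above act on the $V,V^*$ legs; other maps act on components. Elements such as $g_{+-}$ below carry no legs. **Algebra and first-order calculus.** $\mathcal{B}$ is the unital algebra generated by $p^{ij}$, $1\le i,j\le r+1$, with relations $\mathsf{S}_{123}pp=q^{w}pp$, $\tilde{\mathsf{S}}_{234}pp=q^{-w}pp$,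 $\mathsf{E}'_{12}p=q^{m}$ (the algebra of the quantum projective space). The Heckenberger–Kolb first-order differential calculus is $\Omega=\Omega_+\oplus\Omega_-$, with $\Omega_+,\Omega_-$ generated as left $\mathcal{B}$-modules by $\partial p^{ij}$, resp. $\bar\partial p^{ij}$, with relations $$\tilde{\mathsf{S}}_{234}p\,\partial p=q^{-w}p\,\partial p,\quad \mathsf{E}'_{12}\partial p=0,\qquad \mathsf{S}_{123}p\,\bar\partial p=q^{w}p\,\bar\partial p,\quad \mathsf{E}'_{12}\bar\partial p=0,$$ right module structure $\partial p\,p=q^{a}\mathsf{T}_{1234}p\,\partial p$, $\bar\partial p\,p=q^{-a}\mathsf{T}_{1234}p\,\bar\partial p$, and differential $\mathrm{d}=\partial+\bar\partial$, where $\partial,\bar\partial:\mathcal{B}\to\Omega_\pm$ are the derivations with $p^{ij}\mapsto\partial p^{ij},\bar\partial p^{ij}$. **Universal calculus.** $\Omega^\bullet$ is the quotient of the tensor algebra $T_{\mathcal{B}}(\Omega)$ by the two-sided ideal generated by $\{\sum_i\mathrm{d}a_i\otimes\mathrm{d}b_i:\sum_i a_i\mathrm{d}b_i=0\}\subset\Omega\otimes_{\mathcal{B}}\Omega$; its product is $\wedge$, and $\wedge:\Omega\otimes_{\mathcal{B}}\Omega\to\Omega^2$ denotes the product of one-forms. **Metric components.** $g_{+-}=\mathsf{E}'_{12}\mathsf{E}_{23}\,\partial p\otimes\bar\partial p$ and $g_{-+}=\mathsf{E}'_{12}\mathsf{E}_{23}\,\bar\partial p\otimes\partial p$ in $\Omega\otimes_{\mathcal{B}}\Omega$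 (central elements). **Generalized braiding.** $\sigma$ is the (well-defined) $\mathcal{B}$-bimodule map $\Omega\otimes_{\mathcal{B}}\Omega\to\Omega\otimes_{\mathcal{B}}\Omega$ given by $$\sigma(\partial p\otimes\partial p)=q^{a}\mathsf{S}_{123}\tilde{\mathsf{S}}_{234}\,\partial p\otimes\partial p,\qquad \sigma(\bar\partial p\otimes\bar\partial p)=q^{-a}\mathsf{S}_{123}\tilde{\mathsf{S}}_{234}\,\bar\partial p\otimes\bar\partial p,$$ $$\sigma(\partial p\otimes\bar\partial p)=q^{2a-2w}\mathsf{S}_{123}\tilde{\mathsf{S}}_{234}^{-1}\,\bar\partial p\otimes\partial p+(1-q^{a})q^{a}q^{-m}\,p\,g_{-+}\,p,$$ $$\sigma(\bar\partial p\otimes\partial p)=q^{2w-2a}\mathsf{S}_{123}^{-1}\tilde{\mathsf{S}}_{234}\,\partial p\otimes\bar\partial p+(1-q^{-a})q^{-m}\,p\,g_{+-}\,p.$$ *)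

theory Defs
  imports "HOL-Analysis.Analysis" "HOL-Library.Poly_Mapping"
begin

section \<open>Weights of type A\<close>

text \<open>
  Weights of \<open>sl(r+1)\<close> are realised in the trace-zero hyperplane of
  Euclidean space with coordinates \<open>1, ..., r+1\<close>; the Weyl group is the symmetric group permuting
  these coordinates.
\<close>

type_synonym weight = "nat \<Rightarrow> real"

definition form :: "nat \<Rightarrow> weight \<Rightarrow> weight \<Rightarrow> real" where
  "form r \<mu> \<nu> = (\<Sum>k=1..r+1. \<mu> k * \<nu> k)"

definition simple_root :: "nat \<Rightarrow> weight" where
  "simple_root i = (\<lambda>k. if k = i then 1 else if k = i + 1 then -1 else 0)"

definition fund_weight :: "nat \<Rightarrow> nat \<Rightarrow> weight" where
  "fund_weight r i = (\<lambda>k. (if 1 \<le> k \<and> k \<le> i then 1 else 0)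
                        - (if 1 \<le> k \<and> k \<le> r + 1 then real i / real (r + 1) else 0))"

definition weight_lattice :: "nat \<Rightarrow> weight set" where
  "weight_lattice r = {\<mu>. \<exists>n :: nat \<Rightarrow> int. \<mu> = (\<lambda>k. \<Sum>i=1..r. of_int (n i) * fund_weight r i k)}"

definition two_rho :: "nat \<Rightarrow> weight" where
  "two_rho r = (\<lambda>k. 2 * (\<Sum>i=1..r. fund_weight r i k))"

text \<open>The longest element of the symmetric group reverses the order of the coordinates.\<close>

definition w0 :: "nat \<Rightarrow> weight \<Rightarrow> weight" where
  "w0 r \<mu> = (\<lambda>k. \<mu> (r + 2 - k))"

section \<open>Finite-dimensional modules over the quantized enveloping algebra\<close>

text \<open>
  A module with a chosen basis indexed by \<open>'n\<close> is given by the matrices of the generators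
  \<open>K\<^sub>i\<close>, \<open>K\<^sub>i\<^sup>-\<^sup>1\<close>, \<open>E\<^sub>i\<close>, \<open>F\<^sub>i\<close>; only the indices \<open>1 \<le> i \<le> r\<close> matter.
\<close>

record 'n uq_module =
  Kop :: "nat \<Rightarrow> complex^'n^'n"
  Kinv :: "nat \<Rightarrow> complex^'n^'n"
  Eop :: "nat \<Rightarrow> complex^'n^'n"
  Fop :: "nat \<Rightarrow> complex^'n^'n"

definition q_serre :: "real \<Rightarrow> nat \<Rightarrow> (nat \<Rightarrow> complex^'n^'n) \<Rightarrow> bool" where
  "q_serre q r X \<longleftrightarrow> (\<forall>i\<in>{1..r}. \<forall>j\<in>{1..r}.
     (form r (simple_root i) (simple_root j) = 0 \<longrightarrow> X i ** X j = X j ** X i) \<and>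
     (form r (simple_root i) (simple_root j) = -1 \<longrightarrow>
        X i ** X i ** X j - (q + 1 / q) *\<^sub>R (X i ** X j ** X i) + X j ** X i ** X i = 0))"

definition is_uq_module :: "nat \<Rightarrow> real \<Rightarrow> ('n::finite) uq_module \<Rightarrow> bool" where
  "is_uq_module r q M \<longleftrightarrow>
     (\<forall>i\<in>{1..r}. Kop M i ** Kinv M i = mat 1 \<and> Kinv M i ** Kop M i = mat 1) \<and>
     (\<forall>i\<in>{1..r}. \<forall>j\<in>{1..r}.
        Kop M i ** Kop M j = Kop M j ** Kop M i \<and>
        Kop M i ** Eop M j ** Kinv M i
          = (q powr form r (simple_root i) (simple_root j)) *\<^sub>R Eop M j \<and>
        Kop M i ** Fop M j ** Kinv M i
          = (q powr (- form r (simple_root i) (simple_root j))) *\<^sub>R Fop M j \<and>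
        Eop M i ** Fop M j - Fop M j ** Eop M i
          = (if i = j then (1 / (q - 1 / q)) *\<^sub>R (Kop M i - Kinv M i) else 0)) \<and>
     q_serre q r (Eop M) \<and> q_serre q r (Fop M)"

definition has_weight :: "nat \<Rightarrow> real \<Rightarrow> ('n::finite) uq_module \<Rightarrow> weight \<Rightarrow> complex^'n \<Rightarrow> bool" where
  "has_weight r q M \<mu> v \<longleftrightarrow> \<mu> \<in> weight_lattice r \<and>
     (\<forall>i\<in>{1..r}. Kop M i *v v = (q powr form r (simple_root i) \<mu>) *\<^sub>R v)"

definition highest_weight_vector where
  "highest_weight_vector r q M \<mu> v \<longleftrightarrow>
     v \<noteq> 0 \<and> has_weight r q M \<mu> v \<and> (\<forall>i\<in>{1..r}. Eop M i *v v = 0)"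

definition lowest_weight_vector where
  "lowest_weight_vector r q M \<mu> v \<longleftrightarrow>
     v \<noteq> 0 \<and> has_weight r q M \<mu> v \<and> (\<forall>i\<in>{1..r}. Fop M i *v v = 0)"

definition submodule :: "nat \<Rightarrow> ('n::finite) uq_module \<Rightarrow> (complex^'n) set \<Rightarrow> bool" where
  "submodule r M W \<longleftrightarrow> vec.subspace W \<and>
     (\<forall>i\<in>{1..r}. \<forall>x\<in>W. Kop M i *v x \<in> W \<and> Kinv M i *v x \<in> W \<and> Eop M i *v x \<in> W \<and> Fop M i *v x \<in> W)"

text \<open>\<open>M\<close> is (isomorphic to) the simple type 1 module \<open>V(\<mu>)\<close>.\<close>

definition is_simple_hw_module :: "nat \<Rightarrow> real \<Rightarrow> ('n::finite) uq_module \<Rightarrow> weight \<Rightarrow> bool" where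
  "is_simple_hw_module r q M \<mu> \<longleftrightarrow> is_uq_module r q M \<and>
     (\<forall>W. submodule r M W \<longrightarrow> W = {0} \<or> W = UNIV) \<and>
     (\<exists>v. highest_weight_vector r q M \<mu> v)"

text \<open>
  The dual module in the dual basis: \<open>(X f)(v) = f(S(X) v)\<close> means that \<open>X\<close> acts by the transpose
  of \<open>S(X)\<close>, where \<open>S(K\<^sub>i) = K\<^sub>i\<^sup>-\<^sup>1\<close>, \<open>S(E\<^sub>i) = - E\<^sub>i K\<^sub>i\<^sup>-\<^sup>1\<close>, \<open>S(F\<^sub>i) = - K\<^sub>i F\<^sub>i\<close>.
\<close>

definition dual_module :: "('n::finite) uq_module \<Rightarrow> 'n uq_module" where
  "dual_module M = \<lparr>
     Kop = (\<lambda>i. transpose (Kinv M i)),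
     Kinv = (\<lambda>i. transpose (Kop M i)),
     Eop = (\<lambda>i. transpose (- (Eop M i ** Kinv M i))),
     Fop = (\<lambda>i. transpose (- (Kop M i ** Fop M i)))\<rparr>"

definition kron :: "complex^('n::finite)^'n \<Rightarrow> complex^('m::finite)^'m \<Rightarrow> complex^('n \<times> 'm)^('n \<times> 'm)" where
  "kron A B = (\<chi> I J. A $ fst I $ fst J * B $ snd I $ snd J)"

definition tensor_vec :: "complex^('n::finite) \<Rightarrow> complex^('m::finite) \<Rightarrow> complex^('n \<times> 'm)" where
  "tensor_vec v u = (\<chi> I. v $ fst I * u $ snd I)"

definition tensor_module ::
  "('n::finite) uq_module \<Rightarrow> ('m::finite) uq_module \<Rightarrow> ('n \<times> 'm) uq_module" where
  "tensor_module X Y = \<lparr>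
     Kop = (\<lambda>i. kron (Kop X i) (Kop Y i)),
     Kinv = (\<lambda>i. kron (Kinv X i) (Kinv Y i)),
     Eop = (\<lambda>i. kron (Eop X i) (Kop Y i) + kron (mat 1) (Eop Y i)),
     Fop = (\<lambda>i. kron (Fop X i) (mat 1) + kron (Kinv X i) (Fop Y i))\<rparr>"

definition module_map ::
  "nat \<Rightarrow> ('n::finite) uq_module \<Rightarrow> ('m::finite) uq_module \<Rightarrow> complex^'n^'m \<Rightarrow> bool" where
  "module_map r X Y f \<longleftrightarrow> (\<forall>i\<in>{1..r}.
     f ** Kop X i = Kop Y i ** f \<and> f ** Kinv X i = Kinv Y i ** f \<and>
     f ** Eop X i = Eop Y i ** f \<and> f ** Fop X i = Fop Y i ** f)"

text \<open>
  The braiding of two simple type 1 modules. It is unique since the tensor product of a highest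
  and a lowest weight vector generates the tensor product module.
\<close>

definition is_braiding ::
  "nat \<Rightarrow> real \<Rightarrow> ('n::finite) uq_module \<Rightarrow> ('m::finite) uq_module \<Rightarrow> complex^('n \<times> 'm)^('m \<times> 'n) \<Rightarrow> bool"
where
  "is_braiding r q X Y R \<longleftrightarrow>
     module_map r (tensor_module X Y) (tensor_module Y X) R \<and>
     (\<forall>\<mu> \<nu> v y u. highest_weight_vector r q X \<mu> v \<longrightarrow> highest_weight_vector r q Y \<nu> y \<longrightarrow>
        lowest_weight_vector r q Y (w0 r \<nu>) u \<longrightarrow>
        R *v tensor_vec v u = (q powr form r \<mu> (w0 r \<nu>)) *\<^sub>R tensor_vec u v)"

definition braiding ::
  "nat \<Rightarrow> real \<Rightarrow> ('n::finite) uq_module \<Rightarrow> ('m::finite) uq_module \<Rightarrow> complex^('n \<times> 'm)^('m \<times> 'n)"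
where
  "braiding r q X Y = (THE R. is_braiding r q X Y R)"

section \<open>Index-free notation\<close>

text \<open>
  A family \<open>x\<close> indexed by \<open>(i, j, k, l)\<close> stands for the sum of
  \<open>v\<^sub>i \<otimes> f\<^sup>j \<otimes> v\<^sub>k \<otimes> f\<^sup>l \<otimes> x (i, j, k, l)\<close>. A linear map \<open>M\<close> on the legs acts on it through
  the components by matrix multiplication. The argument \<open>sc\<close> is the scalar multiplication of the
  space containing the components.
\<close>

definition on_legs ::
  "(complex \<Rightarrow> 'm \<Rightarrow> 'm) \<Rightarrow> complex^('l::finite)^'l \<Rightarrow> ('l \<Rightarrow> 'm::comm_monoid_add) \<Rightarrow> 'l \<Rightarrow> 'm" where
  "on_legs sc M x = (\<lambda>I. \<Sum>J\<in>UNIV. sc (M $ I $ J) (x J))"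

definition contract12 ::
  "(complex \<Rightarrow> 'm \<Rightarrow> 'm) \<Rightarrow> ('n::finite \<times> 'n \<Rightarrow> complex) \<Rightarrow> ('n \<times> 'n \<Rightarrow> 'm::comm_monoid_add) \<Rightarrow> 'm" where
  "contract12 sc e x = (\<Sum>I\<in>UNIV. sc (e I) (x I))"

definition contract23 ::
  "(complex \<Rightarrow> 'm \<Rightarrow> 'm) \<Rightarrow> ('n::finite \<times> 'n \<Rightarrow> complex) \<Rightarrow> ('n \<times> 'n \<times> 'n \<times> 'n \<Rightarrow> 'm::comm_monoid_add)
     \<Rightarrow> 'n \<times> 'n \<Rightarrow> 'm" where
  "contract23 sc e x = (\<lambda>(i, l). \<Sum>(j, k)\<in>UNIV. sc (e (j, k)) (x (i, j, k, l)))"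

definition fam_prod ::
  "('a \<Rightarrow> 'b \<Rightarrow> 'c) \<Rightarrow> ('n \<times> 'n \<Rightarrow> 'a) \<Rightarrow> ('n \<times> 'n \<Rightarrow> 'b) \<Rightarrow> 'n \<times> 'n \<times> 'n \<times> 'n \<Rightarrow> 'c" where
  "fam_prod f x y = (\<lambda>(i, j, k, l). f (x (i, j)) (y (k, l)))"

definition leg12 ::
  "complex^('n::finite \<times> 'n)^('n \<times> 'n) \<Rightarrow> complex^('n \<times> 'n \<times> 'n \<times> 'n)^('n \<times> 'n \<times> 'n \<times> 'n)" where
  "leg12 M = (\<chi> I J. case (I, J) of ((i, j, k, l), (i', j', k', l')) \<Rightarrow>
     if k = k' \<and> l = l' then M $ (i, j) $ (i', j') else 0)"

definition leg23 ::
  "complex^('n::finite \<times> 'n)^('n \<times> 'n) \<Rightarrow> complex^('n \<times> 'n \<times> 'n \<times> 'n)^('n \<times> 'n \<times> 'n \<times> 'n)" where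
  "leg23 M = (\<chi> I J. case (I, J) of ((i, j, k, l), (i', j', k', l')) \<Rightarrow>
     if i = i' \<and> l = l' then M $ (j, k) $ (j', k') else 0)"

definition leg34 ::
  "complex^('n::finite \<times> 'n)^('n \<times> 'n) \<Rightarrow> complex^('n \<times> 'n \<times> 'n \<times> 'n)^('n \<times> 'n \<times> 'n \<times> 'n)" where
  "leg34 M = (\<chi> I J. case (I, J) of ((i, j, k, l), (i', j', k', l')) \<Rightarrow>
     if i = i' \<and> j = j' then M $ (k, l) $ (k', l') else 0)"

section \<open>Algebras, bimodules and presentations\<close>

text \<open>
  A unital complex algebra is a ring \<open>'b\<close> together with a unit map \<open>\<eta>\<close>; a left action \<open>act\<close> of
  \<open>'b\<close> induces the complex scalar multiplication \<open>scl \<eta> act\<close>.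
\<close>

definition complex_algebra :: "(complex \<Rightarrow> 'b::ring_1) \<Rightarrow> bool" where
  "complex_algebra \<eta> \<longleftrightarrow> \<eta> 1 = 1 \<and> (\<forall>x y. \<eta> (x + y) = \<eta> x + \<eta> y) \<and>
     (\<forall>x y. \<eta> (x * y) = \<eta> x * \<eta> y) \<and> (\<forall>x b. \<eta> x * b = b * \<eta> x)"

definition scl :: "(complex \<Rightarrow> 'b) \<Rightarrow> ('b \<Rightarrow> 'm \<Rightarrow> 'm) \<Rightarrow> complex \<Rightarrow> 'm \<Rightarrow> 'm" where
  "scl \<eta> act c x = act (\<eta> c) x"

definition left_module :: "('b::ring_1 \<Rightarrow> 'm \<Rightarrow> 'm::ab_group_add) \<Rightarrow> bool" where
  "left_module lact \<longleftrightarrow> (\<forall>a. Modules.additive (lact a)) \<and> (\<forall>x. Modules.additive (\<lambda>a. lact a x)) \<and>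
     (\<forall>x. lact 1 x = x) \<and> (\<forall>a b x. lact (a * b) x = lact a (lact b x))"

definition right_module :: "('m \<Rightarrow> 'b::ring_1 \<Rightarrow> 'm::ab_group_add) \<Rightarrow> bool" where
  "right_module ract \<longleftrightarrow> (\<forall>a. Modules.additive (\<lambda>x. ract x a)) \<and> (\<forall>x. Modules.additive (ract x)) \<and>
     (\<forall>x. ract x 1 = x) \<and> (\<forall>a b x. ract x (a * b) = ract (ract x a) b)"

definition bimodule ::
  "(complex \<Rightarrow> 'b::ring_1) \<Rightarrow> ('b \<Rightarrow> 'm \<Rightarrow> 'm) \<Rightarrow> ('m \<Rightarrow> 'b \<Rightarrow> 'm::ab_group_add) \<Rightarrow> bool" where
  "bimodule \<eta> lact ract \<longleftrightarrow> left_module lact \<and> right_module ract \<and>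
     (\<forall>a x b. lact a (ract x b) = ract (lact a x) b) \<and> (\<forall>c x. lact (\<eta> c) x = ract x (\<eta> c))"

inductive_set subgroup_gen :: "'m::ab_group_add set \<Rightarrow> 'm set" for S where
  zero: "0 \<in> subgroup_gen S"
| gen: "x \<in> S \<Longrightarrow> x \<in> subgroup_gen S"
| add: "x \<in> subgroup_gen S \<Longrightarrow> y \<in> subgroup_gen S \<Longrightarrow> x + y \<in> subgroup_gen S"
| minus: "x \<in> subgroup_gen S \<Longrightarrow> - x \<in> subgroup_gen S"

inductive_set left_gen :: "('b \<Rightarrow> 'm \<Rightarrow> 'm) \<Rightarrow> 'm::ab_group_add set \<Rightarrow> 'm set" for act S where
  zero: "0 \<in> left_gen act S"
| gen: "x \<in> S \<Longrightarrow> x \<in> left_gen act S"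
| add: "x \<in> left_gen act S \<Longrightarrow> y \<in> left_gen act S \<Longrightarrow> x + y \<in> left_gen act S"
| act: "x \<in> left_gen act S \<Longrightarrow> act b x \<in> left_gen act S"

inductive_set sub_bimodule_gen ::
  "('b \<Rightarrow> 'm \<Rightarrow> 'm) \<Rightarrow> ('m \<Rightarrow> 'b \<Rightarrow> 'm) \<Rightarrow> 'm::ab_group_add set \<Rightarrow> 'm set" for lact ract S where
  zero: "0 \<in> sub_bimodule_gen lact ract S"
| gen: "x \<in> S \<Longrightarrow> x \<in> sub_bimodule_gen lact ract S"
| add: "x \<in> sub_bimodule_gen lact ract S \<Longrightarrow> y \<in> sub_bimodule_gen lact ract S
          \<Longrightarrow> x + y \<in> sub_bimodule_gen lact ract S"
| lact: "x \<in> sub_bimodule_gen lact ract S \<Longrightarrow> lact b x \<in> sub_bimodule_gen lact ract S"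
| ract: "x \<in> sub_bimodule_gen lact ract S \<Longrightarrow> ract x b \<in> sub_bimodule_gen lact ract S"

abbreviation two_sided_ideal_gen :: "'a::ring_1 set \<Rightarrow> 'a set" where
  "two_sided_ideal_gen S \<equiv> sub_bimodule_gen (*) (*) S"

text \<open>The free monoid; its monoid algebra is the free associative algebra.\<close>

datatype 'x word = Word (letters: "'x list")

instantiation word :: (type) monoid_add
begin
definition "0 = Word []"
definition "u + v = Word (letters u @ letters v)"
instance by standard (simp_all add: zero_word_def plus_word_def)
end

type_synonym 'x free_algebra = "'x word \<Rightarrow>\<^sub>0 complex"

definition free_gen :: "'x \<Rightarrow> 'x free_algebra" where
  "free_gen x = Poly_Mapping.single (Word [x]) 1"

definition free_unit :: "complex \<Rightarrow> 'x free_algebra" where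
  "free_unit c = Poly_Mapping.single 0 c"

definition free_eval :: "(complex \<Rightarrow> 'b::ring_1) \<Rightarrow> ('x \<Rightarrow> 'b) \<Rightarrow> 'x free_algebra \<Rightarrow> 'b" where
  "free_eval \<eta> g f = (\<Sum>u\<in>Poly_Mapping.keys f. \<eta> (Poly_Mapping.lookup f u) * prod_list (map g (letters u)))"

text \<open>\<open>'b\<close> is the unital algebra with generators \<open>g\<close> and relators \<open>Rel\<close>.\<close>

definition algebra_presented ::
  "(complex \<Rightarrow> 'b::ring_1) \<Rightarrow> ('x \<Rightarrow> 'b) \<Rightarrow> 'x free_algebra set \<Rightarrow> bool" where
  "algebra_presented \<eta> g Rel \<longleftrightarrow> complex_algebra \<eta> \<and> surj (free_eval \<eta> g) \<and>
     (\<forall>f. free_eval \<eta> g f = 0 \<longleftrightarrow> f \<in> two_sided_ideal_gen Rel)"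

text \<open>
  The submodule generated by \<open>g\<close> is the left module with generators \<open>g\<close> and relators \<open>Rel\<close>. The free
  left module is \<open>'b^'x\<close>, on which \<open>*s\<close> is multiplication from the left.
\<close>

definition left_module_presented ::
  "('b::ring_1 \<Rightarrow> 'm \<Rightarrow> 'm::ab_group_add) \<Rightarrow> ('x::finite \<Rightarrow> 'm) \<Rightarrow> ('b^'x) set \<Rightarrow> bool" where
  "left_module_presented lact g Rel \<longleftrightarrow>
     (\<forall>c. (\<Sum>x\<in>UNIV. lact (c $ x) (g x)) = 0 \<longleftrightarrow> c \<in> left_gen (*s) Rel)"

text \<open>
  The tensor product over \<open>'b\<close> as a quotient of the free abelian group on pairs. An integer \<open>n\<close>
  acts as the element \<open>of_int n\<close> of \<open>'b\<close>.
\<close>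

definition tensor_relators ::
  "('b \<Rightarrow> 'm \<Rightarrow> 'm) \<Rightarrow> ('m \<Rightarrow> 'b \<Rightarrow> 'm::ab_group_add) \<Rightarrow> ('m \<times> 'm \<Rightarrow>\<^sub>0 int) set" where
  "tensor_relators lact ract =
     (let e = (\<lambda>x y. Poly_Mapping.single (x, y) (1::int)) in
       {e (x + x') y - e x y - e x' y | x x' y. True} \<union>
       {e x (y + y') - e x y - e x y' | x y y'. True} \<union>
       {e (ract x b) y - e x (lact b y) | x b y. True})"

definition tensor_eval ::
  "('b::ring_1 \<Rightarrow> 't \<Rightarrow> 't) \<Rightarrow> ('m \<Rightarrow> 'm \<Rightarrow> 't::ab_group_add) \<Rightarrow> ('m \<times> 'm \<Rightarrow>\<^sub>0 int) \<Rightarrow> 't" where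
  "tensor_eval lactT tens f =
     (\<Sum>(x, y)\<in>Poly_Mapping.keys f. lactT (of_int (Poly_Mapping.lookup f (x, y))) (tens x y))"

definition is_tensor_square ::
  "(complex \<Rightarrow> 'b::ring_1) \<Rightarrow> ('b \<Rightarrow> 'm \<Rightarrow> 'm) \<Rightarrow> ('m \<Rightarrow> 'b \<Rightarrow> 'm::ab_group_add) \<Rightarrow>
   ('m \<Rightarrow> 'm \<Rightarrow> 't::ab_group_add) \<Rightarrow> ('b \<Rightarrow> 't \<Rightarrow> 't) \<Rightarrow> ('t \<Rightarrow> 'b \<Rightarrow> 't) \<Rightarrow> bool" where
  "is_tensor_square \<eta> lact ract tens lactT ractT \<longleftrightarrow>
     bimodule \<eta> lactT ractT \<and>
     (\<forall>b x y. lactT b (tens x y) = tens (lact b x) y) \<and>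
     (\<forall>b x y. ractT (tens x y) b = tens x (ract y b)) \<and>
     surj (tensor_eval lactT tens) \<and>
     (\<forall>f. tensor_eval lactT tens f = 0 \<longleftrightarrow> f \<in> subgroup_gen (tensor_relators lact ract))"

definition derivation ::
  "(complex \<Rightarrow> 'b::ring_1) \<Rightarrow> ('b \<Rightarrow> 'm \<Rightarrow> 'm) \<Rightarrow> ('m \<Rightarrow> 'b \<Rightarrow> 'm::ab_group_add) \<Rightarrow> ('b \<Rightarrow> 'm) \<Rightarrow> bool" where
  "derivation \<eta> lact ract D \<longleftrightarrow> Modules.additive D \<and> (\<forall>c b. D (\<eta> c * b) = lact (\<eta> c) (D b)) \<and>
     (\<forall>a b. D (a * b) = ract (D a) b + lact a (D b))"

section \<open>The quantum projective space\<close>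

text \<open>
  \<open>V\<close> is given in coordinates with respect to a weight basis \<open>(v\<^sub>i)\<close>, so that \<open>v\<^sub>i\<close> is the
  standard basis vector \<open>axis i 1\<close>, and \<open>wt i\<close> is its weight \<open>\<lambda>\<^sub>i\<close>.
\<close>

locale quantum_group_data =
  fixes r s :: nat and q :: real and V :: "('n::finite) uq_module" and wt :: "'n \<Rightarrow> weight"
  assumes r_ge_1: "1 \<le> r" and q_pos: "0 < q" and q_less_1: "q < 1" and s_cases: "s \<in> {1, r}"
    and card_index: "CARD('n) = r + 1"
    and V_simple: "is_simple_hw_module r q V (fund_weight r s)"
    and weight_basis: "has_weight r q V (wt i) (axis i 1)"
begin

definition a :: real where "a = form r (simple_root s) (simple_root s)"
definition w :: real where "w = form r (fund_weight r s) (fund_weight r s)"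
definition m :: real where "m = form r (fund_weight r s) (two_rho r)"

definition qpow :: "real \<Rightarrow> complex" where "qpow x = complex_of_real (q powr x)"

definition R_VV where "R_VV = braiding r q V V"
definition R_VD where "R_VD = braiding r q V (dual_module V)"
definition R_DD where "R_DD = braiding r q (dual_module V) (dual_module V)"

definition S :: "complex^('n \<times> 'n \<times> 'n \<times> 'n)^('n \<times> 'n \<times> 'n \<times> 'n)" where
  "S = leg23 R_VD ** leg12 R_VV ** leg23 (matrix_inv R_VD)"

definition St :: "complex^('n \<times> 'n \<times> 'n \<times> 'n)^('n \<times> 'n \<times> 'n \<times> 'n)" where
  "St = leg23 R_VD ** leg34 (matrix_inv R_DD) ** leg23 (matrix_inv R_VD)"

definition T :: "complex^('n \<times> 'n \<times> 'n \<times> 'n)^('n \<times> 'n \<times> 'n \<times> 'n)" where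
  "T = S ** St"

definition Ev :: "'n \<times> 'n \<Rightarrow> complex" where
  "Ev = (\<lambda>(i, j). if i = j then 1 else 0)"

definition Ev' :: "'n \<times> 'n \<Rightarrow> complex" where
  "Ev' = (\<lambda>(i, j). if i = j then qpow (form r (wt i) (two_rho r)) else 0)"

text \<open>The defining relators of the algebra, in the free algebra on the symbols \<open>p\<^sup>i\<^sup>j\<close>.\<close>

definition B_relators :: "('n \<times> 'n) free_algebra set" where
  "B_relators =
     (let sc = scl free_unit (*); pp = fam_prod (*) free_gen free_gen in
       range (\<lambda>I. on_legs sc S pp I - sc (qpow w) (pp I)) \<union>
       range (\<lambda>I. on_legs sc St pp I - sc (qpow (- w)) (pp I)) \<union>
       {contract12 sc Ev' free_gen - free_unit (qpow m)})"

end

locale quantum_projective_space = quantum_group_data r s q V wt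
  for r s :: nat and q :: real and V :: "('n::finite) uq_module" and wt :: "'n \<Rightarrow> weight" +
  fixes \<eta> :: "complex \<Rightarrow> 'b::ring_1" and p :: "'n \<times> 'n \<Rightarrow> 'b"
  assumes B_presented: "algebra_presented \<eta> p B_relators"
begin

text \<open>
  The relators of the two modules of one-forms, in the free left module on symbols indexed by
  \<open>(i, j)\<close>; the symbols stand for \<open>\<partial>p\<^sup>i\<^sup>j\<close>, respectively for their conjugate counterparts.
\<close>

definition Omega_relators ::
  "complex^('n \<times> 'n \<times> 'n \<times> 'n)^('n \<times> 'n \<times> 'n \<times> 'n) \<Rightarrow> complex \<Rightarrow> ('b^('n \<times> 'n)) set" where
  "Omega_relators M c =
     (let sc = scl \<eta> (*s); e = (\<lambda>I. axis I 1); pe = fam_prod (*s) p e in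
       range (\<lambda>I. on_legs sc M pe I - sc c (pe I)) \<union> {contract12 sc Ev' e})"

end

section \<open>The Heckenberger--Kolb calculus\<close>

text \<open>
  The left submodule generated by all \<open>D p\<^sup>i\<^sup>j\<close>: for \<open>D = \<partial>\<close> and its conjugate, these are the two
  summands of the module of one-forms.
\<close>

definition Omega_part :: "('b \<Rightarrow> 'o \<Rightarrow> 'o) \<Rightarrow> ('x \<Rightarrow> 'b) \<Rightarrow> ('b \<Rightarrow> 'o::ab_group_add) \<Rightarrow> 'o set" where
  "Omega_part lact p D = left_gen lact (range (\<lambda>I. D (p I)))"

locale HK_calculus = quantum_projective_space r s q V wt \<eta> p
  for r s :: nat and q :: real and V :: "('n::finite) uq_module" and wt :: "'n \<Rightarrow> weight"
    and \<eta> :: "complex \<Rightarrow> 'b::ring_1" and p :: "'n \<times> 'n \<Rightarrow> 'b" +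
  fixes lact :: "'b \<Rightarrow> 'o \<Rightarrow> 'o::ab_group_add" and ract :: "'o \<Rightarrow> 'b \<Rightarrow> 'o"
    and del delbar :: "'b \<Rightarrow> 'o"
  assumes Omega_bimodule: "bimodule \<eta> lact ract"
    and del_derivation: "derivation \<eta> lact ract del"
    and delbar_derivation: "derivation \<eta> lact ract delbar"
    and Omega_direct_sum:
      "\<exists>!z. fst z \<in> Omega_part lact p del \<and> snd z \<in> Omega_part lact p delbar \<and> \<omega> = fst z + snd z"
    and Omega_plus_presented:
      "left_module_presented lact (\<lambda>I. del (p I)) (Omega_relators St (qpow (- w)))"
    and Omega_minus_presented:
      "left_module_presented lact (\<lambda>I. delbar (p I)) (Omega_relators S (qpow w))"
    and Omega_plus_right:
      "fam_prod ract (\<lambda>I. del (p I)) p J =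
         scl \<eta> lact (qpow a) (on_legs (scl \<eta> lact) T (fam_prod lact p (\<lambda>I. del (p I))) J)"
    and Omega_minus_right:
      "fam_prod ract (\<lambda>I. delbar (p I)) p J =
         scl \<eta> lact (qpow (- a)) (on_legs (scl \<eta> lact) T (fam_prod lact p (\<lambda>I. delbar (p I))) J)"
begin

definition d :: "'b \<Rightarrow> 'o" where "d b = del b + delbar b"

end

text \<open>
  \<open>tens\<close> is the tensor product of one-forms over the algebra and \<open>wedge\<close> the quotient map onto the
  two-forms of the universal calculus. The ideal defining the latter is generated in degree two, so
  its degree two component is the sub-bimodule generated by the same elements.
\<close>

locale universal_two_forms = HK_calculus r s q V wt \<eta> p lact ract del delbar
  for r s :: nat and q :: real and V :: "('n::finite) uq_module" and wt :: "'n \<Rightarrow> weight"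
    and \<eta> :: "complex \<Rightarrow> 'b::ring_1" and p :: "'n \<times> 'n \<Rightarrow> 'b"
    and lact :: "'b \<Rightarrow> 'o \<Rightarrow> 'o::ab_group_add" and ract :: "'o \<Rightarrow> 'b \<Rightarrow> 'o"
    and del delbar :: "'b \<Rightarrow> 'o" +
  fixes tens :: "'o \<Rightarrow> 'o \<Rightarrow> 't::ab_group_add"
    and lactT :: "'b \<Rightarrow> 't \<Rightarrow> 't" and ractT :: "'t \<Rightarrow> 'b \<Rightarrow> 't"
    and wedge :: "'t \<Rightarrow> 'w::ab_group_add"
  assumes tensor_square: "is_tensor_square \<eta> lact ract tens lactT ractT"
    and wedge_additive: "Modules.additive wedge"
    and wedge_surj: "surj wedge"
    and wedge_kernel:
      "wedge t = 0 \<longleftrightarrow> t \<in> sub_bimodule_gen lactT ractT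
         {\<Sum>(x, y)\<leftarrow>xs. tens (d x) (d y) | xs. (\<Sum>(x, y)\<leftarrow>xs. lact x (d y)) = 0}"
begin

abbreviation scT :: "complex \<Rightarrow> 't \<Rightarrow> 't" where "scT \<equiv> scl \<eta> lactT"
abbreviation dp where "dp \<equiv> (\<lambda>I. del (p I))"
abbreviation dbp where "dbp \<equiv> (\<lambda>I. delbar (p I))"

definition g_pm :: 't where
  "g_pm = contract12 scT Ev' (contract23 scT Ev (fam_prod tens dp dbp))"

definition g_mp :: 't where
  "g_mp = contract12 scT Ev' (contract23 scT Ev (fam_prod tens dbp dp))"

definition pgp :: "'t \<Rightarrow> 'n \<times> 'n \<times> 'n \<times> 'n \<Rightarrow> 't" where
  "pgp g = fam_prod (\<lambda>x y. lactT x (ractT g y)) p p"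

end

text \<open>The generalized braiding \<open>\<sigma>\<close>; it is determined by its values since the \<open>p\<close>-differentials
  generate the one-forms as a bimodule.\<close>

locale generalized_braiding =
  universal_two_forms r s q V wt \<eta> p lact ract del delbar tens lactT ractT wedge
  for r s :: nat and q :: real and V :: "('n::finite) uq_module" and wt :: "'n \<Rightarrow> weight"
    and \<eta> :: "complex \<Rightarrow> 'b::ring_1" and p :: "'n \<times> 'n \<Rightarrow> 'b"
    and lact :: "'b \<Rightarrow> 'o \<Rightarrow> 'o::ab_group_add" and ract :: "'o \<Rightarrow> 'b \<Rightarrow> 'o"
    and del delbar :: "'b \<Rightarrow> 'o"
    and tens :: "'o \<Rightarrow> 'o \<Rightarrow> 't::ab_group_add"
    and lactT :: "'b \<Rightarrow> 't \<Rightarrow> 't" and ractT :: "'t \<Rightarrow> 'b \<Rightarrow> 't"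
    and wedge :: "'t \<Rightarrow> 'w::ab_group_add" +
  fixes \<sigma> :: "'t \<Rightarrow> 't"
  assumes sigma_additive: "Modules.additive \<sigma>"
    and sigma_left: "\<sigma> (lactT b t) = lactT b (\<sigma> t)"
    and sigma_right: "\<sigma> (ractT t b) = ractT (\<sigma> t) b"
    and sigma_pp: "\<sigma> (fam_prod tens dp dp I) =
      scT (qpow a) (on_legs scT (S ** St) (fam_prod tens dp dp) I)"
    and sigma_mm: "\<sigma> (fam_prod tens dbp dbp I) =
      scT (qpow (- a)) (on_legs scT (S ** St) (fam_prod tens dbp dbp) I)"
    and sigma_pm: "\<sigma> (fam_prod tens dp dbp I) =
      scT (qpow (2 * a - 2 * w)) (on_legs scT (S ** matrix_inv St) (fam_prod tens dbp dp) I)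
      + scT ((1 - qpow a) * qpow a * qpow (- m)) (pgp g_mp I)"
    and sigma_mp: "\<sigma> (fam_prod tens dbp dp I) =
      scT (qpow (2 * w - 2 * a)) (on_legs scT (matrix_inv S ** St) (fam_prod tens dp dbp) I)
      + scT ((1 - qpow (- a)) * qpow (- m)) (pgp g_pm I)"

text \<open>The image of \<open>A \<otimes> B\<close> in the tensor square of the one-forms.\<close>

definition tensor_part :: "('o \<Rightarrow> 'o \<Rightarrow> 't::ab_group_add) \<Rightarrow> 'o set \<Rightarrow> 'o set \<Rightarrow> 't set" where
  "tensor_part tens A B = subgroup_gen {tens x y | x y. x \<in> A \<and> y \<in> B}"

datatype sign = Pos | Neg

end

theory Submission
  imports Defs
begin

text \<open>
  The scalars of a section \<open>s\<close> of the wedge product of the form \<open>c - c' \<sigma>\<close> are forced by three facts.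

  \<^item> For each of the four types of generators \<open>t\<close> of the tensor square, \<open>t + \<sigma> t\<close> is a relation
    between two-forms (\<open>wedge_sigma\<close>).
  \<^item> On the relations of pure type \<sigma> is a scalar \<kappa>, equal to \<open>q^a\<close> in type \<open>++\<close> and to \<open>q^(-a)\<close> in type
    \<open>--\<close> (\<open>sigma_on_relations\<close>); and \<open>(\<sigma> + 1) (\<sigma> - \<kappa>)\<close> vanishes on the generators of that type.
  \<^item> Some two-form of type \<open>+-\<close> is not zero (\<open>wedge_nonzero\<close>).

  Since \<open>s\<close> kills relations, the first fact gives \<open>s t + s (\<sigma> t) = 0\<close>. Since \<open>wedge (\<sigma> t) = - wedge t\<close>, the
  condition that \<open>s\<close> is a section gives \<open>(c + c' - 1) wedge t = 0\<close>. For a generator of pure type with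
  \<open>wedge t\<close> not zero, therefore, \<open>c + c' = 1\<close>; by the quadratic equation the first identity becomes
  \<open>(c - c' \<kappa>) (t + \<sigma> t) = 0\<close>, and so either \<open>c = c' \<kappa>\<close>, or \<open>\<sigma> t = - t\<close> and every section of this
  shape has the same value at \<open>t\<close>. If \<open>wedge t = 0\<close>, then \<open>\<sigma> t = \<kappa> t\<close> by the second fact, and both sides of the
  claim vanish. For a generator of mixed type the two identities hidden in \<open>s t + s (\<sigma> t) = 0\<close>, one
  in each of the summands of type \<open>+-\<close> and \<open>-+\<close>, say that \<open>c'\<close> of one type may be replaced by \<open>c\<close> of the
  other; the sum of the two is then 1 because of the third fact.

  The first fact is a computation in the calculus. It rests on explicit braidings: the vector
  representation has a basis along which each \<open>E\<close> and \<open>F\<close> makes a single step, a module map out of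
  the tensor product of two such modules is determined by one column (\<open>ladder_tensor_generated\<close>), and so
  the known R-matrices are verified to be the braidings. They yield the Hecke relation of \<open>S\<close> and the
  inverse of \<open>St\<close>, and the rule \<open>rotation\<close>, by which a strand is bent around a contraction.

  The other two facts need functionals that vanish on all relations between two-forms, although these
  relations are only given as differentials of relations between one-forms. A balanced pairing \<beta> of one-forms
  with values in a bimodule vanishes on them as soon as there is a map \<phi> with
  \<open>\<phi> (b x) = \<beta> (d b, x) + b \<phi> x\<close> and \<open>\<phi> (x b) = \<phi> x b - \<beta> (x, d b)\<close> that kills all \<open>d b\<close>
  (\<open>pairing_vanishes_on_relations\<close>); as the one-forms are presented by generators and relators, the
  existence of \<phi> comes down to identities between four-leg families (\<open>pairing_from_generators\<close>).
  The pairing \<open>(\<sigma> - \<kappa>) (\<pi> x \<otimes> \<pi> y)\<close>, with \<pi> the projection to one type and \<open>\<phi> = 0\<close> on generators,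
  gives the second fact. A complex-valued pairing, built from two derivations at the point of the
  quantum projective space that belongs to the highest weight, gives the third.
\<close>

section \<open>Weights\<close>

lemma form_simple_root:
  assumes "i \<in> {1..r}"
  shows "form r (simple_root i) \<mu> = \<mu> i - \<mu> (i + 1)"
proof -
  have "form r (simple_root i) \<mu> = (\<Sum>k\<in>{1..r+1}. (if k = i then \<mu> k else 0) - (if k = i + 1 then \<mu> k else 0))"
    unfolding form_def simple_root_def by (rule sum.cong) auto
  then show ?thesis using assms by (simp add: sum_subtractf)
qed

lemma form_simple_root_fund_weight:
  assumes "i \<in> {1..r}" "j \<in> {1..r}"
  shows "form r (simple_root i) (fund_weight r j) = (if i = j then 1 else 0)"
  using assms by (auto simp: form_simple_root fund_weight_def)

lemma form_sum_left:
  "form r (\<lambda>k. \<Sum>i\<in>A. n i * f i k) \<mu> = (\<Sum>i\<in>A. n i * form r (f i) \<mu>)"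
  by (simp only: form_def sum_distrib_left sum_distrib_right mult.assoc) (rule sum.swap)

lemma form_commute: "form r \<mu> \<nu> = form r \<nu> \<mu>"
  by (simp add: form_def mult.commute)

lemma weight_lattice_expansion:
  assumes "\<mu> \<in> weight_lattice r"
  shows "\<mu> = (\<lambda>k. \<Sum>i=1..r. form r (simple_root i) \<mu> * fund_weight r i k)"
proof -
  obtain n :: "nat \<Rightarrow> int" where n: "\<mu> = (\<lambda>k. \<Sum>i=1..r. of_int (n i) * fund_weight r i k)"
    using assms by (auto simp: weight_lattice_def)
  have "form r (simple_root j) \<mu> = n j" if "j \<in> {1..r}" for j
  proof -
    have "form r (simple_root j) \<mu> = form r \<mu> (simple_root j)" by (rule form_commute)
    also have "\<dots> = (\<Sum>i=1..r. of_int (n i) * form r (fund_weight r i) (simple_root j))"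
      unfolding n by (rule form_sum_left)
    also have "\<dots> = (\<Sum>i=1..r. if i = j then of_int (n i) else 0)"
      using that by (intro sum.cong) (auto simp: form_commute[of _ "fund_weight r _"] form_simple_root_fund_weight)
    finally show ?thesis using that by simp
  qed
  then show ?thesis by (subst n) (auto intro!: ext sum.cong)
qed

lemma sum_indicator_atLeastAtMost:
  "(\<Sum>i=1..r. if k \<le> i then 1 else (0::real)) = real (r + 1 - k)" if "1 \<le> k" "k \<le> r + 1"
proof -
  have "(\<Sum>i=1..r. if k \<le> i then 1 else (0::real)) = (\<Sum>i\<in>{k..r}. 1)"
    using that by (intro sum.mono_neutral_cong_right) auto
  then show ?thesis by simp
qed

lemma two_rho_component:
  assumes "1 \<le> k" "k \<le> r + 1"
  shows "two_rho r k = real r + 2 - 2 * real k"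
proof -
  have "(\<Sum>i=1..r. fund_weight r i k) = (\<Sum>i=1..r. if k \<le> i then 1 else 0) - (\<Sum>i=1..r. real i) / real (r + 1)"
    using assms by (simp add: fund_weight_def sum_subtractf sum_divide_distrib)
  also have "(\<Sum>i=1..r. real i) = real r * real (r + 1) / 2"
    by (induction r) (auto simp: field_simps)
  also have "(\<Sum>i=1..r. if k \<le> i then 1 else (0::real)) = real (r + 1 - k)"
    by (rule sum_indicator_atLeastAtMost[OF assms])
  also have "real r * real (r + 1) / 2 / real (r + 1) = real r / 2"
  proof -
    have "x * y / 2 / y = x / 2" if "y \<noteq> 0" for x y :: real using that by simp
    then show ?thesis by (metis of_nat_0_eq_iff add_is_0 one_neq_zero)
  qed
  finally show ?thesis using assms unfolding two_rho_def by (simp add: of_nat_diff)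
qed

lemma sum_two_rho: "(\<Sum>k=1..n. real r + 2 - 2 * real k) = real n * (real r + 1 - real n)"
  by (induction n) (auto simp: algebra_simps)

lemma form_fund_weight_two_rho:
  assumes "j \<in> {1..r}"
  shows "form r (fund_weight r j) (two_rho r) = real j * (real r + 1 - real j)"
proof -
  have "form r (fund_weight r j) (two_rho r)
      = (\<Sum>k=1..r+1. (if k \<le> j then real r + 2 - 2 * real k else 0) - real j / real (r + 1) * (real r + 2 - 2 * real k))"
    unfolding form_def by (rule sum.cong) (auto simp: fund_weight_def two_rho_component algebra_simps)
  also have "\<dots> = (\<Sum>k=1..r+1. if k \<le> j then real r + 2 - 2 * real k else 0)
      - real j / real (r + 1) * (\<Sum>k=1..r+1. real r + 2 - 2 * real k)"
    by (subst sum_subtractf) (simp only: sum_distrib_left)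
  also have "(\<Sum>k=1..r+1. if k \<le> j then real r + 2 - 2 * real k else 0) = (\<Sum>k=1..j. real r + 2 - 2 * real k)"
    using assms by (intro sum.mono_neutral_cong_right) auto
  finally show ?thesis by (simp only: sum_two_rho) (simp add: algebra_simps)
qed

lemma form_fund_weight_ends:
  assumes "1 \<le> r"
  shows "form r (fund_weight r 1) (fund_weight r 1) = 1 - 1 / real (r + 1)"
    and "form r (fund_weight r r) (fund_weight r r) = 1 - 1 / real (r + 1)"
    and "form r (fund_weight r 1) (w0 r (fund_weight r 1)) = - 1 / real (r + 1)"
    and "form r (fund_weight r r) (w0 r (fund_weight r r)) = - 1 / real (r + 1)"
    and "form r (fund_weight r 1) (w0 r (fund_weight r r)) = 1 / real (r + 1) - 1"
    and "form r (fund_weight r r) (w0 r (fund_weight r 1)) = 1 / real (r + 1) - 1"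
proof -
  let ?N = "real (r + 1)" and ?d = "\<lambda>i k. if k = i then 1 else (0::real)"
  have f1: "fund_weight r 1 k = ?d 1 k - 1 / ?N" if "k \<in> {1..r+1}" for k
    using that assms by (auto simp: fund_weight_def)
  have fr: "fund_weight r r k = 1 / ?N - ?d (r+1) k" if "k \<in> {1..r+1}" for k
    using that assms by (auto simp: fund_weight_def field_simps)
  have w1: "w0 r (fund_weight r 1) k = ?d (r+1) k - 1 / ?N" if "k \<in> {1..r+1}" for k
  proof -
    have "r + 2 - k \<in> {1..r+1}" using that by auto
    from f1[OF this] that show ?thesis by (auto simp: w0_def)
  qed
  have wr: "w0 r (fund_weight r r) k = 1 / ?N - ?d 1 k" if "k \<in> {1..r+1}" for k
  proof -
    have "r + 2 - k \<in> {1..r+1}" using that by auto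
    from fr[OF this] that show ?thesis by (auto simp: w0_def)
  qed
  have gen: "(\<Sum>k=1..r+1. (x * ?d i k + y) * (x' * ?d j k + y')) =
      x * x' * (if i = j then 1 else 0) + x * y' + x' * y + ?N * (y * y')"
    if "i \<in> {1..r+1}" "j \<in> {1..r+1}" for i j x y x' y'
  proof -
    have "(\<Sum>k=1..r+1. (x * ?d i k + y) * (x' * ?d j k + y'))
       = (\<Sum>k=1..r+1. (if k = i then x * x' * (if i = j then 1 else 0) + x * y' else 0)
            + (if k = j then x' * y else 0) + y * y')"
      by (rule sum.cong) (auto simp: algebra_simps)
    also have "\<dots> = x * x' * (if i = j then 1 else 0) + x * y' + x' * y + ?N * (y * y')"
      using that by (simp only: sum.distrib sum.delta finite_atLeastAtMost) (simp add: sum.delta)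
    finally show ?thesis .
  qed
  define M where "M = 1 / ?N"
  have F1: "\<And>k. k \<in> {1..r+1} \<Longrightarrow> fund_weight r 1 k = 1 * ?d 1 k + (- M)"
    and FR: "\<And>k. k \<in> {1..r+1} \<Longrightarrow> fund_weight r r k = - 1 * ?d (r+1) k + M"
    and W1: "\<And>k. k \<in> {1..r+1} \<Longrightarrow> w0 r (fund_weight r 1) k = 1 * ?d (r+1) k + (- M)"
    and WR: "\<And>k. k \<in> {1..r+1} \<Longrightarrow> w0 r (fund_weight r r) k = - 1 * ?d 1 k + M"
    using f1 fr w1 wr by (simp_all add: M_def)
  have mem: "1 \<in> {1..r+1}" "r + 1 \<in> {1..r+1}" by auto
  have NM: "?N * (M * M) = M" by (simp add: M_def)
  have M': "- 1 / ?N = - M" by (simp add: M_def)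
  have rn: "1 \<noteq> r + 1" "r + 1 \<noteq> 1" using assms by simp_all
  have ends: "form r F G = x * x' * (if i = j then 1 else 0) + x * y' + x' * y + ?N * (y * y')"
    if "\<And>k. k \<in> {1..r+1} \<Longrightarrow> F k = x * ?d i k + y" "\<And>k. k \<in> {1..r+1} \<Longrightarrow> G k = x' * ?d j k + y'"
      "i \<in> {1..r+1}" "j \<in> {1..r+1}" for F G i j x y x' y'
    unfolding form_def gen[OF that(3,4), symmetric] by (rule sum.cong) (simp_all only: that)
  show "form r (fund_weight r 1) (fund_weight r 1) = 1 - 1 / ?N"
    unfolding M' M_def[symmetric]
    by (rule trans[OF ends[OF F1 F1 mem(1) mem(1)]], assumption, assumption)
      (use rn in \<open>simp only: minus_mult_minus mult_minus_left mult_minus_right NM\<close>, simp)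
  show "form r (fund_weight r r) (fund_weight r r) = 1 - 1 / ?N"
    unfolding M' M_def[symmetric]
    by (rule trans[OF ends[OF FR FR mem(2) mem(2)]], assumption, assumption)
      (use rn in \<open>simp only: minus_mult_minus mult_minus_left mult_minus_right NM\<close>, simp)
  show "form r (fund_weight r 1) (w0 r (fund_weight r 1)) = - 1 / ?N"
    unfolding M' M_def[symmetric]
    by (rule trans[OF ends[OF F1 W1 mem(1) mem(2)]], assumption, assumption)
      (use rn in \<open>simp only: minus_mult_minus mult_minus_left mult_minus_right NM\<close>, simp)
  show "form r (fund_weight r r) (w0 r (fund_weight r r)) = - 1 / ?N"
    unfolding M' M_def[symmetric]
    by (rule trans[OF ends[OF FR WR mem(2) mem(1)]], assumption, assumption)
      (use rn in \<open>simp only: minus_mult_minus mult_minus_left mult_minus_right NM\<close>, simp)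
  show "form r (fund_weight r 1) (w0 r (fund_weight r r)) = 1 / ?N - 1"
    unfolding M' M_def[symmetric]
    by (rule trans[OF ends[OF F1 WR mem(1) mem(1)]], assumption, assumption)
      (use rn in \<open>simp only: minus_mult_minus mult_minus_left mult_minus_right NM\<close>, simp)
  show "form r (fund_weight r r) (w0 r (fund_weight r 1)) = 1 / ?N - 1"
    unfolding M' M_def[symmetric]
    by (rule trans[OF ends[OF FR W1 mem(2) mem(2)]], assumption, assumption)
      (use rn in \<open>simp only: minus_mult_minus mult_minus_left mult_minus_right NM\<close>, simp)
qed

section \<open>Ladder modules\<close>

definition kap :: "real \<Rightarrow> nat \<Rightarrow> nat \<Rightarrow> complex" where
  "kap q k j = of_real (if j = k then q else if j = k + 1 then 1 / q else 1)"

text \<open>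
  The shape shared by the vector representation and its dual: one basis vector in each position
  \<open>1, ..., r + 1\<close>, with the highest weight in position 1, and \<open>E\<close>, \<open>F\<close> of node \<open>\<tau> k\<close> joining only the
  positions \<open>k\<close> and \<open>k + 1\<close>. Rescaling the basis changes \<open>e\<close> and \<open>f\<close> but not the product \<open>e k * f k\<close>.
  The relabelling \<tau> of the nodes accounts for the two ends of the diagram at which \<open>V\<close> may sit.
\<close>

definition ladder where
  "ladder r q M P \<tau> e f \<longleftrightarrow>
     bij_betw P UNIV {1..r+1} \<and> bij_betw \<tau> {1..r} {1..r} \<and>
     (\<forall>k\<in>{1..r}. e k * f k = 1 \<and> (\<forall>x y.
        Kop M (\<tau> k) $ x $ y = (if x = y then kap q k (P x) else 0) \<and>
        Kinv M (\<tau> k) $ x $ y = (if x = y then 1 / kap q k (P x) else 0) \<and>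
        Eop M (\<tau> k) $ x $ y = (if P x = k \<and> P y = k + 1 then e k else 0) \<and>
        Fop M (\<tau> k) $ x $ y = (if P x = k + 1 \<and> P y = k then f k else (0::complex))))"

text \<open>
  The dual module is given by transposed matrices of the antipode, which exchange \<open>E\<close>-arrows
  with opposite \<open>E\<close>-arrows; hence the order of the positions and of the nodes is reversed.
\<close>

lemma ladder_dual:
  fixes M :: "('n::finite) uq_module"
  assumes L: "ladder r q M P \<tau> e f" and q: "0 < q"
  shows "ladder r q (dual_module M) (\<lambda>x. r + 2 - P x) (\<lambda>k. \<tau> (r + 1 - k))
     (\<lambda>k. - e (r + 1 - k) * of_real q) (\<lambda>k. - f (r + 1 - k) / of_real q)"
proof -
  have P: "bij_betw P UNIV {1..r+1}" and tau: "bij_betw \<tau> {1..r} {1..r}"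
    using L by (auto simp: ladder_def)
  have Pr: "1 \<le> P x" "P x \<le> r + 1" for x
    using P by (auto simp: bij_betw_def)
  have rev: "bij_betw (\<lambda>k. n + 1 - k) {1..n} {1..n}" for n :: nat
    by (rule bij_betwI[where g = "\<lambda>k. n + 1 - k"]) auto
  have "bij_betw (\<lambda>x. r + 1 + 1 - P x) UNIV {1..r+1}"
    using bij_betw_trans[OF P rev[of "r+1"]] by (simp add: comp_def)
  then have b1: "bij_betw (\<lambda>x. r + 2 - P x) UNIV {1..r+1}" by simp
  have b2: "bij_betw (\<lambda>k. \<tau> (r + 1 - k)) {1..r} {1..r}"
    using bij_betw_trans[OF rev[of r] tau] by (simp add: comp_def)
  have main: "- e (r + 1 - k) * of_real q * (- f (r + 1 - k) / of_real q) = 1 \<and> (\<forall>x y.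
        Kop (dual_module M) (\<tau> (r + 1 - k)) $ x $ y = (if x = y then kap q k (r + 2 - P x) else 0) \<and>
        Kinv (dual_module M) (\<tau> (r + 1 - k)) $ x $ y = (if x = y then 1 / kap q k (r + 2 - P x) else 0) \<and>
        Eop (dual_module M) (\<tau> (r + 1 - k)) $ x $ y = (if r + 2 - P x = k \<and> r + 2 - P y = k + 1 then - e (r + 1 - k) * of_real q else 0) \<and>
        Fop (dual_module M) (\<tau> (r + 1 - k)) $ x $ y = (if r + 2 - P x = k + 1 \<and> r + 2 - P y = k then - f (r + 1 - k) / of_real q else (0::complex)))"
    if k: "k \<in> {1..r}" for k
  proof -
    define l where "l = r + 1 - k"
    have l: "l \<in> {1..r}" and kl: "k = r + 1 - l" using k by (auto simp: l_def)
    have K: "Kop M (\<tau> l) $ x $ y = (if x = y then kap q l (P x) else 0)"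
      and Ki: "Kinv M (\<tau> l) $ x $ y = (if x = y then 1 / kap q l (P x) else 0)"
      and E: "Eop M (\<tau> l) $ x $ y = (if P x = l \<and> P y = l + 1 then e l else 0)"
      and F: "Fop M (\<tau> l) $ x $ y = (if P x = l + 1 \<and> P y = l then f l else 0)"
      and ef: "e l * f l = 1" for x y
      using L[unfolded ladder_def, THEN conjunct2, THEN conjunct2, THEN bspec, OF l] by simp_all
    have e1: "r + 2 - P x = k \<longleftrightarrow> P x = l + 1" "r + 2 - P x = k + 1 \<longleftrightarrow> P x = l" for x
      using Pr[of x] l kl by auto
    have kk: "kap q k (r + 2 - P x) = 1 / kap q l (P x)" for x
      unfolding kap_def e1 using q by auto
    have EK: "(Eop M (\<tau> l) ** Kinv M (\<tau> l)) $ y $ x = (if P y = l \<and> P x = l + 1 then e l * of_real q else 0)" for x y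
    proof -
      have "(Eop M (\<tau> l) ** Kinv M (\<tau> l)) $ y $ x = (\<Sum>z\<in>UNIV. if z = x then Eop M (\<tau> l) $ y $ z / kap q l (P x) else 0)"
        unfolding matrix_matrix_mult_def by (simp add: Ki if_distrib cong: if_cong)
      also have "\<dots> = Eop M (\<tau> l) $ y $ x / kap q l (P x)" by simp
      finally show ?thesis by (simp add: E kap_def)
    qed
    have KF: "(Kop M (\<tau> l) ** Fop M (\<tau> l)) $ y $ x = (if P y = l + 1 \<and> P x = l then f l / of_real q else 0)" for x y
    proof -
      have "(Kop M (\<tau> l) ** Fop M (\<tau> l)) $ y $ x = kap q l (P y) * Fop M (\<tau> l) $ y $ x"
        by (simp add: matrix_matrix_mult_def K if_distrib if_distribR cong: if_cong)
      then show ?thesis by (simp add: F kap_def)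
    qed
    have c1: "- e l * of_real q * (- f l / of_real q) = 1" using ef q by simp
    have c2: "Kop (dual_module M) (\<tau> l) $ x $ y = (if x = y then kap q k (r + 2 - P x) else 0)"
      and c3: "Kinv (dual_module M) (\<tau> l) $ x $ y = (if x = y then 1 / kap q k (r + 2 - P x) else 0)" for x y
      unfolding kk by (simp_all add: dual_module_def transpose_def K Ki)
    have c4: "Eop (dual_module M) (\<tau> l) $ x $ y = (if r + 2 - P x = k \<and> r + 2 - P y = k + 1 then - e l * of_real q else 0)"
      and c5: "Fop (dual_module M) (\<tau> l) $ x $ y = (if r + 2 - P x = k + 1 \<and> r + 2 - P y = k then - f l / of_real q else 0)" for x y
      unfolding e1 by (simp_all add: dual_module_def transpose_def EK KF)
    show ?thesis
      unfolding l_def[symmetric] by (intro conjI allI c1 c2 c3 c4 c5)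
  qed
  show ?thesis unfolding ladder_def by (rule conjI[OF b1 conjI[OF b2 ballI[OF main]]])
qed

context quantum_group_data
begin

text \<open>
  The diagram is read from the end at which \<open>s\<close> sits.
\<close>

definition relabel :: "nat \<Rightarrow> nat" where "relabel k = (if s = 1 then k else r + 1 - k)"

lemma relabel_range: "k \<in> {1..r} \<Longrightarrow> relabel k \<in> {1..r}"
  by (auto simp: relabel_def)

lemma bij_relabel: "bij_betw relabel {1..r} {1..r}"
proof (rule bij_betwI[where g = relabel])
qed (auto simp: relabel_def)

lemma relabel_eq_s: "k \<in> {1..r} \<Longrightarrow> relabel k = s \<longleftrightarrow> k = 1"
  using s_cases r_ge_1 by (auto simp: relabel_def)

lemma form_simple_roots:
  assumes "i \<in> {1..r}" "j \<in> {1..r}"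
  shows "form r (simple_root (relabel i)) (simple_root (relabel j)) =
    (if i = j then 2 else if i = j + 1 \<or> j = i + 1 then -1 else 0)"
proof -
  have "relabel i \<in> {1..r}" "relabel j \<in> {1..r}" using assms by (auto simp: relabel_def)
  then show ?thesis
    unfolding form_simple_root[OF \<open>relabel i \<in> {1..r}\<close>]
    using assms by (auto simp: relabel_def simple_root_def)
qed

lemma q_minus_inverse: "q - 1 / q \<noteq> 0"
proof -
  have "1 < 1 / q" using q_pos q_less_1 by simp
  then show ?thesis using q_less_1 by linarith
qed

lemma V_module: "is_uq_module r q V"
  using V_simple by (simp add: is_simple_hw_module_def)

lemma V_relations:
  assumes "i \<in> {1..r}" "j \<in> {1..r}"
  shows "Kinv V i ** Kop V i = mat 1"
    and "Kop V i ** Eop V j ** Kinv V i = (q powr form r (simple_root i) (simple_root j)) *\<^sub>R Eop V j"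
    and "Kop V i ** Fop V j ** Kinv V i = (q powr (- form r (simple_root i) (simple_root j))) *\<^sub>R Fop V j"
    and "Eop V i ** Fop V j - Fop V j ** Eop V i
          = (if i = j then (1 / (q - 1 / q)) *\<^sub>R (Kop V i - Kinv V i) else 0)"
proof -
  note mod = V_module[unfolded is_uq_module_def]
  show "Kinv V i ** Kop V i = mat 1"
    using mod[THEN conjunct1, THEN bspec, OF assms(1)] by (rule conjunct2)
  note rel = mod[THEN conjunct2, THEN conjunct1, THEN bspec, OF assms(1), THEN bspec, OF assms(2), THEN conjunct2]
  show "Kop V i ** Eop V j ** Kinv V i = (q powr form r (simple_root i) (simple_root j)) *\<^sub>R Eop V j"
    by (rule rel[THEN conjunct1])
  show "Kop V i ** Fop V j ** Kinv V i = (q powr (- form r (simple_root i) (simple_root j))) *\<^sub>R Fop V j"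
    by (rule rel[THEN conjunct2, THEN conjunct1])
  show "Eop V i ** Fop V j - Fop V j ** Eop V i
          = (if i = j then (1 / (q - 1 / q)) *\<^sub>R (Kop V i - Kinv V i) else 0)"
    by (rule rel[THEN conjunct2, THEN conjunct2])
qed

lemma matrix_vector_scaleR: "A *v (c *\<^sub>R v) = c *\<^sub>R (A *v (v :: complex^'k))"
  by (simp add: vec_eq_iff matrix_vector_mult_def scaleR_sum_right)

lemma scaleR_matrix_vector: "(c *\<^sub>R A) *v v = c *\<^sub>R (A *v (v :: complex^'k))"
  by (simp add: vec_eq_iff matrix_vector_mult_def scaleR_sum_right)

lemma K_diag:
  assumes "i \<in> {1..r}"
  shows "Kop V i $ y $ x = (if y = x then of_real (q powr form r (simple_root i) (wt x)) else 0)"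
proof -
  have "Kop V i *v axis x 1 = (q powr form r (simple_root i) (wt x)) *\<^sub>R axis x 1"
    using weight_basis[of x] assms by (simp add: has_weight_def)
  then have "(Kop V i *v axis x 1) $ y = ((q powr form r (simple_root i) (wt x)) *\<^sub>R axis x 1) $ y"
    by simp
  then show ?thesis
    by (simp add: matrix_vector_mult_def axis_def of_real_def if_distrib cong: if_cong)
qed

lemma K_vec:
  assumes "i \<in> {1..r}"
  shows "(Kop V i *v v) $ x = of_real (q powr form r (simple_root i) (wt x)) * v $ x"
  using assms by (simp add: matrix_vector_mult_def K_diag if_distrib if_distribR cong: if_cong)

lemma Kinv_diag:
  assumes "i \<in> {1..r}"
  shows "Kinv V i $ y $ x = (if y = x then 1 / of_real (q powr form r (simple_root i) (wt x)) else 0)"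
proof -
  have "Kop V i ** Kinv V i = mat 1" using V_module assms by (simp add: is_uq_module_def)
  then have "(Kop V i ** Kinv V i) $ y $ x = mat 1 $ y $ x" by simp
  moreover have "(Kop V i ** Kinv V i) $ y $ x = of_real (q powr form r (simple_root i) (wt y)) * Kinv V i $ y $ x"
    using assms by (simp add: matrix_matrix_mult_def K_diag if_distrib if_distribR cong: if_cong)
  ultimately show ?thesis using q_pos by (auto simp: mat_def field_simps)
qed

lemma q_powr_inj: "q powr x = q powr y \<longleftrightarrow> x = y"
  using q_pos q_less_1 by (simp add: powr_def)

lemma K_conj_entry:
  assumes "i \<in> {1..r}" "Kop V i ** A ** Kinv V i = (q powr c) *\<^sub>R A" "A $ x $ y \<noteq> 0"
  shows "form r (simple_root i) (wt x) - form r (simple_root i) (wt y) = c"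
proof -
  have "(Kop V i ** A ** Kinv V i) $ x $ y = of_real (q powr form r (simple_root i) (wt x)) * A $ x $ y
     / of_real (q powr form r (simple_root i) (wt y))"
    using assms(1) by (simp add: matrix_matrix_mult_def K_diag Kinv_diag if_distrib if_distribR cong: if_cong)
  then have "of_real (q powr form r (simple_root i) (wt x)) * A $ x $ y
     / of_real (q powr form r (simple_root i) (wt y)) = ((q powr c) *\<^sub>R A) $ x $ y"
    by (simp only: assms(2))
  also have "\<dots> = of_real (q powr c) * A $ x $ y"
    by (simp add: scaleR_conv_of_real[of "q powr c" "A $ x $ y"])
  finally have "of_real (q powr form r (simple_root i) (wt x)) * A $ x $ y
     / of_real (q powr form r (simple_root i) (wt y)) = of_real (q powr c) * A $ x $ y" .
  then have "complex_of_real (q powr form r (simple_root i) (wt x)) = of_real (q powr c) * of_real (q powr form r (simple_root i) (wt y))"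
    using assms(3) q_pos by (simp add: field_simps)
  then have "complex_of_real (q powr form r (simple_root i) (wt x)) = of_real (q powr (c + form r (simple_root i) (wt y)))"
    by (simp add: powr_add)
  then have "q powr form r (simple_root i) (wt x) = q powr (c + form r (simple_root i) (wt y))"
    using of_real_eq_iff by blast
  then show ?thesis by (simp add: q_powr_inj)
qed

text \<open>
  Successive \<open>F\<close>'s applied to the highest weight vector give a vector in each position: it is not
  zero because \<open>E F v = v\<close> for the \<open>E\<close> of the same node, by the commutation rule and \<open>E v = 0\<close>.
\<close>

lemma ladder_vector:
  "\<exists>v. v \<noteq> 0 \<and> (\<forall>j\<in>{1..r}. Kop V (relabel j) *v v =
       (q powr ((if k + 1 = j then 1 else 0) - (if k + 1 = j + 1 then 1 else 0))) *\<^sub>R v \<and>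
       (k < j \<longrightarrow> Eop V (relabel j) *v v = 0))" if "k \<le> r"
  using that
proof (induction k)
  case 0
  obtain v where v: "highest_weight_vector r q V (fund_weight r s) v"
    using V_simple by (auto simp: is_simple_hw_module_def)
  have "s \<in> {1..r}" using s_cases r_ge_1 by auto
  show ?case
    by (rule exI[of _ v]) (use v relabel_range relabel_eq_s \<open>s \<in> {1..r}\<close> in
      \<open>auto simp: highest_weight_vector_def has_weight_def form_simple_root_fund_weight\<close>)
next
  case (Suc k)
  then obtain v where v0: "v \<noteq> 0" and vK: "\<And>j. j \<in> {1..r} \<Longrightarrow> Kop V (relabel j) *v v =
       (q powr ((if k + 1 = j then 1 else 0) - (if k + 1 = j + 1 then 1 else 0))) *\<^sub>R v"
    and vE: "\<And>j. j \<in> {1..r} \<Longrightarrow> k < j \<Longrightarrow> Eop V (relabel j) *v v = 0" by auto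
  let ?l = "Suc k"
  have l: "?l \<in> {1..r}" using Suc.prems by simp
  define u where "u = Fop V (relabel ?l) *v v"
  have EF: "Eop V (relabel j) ** Fop V (relabel ?l) - Fop V (relabel ?l) ** Eop V (relabel j)
          = (if relabel j = relabel ?l then (1 / (q - 1 / q)) *\<^sub>R (Kop V (relabel j) - Kinv V (relabel j)) else 0)"
    if "j \<in> {1..r}" for j
    by (rule V_relations(4)[OF relabel_range[OF that] relabel_range[OF l]])
  have rel: "relabel j = relabel ?l \<longleftrightarrow> j = ?l" if "j \<in> {1..r}" for j
    by (rule inj_on_eq_iff[OF bij_betw_imp_inj_on[OF bij_relabel] that l])
  have Eu: "Eop V (relabel j) *v u = (if j = ?l then (1 / (q - 1 / q)) *\<^sub>R (Kop V (relabel j) - Kinv V (relabel j)) else 0) *v v"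
    if j: "j \<in> {1..r}" "k < j" for j
  proof -
    have "Eop V (relabel j) *v u = (Eop V (relabel j) ** Fop V (relabel ?l)) *v v"
      by (simp add: u_def matrix_vector_mul_assoc)
    also have "Eop V (relabel j) ** Fop V (relabel ?l) = (Eop V (relabel j) ** Fop V (relabel ?l)
        - Fop V (relabel ?l) ** Eop V (relabel j)) + Fop V (relabel ?l) ** Eop V (relabel j)" by simp
    also have "\<dots> *v v = (Eop V (relabel j) ** Fop V (relabel ?l)
        - Fop V (relabel ?l) ** Eop V (relabel j)) *v v + Fop V (relabel ?l) *v (Eop V (relabel j) *v v)"
      by (simp only: matrix_vector_mult_add_rdistrib matrix_vector_mul_assoc)
    finally show ?thesis using EF[OF j(1)] rel[OF j(1)] vE[OF j] by simp
  qed
  have Kv: "Kop V (relabel ?l) *v v = q *\<^sub>R v"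
    using vK[OF l] q_pos by simp
  have "Kinv V (relabel ?l) *v (Kop V (relabel ?l) *v v) = v"
    by (simp add: V_relations(1)[OF relabel_range[OF l] relabel_range[OF l]] matrix_vector_mul_assoc)
  then have "q *\<^sub>R (Kinv V (relabel ?l) *v v) = v"
    by (simp add: Kv matrix_vector_scaleR)
  then have Kiv: "Kinv V (relabel ?l) *v v = (1 / q) *\<^sub>R v"
    using q_pos by (metis scaleR_scaleR scaleR_one less_irrefl nonzero_divide_eq_eq)
  have qq: "q - 1 / q \<noteq> 0"
    by (rule q_minus_inverse)
  have "Eop V (relabel ?l) *v u = v"
  proof -
    have "Eop V (relabel ?l) *v u = (1 / (q - 1 / q)) *\<^sub>R (Kop V (relabel ?l) *v v - Kinv V (relabel ?l) *v v)"
      using Eu[OF l] by (simp add: scaleR_matrix_vector matrix_vector_mult_diff_rdistrib)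
    also have "\<dots> = (1 / (q - 1 / q)) *\<^sub>R ((q - 1 / q) *\<^sub>R v)"
      by (simp only: Kv Kiv scaleR_left_diff_distrib)
    finally show ?thesis using qq by simp
  qed
  then have u0: "u \<noteq> 0" using v0 by auto
  have KF: "Kop V (relabel j) *v u = (q powr ((if ?l + 1 = j then 1 else 0) - (if ?l + 1 = j + 1 then 1 else 0))) *\<^sub>R u"
    if j: "j \<in> {1..r}" for j
  proof -
    let ?c = "form r (simple_root (relabel j)) (simple_root (relabel ?l))"
    have "Kop V (relabel j) ** Fop V (relabel ?l) ** Kinv V (relabel j) = (q powr (- ?c)) *\<^sub>R Fop V (relabel ?l)"
      and KK: "Kinv V (relabel j) ** Kop V (relabel j) = mat 1"
      by (rule V_relations[OF relabel_range[OF j] relabel_range[OF l]])+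
    then have "(Kop V (relabel j) ** Fop V (relabel ?l) ** Kinv V (relabel j)) *v (Kop V (relabel j) *v v)
        = ((q powr (- ?c)) *\<^sub>R Fop V (relabel ?l)) *v (Kop V (relabel j) *v v)" by simp
    moreover have "(Kop V (relabel j) ** Fop V (relabel ?l) ** Kinv V (relabel j)) *v (Kop V (relabel j) *v v)
        = (Kop V (relabel j) ** Fop V (relabel ?l) ** (Kinv V (relabel j) ** Kop V (relabel j))) *v v"
      by (simp only: matrix_vector_mul_assoc matrix_mul_assoc)
    ultimately have "Kop V (relabel j) *v u = ((q powr (- ?c)) *\<^sub>R Fop V (relabel ?l)) *v (Kop V (relabel j) *v v)"
      by (simp add: KK u_def matrix_vector_mul_assoc)
    also have "\<dots> = (q powr (- ?c) * q powr ((if k + 1 = j then 1 else 0) - (if k + 1 = j + 1 then 1 else 0))) *\<^sub>R u"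
      by (simp add: vK[OF j] u_def scaleR_matrix_vector matrix_vector_scaleR)
    also have "q powr (- ?c) * q powr ((if k + 1 = j then 1 else 0) - (if k + 1 = j + 1 then 1 else 0))
       = q powr ((if ?l + 1 = j then 1 else 0) - (if ?l + 1 = j + 1 then 1 else 0))"
      unfolding powr_add[symmetric] form_simple_roots[OF j l] by (intro arg_cong[of _ _ "\<lambda>x. q powr x"]) auto
    finally show ?thesis .
  qed
  show ?case
    by (rule exI[of _ u]) (use u0 KF Eu in auto)
qed

text \<open>
  The \<open>r + 1\<close> weights of the vectors of \<open>ladder_vector\<close> are distinct, and each occurs on some
  basis vector; as there are \<open>r + 1\<close> basis vectors, each has exactly one of these weights.
\<close>

lemma ladder_positions:
  obtains P where "bij_betw P UNIV {1..r+1}"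
    and "\<And>x j. j \<in> {1..r} \<Longrightarrow> form r (simple_root (relabel j)) (wt x) = (if P x = j then 1 else 0) - (if P x = j + 1 then 1 else 0)"
proof -
  have "\<exists>x. \<forall>j\<in>{1..r}. form r (simple_root (relabel j)) (wt x) = (if k = j then 1 else 0) - (if k = j + 1 then 1 else 0)"
    if k: "k \<in> {1..r+1}" for k
  proof -
    have k1: "k - 1 + 1 = k" "k - 1 \<le> r" using k by auto
    obtain v where v: "v \<noteq> 0" "\<And>j. j \<in> {1..r} \<Longrightarrow> Kop V (relabel j) *v v =
       (q powr ((if k = j then 1 else 0) - (if k = j + 1 then 1 else 0))) *\<^sub>R v"
      using ladder_vector[OF k1(2)] unfolding k1(1) by blast
    obtain x where x: "v $ x \<noteq> 0" using v(1) by (auto simp: vec_eq_iff)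
    have "form r (simple_root (relabel j)) (wt x) = (if k = j then 1 else 0) - (if k = j + 1 then 1 else 0)"
      if j: "j \<in> {1..r}" for j
    proof -
      have "complex_of_real (q powr form r (simple_root (relabel j)) (wt x)) * v $ x
         = of_real (q powr ((if k = j then 1 else 0) - (if k = j + 1 then 1 else 0))) * v $ x"
        unfolding K_vec[OF relabel_range[OF j], symmetric] v(2)[OF j] vector_scaleR_component by (rule scaleR_conv_of_real)
      then have "complex_of_real (q powr form r (simple_root (relabel j)) (wt x))
         = of_real (q powr ((if k = j then 1 else 0) - (if k = j + 1 then 1 else 0)))" using x by simp
      then have "q powr form r (simple_root (relabel j)) (wt x)
         = q powr ((if k = j then 1 else 0) - (if k = j + 1 then 1 else 0))"
        using of_real_eq_iff by blast
      then show ?thesis unfolding q_powr_inj .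
    qed
    then show ?thesis by blast
  qed
  then obtain X where X: "\<And>k j. k \<in> {1..r+1} \<Longrightarrow> j \<in> {1..r} \<Longrightarrow>
      form r (simple_root (relabel j)) (wt (X k)) = (if k = j then 1 else 0) - (if k = j + 1 then 1 else 0)"
    by metis
  have inj: "inj_on X {1..r+1}"
  proof (rule inj_onI)
    fix k l assume kl: "k \<in> {1..r+1}" "l \<in> {1..r+1}" "X k = X l"
    show "k = l"
    proof (rule ccontr)
      assume "k \<noteq> l"
      have eq: "(if k = j then 1 else 0) - (if k = j + 1 then 1 else 0) = (if l = j then 1 else (0::real)) - (if l = j + 1 then 1 else 0)"
        if "j \<in> {1..r}" for j
        using X[OF kl(1) that] X[OF kl(2) that] kl(3) by simp
      show False
      proof (cases "k < l")
        case True
        then have "k \<in> {1..r}" using kl by auto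
        from eq[OF this] True show False by (auto split: if_splits)
      next
        case False
        then have "l \<in> {1..r}" "l < k" using kl \<open>k \<noteq> l\<close> by auto
        from eq[OF this(1)] this(2) show False by (auto split: if_splits)
      qed
    qed
  qed
  have "card (X ` {1..r+1}) = CARD('n)" using card_image[OF inj] card_index by simp
  then have surj: "X ` {1..r+1} = UNIV" by (intro card_subset_eq) auto
  have bX: "bij_betw X {1..r+1} UNIV" using inj surj by (simp add: bij_betw_def)
  define P where "P = the_inv_into {1..r+1} X"
  have bP: "bij_betw P UNIV {1..r+1}" unfolding P_def by (rule bij_betw_the_inv_into[OF bX])
  have XP: "X (P x) = x" for x unfolding P_def using f_the_inv_into_f[OF inj] surj by auto
  have PR: "P x \<in> {1..r+1}" for x using bP by (auto simp: bij_betw_def)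
  show thesis
    by (rule that[OF bP]) (use X[OF PR] XP in auto)
qed

text \<open>
  By weights, \<open>E\<close> and \<open>F\<close> of a node can only join the two positions of that node; the relation for
  \<open>E F - F E\<close> then gives the product of the two entries.
\<close>

theorem V_ladder:
  obtains P e f where "ladder r q V P relabel e f"
    and "\<And>x j. j \<in> {1..r} \<Longrightarrow> form r (simple_root (relabel j)) (wt x) = (if P x = j then 1 else 0) - (if P x = j + 1 then 1 else 0)"
proof -
  obtain P where bP: "bij_betw P UNIV {1..r+1}"
    and wtP: "\<And>x j. j \<in> {1..r} \<Longrightarrow> form r (simple_root (relabel j)) (wt x) = (if P x = j then 1 else 0) - (if P x = j + 1 then 1 else 0)"
    using ladder_positions by blast
  have mod: "Kop V (relabel k) ** Eop V (relabel k) ** Kinv V (relabel k) = (q powr 2) *\<^sub>R Eop V (relabel k)"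
    "Kop V (relabel k) ** Fop V (relabel k) ** Kinv V (relabel k) = (q powr - 2) *\<^sub>R Fop V (relabel k)"
    "Eop V (relabel k) ** Fop V (relabel k) - Fop V (relabel k) ** Eop V (relabel k) =
        (1 / (q - 1 / q)) *\<^sub>R (Kop V (relabel k) - Kinv V (relabel k))"
    if k: "k \<in> {1..r}" for k
    using V_relations(2-4)[OF relabel_range[OF k] relabel_range[OF k]] form_simple_roots[OF k k] by simp_all
  have E: "P x = k \<and> P y = k + 1" if "k \<in> {1..r}" "Eop V (relabel k) $ x $ y \<noteq> 0" for k x y
    using K_conj_entry[OF relabel_range[OF that(1)] mod(1)[OF that(1)] that(2)]
    by (auto simp: wtP[OF that(1)] split: if_splits)
  have F: "P x = k + 1 \<and> P y = k" if "k \<in> {1..r}" "Fop V (relabel k) $ x $ y \<noteq> 0" for k x y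
    using K_conj_entry[OF relabel_range[OF that(1)] mod(2)[OF that(1)] that(2)]
    by (auto simp: wtP[OF that(1)] split: if_splits)
  define X where "X k = the_inv P k" for k
  have injP: "inj P" using bP by (simp add: bij_betw_def)
  have PX: "P (X k) = k" if "k \<in> {1..r+1}" for k
    unfolding X_def using that bP by (auto simp: bij_betw_def intro!: f_the_inv_into_f)
  have XP: "P x = k \<longleftrightarrow> x = X k" if "k \<in> {1..r+1}" for x k
    using PX[OF that] injP by (auto simp: inj_def)
  define e where "e k = Eop V (relabel k) $ X k $ X (k + 1)" for k
  define f where "f k = Fop V (relabel k) $ X (k + 1) $ X k" for k
  have Ee: "Eop V (relabel k) $ x $ y = (if P x = k \<and> P y = k + 1 then e k else 0)" if "k \<in> {1..r}" for k x y
  proof (cases "P x = k \<and> P y = k + 1")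
    case True
    then have "x = X k" "y = X (k + 1)" using XP[of k x] XP[of "k+1" y] that by simp_all
    then show ?thesis using True by (simp add: e_def)
  next
    case False
    then show ?thesis using E[OF that, of x y] by argo
  qed
  have Ff: "Fop V (relabel k) $ x $ y = (if P x = k + 1 \<and> P y = k then f k else 0)" if "k \<in> {1..r}" for k x y
  proof (cases "P x = k + 1 \<and> P y = k")
    case True
    then have "y = X k" "x = X (k + 1)" using XP[of k y] XP[of "k+1" x] that by simp_all
    then show ?thesis using True by (simp add: f_def)
  next
    case False
    then show ?thesis using F[OF that, of x y] by argo
  qed
  have Kk: "Kop V (relabel k) $ x $ y = (if x = y then kap q k (P x) else 0)"
    "Kinv V (relabel k) $ x $ y = (if x = y then 1 / kap q k (P x) else 0)" if "k \<in> {1..r}" for k x y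
    using q_pos by (auto simp: K_diag[OF relabel_range[OF that]] Kinv_diag[OF relabel_range[OF that]] wtP[OF that] kap_def powr_minus_divide)
  have ef: "e k * f k = 1" if k: "k \<in> {1..r}" for k
  proof -
    have in1: "k \<in> {1..r+1}" "k + 1 \<in> {1..r+1}" using k by auto
    have XX: "X k \<noteq> X (k + 1)" using PX[OF in1(1)] PX[OF in1(2)] by auto
    have "(Eop V (relabel k) ** Fop V (relabel k) - Fop V (relabel k) ** Eop V (relabel k)) $ X k $ X k
       = ((1 / (q - 1 / q)) *\<^sub>R (Kop V (relabel k) - Kinv V (relabel k))) $ X k $ X k"
      using mod(3)[OF k] by simp
    moreover have "(Eop V (relabel k) ** Fop V (relabel k)) $ X k $ X k = e k * f k"
    proof -
      have "Eop V (relabel k) $ X k $ z * Fop V (relabel k) $ z $ X k = (if z = X (k+1) then e k * f k else 0)" for z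
        unfolding Ee[OF k] Ff[OF k] XP[OF in1(1)] XP[OF in1(2)] using XX by auto
      then show ?thesis by (simp only: matrix_matrix_mult_def vec_lambda_beta) simp
    qed
    moreover have "(Fop V (relabel k) ** Eop V (relabel k)) $ X k $ X k = 0"
    proof -
      have "Fop V (relabel k) $ X k $ z * Eop V (relabel k) $ z $ X k = 0" for z
        unfolding Ee[OF k] Ff[OF k] XP[OF in1(1)] XP[OF in1(2)] using XX by auto
      then show ?thesis by (simp only: matrix_matrix_mult_def vec_lambda_beta) simp
    qed
    moreover have "((1 / (q - 1 / q)) *\<^sub>R (Kop V (relabel k) - Kinv V (relabel k))) $ X k $ X k = of_real ((1 / (q - 1/q)) * (q - 1/q))"
      unfolding vector_scaleR_component vector_minus_component Kk[OF k] PX[OF in1(1)]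
      by (simp only: kap_def scaleR_conv_of_real of_real_mult of_real_diff of_real_divide of_real_1 if_True refl)
    moreover have "q - 1 / q \<noteq> 0"
    by (rule q_minus_inverse)
    ultimately show ?thesis by simp
  qed
  have "ladder r q V P relabel e f"
    unfolding ladder_def
    by (intro conjI ballI allI bP bij_relabel ef Kk Ee Ff)
  then show thesis using that wtP by blast
qed

end

section \<open>The braidings\<close>

definition swap_coef :: "complex \<Rightarrow> complex \<Rightarrow> 'n \<Rightarrow> 'n \<Rightarrow> complex" where
  "swap_coef x y a b = (if a = b then x else y)"

text \<open>
  The R-matrix of Hecke type on the square of the vector representation, with \<open>P\<close> the position of a
  basis vector; its eigenvalues are \<open>W\<close> and \<open>- W / Q^2\<close>.
\<close>

definition Rsame :: "('n::finite \<Rightarrow> nat) \<Rightarrow> complex \<Rightarrow> complex \<Rightarrow> complex^('n \<times> 'n)^('n \<times> 'n)" where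
  "Rsame P Q W = (\<chi> I J.
     (if J = prod.swap I then swap_coef W (W / Q) (fst I) (snd I) else 0) +
     (if J = I then if P (snd I) < P (fst I) then W - W / Q^2 else 0 else 0))"

definition mix_coef :: "('n \<Rightarrow> nat) \<Rightarrow> complex \<Rightarrow> complex \<Rightarrow> 'n \<Rightarrow> 'n \<Rightarrow> complex" where
  "mix_coef P Q W a c = (if P a < P c then (1 - Q^2) / W / Q ^ (2 * (P c - P a)) else 0)"

text \<open>
  The braiding of a vector representation with its dual; it mixes all pairs of dual basis vectors, with
  coefficients that are geometric in the distance of the positions.
\<close>

definition Rmix :: "('n::finite \<Rightarrow> nat) \<Rightarrow> complex \<Rightarrow> complex \<Rightarrow> complex^('n \<times> 'n)^('n \<times> 'n)" where
  "Rmix P Q W = (\<chi> I J.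
     (if J = prod.swap I then swap_coef (1 / W) (Q / W) (fst I) (snd I) else 0) +
     (if fst I = snd I \<and> fst J = snd J then mix_coef P Q W (fst I) (fst J) else 0))"

text \<open>
  The inverse of \<open>Rmix\<close>; its mixing coefficients do not depend on the distance.
\<close>

definition Rmix_inv :: "('n::finite \<Rightarrow> nat) \<Rightarrow> complex \<Rightarrow> complex \<Rightarrow> complex^('n \<times> 'n)^('n \<times> 'n)" where
  "Rmix_inv P Q W = (\<chi> I J.
     (if J = prod.swap I then swap_coef W (W / Q) (fst I) (snd I) else 0) +
     (if fst I = snd I \<and> fst J = snd J then if P (fst I) < P (fst J) then W - W / Q^2 else 0 else 0))"

lemma Rsame_entry: "Rsame P Q W $ (a, b) $ (c, d) =
    (if c = b \<and> d = a then swap_coef W (W / Q) a b else 0) +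
    (if c = a \<and> d = b then if P b < P a then W - W / Q^2 else 0 else 0)"
  by (simp only: Rsame_def vec_lambda_beta fst_conv snd_conv swap_simp prod.inject)

lemma Rmix_entry: "Rmix P Q W $ (a, b) $ (c, d) =
    (if c = b \<and> d = a then swap_coef (1 / W) (Q / W) a b else 0) +
    (if a = b \<and> c = d then mix_coef P Q W a c else 0)"
  by (simp only: Rmix_def vec_lambda_beta fst_conv snd_conv swap_simp prod.inject)

lemma Rmix_inv_entry: "Rmix_inv P Q W $ (a, b) $ (c, d) =
    (if c = b \<and> d = a then swap_coef W (W / Q) a b else 0) +
    (if a = b \<and> c = d then if P a < P c then W - W / Q^2 else 0 else 0)"
  by (simp only: Rmix_inv_def vec_lambda_beta fst_conv snd_conv swap_simp prod.inject)

lemma sum_prod_UNIV: "(\<Sum>J\<in>UNIV. g (J :: 'a::finite \<times> 'b::finite)) = (\<Sum>s\<in>UNIV. \<Sum>t\<in>UNIV. g (s, t))"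
  by (simp add: sum.cartesian_product case_prod_beta)

lemma sum_two_delta:
  "(\<Sum>s\<in>UNIV. \<Sum>t\<in>UNIV. (if s = x \<and> t = y then g s t else (0::complex))) = g (x::'a::finite) (y::'b::finite)"
proof -
  have "(\<Sum>t\<in>UNIV. (if s = x \<and> t = y then g s t else 0)) = (if s = x then g s y else 0)" for s
    by (cases "s = x") auto
  then show ?thesis by simp
qed

lemma if_zero_mult:
  "(if c then u else 0) * z = (if c then u * z else (0::complex))"
  "z * (if c then u else 0) = (if c then z * u else (0::complex))"
  by simp_all

lemma swap_diag_mult:
  assumes R: "\<And>a b c d. R $ (a, b) $ (c, d) = (if c = b \<and> d = a then f a b else 0) + (if c = a \<and> d = b then g a b else 0)"
  shows "(R ** M) $ (a, b) $ J = f a b * M $ (b, a) $ J + g a b * (M :: complex^'k^('n::finite \<times> 'n)) $ (a, b) $ J"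
    and "(M' ** R) $ I $ (c, d) = M' $ I $ (d, c) * f d c + (M' :: complex^('n \<times> 'n)^'l) $ I $ (c, d) * g c d"
proof -
  have "(R ** M) $ (a, b) $ J = (\<Sum>s\<in>UNIV. \<Sum>t\<in>UNIV.
     (if s = b \<and> t = a then f a b * M $ (s, t) $ J else 0) + (if s = a \<and> t = b then g a b * M $ (s, t) $ J else 0))"
    unfolding matrix_matrix_mult_def sum_prod_UNIV vec_lambda_beta R
    by (intro sum.cong refl) (simp only: distrib_right if_zero_mult)
  then show "(R ** M) $ (a, b) $ J = f a b * M $ (b, a) $ J + g a b * M $ (a, b) $ J"
    by (simp add: sum.distrib sum_two_delta)
  have "(M' ** R) $ I $ (c, d) = (\<Sum>s\<in>UNIV. \<Sum>t\<in>UNIV.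
     (if s = d \<and> t = c then M' $ I $ (s, t) * f d c else 0) + (if s = c \<and> t = d then M' $ I $ (s, t) * g c d else 0))"
    unfolding matrix_matrix_mult_def sum_prod_UNIV vec_lambda_beta R distrib_left if_zero_mult
    by (intro sum.cong refl arg_cong2[of _ _ _ _ "(+)"]) auto
  then show "(M' ** R) $ I $ (c, d) = M' $ I $ (d, c) * f d c + M' $ I $ (c, d) * g c d"
    by (simp add: sum.distrib sum_two_delta)
qed

lemma sum_diag_delta: "(\<Sum>s\<in>UNIV. \<Sum>t\<in>UNIV. (if s = t then g s t else (0::complex))) = (\<Sum>s\<in>UNIV. g s (s::'a::finite))"
  by simp

lemma swap_mix_mult:
  assumes R: "\<And>a b c d. R $ (a, b) $ (c, d) = (if c = b \<and> d = a then f a b else 0) + (if a = b \<and> c = d then h a c else 0)"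
  shows "(R ** M) $ (a, b) $ J = f a b * M $ (b, a) $ J +
       (if a = b then \<Sum>s\<in>UNIV. h a s * (M :: complex^'k^('n::finite \<times> 'n)) $ (s, s) $ J else 0)"
    and "(M' ** R) $ I $ (c, d) = M' $ I $ (d, c) * f d c +
       (if c = d then \<Sum>s\<in>UNIV. (M' :: complex^('n \<times> 'n)^'l) $ I $ (s, s) * h s c else 0)"
proof -
  have "(R ** M) $ (a, b) $ J = (\<Sum>s\<in>UNIV. \<Sum>t\<in>UNIV.
     (if s = b \<and> t = a then f a b * M $ (s, t) $ J else 0) + (if s = t then if a = b then h a s * M $ (s, t) $ J else 0 else 0))"
    unfolding matrix_matrix_mult_def sum_prod_UNIV vec_lambda_beta R
    unfolding distrib_right if_zero_mult
    by (intro sum.cong refl arg_cong2[of _ _ _ _ "(+)"]) auto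
  then show "(R ** M) $ (a, b) $ J = f a b * M $ (b, a) $ J + (if a = b then \<Sum>s\<in>UNIV. h a s * M $ (s, s) $ J else 0)"
    unfolding sum.distrib sum_two_delta sum_diag_delta by simp
  have "(M' ** R) $ I $ (c, d) = (\<Sum>s\<in>UNIV. \<Sum>t\<in>UNIV.
     (if s = d \<and> t = c then M' $ I $ (s, t) * f d c else 0) + (if s = t then if c = d then M' $ I $ (s, t) * h s c else 0 else 0))"
    unfolding matrix_matrix_mult_def sum_prod_UNIV vec_lambda_beta R
    unfolding distrib_left if_zero_mult
    by (intro sum.cong refl arg_cong2[of _ _ _ _ "(+)"]) auto
  then show "(M' ** R) $ I $ (c, d) = M' $ I $ (d, c) * f d c + (if c = d then \<Sum>s\<in>UNIV. M' $ I $ (s, s) * h s c else 0)"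
    unfolding sum.distrib sum_two_delta sum_diag_delta by simp
qed

lemmas Rsame_mult = swap_diag_mult[OF Rsame_entry]
lemmas Rmix_mult = swap_mix_mult[OF Rmix_entry]

lemma sum_mult_delta:
  "(\<Sum>s\<in>UNIV. g s * (if s = k then h else 0)) = g k * (h :: complex)"
  "(\<Sum>s\<in>UNIV. (if s = k then h else 0) * g s) = h * g (k :: 'a::finite)"
proof -
  have "(\<Sum>s\<in>UNIV. g s * (if s = k then h else 0)) = (\<Sum>s\<in>UNIV. if s = k then g s * h else 0)"
    by (intro sum.cong) auto
  then show "(\<Sum>s\<in>UNIV. g s * (if s = k then h else 0)) = g k * h" by simp
  then show "(\<Sum>s\<in>UNIV. (if s = k then h else 0) * g s) = h * g k" by (simp add: mult.commute)
qed

lemma kron_entry: "kron A B $ (a, b) $ (c, d) = A $ a $ c * B $ b $ d"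
  by (simp add: kron_def)

text \<open>
  For one node only two neighbouring positions \<open>x\<close> and \<open>y\<close> matter: at every other position \<open>E\<close> and \<open>F\<close>
  vanish and the comparison with \<open>x\<close> agrees with that with \<open>y\<close>. The intertwining property of the
  matrices above thus becomes a check of finitely many cases.
\<close>

locale ladder_step =
  fixes P :: "'n::finite \<Rightarrow> nat" and x y :: 'n and Q W :: complex
  assumes Q0: "Q \<noteq> 0" and W0: "W \<noteq> 0" and Pxy: "P y = P x + 1" and injP: "inj P"
begin

lemma xy: "x \<noteq> y" "y \<noteq> x" using Pxy by auto

lemma P_neq: "z \<noteq> x \<Longrightarrow> P z \<noteq> P x" "z \<noteq> y \<Longrightarrow> P z \<noteq> P x + 1"
  using injP Pxy by (auto simp: inj_def)

lemma order_left: "z \<noteq> x \<Longrightarrow> z \<noteq> y \<Longrightarrow> P z < P y \<longleftrightarrow> P z < P x"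
  using P_neq[of z] Pxy by auto

lemma order_right: "z \<noteq> x \<Longrightarrow> z \<noteq> y \<Longrightarrow> P y < P z \<longleftrightarrow> P x < P z"
  using P_neq[of z] Pxy by auto

lemma not_yx: "\<not> P y < P x" "P x < P y" using Pxy by auto

definition kp :: "'n \<Rightarrow> complex" where "kp z = (if z = x then Q else if z = y then 1 / Q else 1)"

lemma kp_simps: "kp x = Q" "kp y = 1 / Q" "z \<noteq> x \<Longrightarrow> z \<noteq> y \<Longrightarrow> kp z = 1"
  using xy by (auto simp: kp_def)

lemma kp_nz: "kp z \<noteq> 0" using Q0 by (auto simp: kp_def)

lemma three_cases: "(z = x \<Longrightarrow> thesis) \<Longrightarrow> (z = y \<Longrightarrow> thesis) \<Longrightarrow> (z \<noteq> x \<Longrightarrow> z \<noteq> y \<Longrightarrow> thesis) \<Longrightarrow> thesis"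
  by blast

lemmas step_simps = order_left order_right not_yx kp_simps xy Q0 W0

context
  fixes X :: "'n uq_module" and i :: nat and e f :: complex
  assumes K: "\<And>s c. Kop X i $ s $ c = (if s = c then kp c else 0)"
    and Ki: "\<And>s c. Kinv X i $ s $ c = (if s = c then 1 / kp c else 0)"
    and E: "\<And>s c. Eop X i $ s $ c = (if s = x \<and> c = y then e else 0)"
    and F: "\<And>s c. Fop X i $ s $ c = (if s = y \<and> c = x then f else 0)"
begin

lemma Rsame_E: "Rsame P Q W ** Eop (tensor_module X X) i = Eop (tensor_module X X) i ** Rsame P Q W"
proof -
  have "(Rsame P Q W ** Eop (tensor_module X X) i) $ (a, b) $ (c, d) = (Eop (tensor_module X X) i ** Rsame P Q W) $ (a, b) $ (c, d)" for a b c d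
    unfolding Rsame_mult tensor_module_def uq_module.simps vector_add_component kron_entry K E
    by (rule three_cases[of a]; rule three_cases[of b]; rule three_cases[of c]; rule three_cases[of d];
        simp add: swap_coef_def mix_coef_def step_simps mat_def field_simps power2_eq_square)
  then show ?thesis by (simp add: vec_eq_iff)
qed

lemma Rsame_F: "Rsame P Q W ** Fop (tensor_module X X) i = Fop (tensor_module X X) i ** Rsame P Q W"
proof -
  have "(Rsame P Q W ** Fop (tensor_module X X) i) $ (a, b) $ (c, d) = (Fop (tensor_module X X) i ** Rsame P Q W) $ (a, b) $ (c, d)" for a b c d
    unfolding Rsame_mult tensor_module_def uq_module.simps vector_add_component kron_entry Ki F
    by (rule three_cases[of a]; rule three_cases[of b]; rule three_cases[of c]; rule three_cases[of d];
        simp add: swap_coef_def mix_coef_def step_simps mat_def field_simps power2_eq_square)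
  then show ?thesis by (simp add: vec_eq_iff)
qed

lemma Rsame_K: "Rsame P Q W ** Kop (tensor_module X X) i = Kop (tensor_module X X) i ** Rsame P Q W"
  "Rsame P Q W ** Kinv (tensor_module X X) i = Kinv (tensor_module X X) i ** Rsame P Q W"
proof -
  have "(Rsame P Q W ** Kop (tensor_module X X) i) $ (a, b) $ (c, d) = (Kop (tensor_module X X) i ** Rsame P Q W) $ (a, b) $ (c, d)"
    "(Rsame P Q W ** Kinv (tensor_module X X) i) $ (a, b) $ (c, d) = (Kinv (tensor_module X X) i ** Rsame P Q W) $ (a, b) $ (c, d)" for a b c d
    unfolding Rsame_mult tensor_module_def uq_module.simps kron_entry K Ki
    by (auto simp: swap_coef_def)
  then show "Rsame P Q W ** Kop (tensor_module X X) i = Kop (tensor_module X X) i ** Rsame P Q W"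
  "Rsame P Q W ** Kinv (tensor_module X X) i = Kinv (tensor_module X X) i ** Rsame P Q W" by (simp_all add: vec_eq_iff)
qed

context
  fixes Y :: "'n uq_module"
  assumes K': "\<And>s c. Kop Y i $ s $ c = (if s = c then 1 / kp c else 0)"
    and Ki': "\<And>s c. Kinv Y i $ s $ c = (if s = c then kp c else 0)"
    and E': "\<And>s c. Eop Y i $ s $ c = (if s = y \<and> c = x then - e * Q else 0)"
    and F': "\<And>s c. Fop Y i $ s $ c = (if s = x \<and> c = y then - f / Q else 0)"
begin

lemma Rmix_K: "Rmix P Q W ** Kop (tensor_module X Y) i = Kop (tensor_module Y X) i ** Rmix P Q W"
  "Rmix P Q W ** Kinv (tensor_module X Y) i = Kinv (tensor_module Y X) i ** Rmix P Q W"
proof -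
  have d: "Kop (tensor_module X Y) i $ (s, s) $ (c, d) = (if c = d then if s = c then 1 else 0 else 0)"
    "Kinv (tensor_module X Y) i $ (s, s) $ (c, d) = (if c = d then if s = c then 1 else 0 else 0)"
    "Kop (tensor_module Y X) i $ (a, b) $ (s, s) = (if a = b then if s = a then 1 else 0 else 0)"
    "Kinv (tensor_module Y X) i $ (a, b) $ (s, s) = (if a = b then if s = a then 1 else 0 else 0)" for a b c d s
    unfolding tensor_module_def uq_module.simps kron_entry K Ki K' Ki' using kp_nz by auto
  have "(Rmix P Q W ** Kop (tensor_module X Y) i) $ (a, b) $ (c, d) = (Kop (tensor_module Y X) i ** Rmix P Q W) $ (a, b) $ (c, d)" for a b c d
    unfolding Rmix_mult d
    unfolding tensor_module_def uq_module.simps kron_entry K Ki K' Ki'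
    by (cases "c = d"; cases "a = b"; auto simp: kp_nz sum_mult_delta)
  moreover have "(Rmix P Q W ** Kinv (tensor_module X Y) i) $ (a, b) $ (c, d) = (Kinv (tensor_module Y X) i ** Rmix P Q W) $ (a, b) $ (c, d)" for a b c d
    unfolding Rmix_mult d
    unfolding tensor_module_def uq_module.simps kron_entry K Ki K' Ki'
    by (cases "c = d"; cases "a = b"; auto simp: kp_nz sum_mult_delta)
  ultimately show "Rmix P Q W ** Kop (tensor_module X Y) i = Kop (tensor_module Y X) i ** Rmix P Q W"
  "Rmix P Q W ** Kinv (tensor_module X Y) i = Kinv (tensor_module Y X) i ** Rmix P Q W" by (simp_all add: vec_eq_iff)
qed

lemma exponent_shift:
  "P a < P x \<Longrightarrow> Q ^ (2 * (P y - P a)) = Q ^ (2 * (P x - P a)) * (Q * Q)"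
  "P y < P a \<Longrightarrow> Q ^ (2 * (P a - P x)) = Q ^ (2 * (P a - P y)) * (Q * Q)"
proof -
  assume "P a < P x"
  then have "2 * (P y - P a) = 2 * (P x - P a) + 2" using Pxy by simp
  then show "Q ^ (2 * (P y - P a)) = Q ^ (2 * (P x - P a)) * (Q * Q)" by (simp only: power_add power2_eq_square)
next
  assume "P y < P a"
  then have "2 * (P a - P x) = 2 * (P a - P y) + 2" using Pxy by simp
  then show "Q ^ (2 * (P a - P x)) = Q ^ (2 * (P a - P y)) * (Q * Q)" by (simp only: power_add power2_eq_square)
qed

lemma exponent_xy: "2 * (P y - P x) = 2" using Pxy by simp

lemma Rmix_E: "Rmix P Q W ** Eop (tensor_module X Y) i = Eop (tensor_module Y X) i ** Rmix P Q W"
proof -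
  have d: "Eop (tensor_module X Y) i $ (s, s) $ (c, d) =
      (if s = x then if c = y \<and> d = x then e / Q else 0 else 0) + (if s = y then if c = y \<and> d = x then - e * Q else 0 else 0)"
    "Eop (tensor_module Y X) i $ (a, b) $ (s, s) =
      (if s = x then if a = y \<and> b = x then - e * Q * Q else 0 else 0) + (if s = y then if a = y \<and> b = x then e else 0 else 0)" for a b c d s
    unfolding tensor_module_def uq_module.simps vector_add_component kron_entry K E K' E'
    using xy by (auto simp: kp_simps mat_def)
  have "(Rmix P Q W ** Eop (tensor_module X Y) i) $ (a, b) $ (c, d) = (Eop (tensor_module Y X) i ** Rmix P Q W) $ (a, b) $ (c, d)" for a b c d
    unfolding Rmix_mult d distrib_left distrib_right sum.distrib
    unfolding tensor_module_def uq_module.simps vector_add_component kron_entry K E K' E'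
    by (rule three_cases[of a]; rule three_cases[of b]; rule three_cases[of c]; rule three_cases[of d];
        simp add: swap_coef_def mix_coef_def step_simps mat_def field_simps power2_eq_square exponent_shift exponent_xy sum_mult_delta)
  then show ?thesis by (simp add: vec_eq_iff)
qed

lemma Rmix_F: "Rmix P Q W ** Fop (tensor_module X Y) i = Fop (tensor_module Y X) i ** Rmix P Q W"
proof -
  have d: "Fop (tensor_module X Y) i $ (s, s) $ (c, d) =
      (if s = y then if c = x \<and> d = y then f else 0 else 0) + (if s = x then if c = x \<and> d = y then - f / Q / Q else 0 else 0)"
    "Fop (tensor_module Y X) i $ (a, b) $ (s, s) =
      (if s = y then if a = x \<and> b = y then - f / Q else 0 else 0) + (if s = x then if a = x \<and> b = y then Q * f else 0 else 0)" for a b c d s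
    unfolding tensor_module_def uq_module.simps vector_add_component kron_entry Ki F Ki' F'
    using xy by (auto simp: kp_simps mat_def)
  have "(Rmix P Q W ** Fop (tensor_module X Y) i) $ (a, b) $ (c, d) = (Fop (tensor_module Y X) i ** Rmix P Q W) $ (a, b) $ (c, d)" for a b c d
    unfolding Rmix_mult d distrib_left distrib_right sum.distrib
    unfolding tensor_module_def uq_module.simps vector_add_component kron_entry Ki F Ki' F'
    by (rule three_cases[of a]; rule three_cases[of b]; rule three_cases[of c]; rule three_cases[of d];
        simp add: swap_coef_def mix_coef_def step_simps mat_def field_simps power2_eq_square exponent_shift exponent_xy sum_mult_delta)
  then show ?thesis by (simp add: vec_eq_iff)
qed

end
end
end

lemma intertwiner_zero_column:
  fixes D :: "complex^('k::finite)^('l::finite)"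
  assumes "D ** A = B ** D" and "\<And>I. D $ I $ J = 0"
  shows "(\<Sum>K\<in>UNIV. D $ I $ K * A $ K $ J) = 0"
proof -
  have "(D ** A) $ I $ J = (B ** D) $ I $ J" by (simp only: assms(1))
  then show ?thesis by (simp add: matrix_matrix_mult_def assms(2))
qed

lemma position_exists:
  assumes "bij_betw P UNIV {1..n}" "k \<in> {1..n}"
  shows "\<exists>x. P x = k"
  using assms by (metis bij_betw_def image_iff)

text \<open>
  The highest weight vector tensored with the lowest one generates: \<open>F\<close> moves the first factor down
  and kills the lowest vector of the second, and once all vectors with the lowest second factor
  are reached, \<open>E\<close> moves the second factor up, up to terms already reached.
\<close>

lemma ladder_tensor_generated:
  fixes X :: "('n::finite) uq_module" and Y :: "('k::finite) uq_module"
  assumes X: "ladder r q X P \<tau> e f" and Y: "ladder r q Y P' \<tau>' e' f'"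
    and D: "module_map r (tensor_module X Y) Z D"
    and x: "P x = 1" and y: "P' y = r + 1" and zero: "\<And>I. D $ I $ (x, y) = 0"
  shows "D = 0"
proof -
  have P: "bij_betw P UNIV {1..r+1}" and tau: "bij_betw \<tau> {1..r} {1..r}"
    and P': "bij_betw P' UNIV {1..r+1}" and tau': "bij_betw \<tau>' {1..r} {1..r}"
    using X Y by (simp_all add: ladder_def)
  have inj: "inj P" "inj P'" using P P' by (simp_all add: bij_betw_def)
  have PR: "P z \<in> {1..r+1}" for z using P by (auto simp: bij_betw_def)
  have PR': "P' z \<in> {1..r+1}" for z using P' by (auto simp: bij_betw_def)
  have stage1: "\<forall>c. P c = k \<longrightarrow> (\<forall>I. D $ I $ (c, y) = 0)" if "1 \<le> k" for k
    using that
  proof (induction k rule: dec_induct)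
    case base
    show ?case using zero x inj(1) by (metis inj_eq)
  next
    case (step k)
    show ?case
    proof (intro allI impI)
      fix c I assume c: "P c = Suc k"
      have k: "k \<in> {1..r}" using PR[of c] c step by auto
      obtain c' where c': "P c' = k"
        using position_exists[OF P, of k] k by auto
      have cs: "P s = k + 1 \<longleftrightarrow> s = c" for s
        using c injD[OF inj(1), of s c] by auto
      have F: "Fop X (\<tau> k) $ s $ c' = (if s = c then f k else 0)" for s
        using X[unfolded ladder_def, THEN conjunct2, THEN conjunct2, THEN bspec, OF k] c'
        by (simp only: cs) simp
      have fk: "f k \<noteq> 0"
        using X[unfolded ladder_def, THEN conjunct2, THEN conjunct2, THEN bspec, OF k] by auto
      have tk: "\<tau> k \<in> {1..r}" using tau k by (auto simp: bij_betw_def)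
      then obtain k' where k': "k' \<in> {1..r}" "\<tau> k = \<tau>' k'"
        using tau' by (metis bij_betw_def image_iff)
      have F': "Fop Y (\<tau> k) $ t $ y = 0" for t
        unfolding k'(2) using Y[unfolded ladder_def, THEN conjunct2, THEN conjunct2, THEN bspec, OF k'(1)] y k'(1)
        by auto
      have "D ** Fop (tensor_module X Y) (\<tau> k) = Fop Z (\<tau> k) ** D"
        using D tk by (auto simp: module_map_def)
      then have "(\<Sum>K\<in>UNIV. D $ I $ K * Fop (tensor_module X Y) (\<tau> k) $ K $ (c', y)) = 0"
        by (rule intertwiner_zero_column) (use step.IH c' in blast)
      moreover have "D $ I $ K * Fop (tensor_module X Y) (\<tau> k) $ K $ (c', y)
         = (if K = (c, y) then D $ I $ K * f k else 0)" for K
        by (cases K) (simp add: tensor_module_def kron_entry F F' mat_def)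
      ultimately show "D $ I $ (c, y) = 0" using fk by simp
    qed
  qed
  have stage2: "\<forall>d. P' d = k \<longrightarrow> (\<forall>c I. D $ I $ (c, d) = 0)" if "k \<le> r + 1" for k
    using that
  proof (induction k rule: inc_induct)
    case base
    show ?case
    proof (intro allI impI)
      fix d c I assume "P' d = r + 1"
      then have "d = y" using y inj(2) by (auto simp: inj_def)
      moreover have "1 \<le> P c" using PR[of c] by simp
      ultimately show "D $ I $ (c, d) = 0" using stage1 by blast
    qed
  next
    case (step k)
    show ?case
    proof (intro allI impI)
      fix d c I assume d: "P' d = k"
      have k: "k \<in> {1..r}" using PR'[of d] d step by auto
      obtain d' where d': "P' d' = Suc k"
        using position_exists[OF P', of "Suc k"] k by auto
      note L = Y[unfolded ladder_def, THEN conjunct2, THEN conjunct2, THEN bspec, OF k]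
      have ds: "P' t = k \<longleftrightarrow> t = d" for t
        using d injD[OF inj(2), of t d] by auto
      have E: "Eop Y (\<tau>' k) $ t $ d' = (if t = d then e' k else 0)" for t
        using L d' by (simp only: ds) simp
      have K: "Kop Y (\<tau>' k) $ t $ d' = (if t = d' then kap q k (P' d') else 0)" for t
        using L by auto
      have ek: "e' k \<noteq> 0" using L by auto
      have tk: "\<tau>' k \<in> {1..r}" using tau' k by (auto simp: bij_betw_def)
      have IH: "\<And>I c. D $ I $ (c, d') = 0" using step.IH d' by blast
      have "D ** Eop (tensor_module X Y) (\<tau>' k) = Eop Z (\<tau>' k) ** D"
        using D tk by (auto simp: module_map_def)
      then have "(\<Sum>K\<in>UNIV. D $ I $ K * Eop (tensor_module X Y) (\<tau>' k) $ K $ (c, d')) = 0"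
        by (rule intertwiner_zero_column) (rule IH)
      moreover have "D $ I $ K * Eop (tensor_module X Y) (\<tau>' k) $ K $ (c, d')
         = (if K = (c, d) then D $ I $ K * e' k else 0)" for K
        by (cases K) (simp add: tensor_module_def kron_entry E K mat_def IH distrib_left)
      ultimately show "D $ I $ (c, d) = 0" using ek by simp
    qed
  qed
  have "D $ I $ (c, d) = 0" for I c d
    using stage2[of "P' d"] PR'[of d] by auto
  then show "D = 0" by (simp add: vec_eq_iff)
qed

lemma q_powr_eq_iff: "0 < q \<Longrightarrow> q < 1 \<Longrightarrow> q powr x = q powr y \<longleftrightarrow> x = (y::real)"
  by (simp add: powr_def)

text \<open>
  A coordinate in position \<open>k + 1\<close> is detected by the \<open>E\<close> that moves it to position \<open>k\<close>.
\<close>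

lemma ladder_highest_weight_vector:
  fixes M :: "('n::finite) uq_module"
  assumes L: "ladder r q M P \<tau> e f" and q: "0 < q" "q < 1" and r: "1 \<le> r"
    and v: "highest_weight_vector r q M \<mu> v"
  shows "P x \<noteq> 1 \<Longrightarrow> v $ x = 0" and "\<mu> = fund_weight r (\<tau> 1)"
proof -
  have P: "bij_betw P UNIV {1..r+1}" and tau: "bij_betw \<tau> {1..r} {1..r}"
    using L by (simp_all add: ladder_def)
  have inj: "inj P" using P by (simp add: bij_betw_def)
  have PR: "P z \<in> {1..r+1}" for z using P by (auto simp: bij_betw_def)
  show zero: "v $ x = 0" if "P x \<noteq> 1" for x
  proof -
    define k where "k = P x - 1"
    have k: "k \<in> {1..r}" "P x = k + 1" using PR[of x] that by (auto simp: k_def)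
    note Lk = L[unfolded ladder_def, THEN conjunct2, THEN conjunct2, THEN bspec, OF k(1)]
    obtain z where z: "P z = k" using position_exists[OF P, of k] k by auto
    have tk: "\<tau> k \<in> {1..r}" using tau k by (auto simp: bij_betw_def)
    have "Eop M (\<tau> k) *v v = 0" using v tk by (simp add: highest_weight_vector_def)
    then have "(Eop M (\<tau> k) *v v) $ z = 0" by simp
    moreover have tx: "P t = k + 1 \<longleftrightarrow> t = x" for t
      using k(2) injD[OF inj, of t x] by auto
    have "Eop M (\<tau> k) $ z $ t * v $ t = (if t = x then e k * v $ t else 0)" for t
      using Lk z by (simp only: tx) simp
    then have "(Eop M (\<tau> k) *v v) $ z = e k * v $ x" by (simp add: matrix_vector_mult_def)
    ultimately have "e k * v $ x = 0" by simp
    then show "v $ x = 0" using Lk by auto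
  qed
  have "v \<noteq> 0" using v by (simp add: highest_weight_vector_def)
  then obtain x where x: "v $ x \<noteq> 0" by (auto simp: vec_eq_iff)
  then have Px: "P x = 1" using zero by blast
  have pair: "form r (simple_root (\<tau> k)) \<mu> = (if k = 1 then 1 else 0)" if k: "k \<in> {1..r}" for k
  proof -
    note Lk = L[unfolded ladder_def, THEN conjunct2, THEN conjunct2, THEN bspec, OF k]
    have tk: "\<tau> k \<in> {1..r}" using tau k by (auto simp: bij_betw_def)
    have "Kop M (\<tau> k) *v v = (q powr form r (simple_root (\<tau> k)) \<mu>) *\<^sub>R v"
      using v tk by (simp add: highest_weight_vector_def has_weight_def)
    then have "(Kop M (\<tau> k) *v v) $ x = of_real (q powr form r (simple_root (\<tau> k)) \<mu>) * v $ x"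
      by (simp add: scaleR_conv_of_real[of _ "v $ x"])
    moreover have "(Kop M (\<tau> k) *v v) $ x = kap q k 1 * v $ x"
    proof -
      have "Kop M (\<tau> k) $ x $ t * v $ t = (if t = x then kap q k 1 * v $ t else 0)" for t
        using Lk Px by auto
      then show ?thesis by (simp add: matrix_vector_mult_def)
    qed
    ultimately have "complex_of_real (q powr form r (simple_root (\<tau> k)) \<mu>) = kap q k 1" using x by simp
    also have "kap q k 1 = of_real (q powr (if k = 1 then 1 else 0))" using k q by (auto simp: kap_def)
    finally have "q powr form r (simple_root (\<tau> k)) \<mu> = q powr (if k = 1 then 1 else 0)"
      by (simp only: of_real_eq_iff)
    then show ?thesis by (simp only: q_powr_eq_iff[OF q])
  qed
  have t1: "\<tau> 1 \<in> {1..r}" using tau r by (auto simp: bij_betw_def)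
  have pair': "form r (simple_root i) \<mu> = (if i = \<tau> 1 then 1 else 0)" if i: "i \<in> {1..r}" for i
  proof -
    obtain k where k: "k \<in> {1..r}" "i = \<tau> k" using tau i by (metis bij_betw_def image_iff)
    have "\<tau> k = \<tau> 1 \<longleftrightarrow> k = 1"
      using inj_on_eq_iff[OF bij_betw_imp_inj_on[OF tau] k(1), of 1] r by simp
    then show ?thesis using pair[OF k(1)] k(2) by simp
  qed
  have "\<mu> \<in> weight_lattice r" using v by (simp add: highest_weight_vector_def has_weight_def)
  then have "\<mu> = (\<lambda>k. \<Sum>i=1..r. form r (simple_root i) \<mu> * fund_weight r i k)"
    by (rule weight_lattice_expansion)
  also have "\<dots> = (\<lambda>k. \<Sum>i=1..r. if i = \<tau> 1 then fund_weight r i k else 0)"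
    by (intro ext sum.cong) (auto simp: pair')
  also have "\<dots> = fund_weight r (\<tau> 1)" using t1 by simp
  finally show "\<mu> = fund_weight r (\<tau> 1)" .
qed

lemma ladder_lowest_weight_vector:
  fixes M :: "('n::finite) uq_module"
  assumes L: "ladder r q M P \<tau> e f" and u: "lowest_weight_vector r q M \<mu> u" and x: "P x \<noteq> r + 1"
  shows "u $ x = 0"
proof -
  have P: "bij_betw P UNIV {1..r+1}" and tau: "bij_betw \<tau> {1..r} {1..r}"
    using L by (simp_all add: ladder_def)
  have inj: "inj P" using P by (simp add: bij_betw_def)
  have PR: "P x \<in> {1..r+1}" using P by (auto simp: bij_betw_def)
  define k where "k = P x"
  have k: "k \<in> {1..r}" "P x = k" using PR x by (auto simp: k_def)
  note Lk = L[unfolded ladder_def, THEN conjunct2, THEN conjunct2, THEN bspec, OF k(1)]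
  obtain z where z: "P z = k + 1"
    using position_exists[OF P, of "k + 1"] k by auto
  have tk: "\<tau> k \<in> {1..r}" using tau k by (auto simp: bij_betw_def)
  have "Fop M (\<tau> k) *v u = 0" using u tk by (simp add: lowest_weight_vector_def)
  then have "(Fop M (\<tau> k) *v u) $ z = 0" by simp
  moreover have tx: "P t = k \<longleftrightarrow> t = x" for t
    using k(2) injD[OF inj, of t x] by auto
  have "Fop M (\<tau> k) $ z $ t * u $ t = (if t = x then f k * u $ t else 0)" for t
    using Lk z by (simp only: tx) simp
  then have "(Fop M (\<tau> k) *v u) $ z = f k * u $ x" by (simp add: matrix_vector_mult_def)
  ultimately have "f k * u $ x = 0" by simp
  then show "u $ x = 0" using Lk by auto
qed

lemma matrix_diff_mult: "(A - B) ** C = A ** C - B ** (C :: complex^'k^'n)"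
  by (simp add: vec_eq_iff matrix_matrix_mult_def left_diff_distrib sum_subtractf)

lemma matrix_mult_diff: "C ** (A - B) = C ** A - C ** (B :: complex^'k^'n)"
  by (simp add: vec_eq_iff matrix_matrix_mult_def right_diff_distrib sum_subtractf)

text \<open>
  The braiding is prescribed on highest tensored with lowest weight vectors only. Such vectors are
  unique up to scalars, so by \<open>ladder_tensor_generated\<close> a module map with the prescribed column is the
  braiding.
\<close>

theorem ladder_braiding:
  fixes X :: "('n::finite) uq_module" and Y :: "('k::finite) uq_module"
  assumes X: "ladder r q X P \<tau> e f" and Y: "ladder r q Y P' \<tau>' e' f'"
    and q: "0 < q" "q < 1" and r: "1 \<le> r"
    and R: "module_map r (tensor_module X Y) (tensor_module Y X) R"
    and x: "P x = 1" and y: "P' y = r + 1"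
    and col: "\<And>a b. R $ (a, b) $ (x, y) = (if a = y \<and> b = x
        then of_real (q powr form r (fund_weight r (\<tau> 1)) (w0 r (fund_weight r (\<tau>' 1)))) else 0)"
    and vX: "\<exists>\<mu> v. highest_weight_vector r q X \<mu> v"
    and vY: "\<exists>\<mu> v. highest_weight_vector r q Y \<mu> v"
    and uY: "\<exists>u. lowest_weight_vector r q Y (w0 r (fund_weight r (\<tau>' 1))) u"
  shows "braiding r q X Y = R"
proof -
  have inj: "inj P" "inj P'" using X Y by (simp_all add: ladder_def bij_betw_def)
  let ?c = "q powr form r (fund_weight r (\<tau> 1)) (w0 r (fund_weight r (\<tau>' 1)))"
  have tens: "tensor_vec v u = (\<chi> J. if J = (x, y) then v $ x * u $ y else 0)"
      "tensor_vec u v = (\<chi> J. if J = (y, x) then u $ y * v $ x else 0)"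
    if "highest_weight_vector r q X \<mu> v" "lowest_weight_vector r q Y \<nu> u" for v u \<mu> \<nu>
  proof -
    have "v $ a = 0" if "a \<noteq> x" for a
      using that x inj(1) by (intro ladder_highest_weight_vector(1)[OF X q r \<open>highest_weight_vector r q X \<mu> v\<close>]) (auto simp: inj_def)
    moreover have "u $ b = 0" if "b \<noteq> y" for b
      using that y inj(2) by (intro ladder_lowest_weight_vector[OF Y \<open>lowest_weight_vector r q Y \<nu> u\<close>]) (auto simp: inj_def)
    ultimately show "tensor_vec v u = (\<chi> J. if J = (x, y) then v $ x * u $ y else 0)"
      "tensor_vec u v = (\<chi> J. if J = (y, x) then u $ y * v $ x else 0)"
      by (auto simp: tensor_vec_def vec_eq_iff)
  qed
  have apply_col: "(A *v tensor_vec v u) $ I = A $ I $ (x, y) * (v $ x * u $ y)"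
    if "highest_weight_vector r q X \<mu> v" "lowest_weight_vector r q Y \<nu> u" for A :: "complex^('n \<times> 'k)^('k \<times> 'n)" and v u \<mu> \<nu> I
  proof -
    have "(A *v tensor_vec v u) $ I = (\<Sum>J\<in>UNIV. if J = (x, y) then A $ I $ J * (v $ x * u $ y) else 0)"
      unfolding tens[OF that] matrix_vector_mult_def vec_lambda_beta by (intro sum.cong refl) simp
    then show ?thesis by simp
  qed
  have isb: "is_braiding r q X Y R"
    unfolding is_braiding_def
  proof (intro conjI allI impI)
    show "module_map r (tensor_module X Y) (tensor_module Y X) R" by (rule R)
    fix \<mu> \<nu> v y' u
    assume h: "highest_weight_vector r q X \<mu> v" "highest_weight_vector r q Y \<nu> y'" "lowest_weight_vector r q Y (w0 r \<nu>) u"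
    have mu: "\<mu> = fund_weight r (\<tau> 1)" "\<nu> = fund_weight r (\<tau>' 1)"
      using ladder_highest_weight_vector(2)[OF X q r h(1)] ladder_highest_weight_vector(2)[OF Y q r h(2)] by auto
    have "(R *v tensor_vec v u) $ (a, b) = (?c *\<^sub>R tensor_vec u v) $ (a, b)" for a b
      unfolding apply_col[OF h(1,3)] col vector_scaleR_component tens(2)[OF h(1,3)] vec_lambda_beta
      by (simp add: scaleR_conv_of_real mult.commute)
    then show "R *v tensor_vec v u = (q powr form r \<mu> (w0 r \<nu>)) *\<^sub>R tensor_vec u v"
      unfolding mu vec_eq_iff by auto
  qed
  have uniq: "R' = R" if R': "is_braiding r q X Y R'" for R'
  proof -
    obtain \<mu> v where v: "highest_weight_vector r q X \<mu> v" using vX by blast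
    obtain \<nu> y' where y': "highest_weight_vector r q Y \<nu> y'" using vY by blast
    have nu: "\<nu> = fund_weight r (\<tau>' 1)" using ladder_highest_weight_vector(2)[OF Y q r y'] .
    obtain u where u: "lowest_weight_vector r q Y (w0 r \<nu>) u" using uY nu by blast
    have vx: "v $ x \<noteq> 0"
    proof
      assume "v $ x = 0"
      moreover have "v $ a = 0" if "a \<noteq> x" for a
        using that x inj(1) by (intro ladder_highest_weight_vector(1)[OF X q r v]) (auto simp: inj_def)
      ultimately have "v = 0" unfolding vec_eq_iff by (metis zero_index)
      then show False using v by (simp add: highest_weight_vector_def)
    qed
    have uy: "u $ y \<noteq> 0"
    proof
      assume "u $ y = 0"
      moreover have "u $ b = 0" if "b \<noteq> y" for b
        using that y inj(2) by (intro ladder_lowest_weight_vector[OF Y u]) (auto simp: inj_def)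
      ultimately have "u = 0" unfolding vec_eq_iff by (metis zero_index)
      then show False using u by (simp add: lowest_weight_vector_def)
    qed
    have "R' *v tensor_vec v u = R *v tensor_vec v u"
      using R' isb v y' u unfolding is_braiding_def by metis
    then have "(R' *v tensor_vec v u) $ I = (R *v tensor_vec v u) $ I" for I by simp
    then have col0: "(R' - R) $ I $ (x, y) = 0" for I
      using vx uy unfolding apply_col[OF v u] by simp
    have mm: "module_map r (tensor_module X Y) (tensor_module Y X) (R' - R)"
      using R R' unfolding is_braiding_def module_map_def by (simp add: matrix_diff_mult matrix_mult_diff)
    have "R' - R = 0" by (rule ladder_tensor_generated[OF X Y mm x y col0])
    then show ?thesis by simp
  qed
  show ?thesis unfolding braiding_def by (rule the_equality[where P = "is_braiding r q X Y", OF isb uniq])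
qed

lemma swap_diag_column:
  assumes "x \<noteq> y" "\<not> P y < (P x::nat)"
  shows "(if x = b \<and> y = a then v else 0) + (if x = a \<and> y = b then if P b < P a then u else 0 else 0)
     = (if a = y \<and> b = x then v else (0::complex))"
proof -
  have c1: "(x = b \<and> y = a) = (a = y \<and> b = x)" by blast
  have "\<not> (x = a \<and> y = b) \<or> \<not> P b < P a" using assms by blast
  then have c2: "(if x = a \<and> y = b then if P b < P a then u else 0 else 0) = 0"
    by (elim disjE) (simp_all only: if_False if_cancel)
  show ?thesis unfolding c1 c2 by (rule add_0_right)
qed

lemma Rsame_extreme_column:
  assumes "x \<noteq> y" "\<not> P y < (P x :: nat)"
  shows "Rsame P Q W $ (a, b) $ (x, y) = (if a = y \<and> b = x then W / Q else 0)"
proof -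
  have "a = y \<and> b = x \<Longrightarrow> swap_coef W (W / Q) a b = W / Q" using assms(1) by (auto simp: swap_coef_def)
  then show ?thesis
  unfolding Rsame_entry swap_diag_column[of x y P, OF assms]
  by (rule if_cong[OF refl _ refl])
qed

lemma swap_mix_column:
  assumes "\<not> P a < (P x::nat)"
  shows "(if x = b \<and> x = a then v else 0) + (if a = b \<and> x = x then if P a < P x then u else 0 else 0)
     = (if a = x \<and> b = x then v else (0::complex))"
proof -
  have c1: "(x = b \<and> x = a) = (a = x \<and> b = x)" by blast
  have c2: "(if a = b \<and> x = x then if P a < P x then u else 0 else 0) = 0"
    using assms by (simp_all only: if_False if_cancel)
  show ?thesis unfolding c1 c2 by (rule add_0_right)
qed

lemma Rmix_extreme_column:
  assumes "\<not> P a < (P x :: nat)"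
  shows "Rmix P Q W $ (a, b) $ (x, x) = (if a = x \<and> b = x then 1 / W else 0)"
proof -
  have "a = x \<and> b = x \<Longrightarrow> swap_coef (1 / W) (Q / W) a b = 1 / W" by (auto simp: swap_coef_def)
  then show ?thesis
  unfolding Rmix_entry mix_coef_def swap_mix_column[of P a x, OF assms]
  by (rule if_cong[OF refl _ refl])
qed

lemma w0_fund_weight:
  assumes "1 \<le> r"
  shows "w0 r (fund_weight r 1) = (\<lambda>k. - fund_weight r r k)" "w0 r (fund_weight r r) = (\<lambda>k. - fund_weight r 1 k)"
proof -
  have "fund_weight r 1 (r + 2 - k) = - fund_weight r r k \<and> fund_weight r r (r + 2 - k) = - fund_weight r 1 k" for k
  proof (cases "1 \<le> k \<and> k \<le> r + 1")
    case True
    then have *: "1 \<le> r + 2 - k" "r + 2 - k \<le> r + 1" by auto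
    show ?thesis
      using True * assms by (cases "k = 1"; cases "k = r + 1") (auto simp: fund_weight_def field_simps)
  next
    case False
    then have "\<not> (1 \<le> r + 2 - k \<and> r + 2 - k \<le> r + 1)" by auto
    then show ?thesis using False assms by (auto simp: fund_weight_def)
  qed
  then show "w0 r (fund_weight r 1) = (\<lambda>k. - fund_weight r r k)" "w0 r (fund_weight r r) = (\<lambda>k. - fund_weight r 1 k)"
    by (auto simp: w0_def)
qed

lemma fund_weight_lattice: "j \<in> {1..r} \<Longrightarrow> fund_weight r j \<in> weight_lattice r" "j \<in> {1..r} \<Longrightarrow> (\<lambda>k. - fund_weight r j k) \<in> weight_lattice r"
proof -
  assume j: "j \<in> {1..r}"
  have "fund_weight r j k = (\<Sum>i=1..r. of_int (if i = j then 1 else 0) * fund_weight r i k)"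
    "- fund_weight r j k = (\<Sum>i=1..r. of_int (if i = j then - 1 else 0) * fund_weight r i k)" for k
  proof -
    have "(\<Sum>i=1..r. of_int (if i = j then c else 0) * fund_weight r i k) = (\<Sum>i=1..r. if i = j then of_int c * fund_weight r i k else 0)" for c
      by (intro sum.cong) auto
    then show "fund_weight r j k = (\<Sum>i=1..r. of_int (if i = j then 1 else 0) * fund_weight r i k)"
      "- fund_weight r j k = (\<Sum>i=1..r. of_int (if i = j then - 1 else 0) * fund_weight r i k)" using j by simp_all
  qed
  note sums = this
  show "fund_weight r j \<in> weight_lattice r"
    unfolding weight_lattice_def
    by (rule CollectI, rule exI[of _ "\<lambda>i. if i = j then 1 else 0"], rule ext, rule sums(1))
  show "(\<lambda>k. - fund_weight r j k) \<in> weight_lattice r"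
    unfolding weight_lattice_def
    by (rule CollectI, rule exI[of _ "\<lambda>i. if i = j then - 1 else 0"], rule ext, rule sums(2))
qed

lemma matrix_vector_axis: "(A *v axis x 1) $ y = (A $ y $ x :: complex)"
proof -
  have "(A *v axis x 1) $ y = (\<Sum>t\<in>UNIV. if t = x then A $ y $ t else 0)"
    unfolding matrix_vector_mult_def axis_def vec_lambda_beta by (intro sum.cong refl) auto
  then show ?thesis by simp
qed

lemma ladder_extreme_vectors:
  fixes M :: "('n::finite) uq_module"
  assumes L: "ladder r q M P \<tau> e f" and q: "0 < q" and r: "1 \<le> r"
  shows "P x = 1 \<Longrightarrow> highest_weight_vector r q M (fund_weight r (\<tau> 1)) (axis x 1)"
    and "P x = r + 1 \<Longrightarrow> lowest_weight_vector r q M (\<lambda>k. - fund_weight r (\<tau> r) k) (axis x 1)"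
proof -
  have P: "bij_betw P UNIV {1..r+1}" and tau: "bij_betw \<tau> {1..r} {1..r}"
    using L by (simp_all add: ladder_def)
  have ends: "1 \<in> {1..r}" "r \<in> {1..r}" using r by auto
  have t: "\<tau> 1 \<in> {1..r}" "\<tau> r \<in> {1..r}" using tau ends by (auto simp: bij_betw_def)
  have inj: "\<tau> k = \<tau> j \<longleftrightarrow> k = j" if "k \<in> {1..r}" "j \<in> {1..r}" for k j
    using inj_on_eq_iff[OF bij_betw_imp_inj_on[OF tau] that] .
  have axis0: "axis x 1 \<noteq> (0 :: complex^'n)" by (simp add: axis_eq_0_iff)
  have K: "Kop M (\<tau> k) *v axis x 1 = (q powr c) *\<^sub>R axis x 1" if "k \<in> {1..r}" "kap q k (P x) = of_real (q powr c)" for k c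
  proof -
    have "(Kop M (\<tau> k) *v axis x 1) $ y = ((q powr c) *\<^sub>R axis x 1) $ y" for y
      unfolding matrix_vector_axis using L[unfolded ladder_def, THEN conjunct2, THEN conjunct2, THEN bspec, OF that(1)] that(2)
      by (auto simp: axis_def of_real_def)
    then show ?thesis by (simp add: vec_eq_iff)
  qed
  have surj: "\<exists>k\<in>{1..r}. i = \<tau> k" if "i \<in> {1..r}" for i
    using tau that by (metis bij_betw_def image_iff)
  show "highest_weight_vector r q M (fund_weight r (\<tau> 1)) (axis x 1)" if x: "P x = 1"
    unfolding highest_weight_vector_def has_weight_def
  proof (intro conjI ballI axis0)
    show "fund_weight r (\<tau> 1) \<in> weight_lattice r" by (rule fund_weight_lattice(1)[OF t(1)])
    fix i assume i: "i \<in> {1..r}"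
    then obtain k where k: "k \<in> {1..r}" "i = \<tau> k" using surj by blast
    have "kap q k (P x) = of_real (q powr form r (simple_root (\<tau> k)) (fund_weight r (\<tau> 1)))"
      using k i q r x t by (auto simp: form_simple_root_fund_weight inj kap_def)
    from K[OF k(1) this] show "Kop M i *v axis x 1 = (q powr form r (simple_root i) (fund_weight r (\<tau> 1))) *\<^sub>R axis x 1"
      by (simp add: k(2))
    have "(Eop M i *v axis x 1) $ y = 0" for y
      unfolding matrix_vector_axis k(2) using L[unfolded ladder_def, THEN conjunct2, THEN conjunct2, THEN bspec, OF k(1)] x k(1)
      by auto
    then show "Eop M i *v axis x 1 = 0" by (simp add: vec_eq_iff)
  qed
  show "lowest_weight_vector r q M (\<lambda>k. - fund_weight r (\<tau> r) k) (axis x 1)" if x: "P x = r + 1"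
    unfolding lowest_weight_vector_def has_weight_def
  proof (intro conjI ballI axis0)
    show "(\<lambda>k. - fund_weight r (\<tau> r) k) \<in> weight_lattice r" by (rule fund_weight_lattice(2)[OF t(2)])
    fix i assume i: "i \<in> {1..r}"
    then obtain k where k: "k \<in> {1..r}" "i = \<tau> k" using surj by blast
    have "form r (simple_root (\<tau> k)) (\<lambda>k. - fund_weight r (\<tau> r) k) = - form r (simple_root (\<tau> k)) (fund_weight r (\<tau> r))"
      by (simp add: form_def sum_negf)
    then have "kap q k (P x) = of_real (q powr form r (simple_root (\<tau> k)) (\<lambda>k. - fund_weight r (\<tau> r) k))"
      using k i q r x t by (auto simp: form_simple_root_fund_weight inj kap_def powr_minus_divide)
    from K[OF k(1) this] show "Kop M i *v axis x 1 = (q powr form r (simple_root i) (\<lambda>k. - fund_weight r (\<tau> r) k)) *\<^sub>R axis x 1"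
      by (simp add: k(2))
    have "(Fop M i *v axis x 1) $ y = 0" for y
      unfolding matrix_vector_axis k(2) using L[unfolded ladder_def, THEN conjunct2, THEN conjunct2, THEN bspec, OF k(1)] x k(1)
      by auto
    then show "Fop M i *v axis x 1 = 0" by (simp add: vec_eq_iff)
  qed
qed

lemma ladder_step_data:
  fixes M :: "('n::finite) uq_module"
  assumes L: "ladder r q M P \<tau> e f" and q: "0 < q" and W: "W \<noteq> 0" and i: "i \<in> {1..r}"
  obtains k x y where "k \<in> {1..r}" "i = \<tau> k" "P x = k" "P y = k + 1" "ladder_step P x y (of_real q) W"
    and "\<And>s c. Kop M i $ s $ c = (if s = c then ladder_step.kp x y (of_real q) c else 0)"
    and "\<And>s c. Kinv M i $ s $ c = (if s = c then 1 / ladder_step.kp x y (of_real q) c else 0)"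
    and "\<And>s c. Eop M i $ s $ c = (if s = x \<and> c = y then e k else 0)"
    and "\<And>s c. Fop M i $ s $ c = (if s = y \<and> c = x then f k else 0)"
proof -
  have P: "bij_betw P UNIV {1..r+1}" and tau: "bij_betw \<tau> {1..r} {1..r}"
    using L by (simp_all add: ladder_def)
  have inj: "inj P" using P by (simp add: bij_betw_def)
  obtain k where k: "k \<in> {1..r}" "i = \<tau> k" using tau i by (metis bij_betw_def image_iff)
  obtain x where x: "P x = k" using position_exists[OF P, of k] k by auto
  obtain y where y: "P y = k + 1" using position_exists[OF P, of "k + 1"] k by auto
  have st: "ladder_step P x y (of_real q) W"
    using q W x y inj by (simp add: ladder_step_def)
  have Px: "P z = k \<longleftrightarrow> z = x" "P z = k + 1 \<longleftrightarrow> z = y" for z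
    using x y injD[OF inj, of z x] injD[OF inj, of z y] by auto
  have kp: "kap q k (P c) = ladder_step.kp x y (of_real q) c" for c
    unfolding kap_def ladder_step.kp_def[OF st] Px by simp
  note Lk = L[unfolded ladder_def Px kp, THEN conjunct2, THEN conjunct2, THEN bspec, OF k(1)]
  have *: "Kop M (\<tau> k) $ s $ c = (if s = c then ladder_step.kp x y (of_real q) c else 0)"
     "Kinv M (\<tau> k) $ s $ c = (if s = c then 1 / ladder_step.kp x y (of_real q) c else 0)"
     "Eop M (\<tau> k) $ s $ c = (if s = x \<and> c = y then e k else 0)"
     "Fop M (\<tau> k) $ s $ c = (if s = y \<and> c = x then f k else 0)" for s c
    using L[unfolded ladder_def, THEN conjunct2, THEN conjunct2, THEN bspec, OF k(1)] unfolding Px kp[symmetric] by auto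
  show thesis by (rule that[OF k x y st]) (simp_all only: * k(2))
qed

lemma ladder_Rsame_module_map:
  fixes M :: "('n::finite) uq_module"
  assumes L: "ladder r q M P \<tau> e f" and q: "0 < q" and W: "W \<noteq> 0"
  shows "module_map r (tensor_module M M) (tensor_module M M) (Rsame P (of_real q) W)"
  unfolding module_map_def
proof
  fix i assume i: "i \<in> {1..r}"
  obtain k x y where st: "ladder_step P x y (of_real q) W"
    and *: "\<And>s c. Kop M i $ s $ c = (if s = c then ladder_step.kp x y (of_real q) c else 0)"
    "\<And>s c. Kinv M i $ s $ c = (if s = c then 1 / ladder_step.kp x y (of_real q) c else 0)"
    "\<And>s c. Eop M i $ s $ c = (if s = x \<and> c = y then e k else 0)"
    "\<And>s c. Fop M i $ s $ c = (if s = y \<and> c = x then f k else 0)"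
    by (rule ladder_step_data[OF L q W i]) blast
  show "Rsame P (of_real q) W ** Kop (tensor_module M M) i = Kop (tensor_module M M) i ** Rsame P (of_real q) W \<and>
     Rsame P (of_real q) W ** Kinv (tensor_module M M) i = Kinv (tensor_module M M) i ** Rsame P (of_real q) W \<and>
     Rsame P (of_real q) W ** Eop (tensor_module M M) i = Eop (tensor_module M M) i ** Rsame P (of_real q) W \<and>
     Rsame P (of_real q) W ** Fop (tensor_module M M) i = Fop (tensor_module M M) i ** Rsame P (of_real q) W"
    by (intro conjI ladder_step.Rsame_K[OF st *] ladder_step.Rsame_E[OF st *] ladder_step.Rsame_F[OF st *])
qed

lemma ladder_Rmix_module_map:
  fixes M :: "('n::finite) uq_module"
  assumes L: "ladder r q M P \<tau> e f" and q: "0 < q" and W: "W \<noteq> 0"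
  shows "module_map r (tensor_module M (dual_module M)) (tensor_module (dual_module M) M) (Rmix P (of_real q) W)"
  unfolding module_map_def
proof
  fix i assume i: "i \<in> {1..r}"
  let ?D = "dual_module M"
  obtain k x y where k: "k \<in> {1..r}" "i = \<tau> k" and x: "P x = k" and y: "P y = k + 1"
    and st: "ladder_step P x y (of_real q) W"
    and *: "\<And>s c. Kop M i $ s $ c = (if s = c then ladder_step.kp x y (of_real q) c else 0)"
    "\<And>s c. Kinv M i $ s $ c = (if s = c then 1 / ladder_step.kp x y (of_real q) c else 0)"
    "\<And>s c. Eop M i $ s $ c = (if s = x \<and> c = y then e k else 0)"
    "\<And>s c. Fop M i $ s $ c = (if s = y \<and> c = x then f k else 0)"
    by (rule ladder_step_data[OF L q W i]) blast
  have xy: "x \<noteq> y" using x y by auto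
  have kpxy: "ladder_step.kp x y (of_real q) x = of_real q" "ladder_step.kp x y (of_real q) y = 1 / of_real q"
    using xy by (simp_all add: ladder_step.kp_def[OF st])
  have EK: "(Eop M i ** Kinv M i) $ c $ s = (if c = x \<and> s = y then e k * of_real q else 0)" for c s
  proof -
    have "(Eop M i ** Kinv M i) $ c $ s = (\<Sum>z\<in>UNIV. if z = s then Eop M i $ c $ z * (1 / ladder_step.kp x y (of_real q) z) else 0)"
      unfolding matrix_matrix_mult_def vec_lambda_beta *(2) by (intro sum.cong refl) simp
    also have "\<dots> = Eop M i $ c $ s * (1 / ladder_step.kp x y (of_real q) s)" by simp
    finally show ?thesis unfolding *(3) by (auto simp: kpxy)
  qed
  have KF: "(Kop M i ** Fop M i) $ c $ s = (if c = y \<and> s = x then f k / of_real q else 0)" for c s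
  proof -
    have "(Kop M i ** Fop M i) $ c $ s = (\<Sum>z\<in>UNIV. if z = c then ladder_step.kp x y (of_real q) z * Fop M i $ z $ s else 0)"
      unfolding matrix_matrix_mult_def vec_lambda_beta *(1) by (intro sum.cong refl) auto
    also have "\<dots> = ladder_step.kp x y (of_real q) c * Fop M i $ c $ s" by simp
    finally show ?thesis unfolding *(4) by (auto simp: kpxy)
  qed
  have **: "Kop ?D i $ s $ c = (if s = c then 1 / ladder_step.kp x y (of_real q) c else 0)"
    "Kinv ?D i $ s $ c = (if s = c then ladder_step.kp x y (of_real q) c else 0)"
    "Eop ?D i $ s $ c = (if s = y \<and> c = x then - e k * of_real q else 0)"
    "Fop ?D i $ s $ c = (if s = x \<and> c = y then - f k / of_real q else 0)" for s c
    by (simp_all add: dual_module_def transpose_def * EK KF)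
  show "Rmix P (of_real q) W ** Kop (tensor_module M ?D) i = Kop (tensor_module ?D M) i ** Rmix P (of_real q) W \<and>
     Rmix P (of_real q) W ** Kinv (tensor_module M ?D) i = Kinv (tensor_module ?D M) i ** Rmix P (of_real q) W \<and>
     Rmix P (of_real q) W ** Eop (tensor_module M ?D) i = Eop (tensor_module ?D M) i ** Rmix P (of_real q) W \<and>
     Rmix P (of_real q) W ** Fop (tensor_module M ?D) i = Fop (tensor_module ?D M) i ** Rmix P (of_real q) W"
    by (intro conjI ladder_step.Rmix_K[OF st * **] ladder_step.Rmix_E[OF st * **] ladder_step.Rmix_F[OF st * **])
qed

context quantum_group_data
begin

text \<open>
  Position 1 carries the highest weight, and each further position one simple root less.
\<close>

definition pos :: "'n \<Rightarrow> nat" where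
  "pos = (SOME P. (\<exists>e f. ladder r q V P relabel e f) \<and> (\<forall>x. \<forall>j\<in>{1..r}. form r (simple_root (relabel j)) (wt x) =
     (if P x = j then 1 else 0) - (if P x = j + 1 then 1 else 0)))"

lemma pos: "\<exists>e f. ladder r q V pos relabel e f"
  and pos_weight: "j \<in> {1..r} \<Longrightarrow> form r (simple_root (relabel j)) (wt x) =
     (if pos x = j then 1 else 0) - (if pos x = j + 1 then 1 else 0)"
proof -
  have "\<exists>P. (\<exists>e f. ladder r q V P relabel e f) \<and> (\<forall>x. \<forall>j\<in>{1..r}. form r (simple_root (relabel j)) (wt x) =
     (if P x = j then 1 else 0) - (if P x = j + 1 then 1 else 0))"
    by (rule V_ladder) blast
  from someI_ex[OF this] show "\<exists>e f. ladder r q V pos relabel e f"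
    "j \<in> {1..r} \<Longrightarrow> form r (simple_root (relabel j)) (wt x) =
     (if pos x = j then 1 else 0) - (if pos x = j + 1 then 1 else 0)"
    unfolding pos_def by blast+
qed

lemma bij_pos: "bij_betw pos UNIV {1..r+1}"
  using pos by (auto simp: ladder_def)

lemma inj_pos: "inj pos" using bij_pos by (simp add: bij_betw_def)

lemma pos_range: "1 \<le> pos x" "pos x \<le> r + 1"
  using bij_pos by (auto simp: bij_betw_def)

definition Q :: complex where "Q = of_real q"
definition W :: complex where "W = qpow w"

lemma Q_nz: "Q \<noteq> 0" using q_pos by (simp add: Q_def)
lemma W_nz: "W \<noteq> 0" using q_pos by (simp add: W_def qpow_def)

lemma relabel_ends: "relabel 1 = s" "relabel r = r + 1 - s" "r + 1 - s \<in> {1, r}" "s \<in> {1..r}" "r + 1 - s \<in> {1..r}"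
  using s_cases r_ge_1 by (auto simp: relabel_def)

lemma w_value: "w = 1 - 1 / real (r + 1)"
  using s_cases form_fund_weight_ends[OF r_ge_1] by (auto simp: w_def)

lemma form_w0: "t \<in> {1, r} \<Longrightarrow> form r (fund_weight r t) (w0 r (fund_weight r t)) = w - 1"
  "form r (fund_weight r s) (w0 r (fund_weight r (r + 1 - s))) = - w"
  using s_cases form_fund_weight_ends[OF r_ge_1] by (auto simp: w_value)

lemma w0_dual: "t \<in> {1, r} \<Longrightarrow> w0 r (fund_weight r t) = (\<lambda>k. - fund_weight r (r + 1 - t) k)"
  using w0_fund_weight[OF r_ge_1] by auto

lemma W_powers: "of_real (q powr (w - 1)) = W / Q" "of_real (q powr (- w)) = 1 / W"
  using q_pos by (simp_all add: W_def Q_def qpow_def powr_diff powr_minus_divide)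

theorem R_VV_explicit: "R_VV = Rsame pos Q W"
proof -
  obtain e f where L: "ladder r q V pos relabel e f" using pos by blast
  obtain x where x: "pos x = 1" using position_exists[OF bij_pos, of 1] by auto
  obtain y where y: "pos y = r + 1" using position_exists[OF bij_pos, of "r+1"] by auto
  have xy: "x \<noteq> y" "\<not> pos y < pos x" using x y r_ge_1 by auto
  show ?thesis unfolding R_VV_def Q_def
  proof (rule ladder_braiding[OF L L q_pos q_less_1 r_ge_1 ladder_Rsame_module_map[OF L q_pos W_nz] x y])
    show "Rsame pos (of_real q) W $ (a, b) $ (x, y) = (if a = y \<and> b = x
        then of_real (q powr form r (fund_weight r (relabel 1)) (w0 r (fund_weight r (relabel 1)))) else 0)" for a b
      unfolding relabel_ends form_w0(1)[OF s_cases] W_powers Q_def[symmetric]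
      by (rule Rsame_extreme_column[OF xy])
    show "\<exists>\<mu> v. highest_weight_vector r q V \<mu> v" "\<exists>\<mu> v. highest_weight_vector r q V \<mu> v"
      using ladder_extreme_vectors(1)[OF L q_pos r_ge_1 x] by blast+
    show "\<exists>u. lowest_weight_vector r q V (w0 r (fund_weight r (relabel 1))) u"
      using ladder_extreme_vectors(2)[OF L q_pos r_ge_1 y] unfolding relabel_ends w0_dual[OF s_cases] by blast
  qed
qed

theorem R_DD_explicit: "R_DD = Rsame (\<lambda>x. r + 2 - pos x) Q W"
proof -
  obtain e f where L0: "ladder r q V pos relabel e f" using pos by blast
  note L = ladder_dual[OF L0 q_pos]
  obtain x where x: "pos x = r + 1" using position_exists[OF bij_pos, of "r+1"] by auto
  obtain y where y: "pos y = 1" using position_exists[OF bij_pos, of 1] by auto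
  have x': "r + 2 - pos x = 1" and y': "r + 2 - pos y = r + 1" using x y by auto
  have xy: "x \<noteq> y" "\<not> r + 2 - pos y < r + 2 - pos x" using x y r_ge_1 by auto
  have r1: "r + 1 - 1 = r" "r + 1 - r = 1" by auto
  have s': "r + 1 - (r + 1 - s) = s" using s_cases r_ge_1 by auto
  show ?thesis unfolding R_DD_def Q_def
  proof (rule ladder_braiding[OF L L q_pos q_less_1 r_ge_1 ladder_Rsame_module_map[OF L q_pos W_nz] x' y'])
    show "Rsame (\<lambda>x. r + 2 - pos x) (of_real q) W $ (a, b) $ (x, y) = (if a = y \<and> b = x
        then of_real (q powr form r (fund_weight r (relabel (r + 1 - 1))) (w0 r (fund_weight r (relabel (r + 1 - 1))))) else 0)" for a b
      unfolding r1 relabel_ends form_w0(1)[OF relabel_ends(3)] W_powers Q_def[symmetric]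
      by (rule Rsame_extreme_column[OF xy])
    show "\<exists>\<mu> v. highest_weight_vector r q (dual_module V) \<mu> v" "\<exists>\<mu> v. highest_weight_vector r q (dual_module V) \<mu> v"
      using ladder_extreme_vectors(1)[OF L q_pos r_ge_1 x'] by blast+
    show "\<exists>u. lowest_weight_vector r q (dual_module V) (w0 r (fund_weight r (relabel (r + 1 - 1)))) u"
      using ladder_extreme_vectors(2)[OF L q_pos r_ge_1 y'] unfolding r1 relabel_ends w0_dual[OF relabel_ends(3)] s' by blast
  qed
qed

theorem R_VD_explicit: "R_VD = Rmix pos Q W"
proof -
  obtain e f where L: "ladder r q V pos relabel e f" using pos by blast
  note L' = ladder_dual[OF L q_pos]
  obtain x where x: "pos x = 1" using position_exists[OF bij_pos, of 1] by auto
  obtain z where z: "pos z = r + 1" using position_exists[OF bij_pos, of "r + 1"] by auto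
  have x': "r + 2 - pos x = r + 1" and z': "r + 2 - pos z = 1" using x z by auto
  have r1: "r + 1 - 1 = r" "r + 1 - r = 1" by auto
  have s': "r + 1 - (r + 1 - s) = s" using s_cases r_ge_1 by auto
  have low: "\<not> pos a < pos x" for a using pos_range[of a] x by auto
  show ?thesis unfolding R_VD_def Q_def
  proof (rule ladder_braiding[OF L L' q_pos q_less_1 r_ge_1 ladder_Rmix_module_map[OF L q_pos W_nz] x x'])
    show "Rmix pos (of_real q) W $ (a, b) $ (x, x) = (if a = x \<and> b = x
        then of_real (q powr form r (fund_weight r (relabel 1)) (w0 r (fund_weight r (relabel (r + 1 - 1))))) else 0)" for a b
      unfolding r1 relabel_ends form_w0(2) W_powers Q_def[symmetric]
      by (rule Rmix_extreme_column[where P = pos, OF low])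
    show "\<exists>\<mu> v. highest_weight_vector r q V \<mu> v" using ladder_extreme_vectors(1)[OF L q_pos r_ge_1 x] by blast
    show "\<exists>\<mu> v. highest_weight_vector r q (dual_module V) \<mu> v"
      using ladder_extreme_vectors(1)[OF L' q_pos r_ge_1 z'] by blast
    show "\<exists>u. lowest_weight_vector r q (dual_module V) (w0 r (fund_weight r (relabel (r + 1 - 1)))) u"
      using ladder_extreme_vectors(2)[OF L' q_pos r_ge_1 x'] unfolding r1 relabel_ends w0_dual[OF relabel_ends(3)] s' by blast
  qed
qed

lemma a_value: "a = 2"
  using relabel_ends form_simple_roots[of 1 1] r_ge_1 by (simp add: a_def)

lemma m_value: "m = real r"
  using s_cases r_ge_1 form_fund_weight_two_rho[of s r] relabel_ends(4) by (auto simp: m_def)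

text \<open>
  Only two fundamental weights enter a weight, with coefficients 1 and -1, and \<open>2 \<rho>\<close> pairs with the k-th one to
  \<open>k (r + 1 - k)\<close>.
\<close>

lemma form_weight_two_rho: "form r (wt x) (two_rho r) = real r + 2 - 2 * real (pos x)"
proof -
  let ?g = "\<lambda>k. real k * (real r + 1 - real k)"
  have "wt x \<in> weight_lattice r" using weight_basis[of x] by (simp add: has_weight_def)
  then have "wt x = (\<lambda>k. \<Sum>i=1..r. form r (simple_root i) (wt x) * fund_weight r i k)"
    by (rule weight_lattice_expansion)
  then have "form r (wt x) (two_rho r) = form r (\<lambda>k. \<Sum>i=1..r. form r (simple_root i) (wt x) * fund_weight r i k) (two_rho r)"
    by simp
  also have "\<dots> = (\<Sum>i=1..r. form r (simple_root i) (wt x) * form r (fund_weight r i) (two_rho r))"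
    by (rule form_sum_left)
  also have "\<dots> = (\<Sum>i=1..r. form r (simple_root i) (wt x) * ?g i)"
    by (intro sum.cong refl) (simp add: form_fund_weight_two_rho)
  also have "\<dots> = (\<Sum>k=1..r. form r (simple_root (relabel k)) (wt x) * ?g (relabel k))"
    by (rule sum.reindex_bij_betw[OF bij_relabel, symmetric])
  also have "\<dots> = (\<Sum>k=1..r. (if k = pos x then ?g k else 0) - (if k = pos x - 1 then ?g k else 0))"
  proof (intro sum.cong refl)
    fix k assume k: "k \<in> {1..r}"
    have "?g (relabel k) = ?g k" using k by (auto simp: relabel_def of_nat_diff algebra_simps)
    then show "form r (simple_root (relabel k)) (wt x) * ?g (relabel k) = (if k = pos x then ?g k else 0) - (if k = pos x - 1 then ?g k else 0)"
      using pos_range[of x] unfolding pos_weight[OF k] by (auto simp: algebra_simps)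
  qed
  also have "\<dots> = ?g (pos x) - ?g (pos x - 1)"
    using pos_range[of x] r_ge_1 by (auto simp: sum_subtractf of_nat_diff)
  also have "\<dots> = real r + 2 - 2 * real (pos x)"
    using pos_range[of x] by (simp add: of_nat_diff algebra_simps)
  finally show ?thesis .
qed

end

section \<open>Operators on tensor legs\<close>

lemma sum_four_UNIV:
  "(\<Sum>J\<in>UNIV. g (J :: 'a::finite \<times> 'b::finite \<times> 'c::finite \<times> 'd::finite))
     = (\<Sum>a\<in>UNIV. \<Sum>b\<in>UNIV. \<Sum>c\<in>UNIV. \<Sum>d\<in>UNIV. g (a, b, c, d))"
  by (simp only: sum_prod_UNIV)

lemma sum_if_single:
  "(\<Sum>s\<in>UNIV. if s = k \<and> c then g s else 0) = (if c then g (k::'a::finite) else (0::'m::comm_monoid_add))"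
  "(\<Sum>s\<in>UNIV. if k = s \<and> c then g s else 0) = (if c then g (k::'a::finite) else (0::'m::comm_monoid_add))"
  "(\<Sum>s\<in>UNIV. if s = k then g s else 0) = g (k::'a::finite)"
  "(\<Sum>s\<in>UNIV. if k = s then g s else 0) = g (k::'a::finite)"
  by (cases c; simp)+

lemma sum_if_const: "(\<Sum>s\<in>A. if c then g s else 0) = (if c then sum g A else (0::'m::comm_monoid_add))"
  by simp

lemma leg23_mult:
  fixes A :: "complex^('n::finite \<times> 'n)^('n \<times> 'n)"
  shows "(leg23 A ** M) $ (i, j, k, l) $ J = (\<Sum>x\<in>UNIV. \<Sum>y\<in>UNIV. A $ (j, k) $ (x, y) * M $ (i, x, y, l) $ J)"
proof -
  have "(leg23 A ** M) $ (i, j, k, l) $ J = (\<Sum>i'\<in>UNIV. \<Sum>x\<in>UNIV. \<Sum>y\<in>UNIV. \<Sum>l'\<in>UNIV.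
      (if i = i' \<and> l = l' then A $ (j, k) $ (x, y) * M $ (i', x, y, l') $ J else 0))"
    unfolding matrix_matrix_mult_def leg23_def vec_lambda_beta sum_four_UNIV prod.case if_zero_mult ..
  also have "\<dots> = (\<Sum>i'\<in>UNIV. if i = i' then \<Sum>x\<in>UNIV. \<Sum>y\<in>UNIV. A $ (j, k) $ (x, y) * M $ (i', x, y, l) $ J else 0)"
    by (intro sum.cong refl) (simp add: conj_commute[of "i = _"] sum_if_single sum_if_const)
  finally show ?thesis by (simp only: sum_if_single)
qed

lemma leg12_mult:
  fixes A :: "complex^('n::finite \<times> 'n)^('n \<times> 'n)"
  shows "(leg12 A ** M) $ (i, j, k, l) $ J = (\<Sum>x\<in>UNIV. \<Sum>y\<in>UNIV. A $ (i, j) $ (x, y) * M $ (x, y, k, l) $ J)"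
proof -
  have "(leg12 A ** M) $ (i, j, k, l) $ J = (\<Sum>x\<in>UNIV. \<Sum>y\<in>UNIV. \<Sum>k'\<in>UNIV. \<Sum>l'\<in>UNIV.
      (if k = k' \<and> l = l' then A $ (i, j) $ (x, y) * M $ (x, y, k', l') $ J else 0))"
    unfolding matrix_matrix_mult_def leg12_def vec_lambda_beta sum_four_UNIV prod.case if_zero_mult ..
  also have "\<dots> = (\<Sum>x\<in>UNIV. \<Sum>y\<in>UNIV. \<Sum>k'\<in>UNIV. if k = k' then A $ (i, j) $ (x, y) * M $ (x, y, k', l) $ J else 0)"
    by (intro sum.cong refl) (simp add: conj_commute[of "k = _"] sum_if_single)
  finally show ?thesis by (simp only: sum_if_single)
qed

lemma leg34_mult:
  fixes A :: "complex^('n::finite \<times> 'n)^('n \<times> 'n)"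
  shows "(leg34 A ** M) $ (i, j, k, l) $ J = (\<Sum>x\<in>UNIV. \<Sum>y\<in>UNIV. A $ (k, l) $ (x, y) * M $ (i, j, x, y) $ J)"
proof -
  have "(leg34 A ** M) $ (i, j, k, l) $ J = (\<Sum>i'\<in>UNIV. \<Sum>j'\<in>UNIV. \<Sum>x\<in>UNIV. \<Sum>y\<in>UNIV.
      (if i = i' \<and> j = j' then A $ (k, l) $ (x, y) * M $ (i', j', x, y) $ J else 0))"
    unfolding matrix_matrix_mult_def leg34_def vec_lambda_beta sum_four_UNIV prod.case if_zero_mult ..
  also have "\<dots> = (\<Sum>i'\<in>UNIV. if i = i' then \<Sum>j'\<in>UNIV. if j = j' then \<Sum>x\<in>UNIV. \<Sum>y\<in>UNIV. A $ (k, l) $ (x, y) * M $ (i', j', x, y) $ J else 0 else 0)"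
    by (intro sum.cong refl) (simp add: sum_if_const)
  finally show ?thesis by (simp only: sum_if_single)
qed

lemma leg_entries:
  "leg12 A $ (i, j, k, l) $ (i', j', k', l') = (if k = k' \<and> l = l' then A $ (i, j) $ (i', j') else 0)"
  "leg23 A $ (i, j, k, l) $ (i', j', k', l') = (if i = i' \<and> l = l' then A $ (j, k) $ (j', k') else 0)"
  "leg34 A $ (i, j, k, l) $ (i', j', k', l') = (if i = i' \<and> j = j' then A $ (k, l) $ (k', l') else 0)"
  unfolding leg12_def leg23_def leg34_def vec_lambda_beta prod.case by (rule refl)+

lemma matrix_four_eqI:
  "(\<And>i j k l i' j' k' l'. A $ (i, j, k, l) $ (i', j', k', l') = B $ (i, j, k, l) $ (i', j', k', l')) \<Longrightarrow> A = B"
  by (simp add: vec_eq_iff split_paired_all)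

lemma matrix_two_mult:
  fixes A :: "complex^('n::finite \<times> 'n)^('n \<times> 'n)"
  shows "(A ** B) $ I $ J = (\<Sum>x\<in>UNIV. \<Sum>y\<in>UNIV. A $ I $ (x, y) * B $ (x, y) $ J)"
  unfolding matrix_matrix_mult_def vec_lambda_beta sum_prod_UNIV ..

lemma leg_mult:
  fixes A :: "complex^('n::finite \<times> 'n)^('n \<times> 'n)"
  shows "leg12 A ** leg12 B = leg12 (A ** B)" "leg23 A ** leg23 B = leg23 (A ** B)" "leg34 A ** leg34 B = leg34 (A ** B)"
  by (rule matrix_four_eqI, unfold leg12_mult leg23_mult leg34_mult leg_entries matrix_two_mult,
      simp only: if_zero_mult sum_if_const)+

lemma leg_one: "leg12 (mat 1) = mat 1" "leg23 (mat 1) = mat 1" "leg34 (mat 1) = mat 1"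
  by (rule matrix_four_eqI, unfold leg_entries mat_def vec_lambda_beta, auto)+

lemma leg12_leg34_commute:
  fixes A :: "complex^('n::finite \<times> 'n)^('n \<times> 'n)"
  shows "leg12 A ** leg34 B = leg34 B ** leg12 A"
proof (rule matrix_four_eqI)
  fix i j k l i' j' k' l'
  have "(leg12 A ** leg34 B) $ (i, j, k, l) $ (i', j', k', l')
    = (\<Sum>x\<in>UNIV. if x = i' \<and> True then (\<Sum>y\<in>UNIV. if y = j' \<and> True then A $ (i, j) $ (x, y) * B $ (k, l) $ (k', l') else 0) else 0)"
    unfolding leg12_mult leg_entries by (intro sum.cong refl) (auto simp: if_zero_mult sum_if_single)
  moreover have "(leg34 B ** leg12 A) $ (i, j, k, l) $ (i', j', k', l')
    = (\<Sum>x\<in>UNIV. if x = k' \<and> True then (\<Sum>y\<in>UNIV. if y = l' \<and> True then B $ (k, l) $ (x, y) * A $ (i, j) $ (i', j') else 0) else 0)"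
    unfolding leg34_mult leg_entries by (intro sum.cong refl) (auto simp: if_zero_mult sum_if_single)
  ultimately show "(leg12 A ** leg34 B) $ (i, j, k, l) $ (i', j', k', l') = (leg34 B ** leg12 A) $ (i, j, k, l) $ (i', j', k', l')"
    unfolding sum_if_single by (simp only: mult.commute if_True)
qed

text \<open>
  The three-leg kernels of the two kinds of conjugates that make up \<open>S\<close> and \<open>St\<close>.
\<close>

definition braid_left where
  "braid_left A B C i j k a b c = (\<Sum>x\<in>UNIV. \<Sum>y\<in>UNIV. \<Sum>z\<in>UNIV.
     A $ (j, k) $ (x, y) * (B $ (i, x) $ (a, z) * C $ (z, y) $ (b, c)) :: complex)"

definition braid_right where
  "braid_right A B C j k l b c d = (\<Sum>x\<in>UNIV. \<Sum>y\<in>UNIV. \<Sum>z\<in>UNIV.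
     A $ (j, k) $ (x, y) * (B $ (y, l) $ (z, d) * C $ (x, z) $ (b, c)) :: complex)"

lemma braid_left_entry:
  fixes A :: "complex^('n::finite \<times> 'n)^('n \<times> 'n)"
  shows "(leg23 A ** leg12 B ** leg23 C) $ (i, j, k, l) $ (a, b, c, d) = (if l = d then braid_left A B C i j k a b c else 0)"
proof -
  have "(leg23 A ** (leg12 B ** leg23 C)) $ (i, j, k, l) $ (a, b, c, d)
     = (\<Sum>x\<in>UNIV. \<Sum>y\<in>UNIV. A $ (j, k) $ (x, y) * (\<Sum>x'\<in>UNIV. if x' = a then \<Sum>z\<in>UNIV. if l = d then B $ (i, x) $ (x', z) * C $ (z, y) $ (b, c) else 0 else 0))"
    unfolding leg23_mult leg12_mult leg_entries
    by (intro sum.cong refl arg_cong2[of _ _ _ _ "(*)"]) (simp add: if_zero_mult)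
  also have "\<dots> = (if l = d then braid_left A B C i j k a b c else 0)"
    unfolding braid_left_def sum_if_single sum_if_const sum_distrib_left if_zero_mult ..
  finally show ?thesis by (simp only: matrix_mul_assoc)
qed

lemma braid_right_entry:
  fixes A :: "complex^('n::finite \<times> 'n)^('n \<times> 'n)"
  shows "(leg23 A ** leg34 B ** leg23 C) $ (i, j, k, l) $ (a, b, c, d) = (if i = a then braid_right A B C j k l b c d else 0)"
proof -
  have "(leg23 A ** (leg34 B ** leg23 C)) $ (i, j, k, l) $ (a, b, c, d)
     = (\<Sum>x\<in>UNIV. \<Sum>y\<in>UNIV. A $ (j, k) $ (x, y) * (\<Sum>z\<in>UNIV. \<Sum>y'\<in>UNIV. if y' = d then if i = a then B $ (y, l) $ (z, y') * C $ (x, z) $ (b, c) else 0 else 0))"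
    unfolding leg23_mult leg34_mult leg_entries
    by (intro sum.cong refl arg_cong2[of _ _ _ _ "(*)"]) (simp add: if_zero_mult)
  also have "\<dots> = (if i = a then braid_right A B C j k l b c d else 0)"
    unfolding braid_right_def sum_if_single sum_if_const sum_distrib_left if_zero_mult ..
  finally show ?thesis by (simp only: matrix_mul_assoc)
qed

section \<open>Inverses of the braidings and the Hecke relation\<close>

definition Rsame_inv :: "('n::finite \<Rightarrow> nat) \<Rightarrow> complex \<Rightarrow> complex \<Rightarrow> complex^('n \<times> 'n)^('n \<times> 'n)" where
  "Rsame_inv P Q W = (\<chi> I J.
     (if J = prod.swap I then swap_coef (1 / W) (Q / W) (fst I) (snd I) else 0) +
     (if J = I then if P (fst I) < P (snd I) then (1 - Q^2) / W else 0 else 0))"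

lemma Rsame_inv_entry: "Rsame_inv P Q W $ (a, b) $ (c, d) =
    (if c = b \<and> d = a then swap_coef (1 / W) (Q / W) a b else 0) +
    (if c = a \<and> d = b then if P a < P b then (1 - Q^2) / W else 0 else 0)"
  by (simp only: Rsame_inv_def vec_lambda_beta fst_conv snd_conv swap_simp prod.inject)

lemma mat_entry_pair: "mat 1 $ (a, b) $ (c, d) = (if c = a \<and> d = b then 1 else (0::complex))"
  by (auto simp: mat_def)

lemma swap_coef_inverse:
  assumes "W \<noteq> 0" "Q \<noteq> 0"
  shows "swap_coef W (W / Q) a b * swap_coef (1 / W) (Q / W) b a = 1"
    "swap_coef W (W / Q) a b * swap_coef (1 / W) (Q / W) a b = 1"
    "swap_coef (1 / W) (Q / W) a b * swap_coef W (W / Q) a b = 1"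
    "swap_coef (1 / W) (Q / W) a b * swap_coef W (W / Q) b a = 1"
  using assms by (cases "a = b"; simp add: swap_coef_def)+

lemma if_rearrange:
  "x * ((if p then u else 0) + (if r then v else 0)) + y * ((if r then u' else 0) + (if p then v' else 0))
     = (if p then x * u + y * v' else 0) + (if r then x * v + y * u' else (0::complex))"
  by (cases p; cases r; simp add: distrib_left)

lemma Rsame_mult_inv:
  assumes "W \<noteq> 0" "Q \<noteq> 0"
  shows "Rsame P Q W ** Rsame_inv P Q W = mat 1"
proof -
  have "(Rsame P Q W ** Rsame_inv P Q W) $ (a, b) $ (c, d) = mat 1 $ (a, b) $ (c, d)" for a b c d
  proof -
    have z1: "swap_coef W (W / Q) a b * swap_coef (1 / W) (Q / W) b a +
        (if P b < P a then W - W / Q^2 else 0) * (if P a < P b then (1 - Q^2) / W else 0) = 1"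
      using swap_coef_inverse[OF assms, of a b] by simp
    have z2: "swap_coef W (W / Q) a b * (if P b < P a then (1 - Q^2) / W else 0) +
        (if P b < P a then W - W / Q^2 else 0) * swap_coef (1 / W) (Q / W) a b = 0"
    proof (cases "P b < P a")
      case True
      then have "a \<noteq> b" by auto
      then have "swap_coef W (W / Q) a b = W / Q" "swap_coef (1 / W) (Q / W) a b = Q / W" by (simp_all add: swap_coef_def)
      moreover have "W / Q * ((1 - Q\<^sup>2) / W) + (W - W / Q\<^sup>2) * (Q / W) = 0"
        using assms by (simp add: field_simps power2_eq_square)
      ultimately show ?thesis using True by (simp only: if_True)
    qed simp
    show ?thesis
      unfolding Rsame_mult Rsame_inv_entry if_rearrange z1 z2 mat_entry_pair if_cancel by (rule add_0_right)
  qed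
  then show ?thesis by (simp add: vec_eq_iff split_paired_all)
qed

text \<open>
  The quadratic relation \<open>(R - W) (R + W / Q^2) = 0\<close>, solved for \<open>R\<close>.
\<close>

lemma Rsame_Hecke:
  assumes W: "W \<noteq> 0" and Q: "Q \<noteq> 0" and P: "inj P"
  shows "Rsame P Q W $ (a, b) $ (c, d) =
    (W - W / Q^2) * (if c = a \<and> d = b then 1 else 0) + W^2 / Q^2 * Rsame_inv P Q W $ (a, b) $ (c, d)"
proof (cases "a = b")
  case True
  have e: "W = W - W / Q^2 + W^2 / Q^2 * (1 / W)" using W Q by (simp add: power2_eq_square)
  have s: "swap_coef x y b b = x" for x y :: complex by (simp add: swap_coef_def)
  show ?thesis
    unfolding Rsame_entry Rsame_inv_entry True s less_irrefl if_False if_cancel add_0_right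
    by (cases "c = b \<and> d = b",
      simp_all only: simp_thms less_irrefl if_True if_False mult_zero_right add_0_right mult_1_right) (rule e)
next
  case False
  have s: "swap_coef x y a b = y" for x y :: complex using False by (simp add: swap_coef_def)
  have f: "W / Q = W^2 / Q^2 * (Q / W)" using W Q by (simp add: power2_eq_square)
  have g: "(if P b < P a then W - W / Q^2 else 0) = W - W / Q^2 + W^2 / Q^2 * (if P a < P b then (1 - Q^2) / W else 0)"
  proof (cases "P b < P a")
    case True
    then show ?thesis by simp
  next
    case not: False
    have "P a \<noteq> P b" using False P by (auto simp: inj_def)
    then have "P a < P b" using not by simp
    moreover have "0 = W - W / Q^2 + W^2 / Q^2 * ((1 - Q^2) / W)" using W Q by (simp add: field_simps power2_eq_square)
    ultimately show ?thesis using not by (simp only: if_True if_False)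
  qed
  have pr: "(if p then u else 0) + (if r then v else 0) = D * (if r then 1 else 0) + E * ((if p then u' else 0) + (if r then v' else 0))"
    if "u = E * u'" "v = D + E * v'" for p r and u v u' v' D E :: complex
    by (cases p; cases r; simp add: that distrib_left)
  show ?thesis
    unfolding Rsame_entry Rsame_inv_entry s by (rule pr[OF f g])
qed

lemma geometric_between:
  fixes X :: complex
  assumes "u < v"
  shows "(1 - X) * (\<Sum>k\<in>{u<..<v}. X ^ (k - u)) = X - X ^ (v - u)"
  using assms
proof (induction v)
  case (Suc v)
  show ?case
  proof (cases "u = v")
    case True
    have "{v<..<Suc v} = {}" by auto
    then show ?thesis using True by simp
  next
    case False
    then have uv: "u < v" using Suc by simp
    have "{u<..<Suc v} = insert v {u<..<v}" using uv by auto
    then have "(1 - X) * (\<Sum>k\<in>{u<..<Suc v}. X ^ (k - u)) = (1 - X) * X ^ (v - u) + (X - X ^ (v - u))"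
      using Suc.IH[OF uv] by (simp add: distrib_left)
    moreover have "X ^ (Suc v - u) = X * X ^ (v - u)" using uv by (simp add: Suc_diff_le)
    ultimately show ?thesis by (simp add: algebra_simps)
  qed
qed simp

definition ext_coef :: "('n \<Rightarrow> nat) \<Rightarrow> complex \<Rightarrow> complex \<Rightarrow> 'n \<Rightarrow> 'n \<Rightarrow> complex" where
  "ext_coef P Q W a c = (if P a < P c then W - W / Q^2 else 0)"

definition ext_coef_inv :: "('n \<Rightarrow> nat) \<Rightarrow> complex \<Rightarrow> complex \<Rightarrow> 'n \<Rightarrow> 'n \<Rightarrow> complex" where
  "ext_coef_inv P Q W a c = (if P a < P c then (1 - Q^2) / W else 0)"

lemma Rsame_entry': "Rsame P Q W $ (a, b) $ (c, d) =
    (if c = b \<and> d = a then swap_coef W (W / Q) a b else 0) + (if c = a \<and> d = b then ext_coef P Q W b a else 0)"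
  unfolding Rsame_entry ext_coef_def ..

lemma Rsame_inv_entry': "Rsame_inv P Q W $ (a, b) $ (c, d) =
    (if c = b \<and> d = a then swap_coef (1 / W) (Q / W) a b else 0) + (if c = a \<and> d = b then ext_coef_inv P Q W a b else 0)"
  unfolding Rsame_inv_entry ext_coef_inv_def ..

lemma Rmix_inv_entry': "Rmix_inv P Q W $ (a, b) $ (c, d) =
    (if c = b \<and> d = a then swap_coef W (W / Q) a b else 0) + (if a = b \<and> c = d then ext_coef P Q W a c else 0)"
  unfolding Rmix_inv_entry ext_coef_def ..

lemma power_inverse_square: "1 / Q ^ (2 * n) = (1 / Q^2) ^ n" for Q :: complex
  by (simp add: power_mult power_one_over)

text \<open>
  The mixing coefficients of the two matrices cancel because a geometric series telescopes.
\<close>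

lemma mix_convolution:
  assumes W: "W \<noteq> 0" and Q: "Q \<noteq> 0" and P: "bij_betw P (UNIV::'n::finite set) {1..N}"
  shows "ext_coef P Q W a c / W + W * mix_coef P Q W a c + (\<Sum>s\<in>UNIV. mix_coef P Q W a s * ext_coef P Q W s c) = 0"
proof (cases "P a < P c")
  case False
  then have "mix_coef P Q W a s * ext_coef P Q W s c = 0" for s by (auto simp: mix_coef_def ext_coef_def)
  then have "(\<Sum>s\<in>UNIV. mix_coef P Q W a s * ext_coef P Q W s c) = 0" by (simp only: sum.neutral_const)
  then show ?thesis using False by (simp add: ext_coef_def mix_coef_def)
next
  case True
  let ?X = "1 / Q^2"
  have R: "P z \<in> {1..N}" for z using P by (auto simp: bij_betw_def)
  have "(\<Sum>s\<in>UNIV. mix_coef P Q W a s * ext_coef P Q W s c)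
      = (\<Sum>s\<in>UNIV. (\<lambda>k. if k \<in> {P a<..<P c} then (1 - Q^2) / W * (W - W / Q^2) * ?X ^ (k - P a) else 0) (P s))"
  proof (intro sum.cong refl)
    fix s
    show "mix_coef P Q W a s * ext_coef P Q W s c =
      (\<lambda>k. if k \<in> {P a<..<P c} then (1 - Q^2) / W * (W - W / Q^2) * ?X ^ (k - P a) else 0) (P s)"
      by (cases "P a < P s"; cases "P s < P c") (simp_all add: mix_coef_def ext_coef_def power_inverse_square[symmetric])
  qed
  also have "\<dots> = (\<Sum>k\<in>{1..N}. if k \<in> {P a<..<P c} then (1 - Q^2) / W * (W - W / Q^2) * ?X ^ (k - P a) else 0)"
    by (rule sum.reindex_bij_betw[OF P])
  also have "\<dots> = (\<Sum>k\<in>{P a<..<P c}. (1 - Q^2) / W * (W - W / Q^2) * ?X ^ (k - P a))"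
    using R[of a] R[of c] by (intro sum.mono_neutral_cong_right) auto
  also have "\<dots> = (1 - Q^2) * ((1 - ?X) * (\<Sum>k\<in>{P a<..<P c}. ?X ^ (k - P a)))"
    unfolding sum_distrib_left[symmetric] using W by (simp add: field_simps)
  also have "\<dots> = (1 - Q^2) * (?X - ?X ^ (P c - P a))" unfolding geometric_between[OF True] ..
  finally have "(\<Sum>s\<in>UNIV. mix_coef P Q W a s * ext_coef P Q W s c) = (1 - Q^2) * (?X - ?X ^ (P c - P a))" .
  moreover have "W * mix_coef P Q W a c = (1 - Q^2) * ?X ^ (P c - P a)"
    using True W by (simp add: mix_coef_def power_inverse_square[symmetric])
  moreover have "ext_coef P Q W a c / W = 1 - ?X" using True W by (simp add: ext_coef_def diff_divide_distrib)
  moreover have "Q^2 * ?X = 1" using Q by simp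
  ultimately show ?thesis by (simp only: right_diff_distrib left_diff_distrib) simp
qed

lemma Rmix_mult_inv:
  fixes P :: "'n::finite \<Rightarrow> nat"
  assumes W: "W \<noteq> 0" and Q: "Q \<noteq> 0" and P: "bij_betw P UNIV {1..N}"
  shows "Rmix P Q W ** Rmix_inv P Q W = mat 1"
proof -
  have "(Rmix P Q W ** Rmix_inv P Q W) $ (a, b) $ (c, d) = mat 1 $ (a, b) $ (c, d)" for a b c d
  proof (cases "a = b")
    case False
    have ba: "b \<noteq> a" using False by simp
    show ?thesis
      unfolding Rmix_mult Rmix_inv_entry' mat_entry_pair
      by (simp only: False ba if_False simp_thms add_0_right if_zero_mult swap_coef_inverse[OF W Q])
  next
    case True
    have s: "swap_coef x y s s = x" for x y :: complex and s :: 'n by (simp add: swap_coef_def)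
    have "(\<Sum>z\<in>UNIV. mix_coef P Q W b z * ((if c = z \<and> d = z then W else 0) + (if c = d then ext_coef P Q W z c else 0)))
      = (if c = d then W * mix_coef P Q W b c + (\<Sum>z\<in>UNIV. mix_coef P Q W b z * ext_coef P Q W z c) else 0)"
    proof (cases "c = d")
      case True
      then show ?thesis
        by (simp add: distrib_left sum.distrib sum_mult_delta if_zero_mult sum_if_single mult.commute)
    next
      case False
      then have "\<not> (c = z \<and> d = z)" for z by blast
      then show ?thesis using False by (simp only: if_False add_0_right mult_zero_right sum.neutral_const)
    qed
    then have "(Rmix P Q W ** Rmix_inv P Q W) $ (a, b) $ (c, d) =
       1 / W * ((if c = b \<and> d = b then W else 0) + (if c = d then ext_coef P Q W b c else 0)) +
       (if c = d then W * mix_coef P Q W b c + (\<Sum>z\<in>UNIV. mix_coef P Q W b z * ext_coef P Q W z c) else 0)"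
      unfolding Rmix_mult Rmix_inv_entry' True s by (simp only: simp_thms if_True)
    also have "\<dots> = (if c = b \<and> d = b then 1 else 0) + (if c = d then ext_coef P Q W b c / W + W * mix_coef P Q W b c +
        (\<Sum>z\<in>UNIV. mix_coef P Q W b z * ext_coef P Q W z c) else 0)"
      using W by (simp add: distrib_left)
    also have "\<dots> = mat 1 $ (a, b) $ (c, d)"
      unfolding mix_convolution[OF W Q P] True mat_entry_pair if_cancel by (rule add_0_right)
    finally show ?thesis .
  qed
  then show ?thesis by (simp add: vec_eq_iff split_paired_all)
qed


text \<open>
  The weights \<open>q^((\<lambda>, 2 \<rho>))\<close> of the quantum trace, divided by the one at the highest weight.
\<close>

definition level :: "('n \<Rightarrow> nat) \<Rightarrow> complex \<Rightarrow> 'n \<Rightarrow> complex" where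
  "level P Q x = (1 / Q^2) ^ (P x - 1)"

text \<open>
  Followed by the plain contraction of its two outputs, the braiding is the contraction weighted by the quantum trace.
\<close>

lemma cup_Rmix:
  fixes P :: "'n::finite \<Rightarrow> nat"
  assumes W: "W \<noteq> 0" and Q: "Q \<noteq> 0" and P: "bij_betw P UNIV {1..N}"
  shows "(\<Sum>j\<in>UNIV. Rmix P Q W $ (j, j) $ (x, y)) = (if x = y then level P Q x / W else 0)"
proof -
  have R: "1 \<le> P z" "P z \<le> N" for z using P by (auto simp: bij_betw_def)
  have s: "swap_coef u v s s = u" for u v :: complex and s :: 'n by (simp add: swap_coef_def)
  have "(\<Sum>j\<in>UNIV. Rmix P Q W $ (j, j) $ (x, y)) =
    (\<Sum>j\<in>UNIV. (if x = j \<and> y = j then 1 / W else 0) + (if x = y then mix_coef P Q W j x else 0))"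
    unfolding Rmix_entry s by (simp only: simp_thms)
  also have "\<dots> = (if x = y then 1 / W + (\<Sum>j\<in>UNIV. mix_coef P Q W j x) else 0)"
  proof (cases "x = y")
    case True
    then show ?thesis by (simp add: sum.distrib sum_if_single)
  next
    case False
    then have "\<not> (x = z \<and> y = z)" for z by blast
    then show ?thesis using False by (simp only: if_False add_0_right mult_zero_right sum.neutral_const)
  qed
  also have "1 / W + (\<Sum>j\<in>UNIV. mix_coef P Q W j x) = level P Q x / W"
  proof -
    let ?X = "1 / Q^2"
    have "(\<Sum>j\<in>UNIV. mix_coef P Q W j x)
       = (\<Sum>j\<in>UNIV. (\<lambda>k. if k < P x then (1 - Q^2) / W * ?X ^ (P x - k) else 0) (P j))"
      by (intro sum.cong refl) (simp add: mix_coef_def power_inverse_square[symmetric])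
    also have "\<dots> = (\<Sum>k\<in>{1..N}. if k < P x then (1 - Q^2) / W * ?X ^ (P x - k) else 0)"
      by (rule sum.reindex_bij_betw[OF P])
    also have "\<dots> = (\<Sum>k\<in>{0<..<P x}. (1 - Q^2) / W * ?X ^ (P x - k))"
      using R[of x] by (intro sum.mono_neutral_cong_right) auto
    also have "\<dots> = (\<Sum>k\<in>{0<..<P x}. (1 - Q^2) / W * ?X ^ (k - 0))"
      by (rule sum.reindex_bij_witness[of _ "\<lambda>k. P x - k" "\<lambda>k. P x - k"]) auto
    also have "\<dots> = (1 - Q^2) / W * (\<Sum>k\<in>{0<..<P x}. ?X ^ (k - 0))" by (simp only: sum_distrib_left)
    finally have S: "(\<Sum>j\<in>UNIV. mix_coef P Q W j x) = (1 - Q^2) / W * (\<Sum>k\<in>{0<..<P x}. ?X ^ (k - 0))" .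
    have "0 < P x" using R[of x] by simp
    note geo = geometric_between[OF this, of ?X]
    have "1 - Q^2 = - (Q^2) * (1 - ?X)" using Q by (simp add: field_simps)
    then have "(\<Sum>j\<in>UNIV. mix_coef P Q W j x) = - (Q^2) / W * ((1 - ?X) * (\<Sum>k\<in>{0<..<P x}. ?X ^ (k - 0)))"
      unfolding S by (simp only: mult.assoc times_divide_eq_left)
    also have "\<dots> = - (Q^2) / W * (?X - ?X ^ P x)" unfolding geo by simp
    also have "?X ^ P x = ?X * level P Q x"
      unfolding level_def using R[of x] by (simp add: power_Suc[symmetric] del: power_Suc)
    also have "- (Q^2) / W * (?X - ?X * level P Q x) = (level P Q x - 1) / W"
      using Q W by (simp add: field_simps)
    finally show ?thesis by (simp add: diff_divide_distrib)
  qed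
  finally show ?thesis .
qed

lemma level_convolution:
  fixes P :: "'n::finite \<Rightarrow> nat"
  assumes W: "W \<noteq> 0" and Q: "Q \<noteq> 0" and P: "bij_betw P UNIV {1..N}"
  shows "level P Q a * ext_coef P Q W a c / W + W * (level P Q c * ext_coef_inv P Q W a c)
    + (\<Sum>s\<in>UNIV. level P Q s * ext_coef_inv P Q W a s * ext_coef P Q W s c) = 0"
proof -
  have R: "1 \<le> P z" "P z \<le> N" for z using P by (auto simp: bij_betw_def)
  have mix: "level P Q s * ext_coef_inv P Q W a s = level P Q a * mix_coef P Q W a s" for s
  proof (cases "P a < P s")
    case True
    then have "P s - 1 = (P a - 1) + (P s - P a)" using R[of a] by simp
    then have "level P Q s = level P Q a * (1 / Q^2) ^ (P s - P a)" unfolding level_def by (simp only: power_add)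
    then show ?thesis using True by (simp add: ext_coef_inv_def mix_coef_def power_inverse_square[symmetric])
  next
    case False
    then show ?thesis by (simp add: ext_coef_inv_def mix_coef_def)
  qed
  have "level P Q a * (ext_coef P Q W a c / W + W * mix_coef P Q W a c
      + (\<Sum>s\<in>UNIV. mix_coef P Q W a s * ext_coef P Q W s c)) = 0"
    unfolding mix_convolution[OF W Q P] by simp
  then show ?thesis unfolding mix by (simp add: distrib_left sum_distrib_left mult_ac)
qed

text \<open>A strand passing over, or under, a cap.\<close>

lemma cap_slide:
  fixes P :: "'n::finite \<Rightarrow> nat"
  assumes W: "W \<noteq> 0" and Q: "Q \<noteq> 0" and P: "bij_betw P UNIV {1..N}"
  shows "(\<Sum>x\<in>UNIV. level P Q x * ((if a = x then swap_coef (1 / W) (Q / W) i x * Rmix_inv P Q W $ (i, x) $ (b, c) else 0)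
      + (if a = i then ext_coef_inv P Q W i x * Rmix_inv P Q W $ (x, x) $ (b, c) else 0)))
     = (if a = b \<and> i = c then level P Q a else 0)"
proof -
  have s: "swap_coef u v s s = u" for u v :: complex and s :: 'n by (simp add: swap_coef_def)
  have 1: "(\<Sum>x\<in>UNIV. level P Q x * (if a = x then swap_coef (1 / W) (Q / W) i x * Rmix_inv P Q W $ (i, x) $ (b, c) else 0))
     = (if a = b \<and> i = c then level P Q a else 0) + (if a = i \<and> b = c then level P Q i * ext_coef P Q W i b / W else 0)"
  proof -
    have "(\<Sum>x\<in>UNIV. level P Q x * (if a = x then swap_coef (1 / W) (Q / W) i x * Rmix_inv P Q W $ (i, x) $ (b, c) else 0))
      = level P Q a * (swap_coef (1 / W) (Q / W) i a * Rmix_inv P Q W $ (i, a) $ (b, c))"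
      by (simp only: if_zero_mult sum_if_single)
    also have "swap_coef (1 / W) (Q / W) i a * Rmix_inv P Q W $ (i, a) $ (b, c) =
      (if a = b \<and> i = c then 1 else 0) + (if a = i \<and> b = c then ext_coef P Q W i b / W else 0)"
    proof -
      have "(b = a \<and> c = i) = (a = b \<and> i = c)" by blast
      moreover have "(if i = a \<and> b = c then swap_coef (1 / W) (Q / W) i a * ext_coef P Q W i b else 0)
        = (if a = i \<and> b = c then ext_coef P Q W i b / W else 0)"
        by (cases "a = i") (simp_all add: s)
      ultimately show ?thesis
        unfolding Rmix_inv_entry' distrib_left if_zero_mult swap_coef_inverse[OF W Q] by (simp only:)
    qed
    finally show ?thesis by (cases "a = i") (simp_all add: distrib_left)
  qed
  have 2: "(\<Sum>x\<in>UNIV. level P Q x * (if a = i then ext_coef_inv P Q W i x * Rmix_inv P Q W $ (x, x) $ (b, c) else 0))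
     = (if a = i \<and> b = c then W * (level P Q b * ext_coef_inv P Q W i b) +
        (\<Sum>x\<in>UNIV. level P Q x * ext_coef_inv P Q W i x * ext_coef P Q W x b) else 0)"
  proof (cases "a = i")
    case True
    have "(\<Sum>x\<in>UNIV. level P Q x * (ext_coef_inv P Q W i x * Rmix_inv P Q W $ (x, x) $ (b, c)))
      = (\<Sum>x\<in>UNIV. (if b = x \<and> c = x then level P Q x * ext_coef_inv P Q W i x * W else 0)
         + (if b = c then level P Q x * ext_coef_inv P Q W i x * ext_coef P Q W x b else 0))"
      unfolding Rmix_inv_entry' s by (intro sum.cong refl) (simp only: simp_thms distrib_left if_zero_mult mult.assoc)
    also have "\<dots> = (if b = c then W * (level P Q b * ext_coef_inv P Q W i b) +
        (\<Sum>x\<in>UNIV. level P Q x * ext_coef_inv P Q W i x * ext_coef P Q W x b) else 0)"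
    proof (cases "b = c")
      case True
      then show ?thesis by (simp add: sum.distrib sum_if_single mult_ac)
    next
      case False
      then have "\<not> (b = z \<and> c = z)" for z by blast
      then show ?thesis using False by (simp only: if_False add_0_right mult_zero_right sum.neutral_const)
    qed
    finally show ?thesis using True by simp
  qed simp
  have "(\<Sum>x\<in>UNIV. level P Q x * ((if a = x then swap_coef (1 / W) (Q / W) i x * Rmix_inv P Q W $ (i, x) $ (b, c) else 0)
      + (if a = i then ext_coef_inv P Q W i x * Rmix_inv P Q W $ (x, x) $ (b, c) else 0)))
    = (if a = b \<and> i = c then level P Q a else 0) + ((if a = i \<and> b = c then level P Q i * ext_coef P Q W i b / W else 0)
     + (if a = i \<and> b = c then W * (level P Q b * ext_coef_inv P Q W i b) +
        (\<Sum>x\<in>UNIV. level P Q x * ext_coef_inv P Q W i x * ext_coef P Q W x b) else 0))"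
    unfolding distrib_left sum.distrib 1 2 add.assoc ..
  also have "(if a = i \<and> b = c then level P Q i * ext_coef P Q W i b / W else 0)
     + (if a = i \<and> b = c then W * (level P Q b * ext_coef_inv P Q W i b) +
        (\<Sum>x\<in>UNIV. level P Q x * ext_coef_inv P Q W i x * ext_coef P Q W x b) else 0) = 0"
    using level_convolution[OF W Q P, of i b] by (cases "a = i \<and> b = c") (simp_all only: simp_thms if_True if_False add_0_right add.assoc)
  finally show ?thesis by (simp only: add_0_right)
qed

section \<open>Families acted on by matrices\<close>

text \<open>
  The action of a three-leg kernel, curried so that the legs can be contracted one at a time.
\<close>

definition act3 :: "(complex \<Rightarrow> 'm \<Rightarrow> 'm) \<Rightarrow> ('n \<Rightarrow> 'n \<Rightarrow> 'n \<Rightarrow> 'n::finite \<Rightarrow> 'n \<Rightarrow> 'n \<Rightarrow> complex)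
    \<Rightarrow> ('n \<Rightarrow> 'n \<Rightarrow> 'n \<Rightarrow> 'm::comm_monoid_add) \<Rightarrow> 'n \<Rightarrow> 'n \<Rightarrow> 'n \<Rightarrow> 'm" where
  "act3 sc M x i j k = (\<Sum>a\<in>UNIV. \<Sum>b\<in>UNIV. \<Sum>c\<in>UNIV. sc (M i j k a b c) (x a b c))"

locale complex_space = vector_space scale for scale :: "complex \<Rightarrow> 'm::ab_group_add \<Rightarrow> 'm"
begin

lemma on_legs_mult: "on_legs scale M (on_legs scale N X) I = on_legs scale (M ** N) X I"
proof -
  have "on_legs scale M (on_legs scale N X) I = (\<Sum>J\<in>UNIV. \<Sum>K\<in>UNIV. scale (M $ I $ J * N $ J $ K) (X K))"
    by (simp add: on_legs_def scale_sum_right)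
  also have "\<dots> = (\<Sum>K\<in>UNIV. \<Sum>J\<in>UNIV. scale (M $ I $ J * N $ J $ K) (X K))" by (rule sum.swap)
  finally show ?thesis by (simp add: on_legs_def matrix_matrix_mult_def scale_sum_left)
qed

lemma on_legs_lincomb:
  assumes "\<And>I J. M $ I $ J = d * (if J = I then 1 else 0) + e * N $ I $ J"
  shows "on_legs scale M X I = scale d (X I) + scale e (on_legs scale N X I)"
proof -
  have "on_legs scale M X I = (\<Sum>J\<in>UNIV. (if J = I then scale d (X J) else 0) + scale e (scale (N $ I $ J) (X J)))"
    unfolding on_legs_def assms by (intro sum.cong refl) (simp add: scale_left_distrib)
  then show ?thesis by (simp add: sum.distrib on_legs_def scale_sum_right)
qed

lemma on_legs_one: "on_legs scale (mat 1) X I = X I"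
proof -
  have "on_legs scale (mat 1) X I = (\<Sum>J\<in>UNIV. if J = I then X J else 0)"
    unfolding on_legs_def mat_def by (intro sum.cong refl) auto
  then show ?thesis by simp
qed

lemma on_legs_add: "on_legs scale M (\<lambda>J. X J + Y J) I = on_legs scale M X I + on_legs scale M Y I"
  by (simp add: on_legs_def scale_right_distrib sum.distrib)

lemma on_legs_diff: "on_legs scale M (\<lambda>J. X J - Y J) I = on_legs scale M X I - on_legs scale M Y I"
  by (simp add: on_legs_def scale_right_diff_distrib sum_subtractf)

lemma on_legs_scale: "on_legs scale M (\<lambda>J. scale c (X J)) I = scale c (on_legs scale M X I)"
  by (simp add: on_legs_def scale_sum_right mult.commute)

end

lemma linear_act3:
  assumes "Vector_Spaces.linear s1 s2 f"
  shows "f (act3 s1 M x i j k) = act3 s2 M (\<lambda>a b c. f (x a b c)) i j k"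
proof -
  interpret Vector_Spaces.linear s1 s2 f by (rule assms)
  show ?thesis by (simp add: act3_def sum scale)
qed

lemma sum_four_UNIV_monoid:
  "(\<Sum>J\<in>UNIV. g (J :: 'a::finite \<times> 'b::finite \<times> 'c::finite \<times> 'd::finite))
     = (\<Sum>a\<in>UNIV. \<Sum>b\<in>UNIV. \<Sum>c\<in>UNIV. \<Sum>d\<in>UNIV. g (a, b, c, d) :: 'm::comm_monoid_add)"
  by (simp add: sum.cartesian_product case_prod_beta)

lemma on_legs_sum_four:
  "on_legs sc M X I = (\<Sum>a\<in>UNIV. \<Sum>b\<in>UNIV. \<Sum>c\<in>UNIV. \<Sum>d\<in>UNIV. sc (M $ I $ (a, b, c, d)) (X (a, b, c, d)))"
  unfolding on_legs_def by (rule sum_four_UNIV_monoid)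


context quantum_group_data
begin

text \<open>
  The coefficients in \<open>S = D + E Si\<close> and \<open>Sti = D + E St\<close>.
\<close>

definition D where "D = W - W / Q^2"
definition E where "E = W^2 / Q^2"

definition R_VDi where "R_VDi = Rmix_inv pos Q W"
definition R_VVi where "R_VVi = Rsame_inv pos Q W"
definition R_DDi where "R_DDi = Rsame_inv (\<lambda>x. r + 2 - pos x) Q W"

lemma inj_pos_rev: "inj (\<lambda>x. r + 2 - pos x)"
proof (rule injI)
  fix x y assume "r + 2 - pos x = r + 2 - pos y"
  then have "pos x = pos y" using pos_range[of x] pos_range[of y] by linarith
  then show "x = y" using inj_pos by (simp add: inj_def)
qed

lemma pos_rev_less: "r + 2 - pos x < r + 2 - pos y \<longleftrightarrow> pos y < pos x"
  using pos_range[of x] pos_range[of y] by linarith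

lemma inverse_R:
  "R_VD ** R_VDi = mat 1" "R_VDi ** R_VD = mat 1"
  "R_VV ** R_VVi = mat 1" "R_VVi ** R_VV = mat 1"
  "R_DD ** R_DDi = mat 1" "R_DDi ** R_DD = mat 1"
proof -
  show 1: "R_VD ** R_VDi = mat 1"
    unfolding R_VD_explicit R_VDi_def by (rule Rmix_mult_inv[OF W_nz Q_nz bij_pos])
  show 2: "R_VV ** R_VVi = mat 1"
    unfolding R_VV_explicit R_VVi_def by (rule Rsame_mult_inv[OF W_nz Q_nz])
  show 3: "R_DD ** R_DDi = mat 1"
    unfolding R_DD_explicit R_DDi_def by (rule Rsame_mult_inv[OF W_nz Q_nz])
  show "R_VDi ** R_VD = mat 1" "R_VVi ** R_VV = mat 1" "R_DDi ** R_DD = mat 1"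
    using 1 2 3 by (simp_all only: matrix_left_right_inverse)
qed

lemma matrix_inv_eqI:
  fixes A :: "complex^'k^'k"
  assumes "A ** B = mat 1" "B ** A = mat 1"
  shows "matrix_inv A = B"
proof -
  have "A ** matrix_inv A = mat 1 \<and> matrix_inv A ** A = mat 1"
    unfolding matrix_inv_def by (rule someI[where x = B]) (use assms in blast)
  then have "B ** (A ** matrix_inv A) = B" by simp
  then show ?thesis using assms(2) by (simp add: matrix_mul_assoc)
qed

lemma matrix_inv_R: "matrix_inv R_VD = R_VDi" "matrix_inv R_DD = R_DDi"
  using matrix_inv_eqI inverse_R by blast+

definition Si where "Si = leg23 R_VD ** leg12 R_VVi ** leg23 R_VDi"
definition Sti where "Sti = leg23 R_VD ** leg34 R_DD ** leg23 R_VDi"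

lemma S_form: "S = leg23 R_VD ** leg12 R_VV ** leg23 R_VDi"
  by (simp only: S_def matrix_inv_R)

lemma St_form: "St = leg23 R_VD ** leg34 R_DDi ** leg23 R_VDi"
  by (simp only: St_def matrix_inv_R)

lemma conj_cancel:
  fixes A :: "complex^('n \<times> 'n \<times> 'n \<times> 'n)^('n \<times> 'n \<times> 'n \<times> 'n)"
  shows "(leg23 R_VD ** A ** leg23 R_VDi) ** (leg23 R_VD ** B ** leg23 R_VDi) = leg23 R_VD ** (A ** B) ** leg23 R_VDi"
proof -
  have "(leg23 R_VD ** A ** leg23 R_VDi) ** (leg23 R_VD ** B ** leg23 R_VDi)
    = leg23 R_VD ** A ** (leg23 R_VDi ** leg23 R_VD) ** B ** leg23 R_VDi"
    by (simp only: matrix_mul_assoc)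
  also have "leg23 R_VDi ** leg23 R_VD = mat 1" by (simp only: leg_mult inverse_R leg_one)
  finally show ?thesis by (simp only: matrix_mul_assoc matrix_mul_rid)
qed

lemma conj_one: "leg23 R_VD ** mat 1 ** leg23 R_VDi = mat 1"
  by (simp only: matrix_mul_rid leg_mult inverse_R leg_one)

lemma S_inverse: "S ** Si = mat 1" "Si ** S = mat 1"
  unfolding S_form Si_def conj_cancel leg_mult inverse_R leg_one conj_one by (rule refl)+

lemma St_inverse: "St ** Sti = mat 1" "Sti ** St = mat 1"
  unfolding St_form Sti_def conj_cancel leg_mult inverse_R leg_one conj_one by (rule refl)+

lemma S_St_commute: "St ** S = S ** St" "St ** Si = Si ** St" "Sti ** S = S ** Sti"
  unfolding St_form S_form Si_def Sti_def conj_cancel leg12_leg34_commute by (rule refl)+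

lemma matrix_inv_S: "matrix_inv S = Si" "matrix_inv St = Sti"
  using matrix_inv_eqI S_inverse St_inverse by blast+

definition S3 where "S3 = braid_left R_VD R_VV R_VDi"
definition S3i where "S3i = braid_left R_VD R_VVi R_VDi"
definition St3 where "St3 = braid_right R_VD R_DDi R_VDi"
definition St3i where "St3i = braid_right R_VD R_DD R_VDi"

lemma S_entry: "S $ (i, j, k, l) $ (i', j', k', l') = (if l = l' then S3 i j k i' j' k' else 0)"
  and Si_entry: "Si $ (i, j, k, l) $ (i', j', k', l') = (if l = l' then S3i i j k i' j' k' else 0)"
  and St_entry: "St $ (i, j, k, l) $ (i', j', k', l') = (if i = i' then St3 j k l j' k' l' else 0)"
  and Sti_entry: "Sti $ (i, j, k, l) $ (i', j', k', l') = (if i = i' then St3i j k l j' k' l' else 0)"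
  unfolding S_form Si_def St_form Sti_def S3_def S3i_def St3_def St3i_def
  by (rule braid_left_entry braid_right_entry)+

text \<open>
  Bending the first output of \<open>S\<close> to an input and its last input to an output gives the inverse of \<open>St\<close>. The two kernels
  agree term by term: rotated in this way, \<open>R_VV\<close> becomes the inverse of \<open>R_VD\<close>, and the inverse of \<open>R_VD\<close> becomes \<open>R_DD\<close>.
  This is what allows a contraction to be pulled through \<open>S\<close> and \<open>St\<close>.
\<close>

lemma rotation: "S3 h j k i b c = St3i j k c h i b"
proof -
  have n3: "Rsame pos Q W $ (p, x) $ (b, z) = Rmix_inv pos Q W $ (x, z) $ (p, b)" for p x b z
  proof -
    have "(b = x \<and> z = p) = (p = z \<and> b = x)" "(b = p \<and> z = x) = (x = z \<and> p = b)" by blast+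
    moreover have "(if p = z \<and> b = x then swap_coef W (W / Q) p x else 0) = (if p = z \<and> b = x then swap_coef W (W / Q) x z else 0)"
      by (auto simp: swap_coef_def)
    ultimately show ?thesis unfolding Rsame_entry Rmix_inv_entry by (simp only:)
  qed
  have n4: "Rsame (\<lambda>x. r + 2 - pos x) Q W $ (y, c) $ (z, b) = Rmix_inv pos Q W $ (z, y) $ (b, c)" for y c z b
  proof -
    have "(z = c \<and> b = y) = (b = y \<and> c = z)" "(z = y \<and> b = c) = (z = y \<and> b = c)" by blast+
    moreover have "(if b = y \<and> c = z then swap_coef W (W / Q) y c else 0) = (if b = y \<and> c = z then swap_coef W (W / Q) z y else 0)"
      by (auto simp: swap_coef_def)
    moreover have "(if z = y \<and> b = c then if pos y < pos c then u else 0 else 0) = (if z = y \<and> b = c then if pos z < pos b then u else 0 else (0::complex))" for u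
      by (cases "z = y"; cases "b = c") (simp_all only: simp_thms if_False)
    ultimately show ?thesis unfolding Rsame_entry Rmix_inv_entry pos_rev_less by (simp only:)
  qed
  show ?thesis
    unfolding S3_def St3i_def braid_left_def braid_right_def R_VV_explicit R_DD_explicit R_VDi_def n3 n4
    by (simp only: mult.commute)
qed

text \<open>
  The weighted contraction is the quantum trace, with its value at the highest weight split off.
\<close>

lemma weighted_cap: "Ev' (x, y) = (if x = y then Q ^ r * level pos Q x else 0)"
proof (cases "x = y")
  case True
  have "qpow (real r + 2 - 2 * real (pos x)) = Q ^ r * level pos Q x"
  proof -
    have "real r + 2 - 2 * real (pos x) = real r - real (2 * (pos x - 1))"
      using pos_range[of x] by (simp add: of_nat_diff)
    then have "qpow (real r + 2 - 2 * real (pos x)) = of_real (q powr real r / q powr real (2 * (pos x - 1)))"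
      unfolding qpow_def by (simp only: powr_diff)
    also have "\<dots> = Q ^ r / Q ^ (2 * (pos x - 1))"
      using q_pos by (simp only: powr_realpow of_real_divide of_real_power Q_def)
    also have "\<dots> = Q ^ r * level pos Q x" unfolding level_def power_inverse_square[symmetric] by simp
    finally show ?thesis .
  qed
  then show ?thesis using True by (simp add: Ev'_def form_weight_two_rho)
next
  case False
  then show ?thesis by (simp add: Ev'_def)
qed

lemma qpow_values: "qpow m = Q ^ r" "qpow (- m) = 1 / Q ^ r" "qpow a = Q^2" "qpow (- a) = 1 / Q^2" "qpow w = W" "qpow (- w) = 1 / W"
  "qpow (2 * a - 2 * w) = Q^4 / W^2" "qpow (2 * w - 2 * a) = W^2 / Q^4"
proof -
  have p: "q powr real n = q ^ n" "q powr (- real n) = 1 / q ^ n" for n using q_pos by (simp_all add: powr_realpow powr_minus_divide)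
  have p2: "q powr 2 = q^2" "q powr (-2) = 1 / q^2" "q powr 4 = q^4" using p[of 2] p[of 4] by simp_all
  have w2: "q powr (2 * w) = (q powr w)^2" using q_pos by (simp add: powr_power mult.commute)
  show "qpow m = Q ^ r" "qpow (- m) = 1 / Q ^ r" unfolding qpow_def m_value p Q_def by simp_all
  show "qpow a = Q^2" "qpow (- a) = 1 / Q^2" unfolding qpow_def a_value p2 Q_def by simp_all
  show "qpow w = W" "qpow (- w) = 1 / W" unfolding W_powers(2) W_def qpow_def by (simp_all add: powr_minus_divide)
  show "qpow (2 * a - 2 * w) = Q^4 / W^2" "qpow (2 * w - 2 * a) = W^2 / Q^4"
    unfolding qpow_def a_value Q_def W_def by (simp_all add: powr_diff w2 p2)
qed

lemma cup_R_VD: "(\<Sum>j\<in>UNIV. R_VD $ (j, j) $ (x, y)) = (if x = y then level pos Q x / W else 0)"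
  unfolding R_VD_explicit by (rule cup_Rmix[OF W_nz Q_nz bij_pos])

lemma sum_pull_first:
  "(\<Sum>j\<in>UNIV. \<Sum>x\<in>UNIV. \<Sum>y\<in>UNIV. \<Sum>z\<in>UNIV. R_VD $ (j, j) $ (x, y) * g x y z)
    = (\<Sum>x\<in>UNIV. \<Sum>z\<in>UNIV. level pos Q x / W * g x x (z::'n))"
proof -
  have "(\<Sum>j\<in>UNIV. \<Sum>x\<in>UNIV. \<Sum>y\<in>UNIV. \<Sum>z\<in>UNIV. R_VD $ (j, j) $ (x, y) * g x y z)
     = (\<Sum>x\<in>UNIV. \<Sum>y\<in>UNIV. \<Sum>j\<in>UNIV. \<Sum>z\<in>UNIV. R_VD $ (j, j) $ (x, y) * g x y z)"
    by (subst sum.swap) (intro sum.cong refl sum.swap)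
  also have "\<dots> = (\<Sum>x\<in>UNIV. \<Sum>y\<in>UNIV. (\<Sum>j\<in>UNIV. R_VD $ (j, j) $ (x, y)) * (\<Sum>z\<in>UNIV. g x y z))"
    by (simp only: sum_product)
  also have "\<dots> = (\<Sum>x\<in>UNIV. \<Sum>y\<in>UNIV. if x = y then level pos Q x / W * (\<Sum>z\<in>UNIV. g x y z) else 0)"
    unfolding cup_R_VD if_zero_mult ..
  also have "\<dots> = (\<Sum>x\<in>UNIV. level pos Q x / W * (\<Sum>z\<in>UNIV. g x x z))" by (simp only: sum_if_single)
  finally show ?thesis by (simp only: sum_distrib_left)
qed

text \<open>
  The contracted outputs are those of the outermost \<open>R_VD\<close>, so the contraction becomes weighted by \<open>cup_R_VD\<close>; then it slides
  across the other two braidings by \<open>cap_slide\<close>.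
\<close>

lemma cap_left: "(\<Sum>j\<in>UNIV. S3i i j j a' b c) = (if a' = b \<and> i = c then level pos Q a' / W else 0)"
proof -
  have inner: "(\<Sum>z\<in>UNIV. R_VVi $ (i, x) $ (a', z) * R_VDi $ (z, x) $ (b, c)) =
      (if a' = x then swap_coef (1 / W) (Q / W) i x * Rmix_inv pos Q W $ (i, x) $ (b, c) else 0)
      + (if a' = i then ext_coef_inv pos Q W i x * Rmix_inv pos Q W $ (x, x) $ (b, c) else 0)" for x
  proof -
    have "(\<Sum>z\<in>UNIV. R_VVi $ (i, x) $ (a', z) * R_VDi $ (z, x) $ (b, c)) =
      (\<Sum>z\<in>UNIV. (if z = i \<and> a' = x then swap_coef (1 / W) (Q / W) i x * Rmix_inv pos Q W $ (z, x) $ (b, c) else 0)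
      + (if z = x \<and> a' = i then ext_coef_inv pos Q W i x * Rmix_inv pos Q W $ (z, x) $ (b, c) else 0))"
      unfolding R_VVi_def Rsame_inv_entry' R_VDi_def distrib_right if_zero_mult by (simp only: conj_commute)
    then show ?thesis by (simp only: sum.distrib sum_if_single)
  qed
  have "(\<Sum>j\<in>UNIV. S3i i j j a' b c)
     = (\<Sum>x\<in>UNIV. \<Sum>z\<in>UNIV. level pos Q x / W * (R_VVi $ (i, x) $ (a', z) * R_VDi $ (z, x) $ (b, c)))"
    unfolding S3i_def braid_left_def by (rule sum_pull_first)
  also have "\<dots> = 1 / W * (\<Sum>x\<in>UNIV. level pos Q x * (\<Sum>z\<in>UNIV. R_VVi $ (i, x) $ (a', z) * R_VDi $ (z, x) $ (b, c)))"
    by (simp add: sum_distrib_left)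
  finally show ?thesis unfolding inner cap_slide[OF W_nz Q_nz bij_pos] if_zero_mult by simp
qed

lemma cap_right: "(\<Sum>j\<in>UNIV. St3 j j l b c d) = (if c = d \<and> l = b then level pos Q c / W else 0)"
proof -
  have inner: "(\<Sum>z\<in>UNIV. R_DDi $ (x, l) $ (z, d) * R_VDi $ (x, z) $ (b, c)) =
      (if d = x then swap_coef (1 / W) (Q / W) l x * Rmix_inv pos Q W $ (l, x) $ (c, b) else 0)
      + (if d = l then ext_coef_inv pos Q W l x * Rmix_inv pos Q W $ (x, x) $ (c, b) else 0)" for x
  proof -
    have e: "ext_coef_inv (\<lambda>x. r + 2 - pos x) Q W x l = ext_coef_inv pos Q W l x"
      unfolding ext_coef_inv_def pos_rev_less ..
    have c: "swap_coef u v x l = swap_coef u v l x" for u v :: complex by (auto simp: swap_coef_def)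
    have f: "Rmix_inv pos Q W $ (x, z) $ (b, c) = Rmix_inv pos Q W $ (z, x) $ (c, b)" for x z
    proof -
      have "(b = z \<and> c = x) = (b = z \<and> c = x)" "(x = z \<and> b = c) = (z = x \<and> c = b)" "(c = x \<and> b = z) = (b = z \<and> c = x)" by blast+
      moreover have "swap_coef W (W / Q) x z = swap_coef W (W / Q) z x" by (auto simp: swap_coef_def)
      moreover have "(if z = x \<and> c = b then ext_coef pos Q W x b else 0) = (if z = x \<and> c = b then ext_coef pos Q W z c else 0)" by auto
      ultimately show ?thesis unfolding Rmix_inv_entry' by (simp only:)
    qed
    have "(\<Sum>z\<in>UNIV. R_DDi $ (x, l) $ (z, d) * R_VDi $ (x, z) $ (b, c)) =
      (\<Sum>z\<in>UNIV. (if z = l \<and> d = x then swap_coef (1 / W) (Q / W) l x * Rmix_inv pos Q W $ (z, x) $ (c, b) else 0)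
      + (if z = x \<and> d = l then ext_coef_inv pos Q W l x * Rmix_inv pos Q W $ (z, x) $ (c, b) else 0))"
      unfolding R_DDi_def Rsame_inv_entry' R_VDi_def distrib_right if_zero_mult e c[of _ _] f by (simp only:)
    then show ?thesis by (simp only: sum.distrib sum_if_single)
  qed
  have "(\<Sum>j\<in>UNIV. St3 j j l b c d)
     = (\<Sum>x\<in>UNIV. \<Sum>z\<in>UNIV. level pos Q x / W * (R_DDi $ (x, l) $ (z, d) * R_VDi $ (x, z) $ (b, c)))"
    unfolding St3_def braid_right_def by (rule sum_pull_first)
  also have "\<dots> = 1 / W * (\<Sum>x\<in>UNIV. level pos Q x * (\<Sum>z\<in>UNIV. R_DDi $ (x, l) $ (z, d) * R_VDi $ (x, z) $ (b, c)))"
    by (simp add: sum_distrib_left)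
  finally show ?thesis unfolding inner cap_slide[OF W_nz Q_nz bij_pos] if_zero_mult by (cases "c = d"; cases "l = b"; simp)
qed

end

lemma sum_rotate:
  "(\<Sum>j\<in>A. \<Sum>x\<in>B. \<Sum>y\<in>C. \<Sum>z\<in>D. f j x y z) = (\<Sum>x\<in>B. \<Sum>y\<in>C. \<Sum>z\<in>D. \<Sum>j\<in>A. f j x y z :: 'm::comm_monoid_add)"
proof -
  have "(\<Sum>j\<in>A. \<Sum>x\<in>B. \<Sum>y\<in>C. \<Sum>z\<in>D. f j x y z) = (\<Sum>x\<in>B. \<Sum>j\<in>A. \<Sum>y\<in>C. \<Sum>z\<in>D. f j x y z)"
    by (rule sum.swap)
  also have "\<dots> = (\<Sum>x\<in>B. \<Sum>y\<in>C. \<Sum>j\<in>A. \<Sum>z\<in>D. f j x y z)"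
    by (rule sum.cong[OF refl], rule sum.swap)
  also have "\<dots> = (\<Sum>x\<in>B. \<Sum>y\<in>C. \<Sum>z\<in>D. \<Sum>j\<in>A. f j x y z)"
    by (rule sum.cong[OF refl], rule sum.cong[OF refl], rule sum.swap)
  finally show ?thesis .
qed

context quantum_group_data
begin

lemma D_E: "R_VV $ I $ J = D * (if J = I then 1 else 0) + E * R_VVi $ I $ J"
  "R_DD $ I $ J = D * (if J = I then 1 else 0) + E * R_DDi $ I $ J"
proof -
  obtain i j where I: "I = (i, j)" by (cases I)
  obtain k l where J: "J = (k, l)" by (cases J)
  show "R_VV $ I $ J = D * (if J = I then 1 else 0) + E * R_VVi $ I $ J"
    unfolding I J R_VV_explicit R_VVi_def D_def E_def prod.inject by (rule Rsame_Hecke[OF W_nz Q_nz inj_pos])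
  show "R_DD $ I $ J = D * (if J = I then 1 else 0) + E * R_DDi $ I $ J"
    unfolding I J R_DD_explicit R_DDi_def D_def E_def prod.inject by (rule Rsame_Hecke[OF W_nz Q_nz inj_pos_rev])
qed

lemma lincomb_conj:
  fixes A C :: "complex^('k::finite)^('k)"
  assumes M: "\<And>I J. M $ I $ J = d * (if J = I then 1 else 0) + e * N $ I $ J" and AC: "A ** C = mat 1"
  shows "(A ** M ** C) $ I $ J = d * (if J = I then 1 else 0) + e * (A ** N ** C) $ I $ J"
proof -
  have 1: "(A ** M) $ I $ K = d * A $ I $ K + e * (A ** N) $ I $ K" for K
  proof -
    have "(A ** M) $ I $ K = (\<Sum>L\<in>UNIV. (if L = K then d * A $ I $ L else 0) + e * (A $ I $ L * N $ L $ K))"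
      unfolding matrix_matrix_mult_def vec_lambda_beta M by (intro sum.cong refl) (auto simp: algebra_simps)
    then show ?thesis by (simp add: sum.distrib matrix_matrix_mult_def sum_distrib_left)
  qed
  have "(A ** M ** C) $ I $ J = d * (A ** C) $ I $ J + e * (A ** N ** C) $ I $ J"
    unfolding matrix_matrix_mult_def[of "A ** M"] vec_lambda_beta 1
    by (simp add: matrix_matrix_mult_def[of "A ** N"] matrix_matrix_mult_def[of A C] distrib_right sum.distrib sum_distrib_left mult.assoc)
  then show ?thesis unfolding AC by (simp add: mat_def eq_commute)
qed

lemma leg_lincomb:
  assumes M: "\<And>I J. M $ I $ J = d * (if J = I then 1 else 0) + e * N $ I $ J"
  shows "leg12 M $ I $ J = d * (if J = I then 1 else 0) + e * leg12 N $ I $ J"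
    "leg34 M $ I $ J = d * (if J = I then 1 else 0) + e * leg34 N $ I $ J"
proof -
  obtain i j k l where I: "I = (i, j, k, l)" by (cases I)
  obtain i' j' k' l' where J: "J = (i', j', k', l')" by (cases J)
  show "leg12 M $ I $ J = d * (if J = I then 1 else 0) + e * leg12 N $ I $ J"
    unfolding I J leg_entries M prod.inject by (cases "k = k' \<and> l = l'") auto
  show "leg34 M $ I $ J = d * (if J = I then 1 else 0) + e * leg34 N $ I $ J"
    unfolding I J leg_entries M prod.inject by (cases "i = i' \<and> j = j'") auto
qed

lemma S_Hecke: "S $ I $ J = D * (if J = I then 1 else 0) + E * Si $ I $ J"
  unfolding S_form Si_def
  by (rule lincomb_conj[OF leg_lincomb(1)[OF D_E(1)]]) (simp only: leg_mult inverse_R leg_one)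

lemma Sti_Hecke: "Sti $ I $ J = D * (if J = I then 1 else 0) + E * St $ I $ J"
  unfolding St_form Sti_def
  by (rule lincomb_conj[OF leg_lincomb(2)[OF D_E(2)]]) (simp only: leg_mult inverse_R leg_one)

lemma E_nz: "E \<noteq> 0" using W_nz Q_nz by (simp add: E_def)

context
  fixes sc :: "complex \<Rightarrow> 'm::ab_group_add \<Rightarrow> 'm"
  assumes cs: "complex_space sc"
begin

interpretation complex_space sc by (rule cs)

lemma on_legs_legs:
  "on_legs sc S X (i, j, k, l) = act3 sc S3 (\<lambda>x y z. X (x, y, z, l)) i j k"
  "on_legs sc Si X (i, j, k, l) = act3 sc S3i (\<lambda>x y z. X (x, y, z, l)) i j k"
  "on_legs sc St X (i, j, k, l) = act3 sc St3 (\<lambda>x y z. X (i, x, y, z)) j k l"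
  "on_legs sc Sti X (i, j, k, l) = act3 sc St3i (\<lambda>x y z. X (i, x, y, z)) j k l"
proof -
  have z: "sc (if c then t else 0) x = (if c then sc t x else 0)" for c t x by simp
  show "on_legs sc S X (i, j, k, l) = act3 sc S3 (\<lambda>x y z. X (x, y, z, l)) i j k"
    "on_legs sc Si X (i, j, k, l) = act3 sc S3i (\<lambda>x y z. X (x, y, z, l)) i j k"
    unfolding on_legs_sum_four S_entry Si_entry z sum_if_single act3_def by (rule refl)+
  show "on_legs sc St X (i, j, k, l) = act3 sc St3 (\<lambda>x y z. X (i, x, y, z)) j k l"
    "on_legs sc Sti X (i, j, k, l) = act3 sc St3i (\<lambda>x y z. X (i, x, y, z)) j k l"
    unfolding on_legs_sum_four St_entry Sti_entry z sum_if_const sum_if_single act3_def by (rule refl)+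
qed

lemma on_legs_inverse:
  "on_legs sc S (on_legs sc Si X) I = X I" "on_legs sc Si (on_legs sc S X) I = X I"
  "on_legs sc St (on_legs sc Sti X) I = X I" "on_legs sc Sti (on_legs sc St X) I = X I"
  unfolding on_legs_mult S_inverse St_inverse by (rule on_legs_one)+

lemma on_legs_commute:
  "on_legs sc St (on_legs sc S X) I = on_legs sc S (on_legs sc St X) I"
  "on_legs sc St (on_legs sc Si X) I = on_legs sc Si (on_legs sc St X) I"
  "on_legs sc Sti (on_legs sc S X) I = on_legs sc S (on_legs sc Sti X) I"
  unfolding on_legs_mult S_St_commute by (rule refl)+

lemma on_legs_T: "on_legs sc T X I = on_legs sc S (on_legs sc St X) I"
  unfolding on_legs_mult T_def ..

lemma on_legs_Hecke:
  "on_legs sc S X I = sc D (X I) + sc E (on_legs sc Si X I)"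
  "on_legs sc Sti X I = sc D (X I) + sc E (on_legs sc St X I)"
  by (rule on_legs_lincomb[OF S_Hecke] on_legs_lincomb[OF Sti_Hecke])+

text \<open>The trace of a family in its two legs, up to the factor \<open>Q ^ r\<close> the contraction \<open>contract12 sc Ev'\<close>.\<close>

definition trace :: "('n \<times> 'n \<Rightarrow> 'm) \<Rightarrow> 'm" where
  "trace x = (\<Sum>i\<in>UNIV. sc (level pos Q i) (x (i, i)))"

lemma contract12_trace: "contract12 sc Ev' x = sc (Q ^ r) (trace x)"
proof -
  have "contract12 sc Ev' x = (\<Sum>i\<in>UNIV. \<Sum>j\<in>UNIV. sc (Ev' (i, j)) (x (i, j)))"
    unfolding contract12_def by (simp add: sum.cartesian_product case_prod_beta)
  also have "\<dots> = (\<Sum>i\<in>UNIV. \<Sum>j\<in>UNIV. if i = j then sc (Q ^ r * level pos Q i) (x (i, j)) else 0)"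
    by (intro sum.cong refl) (simp add: weighted_cap)
  finally show ?thesis by (simp add: sum_if_single trace_def scale_sum_right)
qed

lemma contract23_sum: "contract23 sc Ev x (i, l) = (\<Sum>j\<in>UNIV. x (i, j, j, l))"
proof -
  have "contract23 sc Ev x (i, l) = (\<Sum>j\<in>UNIV. \<Sum>k\<in>UNIV. sc (Ev (j, k)) (x (i, j, k, l)))"
    unfolding contract23_def by (simp add: sum.cartesian_product case_prod_beta)
  also have "\<dots> = (\<Sum>j\<in>UNIV. \<Sum>k\<in>UNIV. if j = k then x (i, j, k, l) else 0)"
    by (intro sum.cong refl) (simp add: Ev_def)
  finally show ?thesis by (simp add: sum_if_single)
qed

lemma act3_cap_left: "(\<Sum>j\<in>UNIV. act3 sc S3i x i j j) = sc (1 / W) (\<Sum>y\<in>UNIV. sc (level pos Q y) (x y y i))"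
proof -
  have "(\<Sum>j\<in>UNIV. act3 sc S3i x i j j) = (\<Sum>a'\<in>UNIV. \<Sum>b\<in>UNIV. \<Sum>c\<in>UNIV. \<Sum>j\<in>UNIV. sc (S3i i j j a' b c) (x a' b c))"
    unfolding act3_def by (rule sum_rotate)
  also have "\<dots> = (\<Sum>a'\<in>UNIV. \<Sum>b\<in>UNIV. \<Sum>c\<in>UNIV. if a' = b then if i = c then sc (level pos Q a' / W) (x a' b c) else 0 else 0)"
    unfolding scale_sum_left[symmetric] cap_left by (intro sum.cong refl) simp
  also have "\<dots> = (\<Sum>y\<in>UNIV. sc (level pos Q y / W) (x y y i))"
    by (simp only: sum_if_const sum_if_single)
  finally show ?thesis by (simp add: scale_sum_right)
qed

lemma act3_cap_right: "(\<Sum>j\<in>UNIV. act3 sc St3 x j j l) = sc (1 / W) (\<Sum>y\<in>UNIV. sc (level pos Q y) (x l y y))"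
proof -
  have "(\<Sum>j\<in>UNIV. act3 sc St3 x j j l) = (\<Sum>b\<in>UNIV. \<Sum>c\<in>UNIV. \<Sum>d\<in>UNIV. \<Sum>j\<in>UNIV. sc (St3 j j l b c d) (x b c d))"
    unfolding act3_def by (rule sum_rotate)
  also have "\<dots> = (\<Sum>b\<in>UNIV. \<Sum>c\<in>UNIV. \<Sum>d\<in>UNIV. if c = d then if l = b then sc (level pos Q c / W) (x b c d) else 0 else 0)"
    unfolding scale_sum_left[symmetric] cap_right by (intro sum.cong refl) simp
  also have "\<dots> = (\<Sum>b\<in>UNIV. if l = b then (\<Sum>c\<in>UNIV. sc (level pos Q c / W) (x b c c)) else 0)"
    by (intro sum.cong refl) (simp add: sum_if_single)
  also have "\<dots> = (\<Sum>y\<in>UNIV. sc (level pos Q y / W) (x l y y))" by (simp only: sum_if_single)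
  finally show ?thesis by (simp add: scale_sum_right)
qed

text \<open>
  \<open>rotation\<close> under a contraction: the contracted leg moves from the first to the last place.
\<close>

lemma act3_rotate:
  "(\<Sum>h\<in>UNIV. act3 sc S3 (\<lambda>i b c. f h i b c) h j k) = (\<Sum>c\<in>UNIV. act3 sc St3i (\<lambda>h i b. f h i b c) j k c)"
proof -
  have "(\<Sum>h\<in>UNIV. act3 sc S3 (\<lambda>i b c. f h i b c) h j k)
    = (\<Sum>h\<in>UNIV. \<Sum>i\<in>UNIV. \<Sum>b\<in>UNIV. \<Sum>c\<in>UNIV. sc (St3i j k c h i b) (f h i b c))"
    unfolding act3_def rotation ..
  also have "\<dots> = (\<Sum>c\<in>UNIV. \<Sum>h\<in>UNIV. \<Sum>i\<in>UNIV. \<Sum>b\<in>UNIV. sc (St3i j k c h i b) (f h i b c))"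
    by (rule sum_rotate[symmetric])
  finally show ?thesis unfolding act3_def .
qed

end

end

section \<open>Evaluation of the free algebra\<close>

lemma free_eval_superset:
  fixes \<eta> :: "complex \<Rightarrow> 'b::ring_1"
  assumes "complex_algebra \<eta>" "finite K" "Poly_Mapping.keys f \<subseteq> K"
  shows "free_eval \<eta> g f = (\<Sum>u\<in>K. \<eta> (Poly_Mapping.lookup f u) * prod_list (map g (letters u)))"
proof -
  have "\<eta> (0 + 0) = \<eta> 0 + \<eta> 0" using assms(1) unfolding complex_algebra_def by blast
  then have "\<eta> 0 = 0" by simp
  then show ?thesis unfolding free_eval_def using assms(2,3)
    by (intro sum.mono_neutral_left) (auto simp: in_keys_iff)
qed

lemma free_eval_add:
  assumes "complex_algebra \<eta>"
  shows "free_eval \<eta> g (f + h) = free_eval \<eta> g f + free_eval \<eta> g h"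
proof -
  let ?K = "Poly_Mapping.keys f \<union> Poly_Mapping.keys h"
  have "Poly_Mapping.keys (f + h) \<subseteq> ?K" by (rule Poly_Mapping.keys_add)
  moreover have "\<eta> (x + y) = \<eta> x + \<eta> y" for x y using assms unfolding complex_algebra_def by blast
  ultimately show ?thesis
    by (simp add: free_eval_superset[OF assms, of ?K] lookup_add distrib_right sum.distrib)
qed

lemma free_eval_single:
  assumes "complex_algebra \<eta>"
  shows "free_eval \<eta> g (Poly_Mapping.single u c) = \<eta> c * prod_list (map g (letters u))"
proof -
  have "free_eval \<eta> g (Poly_Mapping.single u c) = (\<Sum>v\<in>{u}. \<eta> (Poly_Mapping.lookup (Poly_Mapping.single u c) v) * prod_list (map g (letters v)))"
    by (rule free_eval_superset[OF assms]) auto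
  then show ?thesis by simp
qed

lemma free_eval_zero: "free_eval \<eta> g 0 = 0" by (simp add: free_eval_def)

lemma free_eval_uminus:
  assumes "complex_algebra \<eta>"
  shows "free_eval \<eta> g (- f) = - free_eval \<eta> g f"
  using free_eval_add[OF assms, of g f "- f"] by (simp add: free_eval_zero eq_neg_iff_add_eq_0 add.commute)

lemma free_eval_sum:
  assumes "complex_algebra \<eta>"
  shows "free_eval \<eta> g (\<Sum>s\<in>A. f s) = (\<Sum>s\<in>A. free_eval \<eta> g (f s))"
  by (induction A rule: infinite_finite_induct) (simp_all add: free_eval_zero free_eval_add[OF assms])

lemma free_algebra_expansion: "f = (\<Sum>u\<in>Poly_Mapping.keys f. Poly_Mapping.single u (Poly_Mapping.lookup f u))"
proof (rule poly_mapping_eqI)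
  fix v
  have "Poly_Mapping.lookup (\<Sum>u\<in>Poly_Mapping.keys f. Poly_Mapping.single u (Poly_Mapping.lookup f u)) v
     = (\<Sum>u\<in>Poly_Mapping.keys f. if u = v then Poly_Mapping.lookup f u else 0)"
    by (simp add: lookup_sum lookup_single when_def)
  then show "Poly_Mapping.lookup f v = Poly_Mapping.lookup (\<Sum>u\<in>Poly_Mapping.keys f. Poly_Mapping.single u (Poly_Mapping.lookup f u)) v"
    by (simp add: in_keys_iff)
qed

lemma free_eval_mult:
  assumes "complex_algebra \<eta>"
  shows "free_eval \<eta> g (f * h) = free_eval \<eta> g f * free_eval \<eta> g h"
proof -
  have e: "\<eta> (x * y) = \<eta> x * \<eta> y" "\<eta> x * b = b * \<eta> x" for x y b
    using assms unfolding complex_algebra_def by blast+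
  have single: "free_eval \<eta> g (Poly_Mapping.single u c * Poly_Mapping.single v d)
    = free_eval \<eta> g (Poly_Mapping.single u c) * free_eval \<eta> g (Poly_Mapping.single v d)" for u v c d
  proof -
    let ?u = "prod_list (map g (letters u))" and ?v = "prod_list (map g (letters v))"
    have "free_eval \<eta> g (Poly_Mapping.single u c * Poly_Mapping.single v d) = \<eta> c * (\<eta> d * ?u * ?v)"
      unfolding mult_single free_eval_single[OF assms] plus_word_def word.sel map_append prod_list.append e(1)
      by (simp only: mult.assoc)
    also have "\<dots> = \<eta> c * (?u * \<eta> d * ?v)" by (simp only: e(2)[of d ?u])
    finally show ?thesis unfolding free_eval_single[OF assms] by (simp only: mult.assoc)
  qed
  let ?s = "\<lambda>f u. Poly_Mapping.single u (Poly_Mapping.lookup f u)"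
  note exp = sym[OF free_algebra_expansion]
  have "free_eval \<eta> g (f * h) = free_eval \<eta> g ((\<Sum>u\<in>Poly_Mapping.keys f. ?s f u) * (\<Sum>v\<in>Poly_Mapping.keys h. ?s h v))"
    by (simp only: exp)
  also have "\<dots> = (\<Sum>u\<in>Poly_Mapping.keys f. \<Sum>v\<in>Poly_Mapping.keys h. free_eval \<eta> g (?s f u) * free_eval \<eta> g (?s h v))"
    by (simp only: sum_product free_eval_sum[OF assms] single)
  also have "\<dots> = (\<Sum>u\<in>Poly_Mapping.keys f. free_eval \<eta> g (?s f u)) * (\<Sum>v\<in>Poly_Mapping.keys h. free_eval \<eta> g (?s h v))"
    by (simp only: sum_product)
  also have "\<dots> = free_eval \<eta> g f * free_eval \<eta> g h"
    by (simp only: free_eval_sum[OF assms, symmetric] exp)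
  finally show ?thesis .
qed

lemma free_eval_gen: "complex_algebra \<eta> \<Longrightarrow> free_eval \<eta> g (free_gen x) = g x"
  unfolding free_gen_def free_eval_single by (simp add: complex_algebra_def)

lemma free_eval_unit: "complex_algebra \<eta> \<Longrightarrow> free_eval \<eta> g (free_unit c) = \<eta> c"
  by (simp add: free_unit_def free_eval_single zero_word_def)

lemma free_eval_on_legs:
  assumes "complex_algebra \<eta>"
  shows "free_eval \<eta> g (on_legs (scl free_unit (*)) M X I) = on_legs (scl \<eta> (*)) M (\<lambda>J. free_eval \<eta> g (X J)) I"
  by (simp add: on_legs_def scl_def free_eval_sum[OF assms] free_eval_mult[OF assms] free_eval_unit[OF assms])

lemma free_eval_contract12:
  assumes "complex_algebra \<eta>"
  shows "free_eval \<eta> g (contract12 (scl free_unit (*)) e X) = contract12 (scl \<eta> (*)) e (\<lambda>J. free_eval \<eta> g (X J))"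
  by (simp add: contract12_def scl_def free_eval_sum[OF assms] free_eval_mult[OF assms] free_eval_unit[OF assms])

lemma two_sided_ideal_gen_eval:
  assumes \<eta>: "complex_algebra \<eta>" and Rel: "\<And>f. f \<in> Rel \<Longrightarrow> free_eval \<eta> g f = 0" and f: "f \<in> two_sided_ideal_gen Rel"
  shows "free_eval \<eta> g f = 0"
  using f by induction (simp_all add: Rel free_eval_zero free_eval_add[OF \<eta>] free_eval_mult[OF \<eta>])

section \<open>Modules, bimodules and the tensor square\<close>

lemma additiveD:
  assumes "Modules.additive f"
  shows "f (x + y) = f x + f y" "f 0 = 0" "f (- x) = - f x" "f (x - y) = f x - f y" "f (sum g A) = (\<Sum>s\<in>A. f (g s))"
  using additive.add[OF assms] additive.zero[OF assms] additive.minus[OF assms] additive.diff[OF assms]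
    additive.sum[OF assms] by auto

lemma complex_algebraD:
  assumes "complex_algebra \<eta>"
  shows "\<eta> 1 = 1" "\<eta> (x + y) = \<eta> x + \<eta> y" "\<eta> (x * y) = \<eta> x * \<eta> y" "\<eta> x * b = b * \<eta> x" "\<eta> 0 = 0"
proof -
  show 1: "\<eta> 1 = 1" "\<eta> (x + y) = \<eta> x + \<eta> y" "\<eta> (x * y) = \<eta> x * \<eta> y" "\<eta> x * b = b * \<eta> x" for x y b
    using assms unfolding complex_algebra_def by blast+
  have "\<eta> (0 + 0) = \<eta> 0 + \<eta> 0" by (rule 1)
  then show "\<eta> 0 = 0" by simp
qed

lemma left_moduleD:
  assumes "left_module act"
  shows "Modules.additive (act b)" "Modules.additive (\<lambda>b. act b x)" "act 1 x = x" "act (b * c) x = act b (act c x)"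
  using assms unfolding left_module_def by blast+

lemma right_moduleD:
  assumes "right_module act"
  shows "Modules.additive (\<lambda>x. act x b)" "Modules.additive (act x)" "act x 1 = x" "act x (b * c) = act (act x b) c"
  using assms unfolding right_module_def by blast+

lemma bimoduleD:
  assumes "bimodule \<eta> lact ract"
  shows "left_module lact" "right_module ract" "lact b (ract x c) = ract (lact b x) c" "lact (\<eta> z) x = ract x (\<eta> z)"
  using assms unfolding bimodule_def by blast+

lemma scl_complex_space:
  assumes \<eta>: "complex_algebra \<eta>" and act: "left_module act"
  shows "complex_space (scl \<eta> act)"
  unfolding complex_space_def
proof
  fix c d x y
  show "scl \<eta> act c (x + y) = scl \<eta> act c x + scl \<eta> act c y"
    unfolding scl_def by (rule additiveD(1)[OF left_moduleD(1)[OF act]])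
  show "scl \<eta> act (c + d) x = scl \<eta> act c x + scl \<eta> act d x"
    unfolding scl_def complex_algebraD[OF \<eta>] by (rule additiveD(1)[OF left_moduleD(2)[OF act]])
  show "scl \<eta> act c (scl \<eta> act d x) = scl \<eta> act (c * d) x"
    unfolding scl_def complex_algebraD(3)[OF \<eta>] left_moduleD(4)[OF act] ..
  show "scl \<eta> act 1 x = x"
    unfolding scl_def complex_algebraD(1)[OF \<eta>] by (rule left_moduleD(3)[OF act])
qed

lemma complex_linearI:
  assumes "complex_space s1" "complex_space s2" "Modules.additive f" "\<And>c x. f (s1 c x) = s2 c (f x)"
  shows "Vector_Spaces.linear s1 s2 f"
  using assms unfolding complex_space_def
  by (auto simp: linear_iff_module_hom module_hom_def module_hom_axioms_def module_iff_vector_space additiveD)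

lemma left_module_mult: "left_module ((*) :: 'b::ring_1 \<Rightarrow> 'b \<Rightarrow> 'b)"
  unfolding left_module_def by (auto simp: Modules.additive_def distrib_left distrib_right mult.assoc)

lemma linear_lact:
  assumes \<eta>: "complex_algebra \<eta>" and M: "left_module act"
  shows "Vector_Spaces.linear (scl \<eta> act) (scl \<eta> act) (act b)"
proof (rule complex_linearI[OF scl_complex_space[OF \<eta> M] scl_complex_space[OF \<eta> M] left_moduleD(1)[OF M]])
  show "act b (scl \<eta> act c x) = scl \<eta> act c (act b x)" for c x
    unfolding scl_def left_moduleD(4)[OF M, symmetric] complex_algebraD(4)[OF \<eta>] ..
qed

lemma linear_ract:
  assumes \<eta>: "complex_algebra \<eta>" and M: "bimodule \<eta> lact ract"
  shows "Vector_Spaces.linear (scl \<eta> lact) (scl \<eta> lact) (\<lambda>x. ract x b)"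
proof (rule complex_linearI)
  show "complex_space (scl \<eta> lact)" "complex_space (scl \<eta> lact)"
    by (rule scl_complex_space[OF \<eta> bimoduleD(1)[OF M]])+
  show "Modules.additive (\<lambda>x. ract x b)" by (rule right_moduleD(1)[OF bimoduleD(2)[OF M]])
  show "ract (scl \<eta> lact c x) b = scl \<eta> lact c (ract x b)" for c x
    unfolding scl_def bimoduleD(3)[OF M] ..
qed

lemma tensor_eval_superset:
  assumes M: "left_module act" and "finite K" "Poly_Mapping.keys f \<subseteq> K"
  shows "tensor_eval act \<beta> f = (\<Sum>z\<in>K. act (of_int (Poly_Mapping.lookup f z)) (\<beta> (fst z) (snd z)))"
proof -
  have "tensor_eval act \<beta> f = (\<Sum>z\<in>Poly_Mapping.keys f. act (of_int (Poly_Mapping.lookup f z)) (\<beta> (fst z) (snd z)))"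
    unfolding tensor_eval_def by (simp add: case_prod_beta)
  also have "\<dots> = (\<Sum>z\<in>K. act (of_int (Poly_Mapping.lookup f z)) (\<beta> (fst z) (snd z)))"
    using assms(2,3) additiveD(2)[OF left_moduleD(2)[OF M]]
    by (intro sum.mono_neutral_left) (auto simp: in_keys_iff)
  finally show ?thesis .
qed

lemma tensor_eval_add:
  assumes M: "left_module act"
  shows "tensor_eval act \<beta> (f + g) = tensor_eval act \<beta> f + tensor_eval act \<beta> g"
proof -
  let ?K = "Poly_Mapping.keys f \<union> Poly_Mapping.keys g"
  have "Poly_Mapping.keys (f + g) \<subseteq> ?K" by (rule Poly_Mapping.keys_add)
  then show ?thesis
    by (simp add: tensor_eval_superset[OF M, of ?K] lookup_add additiveD(1)[OF left_moduleD(2)[OF M]] sum.distrib)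
qed

lemma tensor_eval_zero: "tensor_eval act \<beta> 0 = 0" by (simp add: tensor_eval_def)

lemma tensor_eval_uminus:
  assumes "left_module act"
  shows "tensor_eval act \<beta> (- f) = - tensor_eval act \<beta> f"
  using tensor_eval_add[OF assms, of \<beta> f "- f"] by (simp add: tensor_eval_zero eq_neg_iff_add_eq_0 add.commute)

lemma tensor_eval_diff:
  assumes "left_module act"
  shows "tensor_eval act \<beta> (f - g) = tensor_eval act \<beta> f - tensor_eval act \<beta> g"
  using tensor_eval_add[OF assms, of \<beta> f "- g"] by (simp add: tensor_eval_uminus[OF assms])

lemma tensor_eval_single:
  assumes M: "left_module act"
  shows "tensor_eval act \<beta> (Poly_Mapping.single (x, y) n) = act (of_int n) (\<beta> x y)"
proof -
  have "tensor_eval act \<beta> (Poly_Mapping.single (x, y) n) =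
     (\<Sum>z\<in>{(x, y)}. act (of_int (Poly_Mapping.lookup (Poly_Mapping.single (x, y) n) z)) (\<beta> (fst z) (snd z)))"
    by (rule tensor_eval_superset[OF M]) auto
  then show ?thesis by simp
qed

lemma tensor_eval_subgroup:
  assumes M: "left_module act" and "\<And>f. f \<in> G \<Longrightarrow> tensor_eval act \<beta> f = 0" and "f \<in> subgroup_gen G"
  shows "tensor_eval act \<beta> f = 0"
  using assms(3) by induction (simp_all add: assms(2) tensor_eval_zero tensor_eval_add[OF M] tensor_eval_uminus[OF M])

context
  fixes \<eta> :: "complex \<Rightarrow> 'b::ring_1" and lact :: "'b \<Rightarrow> 'o \<Rightarrow> 'o::ab_group_add" and ract :: "'o \<Rightarrow> 'b \<Rightarrow> 'o"
    and tens :: "'o \<Rightarrow> 'o \<Rightarrow> 't::ab_group_add" and lactT :: "'b \<Rightarrow> 't \<Rightarrow> 't" and ractT :: "'t \<Rightarrow> 'b \<Rightarrow> 't"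
  assumes ts: "is_tensor_square \<eta> lact ract tens lactT ractT"
begin

lemma tensor_bimodule: "bimodule \<eta> lactT ractT"
  and tensor_lact: "lactT b (tens x y) = tens (lact b x) y"
  and tensor_ract: "ractT (tens x y) b = tens x (ract y b)"
  and tensor_eval_surj: "surj (tensor_eval lactT tens)"
  and tensor_eval_kernel: "tensor_eval lactT tens f = 0 \<longleftrightarrow> f \<in> subgroup_gen (tensor_relators lact ract)"
  using ts unfolding is_tensor_square_def by blast+

lemma tensor_relatorsI:
  "Poly_Mapping.single (x + x', y) 1 - Poly_Mapping.single (x, y) 1 - Poly_Mapping.single (x', y) 1 \<in> tensor_relators lact ract"
  "Poly_Mapping.single (x, y + y') 1 - Poly_Mapping.single (x, y) 1 - Poly_Mapping.single (x, y') 1 \<in> tensor_relators lact ract"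
  "Poly_Mapping.single (ract x b, y) 1 - Poly_Mapping.single (x, lact b y) 1 \<in> tensor_relators lact ract"
  unfolding tensor_relators_def Let_def by blast+

lemma tens_additive: "Modules.additive (tens x)" "Modules.additive (\<lambda>x. tens x y)"
  and tens_balanced: "tens (ract x b) y = tens x (lact b y)"
proof -
  note M = bimoduleD(1)[OF tensor_bimodule]
  note ev = tensor_eval_diff[OF M] tensor_eval_single[OF M] of_int_1 left_moduleD(3)[OF M]
  have z: "tensor_eval lactT tens f = 0" if "f \<in> tensor_relators lact ract" for f
    unfolding tensor_eval_kernel by (rule subgroup_gen.gen[OF that])
  show "Modules.additive (tens x)" for x
  proof
    show "tens x (y + y') = tens x y + tens x y'" for y y'
      using z[OF tensor_relatorsI(2)[of x y y']] unfolding ev by (simp add: algebra_simps)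
  qed
  show "Modules.additive (\<lambda>x. tens x y)" for y
  proof
    show "tens (x + x') y = tens x y + tens x' y" for x x'
      using z[OF tensor_relatorsI(1)[of x x' y]] unfolding ev by (simp add: algebra_simps)
  qed
  show "tens (ract x b) y = tens x (lact b y)"
    using z[OF tensor_relatorsI(3)[of x b y]] unfolding ev by simp
qed

lemma tensor_induct:
  assumes zero: "P 0" and tens: "\<And>x y. P (tens x y)" and add: "\<And>s t. P s \<Longrightarrow> P t \<Longrightarrow> P (s + t)"
  shows "P t"
proof -
  obtain f where f: "t = tensor_eval lactT tens f" using tensor_eval_surj by (metis surjD)
  have "P (\<Sum>z\<in>K. lactT (of_int (Poly_Mapping.lookup f z)) (tens (fst z) (snd z)))" if "finite K" for K
    using that by induction (simp_all add: zero tens add tensor_lact)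
  then show ?thesis
    unfolding f tensor_eval_superset[OF bimoduleD(1)[OF tensor_bimodule] finite_keys order_refl] by simp
qed

text \<open>
  The universal property of the tensor square; it holds since the kernel of the evaluation of formal sums of pairs
  is exactly what the balancing relators generate.
\<close>

lemma tensor_lift:
  fixes act :: "'b \<Rightarrow> 'z \<Rightarrow> 'z::ab_group_add" and \<beta> :: "'o \<Rightarrow> 'o \<Rightarrow> 'z"
  assumes M: "left_module act"
    and \<beta>: "\<And>x. Modules.additive (\<beta> x)" "\<And>y. Modules.additive (\<lambda>x. \<beta> x y)"
    and bal: "\<And>x b y. \<beta> (ract x b) y = \<beta> x (lact b y)"
  obtains h where "Modules.additive h" "\<And>x y. h (tens x y) = \<beta> x y"
proof -
  have rel: "tensor_eval act \<beta> f = 0" if "f \<in> tensor_relators lact ract" for f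
    using that unfolding tensor_relators_def Let_def
    by (auto simp: tensor_eval_diff[OF M] tensor_eval_single[OF M] left_moduleD(3)[OF M] bal additiveD(1)[OF \<beta>(1)] additiveD(1)[OF \<beta>(2)])
  have ker: "tensor_eval act \<beta> f = 0" if "tensor_eval lactT tens f = 0" for f
    using that tensor_eval_subgroup[OF M, of "tensor_relators lact ract" \<beta> f] rel unfolding tensor_eval_kernel by blast
  define h where "h t = tensor_eval act \<beta> (SOME f. tensor_eval lactT tens f = t)" for t
  have h: "h (tensor_eval lactT tens f) = tensor_eval act \<beta> f" for f
  proof -
    have "tensor_eval lactT tens (SOME g. tensor_eval lactT tens g = tensor_eval lactT tens f) = tensor_eval lactT tens f"
      by (rule someI[where x = f]) simp
    then have "tensor_eval lactT tens ((SOME g. tensor_eval lactT tens g = tensor_eval lactT tens f) - f) = 0"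
      by (simp add: tensor_eval_diff[OF bimoduleD(1)[OF tensor_bimodule]])
    from ker[OF this] show ?thesis unfolding h_def tensor_eval_diff[OF M] by simp
  qed
  show thesis
  proof
    show "Modules.additive h"
    proof
      fix s t
      obtain f g where fg: "s = tensor_eval lactT tens f" "t = tensor_eval lactT tens g"
        using tensor_eval_surj by (metis surjD)
      show "h (s + t) = h s + h t"
        unfolding fg tensor_eval_add[OF bimoduleD(1)[OF tensor_bimodule], symmetric] h tensor_eval_add[OF M] ..
    qed
    show "h (tens x y) = \<beta> x y" for x y
    proof -
      have "tens x y = tensor_eval lactT tens (Poly_Mapping.single (x, y) 1)"
        by (simp add: tensor_eval_single[OF bimoduleD(1)[OF tensor_bimodule]] left_moduleD(3)[OF bimoduleD(1)[OF tensor_bimodule]])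
      then show ?thesis by (simp add: h tensor_eval_single[OF M] left_moduleD(3)[OF M])
    qed
  qed
qed

lemma linear_tens:
  assumes \<eta>: "complex_algebra \<eta>" and O: "bimodule \<eta> lact ract"
  shows "Vector_Spaces.linear (scl \<eta> lact) (scl \<eta> lactT) (tens x)"
    and "Vector_Spaces.linear (scl \<eta> lact) (scl \<eta> lactT) (\<lambda>x. tens x y)"
proof -
  note cs = scl_complex_space[OF \<eta> bimoduleD(1)[OF O]] scl_complex_space[OF \<eta> bimoduleD(1)[OF tensor_bimodule]]
  show "Vector_Spaces.linear (scl \<eta> lact) (scl \<eta> lactT) (\<lambda>x. tens x y)"
    by (rule complex_linearI[OF cs tens_additive(2)]) (simp only: scl_def tensor_lact)
  show "Vector_Spaces.linear (scl \<eta> lact) (scl \<eta> lactT) (tens x)"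
    by (rule complex_linearI[OF cs tens_additive(1)], unfold scl_def tensor_lact tens_balanced[symmetric])
      (simp only: bimoduleD(4)[OF O])
qed

end

section \<open>The quantum projective space\<close>

context quantum_projective_space
begin

lemma \<eta>_algebra: "complex_algebra \<eta>"
  using B_presented by (simp add: algebra_presented_def)

abbreviation scB :: "complex \<Rightarrow> 'b \<Rightarrow> 'b" where "scB \<equiv> scl \<eta> (*)"

lemma csB: "complex_space scB"
  by (rule scl_complex_space[OF \<eta>_algebra left_module_mult])

lemma free_eval_relator: "f \<in> B_relators \<Longrightarrow> free_eval \<eta> p f = 0"
  using B_presented unfolding algebra_presented_def by (blast intro: sub_bimodule_gen.gen)

lemma trace_p: "trace scB p = 1"
proof -
  interpret complex_space scB by (rule csB)
  let ?f = "contract12 (scl free_unit (*)) Ev' free_gen - free_unit (qpow m)"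
  have "?f \<in> B_relators" unfolding B_relators_def Let_def by blast
  then have "free_eval \<eta> p ?f = 0" by (rule free_eval_relator)
  then have "contract12 scB Ev' p = \<eta> (Q ^ r)"
    unfolding diff_conv_add_uminus free_eval_add[OF \<eta>_algebra] free_eval_uminus[OF \<eta>_algebra] free_eval_contract12[OF \<eta>_algebra]
      free_eval_unit[OF \<eta>_algebra] free_eval_gen[OF \<eta>_algebra] qpow_values by simp
  then have "scB (Q ^ r) (trace scB p) = scB (Q ^ r) 1"
    unfolding contract12_trace[OF csB] by (simp add: scl_def)
  then show ?thesis using Q_nz by (simp only: scale_cancel_left power_eq_0_iff simp_thms)
qed

lemma generator_induct:
  assumes "\<And>c. P (\<eta> c)" "\<And>I. P (p I)" "\<And>x y. P x \<Longrightarrow> P y \<Longrightarrow> P (x + y)" "\<And>x y. P x \<Longrightarrow> P y \<Longrightarrow> P (x * y)"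
  shows "P b"
proof -
  obtain f where f: "b = free_eval \<eta> p f" using B_presented unfolding algebra_presented_def by (metis surjD)
  have word: "P (prod_list (map p xs))" for xs
    using assms(1)[of 1] complex_algebraD(1)[OF \<eta>_algebra] by (induction xs) (simp_all add: assms(2,4))
  have "P (\<Sum>u\<in>K. \<eta> (Poly_Mapping.lookup f u) * prod_list (map p (letters u)))" if "finite K" for K
    using that assms(1)[of 0] complex_algebraD(5)[OF \<eta>_algebra] by induction (simp_all add: assms(1,3,4) word)
  then show ?thesis unfolding f free_eval_def by simp
qed

end

section \<open>Relations between one-forms\<close>

context quantum_projective_space
begin

lemma Omega_relations:
  fixes act :: "'b \<Rightarrow> 'o \<Rightarrow> 'o::ab_group_add" and g :: "'n \<times> 'n \<Rightarrow> 'o"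
  assumes M: "left_module act" and pres: "left_module_presented act g (Omega_relators K c)"
  shows "on_legs (scl \<eta> act) K (fam_prod act p g) I = scl \<eta> act c (fam_prod act p g I)"
    and "contract12 (scl \<eta> act) Ev' g = 0"
proof -
  define ev where "ev v = (\<Sum>x\<in>UNIV. act (v $ x) (g x))" for v :: "'b^('n \<times> 'n)"
  note actD = additiveD[OF left_moduleD(2)[OF M]]
  have ev_add: "ev (u + v) = ev u + ev v" for u v
    by (simp add: ev_def actD sum.distrib)
  have ev_diff: "ev (u - v) = ev u - ev v" for u v
    by (simp add: ev_def actD sum_subtractf)
  have ev_0: "ev 0 = 0" by (simp add: ev_def actD)
  have ev_sum: "ev (\<Sum>s\<in>A. h s) = (\<Sum>s\<in>A. ev (h s))" for h and A :: "'z set"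
    by (induction A rule: infinite_finite_induct) (simp_all add: ev_0 ev_add)
  have ev_sum4: "ev (\<Sum>s\<in>A. h s) = (\<Sum>s\<in>A. ev (h s))" for h and A :: "('n \<times> 'n \<times> 'n \<times> 'n) set"
    by (induction A rule: infinite_finite_induct) (simp_all add: ev_0 ev_add)
  have ev_sum2: "ev (\<Sum>s\<in>A. h s) = (\<Sum>s\<in>A. ev (h s))" for h and A :: "('n \<times> 'n) set"
    by (induction A rule: infinite_finite_induct) (simp_all add: ev_0 ev_add)
  have ev_scale: "ev (b *s v) = act b (ev v)" for b v
    by (simp add: ev_def left_moduleD(4)[OF M] additiveD[OF left_moduleD(1)[OF M]])
  have ev_axis: "ev (axis x 1) = g x" for x
  proof -
    have "ev (axis x 1) = (\<Sum>y\<in>UNIV. if y = x then g y else 0)"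
      unfolding ev_def axis_def vec_lambda_beta by (intro sum.cong refl) (auto simp: left_moduleD(3)[OF M] actD)
    then show ?thesis by simp
  qed
  have ev_pe: "ev (fam_prod (*s) p (\<lambda>I. axis I 1) J) = fam_prod act p g J" for J
    by (cases J) (simp add: fam_prod_def ev_scale ev_axis)
  have rel: "ev v = 0" if "v \<in> Omega_relators K c" for v
    using pres left_gen.gen[OF that] unfolding left_module_presented_def ev_def by blast
  have "on_legs (scl \<eta> (*s)) K (fam_prod (*s) p (\<lambda>I. axis I 1)) I - scl \<eta> (*s) c (fam_prod (*s) p (\<lambda>I. axis I 1) I) \<in> Omega_relators K c"
    unfolding Omega_relators_def Let_def by blast
  from rel[OF this] show "on_legs (scl \<eta> act) K (fam_prod act p g) I = scl \<eta> act c (fam_prod act p g I)"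
    unfolding ev_diff on_legs_def ev_sum4 scl_def ev_scale ev_pe by simp
  have "contract12 (scl \<eta> (*s)) Ev' (\<lambda>I. axis I 1) \<in> Omega_relators K c"
    unfolding Omega_relators_def Let_def by blast
  from rel[OF this] show "contract12 (scl \<eta> act) Ev' g = 0"
    unfolding contract12_def ev_sum2 scl_def ev_scale ev_axis .
qed

end

context HK_calculus
begin

abbreviation scO :: "complex \<Rightarrow> 'o \<Rightarrow> 'o" where "scO \<equiv> scl \<eta> lact"

abbreviation del_p where "del_p \<equiv> (\<lambda>I. del (p I))"
abbreviation delbar_p where "delbar_p \<equiv> (\<lambda>I. delbar (p I))"

abbreviation "pd \<equiv> fam_prod lact p del_p"
abbreviation "pdb \<equiv> fam_prod lact p delbar_p"
abbreviation "dpp \<equiv> fam_prod ract del_p p"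
abbreviation "dbpp \<equiv> fam_prod ract delbar_p p"

lemma Omega_left: "left_module lact" and Omega_right: "right_module ract"
  using bimoduleD[OF Omega_bimodule] by blast+

lemma csO: "complex_space scO" by (rule scl_complex_space[OF \<eta>_algebra Omega_left])

lemmas lact_add = additiveD[OF left_moduleD(1)[OF Omega_left]]
lemmas lact_add' = additiveD[OF left_moduleD(2)[OF Omega_left]]
lemmas lact_mult = left_moduleD(4)[OF Omega_left]
lemmas ract_add = additiveD[OF right_moduleD(1)[OF Omega_right]]
lemmas ract_add' = additiveD[OF right_moduleD(2)[OF Omega_right]]
lemmas ract_mult = right_moduleD(4)[OF Omega_right]
lemmas lact_ract = bimoduleD(3)[OF Omega_bimodule]

lemma trace_zero_of_contract: "contract12 scO Ev' x = 0 \<Longrightarrow> trace scO x = 0"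
proof -
  interpret complex_space scO by (rule csO)
  show "contract12 scO Ev' x = 0 \<Longrightarrow> trace scO x = 0"
    unfolding contract12_trace[OF csO] using Q_nz by simp
qed

lemma pd_St: "on_legs scO St pd I = scO (1 / W) (pd I)" and trace_dp: "trace scO del_p = 0"
  using Omega_relations[OF Omega_left Omega_plus_presented] unfolding qpow_values by (auto intro: trace_zero_of_contract)

lemma pdb_S: "on_legs scO S pdb I = scO W (pdb I)" and trace_dbp: "trace scO delbar_p = 0"
  using Omega_relations[OF Omega_left Omega_minus_presented] unfolding qpow_values by (auto intro: trace_zero_of_contract)

text \<open>
  On \<open>p \<partial>p\<close> the operator \<open>St\<close> is a scalar, so that in the right module rule \<open>T = S St\<close> may be replaced by \<open>S\<close>;
  for the other type the roles of \<open>S\<close> and \<open>St\<close> are exchanged.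
\<close>

lemma dpp_pd: "dpp I = scO (Q^2 / W) (on_legs scO S pd I)"
  and pd_dpp: "pd I = scO (W / Q^2) (on_legs scO Si dpp I)"
  and dpp_St: "on_legs scO St dpp I = scO (1 / W) (dpp I)"
proof -
  interpret complex_space scO by (rule csO)
  have W2: "W * (1 / W) = 1" "W / Q^2 * (Q^2 / W) = 1" using W_nz Q_nz by simp_all
  show 1: "dpp I = scO (Q^2 / W) (on_legs scO S pd I)" for I
    unfolding Omega_plus_right qpow_values on_legs_T[OF csO] pd_St[abs_def] on_legs_scale by simp
  have "scO (W / Q^2) (on_legs scO Si dpp I) = scO (W / Q^2 * (Q^2 / W)) (pd I)"
    unfolding 1[abs_def] on_legs_scale on_legs_inverse[OF csO] scale_scale ..
  then show "pd I = scO (W / Q^2) (on_legs scO Si dpp I)" unfolding W2 by simp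
  show "on_legs scO St dpp I = scO (1 / W) (dpp I)"
    unfolding 1[abs_def] on_legs_scale on_legs_commute[OF csO] pd_St[abs_def] by (simp add: mult.commute)
qed

lemma dbpp_pdb: "dbpp I = scO (W / Q^2) (on_legs scO St pdb I)"
  and pdb_dbpp: "pdb I = scO (Q^2 / W) (on_legs scO Sti dbpp I)"
  and dbpp_S: "on_legs scO S dbpp I = scO W (dbpp I)"
proof -
  interpret complex_space scO by (rule csO)
  have W2: "Q^2 / W * (W / Q^2) = 1" using W_nz Q_nz by simp_all
  show 1: "dbpp I = scO (W / Q^2) (on_legs scO St pdb I)" for I
    unfolding Omega_minus_right qpow_values on_legs_T[OF csO] on_legs_commute(1)[OF csO, symmetric] pdb_S[abs_def] on_legs_scale by simp
  have "scO (Q^2 / W) (on_legs scO Sti dbpp I) = scO (Q^2 / W * (W / Q^2)) (pdb I)"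
    unfolding 1[abs_def] on_legs_scale on_legs_inverse[OF csO] scale_scale ..
  then show "pdb I = scO (Q^2 / W) (on_legs scO Sti dbpp I)" unfolding W2 by simp
  show "on_legs scO S dbpp I = scO W (dbpp I)"
    unfolding 1[abs_def] on_legs_scale on_legs_commute(1)[OF csO, symmetric] pdb_S[abs_def] by (simp add: mult.commute)
qed

text \<open>
  Contracting the two middle legs of the relation for \<open>St\<close> produces on one side a trace of \<open>x\<close>, which vanishes, and
  on the other a multiple of the sum in question.
\<close>

lemma cap_right_one_form:
  assumes X: "\<And>I. on_legs scO St (fam_prod lact p x) I = scO (1 / W) (fam_prod lact p x I)" and tr: "trace scO x = 0"
  shows "(\<Sum>j\<in>UNIV. lact (p (i, j)) (x (j, l))) = 0" and "(\<Sum>j\<in>UNIV. on_legs scO St (fam_prod lact p x) (i, j, j, l)) = 0"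
proof -
  interpret complex_space scO by (rule csO)
  have "(\<Sum>j\<in>UNIV. on_legs scO St (fam_prod lact p x) (i, j, j, l)) = (\<Sum>j\<in>UNIV. act3 scO St3 (\<lambda>y z t. lact (p (i, y)) (x (z, t))) j j l)"
    unfolding on_legs_legs[OF csO] fam_prod_def prod.case ..
  also have "\<dots> = scO (1 / W) (lact (p (i, l)) (trace scO x))"
    unfolding act3_cap_right[OF csO] trace_def[OF csO] lact_add
    by (simp add: scl_def lact_mult[symmetric] complex_algebraD(4)[OF \<eta>_algebra])
  finally show *: "(\<Sum>j\<in>UNIV. on_legs scO St (fam_prod lact p x) (i, j, j, l)) = 0"
    by (simp add: tr lact_add)
  then have "(\<Sum>j\<in>UNIV. scO (1 / W) (fam_prod lact p x (i, j, j, l))) = 0" unfolding X .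
  then have "scO (1 / W) (\<Sum>j\<in>UNIV. lact (p (i, j)) (x (j, l))) = 0"
    by (simp only: fam_prod_def prod.case scale_sum_right)
  then show "(\<Sum>j\<in>UNIV. lact (p (i, j)) (x (j, l))) = 0" using W_nz by simp
qed

text \<open>
  The four contractions \<open>cap_p_dp\<close>, \<open>cap_p_dbp\<close>, \<open>cap_dp_p\<close> and \<open>cap_dbp_p\<close> are the derivative of the idempotency of
  \<open>p\<close>, split into types: \<open>\<partial>p\<close> absorbs \<open>p\<close> on the right and \<open>\<partial>\<close> conjugate of \<open>p\<close> absorbs it on the left.
\<close>

lemma cap_p_dp: "(\<Sum>j\<in>UNIV. lact (p (i, j)) (del_p (j, l))) = 0"
  by (rule cap_right_one_form(1)[OF pd_St trace_dp])

lemma act3_cap_left_one_form: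
  "(\<Sum>j\<in>UNIV. on_legs scO Si (fam_prod lact p x) (i, j, j, l)) = scO (1 / W) (x (i, l))"
proof -
  interpret complex_space scO by (rule csO)
  have "(\<Sum>j\<in>UNIV. on_legs scO Si (fam_prod lact p x) (i, j, j, l)) = (\<Sum>j\<in>UNIV. act3 scO S3i (\<lambda>y z t. lact (p (y, z)) (x (t, l))) i j j)"
    unfolding on_legs_legs[OF csO] fam_prod_def prod.case ..
  also have "\<dots> = scO (1 / W) (lact (trace scB p) (x (i, l)))"
    unfolding act3_cap_left[OF csO] trace_def[OF csB] lact_add' by (simp add: scl_def lact_mult)
  finally show ?thesis by (simp add: trace_p left_moduleD(3)[OF Omega_left])
qed

lemma cap_p_dbp: "(\<Sum>j\<in>UNIV. lact (p (i, j)) (delbar_p (j, l))) = delbar_p (i, l)"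
proof -
  interpret complex_space scO by (rule csO)
  have "on_legs scO Si (on_legs scO S pdb) I = scO W (on_legs scO Si pdb I)" for I
    unfolding pdb_S[abs_def] on_legs_scale ..
  then have "pdb I = scO W (on_legs scO Si pdb I)" for I unfolding on_legs_inverse[OF csO] .
  from this[of "(i, j, j, l)" for j]
  have "lact (p (i, j)) (delbar_p (j, l)) = scO W (on_legs scO Si pdb (i, j, j, l))" for j
    unfolding fam_prod_def prod.case .
  then have "(\<Sum>j\<in>UNIV. lact (p (i, j)) (delbar_p (j, l))) = scO W (\<Sum>j\<in>UNIV. on_legs scO Si pdb (i, j, j, l))"
    by (simp only: scale_sum_right)
  then show ?thesis unfolding act3_cap_left_one_form using W_nz by simp
qed

lemma cap_dp_p: "(\<Sum>j\<in>UNIV. ract (del_p (i, j)) (p (j, l))) = del_p (i, l)"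
proof -
  interpret complex_space scO by (rule csO)
  have "dpp I = scO (Q^2 / W * D) (pd I) + scO (Q^2 / W * E) (on_legs scO Si pd I)" for I
    unfolding dpp_pd on_legs_Hecke[OF csO] by (simp add: scale_right_distrib)
  from this[of "(i, j, j, l)" for j]
  have "ract (del_p (i, j)) (p (j, l)) = scO (Q^2 / W * D) (lact (p (i, j)) (del_p (j, l))) + scO (Q^2 / W * E) (on_legs scO Si pd (i, j, j, l))" for j
    unfolding fam_prod_def prod.case .
  then have "(\<Sum>j\<in>UNIV. ract (del_p (i, j)) (p (j, l))) =
     scO (Q^2 / W * D) (\<Sum>j\<in>UNIV. lact (p (i, j)) (del_p (j, l))) + scO (Q^2 / W * E) (\<Sum>j\<in>UNIV. on_legs scO Si pd (i, j, j, l))"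
    by (simp only: sum.distrib scale_sum_right)
  also have "\<dots> = scO (Q^2 / W * E * (1 / W)) (del_p (i, l))"
    unfolding cap_p_dp act3_cap_left_one_form by simp
  also have "Q^2 / W * E * (1 / W) = 1" using Q_nz W_nz by (simp add: E_def power2_eq_square)
  finally show ?thesis by simp
qed

lemma cap_dbp_p: "(\<Sum>j\<in>UNIV. ract (delbar_p (i, j)) (p (j, l))) = 0"
proof -
  interpret complex_space scO by (rule csO)
  have "dbpp (i, j, j, l) = scO (W / Q^2) (act3 scO St3 (\<lambda>y z t. lact (p (i, y)) (delbar_p (z, t))) j j l)" for j
    unfolding dbpp_pdb on_legs_legs[OF csO] by (simp only: fam_prod_def prod.case)
  then have "ract (delbar_p (i, j)) (p (j, l)) = scO (W / Q^2) (act3 scO St3 (\<lambda>y z t. lact (p (i, y)) (delbar_p (z, t))) j j l)" for j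
    by (simp only: fam_prod_def prod.case)
  then have "(\<Sum>j\<in>UNIV. ract (delbar_p (i, j)) (p (j, l))) = scO (W / Q^2) (\<Sum>j\<in>UNIV. act3 scO St3 (\<lambda>y z t. lact (p (i, y)) (delbar_p (z, t))) j j l)"
    by (simp only: scale_sum_right)
  also have "(\<Sum>j\<in>UNIV. act3 scO St3 (\<lambda>y z t. lact (p (i, y)) (delbar_p (z, t))) j j l) = scO (1 / W) (lact (p (i, l)) (trace scO delbar_p))"
    unfolding act3_cap_right[OF csO] trace_def[OF csO] lact_add
    by (simp add: scl_def lact_mult[symmetric] complex_algebraD(4)[OF \<eta>_algebra])
  finally show ?thesis by (simp add: trace_dbp lact_add)
qed

lemma derivationD:
  assumes "derivation \<eta> lact ract \<delta>"
  shows "\<delta> (x + y) = \<delta> x + \<delta> y" "\<delta> (x * y) = ract (\<delta> x) y + lact x (\<delta> y)" "\<delta> (\<eta> c) = 0" "\<delta> (sum g A) = (\<Sum>s\<in>A. \<delta> (g s))"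
    "\<delta> (\<eta> c * x) = lact (\<eta> c) (\<delta> x)" "\<delta> (x - y) = \<delta> x - \<delta> y"
proof -
  have add: "Modules.additive \<delta>" and der: "\<delta> (\<eta> c * b) = lact (\<eta> c) (\<delta> b)" "\<delta> (x * y) = ract (\<delta> x) y + lact x (\<delta> y)" for b c x y
    using assms unfolding derivation_def by blast+
  show "\<delta> (x + y) = \<delta> x + \<delta> y" "\<delta> (sum g A) = (\<Sum>s\<in>A. \<delta> (g s))" "\<delta> (x - y) = \<delta> x - \<delta> y"
    by (rule additiveD[OF add])+
  show "\<delta> (x * y) = ract (\<delta> x) y + lact x (\<delta> y)" "\<delta> (\<eta> c * x) = lact (\<eta> c) (\<delta> x)" by (rule der)+
  have "\<delta> (1 * 1) = ract (\<delta> 1) 1 + lact 1 (\<delta> 1)" by (rule der(2))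
  then have "\<delta> 1 = 0" unfolding right_moduleD(3)[OF Omega_right] left_moduleD(3)[OF Omega_left] by simp
  then show "\<delta> (\<eta> c) = 0" using der(1)[of c 1] by (simp add: lact_add)
qed

lemma d_derivation: "derivation \<eta> lact ract d"
proof -
  note D1 = derivationD[OF del_derivation] and D2 = derivationD[OF delbar_derivation]
  have "Modules.additive d" by standard (simp add: d_def D1 D2)
  then show ?thesis unfolding derivation_def d_def by (simp add: D1 D2 lact_add ract_add)
qed

lemmas dD = derivationD[OF d_derivation]

end

section \<open>Relations between two-tensors\<close>

lemma (in complex_space) act3_sum: "act3 scale M (\<lambda>i j k. \<Sum>s\<in>A. x s i j k) i j k = (\<Sum>s\<in>A. act3 scale M (x s) i j k)"
  unfolding act3_def scale_sum_right by (rule sum_rotate[symmetric])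

context universal_two_forms
begin

lemmas T_bimodule = tensor_bimodule[OF tensor_square]
lemmas T_left = bimoduleD(1)[OF T_bimodule]
lemmas T_right = bimoduleD(2)[OF T_bimodule]
lemmas csT = scl_complex_space[OF \<eta>_algebra T_left]
lemmas lactT_linear = linear_lact[OF \<eta>_algebra T_left]
lemmas ractT_linear = linear_ract[OF \<eta>_algebra T_bimodule]
lemmas tens_linear = linear_tens[OF tensor_square \<eta>_algebra Omega_bimodule]
lemmas lactT_add = additiveD[OF left_moduleD(1)[OF T_left]]
lemmas ractT_add = additiveD[OF right_moduleD(1)[OF T_right]]
lemmas lactT_ractT = bimoduleD(3)[OF T_bimodule]
lemmas tens_add = additiveD[OF tens_additive(1)[OF tensor_square]]
lemmas tens_add' = additiveD[OF tens_additive(2)[OF tensor_square]]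
lemmas tens_bal = tens_balanced[OF tensor_square]
lemmas lactT_tens = tensor_lact[OF tensor_square]
lemmas ractT_tens = tensor_ract[OF tensor_square]

lemma linear_scale: "Vector_Spaces.linear s1 s2 f \<Longrightarrow> f (s1 c x) = s2 c (f x)"
  by (simp add: linear_iff_module_hom module_hom.scale)

lemmas tens_scale = linear_scale[OF tens_linear(1)] linear_scale[OF tens_linear(2)]
lemmas lactT_scale = linear_scale[OF lactT_linear]
lemmas ractT_scale = linear_scale[OF ractT_linear]

text \<open>
  The \<open>p\<close> that is absorbed by a differential is moved to the other factor. In this way the relations of
  one-forms become available inside two-tensors.
\<close>

lemma tens_dp_left: "tens (dp (i, j)) y = (\<Sum>h\<in>UNIV. tens (dp (i, h)) (lact (p (h, j)) y))"
proof -
  have "tens (dp (i, j)) y = tens (\<Sum>h\<in>UNIV. ract (dp (i, h)) (p (h, j))) y" by (simp only: cap_dp_p)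
  then show ?thesis by (simp only: tens_add' tens_bal)
qed

lemma tens_dbp_right: "tens x (dbp (k, l)) = (\<Sum>h\<in>UNIV. tens (ract x (p (k, h))) (dbp (h, l)))"
proof -
  have "tens x (dbp (k, l)) = tens x (\<Sum>h\<in>UNIV. lact (p (k, h)) (dbp (h, l)))" by (simp only: cap_p_dbp)
  then show ?thesis by (simp only: tens_add tens_bal)
qed

abbreviation "DD \<equiv> fam_prod tens dp dp"
abbreviation "BB \<equiv> fam_prod tens dbp dbp"
abbreviation "DB \<equiv> fam_prod tens dp dbp"
abbreviation "BD \<equiv> fam_prod tens dbp dp"

lemma pd_St_act3: "act3 scO St3 (\<lambda>x y z. lact (p (h, x)) (dp (y, z))) j k l = scO (1 / W) (lact (p (h, j)) (dp (k, l)))"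
  using pd_St[of "(h, j, k, l)"] unfolding on_legs_legs[OF csO] by (simp only: fam_prod_def prod.case)

lemma pdb_S_act3: "act3 scO S3 (\<lambda>x y z. lact (p (x, y)) (dbp (z, h))) i j k = scO W (lact (p (i, j)) (dbp (k, h)))"
  using pdb_S[of "(i, j, k, h)"] unfolding on_legs_legs[OF csO] by (simp only: fam_prod_def prod.case)

lemma dpp_St_act3: "act3 scO St3 (\<lambda>x y z. ract (dp (h, x)) (p (y, z))) j k l = scO (1 / W) (ract (dp (h, j)) (p (k, l)))"
  using dpp_St[of "(h, j, k, l)"] unfolding on_legs_legs[OF csO] by (simp only: fam_prod_def prod.case)

lemma dbpp_S_act3: "act3 scO S3 (\<lambda>x y z. ract (dbp (x, y)) (p (z, h))) i j k = scO W (ract (dbp (i, j)) (p (k, h)))"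
  using dbpp_S[of "(i, j, k, h)"] unfolding on_legs_legs[OF csO] by (simp only: fam_prod_def prod.case)

lemma pd_dpp_act3: "lact (p (i, j)) (dp (k, h)) = scO (W / Q^2) (act3 scO S3i (\<lambda>x y z. ract (dp (x, y)) (p (z, h))) i j k)"
  using pd_dpp[of "(i, j, k, h)"] unfolding on_legs_legs[OF csO] by (simp only: fam_prod_def prod.case)

lemma dpp_pd_act3: "ract (dp (h, j)) (p (k, l)) = scO (Q^2 / W) (act3 scO S3 (\<lambda>x y z. lact (p (x, y)) (dp (z, l))) h j k)"
  using dpp_pd[of "(h, j, k, l)"] unfolding on_legs_legs[OF csO] by (simp only: fam_prod_def prod.case)

lemma dbpp_pdb_act3: "ract (dbp (h, j)) (p (k, l)) = scO (W / Q^2) (act3 scO St3 (\<lambda>x y z. lact (p (h, x)) (dbp (y, z))) j k l)"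
  using dbpp_pdb[of "(h, j, k, l)"] unfolding on_legs_legs[OF csO] by (simp only: fam_prod_def prod.case)

lemma pdb_dbpp_act3: "lact (p (i, j)) (dbp (k, h)) = scO (Q^2 / W) (act3 scO St3i (\<lambda>x y z. ract (dbp (i, x)) (p (y, z))) j k h)"
  using pdb_dbpp[of "(i, j, k, h)"] unfolding on_legs_legs[OF csO] by (simp only: fam_prod_def prod.case)

lemma act3_tens:
  "tens x (act3 scO M y i j k) = act3 scT M (\<lambda>a' b c. tens x (y a' b c)) i j k"
  "tens (act3 scO M y i j k) x = act3 scT M (\<lambda>a' b c. tens (y a' b c) x) i j k"
  by (rule linear_act3[OF tens_linear(1)] linear_act3[OF tens_linear(2)])+

lemma DD_St: "on_legs scT St DD I = scT (1 / W) (DD I)"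
proof -
  interpret complex_space scT by (rule csT)
  obtain i j k l where I: "I = (i, j, k, l)" by (cases I)
  have "on_legs scT St DD I = act3 scT St3 (\<lambda>x y z. \<Sum>h\<in>UNIV. tens (dp (i, h)) (lact (p (h, x)) (dp (y, z)))) j k l"
    unfolding I on_legs_legs[OF csT] tens_dp_left[symmetric] by (simp only: fam_prod_def prod.case)
  also have "\<dots> = (\<Sum>h\<in>UNIV. tens (dp (i, h)) (scO (1 / W) (lact (p (h, j)) (dp (k, l)))))"
    unfolding act3_sum act3_tens[symmetric] pd_St_act3 ..
  also have "\<dots> = scT (1 / W) (DD I)"
    unfolding tens_scale scale_sum_right[symmetric] tens_dp_left[symmetric] I by (simp only: fam_prod_def prod.case)
  finally show ?thesis .
qed

lemma BB_S: "on_legs scT S BB I = scT W (BB I)"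
proof -
  interpret complex_space scT by (rule csT)
  obtain i j k l where I: "I = (i, j, k, l)" by (cases I)
  have "on_legs scT S BB I = act3 scT S3 (\<lambda>x y z. \<Sum>h\<in>UNIV. tens (ract (dbp (x, y)) (p (z, h))) (dbp (h, l))) i j k"
    unfolding I on_legs_legs[OF csT] tens_dbp_right[symmetric] by (simp only: fam_prod_def prod.case)
  also have "\<dots> = (\<Sum>h\<in>UNIV. tens (scO W (ract (dbp (i, j)) (p (k, h)))) (dbp (h, l)))"
    unfolding act3_sum act3_tens[symmetric] dbpp_S_act3 ..
  also have "\<dots> = scT W (BB I)"
    unfolding tens_scale scale_sum_right[symmetric] tens_dbp_right[symmetric] I by (simp only: fam_prod_def prod.case)
  finally show ?thesis .
qed

text \<open>
  The inner contractions of the mixed products; their traces are \<open>g_pm\<close> and \<open>g_mp\<close> up to a factor.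
\<close>

definition A where "A = (\<lambda>(i, l). \<Sum>h\<in>UNIV. tens (dp (i, h)) (dbp (h, l)))"
definition G where "G = (\<lambda>(i, l). \<Sum>h\<in>UNIV. tens (dbp (i, h)) (dp (h, l)))"

abbreviation "AP \<equiv> fam_prod ractT A p"
abbreviation "PA \<equiv> fam_prod lactT p A"
abbreviation "GP \<equiv> fam_prod ractT G p"

lemma cap_dp_dp: "(\<Sum>h\<in>UNIV. tens (dp (i, h)) (dp (h, l))) = 0"
proof -
  have "(\<Sum>h\<in>UNIV. tens (dp (i, h)) (dp (h, l))) = (\<Sum>h\<in>UNIV. \<Sum>g\<in>UNIV. tens (dp (i, g)) (lact (p (g, h)) (dp (h, l))))"
    by (subst tens_dp_left) (rule refl)
  also have "\<dots> = (\<Sum>g\<in>UNIV. tens (dp (i, g)) (\<Sum>h\<in>UNIV. lact (p (g, h)) (dp (h, l))))"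
    by (subst sum.swap) (simp only: tens_add)
  finally show ?thesis by (simp add: cap_p_dp tens_add)
qed

lemma cap_dbp_dbp: "(\<Sum>h\<in>UNIV. tens (dbp (i, h)) (dbp (h, l))) = 0"
proof -
  have "(\<Sum>h\<in>UNIV. tens (dbp (i, h)) (dbp (h, l))) = (\<Sum>h\<in>UNIV. \<Sum>g\<in>UNIV. tens (ract (dbp (i, h)) (p (h, g))) (dbp (g, l)))"
    by (subst tens_dbp_right) (rule refl)
  also have "\<dots> = (\<Sum>g\<in>UNIV. tens (\<Sum>h\<in>UNIV. ract (dbp (i, h)) (p (h, g))) (dbp (g, l)))"
    by (subst sum.swap) (simp only: tens_add')
  finally show ?thesis by (simp add: cap_dbp_p tens_add')
qed

lemma AP_DB: "AP I = scT (W / Q^2) (on_legs scT St DB I)"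
proof -
  interpret complex_space scT by (rule csT)
  obtain i j k l where I: "I = (i, j, k, l)" by (cases I)
  have "AP I = (\<Sum>h\<in>UNIV. tens (dp (i, h)) (ract (dbp (h, j)) (p (k, l))))"
    by (simp only: I fam_prod_def prod.case A_def ractT_add ractT_tens)
  also have "\<dots> = scT (W / Q^2) (act3 scT St3 (\<lambda>x y z. \<Sum>h\<in>UNIV. tens (dp (i, h)) (lact (p (h, x)) (dbp (y, z)))) j k l)"
    unfolding dbpp_pdb_act3 tens_scale act3_tens scale_sum_right[symmetric] act3_sum ..
  also have "\<dots> = scT (W / Q^2) (on_legs scT St DB I)"
    unfolding I on_legs_legs[OF csT] tens_dp_left[symmetric] by (simp only: fam_prod_def prod.case)
  finally show ?thesis .
qed

lemma PA_DB: "PA I = scT (W / Q^2) (on_legs scT Si DB I)"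
proof -
  interpret complex_space scT by (rule csT)
  obtain i j k l where I: "I = (i, j, k, l)" by (cases I)
  have "PA I = (\<Sum>h\<in>UNIV. tens (lact (p (i, j)) (dp (k, h))) (dbp (h, l)))"
    by (simp only: I fam_prod_def prod.case A_def lactT_add lactT_tens)
  also have "\<dots> = scT (W / Q^2) (act3 scT S3i (\<lambda>x y z. \<Sum>h\<in>UNIV. tens (ract (dp (x, y)) (p (z, h))) (dbp (h, l))) i j k)"
    unfolding pd_dpp_act3 tens_scale act3_tens scale_sum_right[symmetric] act3_sum ..
  also have "\<dots> = scT (W / Q^2) (on_legs scT Si DB I)"
    unfolding I on_legs_legs[OF csT] tens_dbp_right[symmetric] by (simp only: fam_prod_def prod.case)
  finally show ?thesis .
qed

text \<open>
  Moving \<open>p\<close> to the left through the second factor of \<open>G\<close> applies \<open>S\<close> with one leg contracted. By \<open>act3_rotate\<close> this is the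
  inverse of \<open>St\<close> on the first factor and \<open>p\<close>, which moves \<open>p\<close> through the first factor.
\<close>

lemma PG_GP: "fam_prod lactT p G I = GP I"
proof -
  interpret complex_space scT by (rule csT)
  obtain i j k l where I: "I = (i, j, k, l)" by (cases I)
  have "GP I = (\<Sum>h\<in>UNIV. tens (dbp (i, h)) (ract (dp (h, j)) (p (k, l))))"
    by (simp only: I fam_prod_def prod.case G_def ractT_add ractT_tens)
  also have "\<dots> = scT (Q^2 / W) (\<Sum>h\<in>UNIV. act3 scT S3 (\<lambda>x y z. tens (dbp (i, h)) (lact (p (x, y)) (dp (z, l)))) h j k)"
    unfolding dpp_pd_act3 tens_scale act3_tens scale_sum_right[symmetric] ..
  also have "(\<Sum>h\<in>UNIV. act3 scT S3 (\<lambda>x y z. tens (dbp (i, h)) (lact (p (x, y)) (dp (z, l)))) h j k)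
     = (\<Sum>c\<in>UNIV. act3 scT St3i (\<lambda>h x y. tens (dbp (i, h)) (lact (p (x, y)) (dp (c, l)))) j k c)"
    by (rule act3_rotate[OF csT, of "\<lambda>h x y z. tens (dbp (i, h)) (lact (p (x, y)) (dp (z, l)))"])
  also have "scT (Q^2 / W) \<dots> = (\<Sum>c\<in>UNIV. tens (lact (p (i, j)) (dbp (k, c))) (dp (c, l)))"
    unfolding pdb_dbpp_act3 tens_scale act3_tens scale_sum_right tens_bal ..
  also have "\<dots> = fam_prod lactT p G I"
    by (simp only: I fam_prod_def prod.case G_def lactT_add lactT_tens)
  finally show ?thesis ..
qed

lemma GP_St: "on_legs scT St GP I = scT (1 / W) (GP I)"
proof -
  interpret complex_space scT by (rule csT)
  obtain i j k l where I: "I = (i, j, k, l)" by (cases I)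
  have "on_legs scT St GP I = act3 scT St3 (\<lambda>x y z. \<Sum>h\<in>UNIV. tens (dbp (i, h)) (ract (dp (h, x)) (p (y, z)))) j k l"
    unfolding I on_legs_legs[OF csT] by (simp only: fam_prod_def prod.case G_def ractT_add ractT_tens)
  also have "\<dots> = (\<Sum>h\<in>UNIV. tens (dbp (i, h)) (scO (1 / W) (ract (dp (h, j)) (p (k, l)))))"
    unfolding act3_sum act3_tens[symmetric] dpp_St_act3 ..
  also have "\<dots> = scT (1 / W) (GP I)"
    unfolding tens_scale scale_sum_right[symmetric] I by (simp only: fam_prod_def prod.case G_def ractT_add ractT_tens)
  finally show ?thesis .
qed

lemma GP_S: "on_legs scT S GP I = scT W (GP I)"
proof -
  interpret complex_space scT by (rule csT)
  obtain i j k l where I: "I = (i, j, k, l)" by (cases I)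
  have "on_legs scT S (fam_prod lactT p G) I = act3 scT S3 (\<lambda>x y z. \<Sum>h\<in>UNIV. tens (lact (p (x, y)) (dbp (z, h))) (dp (h, l))) i j k"
    unfolding I on_legs_legs[OF csT] by (simp only: fam_prod_def prod.case G_def lactT_add lactT_tens)
  also have "\<dots> = (\<Sum>h\<in>UNIV. tens (scO W (lact (p (i, j)) (dbp (k, h)))) (dp (h, l)))"
    unfolding act3_sum act3_tens[symmetric] pdb_S_act3 ..
  also have "\<dots> = scT W (fam_prod lactT p G I)"
    unfolding tens_scale scale_sum_right[symmetric] I by (simp only: fam_prod_def prod.case G_def lactT_add lactT_tens)
  finally show ?thesis unfolding PG_GP[abs_def] .
qed

lemma cap_p_G: "(\<Sum>j\<in>UNIV. lactT (p (i, j)) (G (j, l))) = G (i, l)"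
proof -
  have "(\<Sum>j\<in>UNIV. lactT (p (i, j)) (G (j, l))) = (\<Sum>j\<in>UNIV. \<Sum>h\<in>UNIV. tens (lact (p (i, j)) (dbp (j, h))) (dp (h, l)))"
    by (simp only: G_def prod.case lactT_add lactT_tens)
  also have "\<dots> = (\<Sum>h\<in>UNIV. tens (\<Sum>j\<in>UNIV. lact (p (i, j)) (dbp (j, h))) (dp (h, l)))"
    by (subst sum.swap) (simp only: tens_add')
  finally show ?thesis by (simp only: cap_p_dbp G_def prod.case)
qed

definition \<gamma> where "\<gamma> = trace scT G"

text \<open>
  Contract the two middle legs of \<open>St (p G) = p G / W\<close>: this gives \<open>p\<close> times the trace of \<open>G\<close> on one side, and
  \<open>G\<close> on the other as \<open>p\<close> is absorbed by it.
\<close>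

lemma G_p_\<gamma>: "G (i, l) = lactT (p (i, l)) \<gamma>"
proof -
  interpret complex_space scT by (rule csT)
  have "on_legs scT St (fam_prod lactT p G) I = scT (1 / W) (fam_prod lactT p G I)" for I
    using GP_St unfolding PG_GP[abs_def] .
  from this[of "(i, j, j, l)" for j]
  have e: "act3 scT St3 (\<lambda>x y z. lactT (p (i, x)) (G (y, z))) j j l = scT (1 / W) (lactT (p (i, j)) (G (j, l)))" for j
    unfolding on_legs_legs[OF csT] by (simp only: fam_prod_def prod.case)
  have "scT (1 / W) (G (i, l)) = (\<Sum>j\<in>UNIV. act3 scT St3 (\<lambda>x y z. lactT (p (i, x)) (G (y, z))) j j l)"
    unfolding e scale_sum_right[symmetric] cap_p_G ..
  also have "\<dots> = scT (1 / W) (lactT (p (i, l)) \<gamma>)"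
    unfolding act3_cap_right[OF csT] \<gamma>_def trace_def[OF csT] lactT_add lactT_scale ..
  finally show ?thesis using W_nz by simp
qed

lemma g_mp_\<gamma>: "g_mp = scT (Q ^ r) \<gamma>" and g_pm_A: "g_pm = scT (Q ^ r) (trace scT A)"
proof -
  have "contract23 scT Ev BD = G" "contract23 scT Ev DB = A"
    by (auto simp: contract23_sum[OF csT] G_def A_def fam_prod_def)
  then show "g_mp = scT (Q ^ r) \<gamma>" "g_pm = scT (Q ^ r) (trace scT A)"
    unfolding g_mp_def g_pm_def contract12_trace[OF csT] \<gamma>_def by simp_all
qed

lemma GP_\<gamma>: "GP = pgp \<gamma>"
  by (auto simp: pgp_def fam_prod_def G_p_\<gamma> lactT_ractT)

end

section \<open>Relations between two-forms\<close>

context universal_two_forms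
begin

text \<open>
  \<open>rel x t\<close> holds for \<open>x = \<Sum> b dc\<close> and \<open>t = \<Sum> db \<otimes> dc\<close> with the same finite family of pairs \<open>b\<close>, \<open>c\<close>. The relations between
  two-forms are the \<open>t\<close> with \<open>rel 0 t\<close>, and to find them one computes with such pairs.
\<close>

inductive rel :: "'o \<Rightarrow> 't \<Rightarrow> bool" where
  rel_zero: "rel 0 0"
| rel_step: "rel x t \<Longrightarrow> rel (lact b (d c) + x) (tens (d b) (d c) + t)"

lemma rel_list: "rel x t \<Longrightarrow> \<exists>xs. x = (\<Sum>(b, c)\<leftarrow>xs. lact b (d c)) \<and> t = (\<Sum>(b, c)\<leftarrow>xs. tens (d b) (d c))"
proof (induction rule: rel.induct)
  case rel_zero
  show ?case by (rule exI[of _ "[]"]) simp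
next
  case (rel_step x t b c)
  then obtain xs where "x = (\<Sum>(b, c)\<leftarrow>xs. lact b (d c))" "t = (\<Sum>(b, c)\<leftarrow>xs. tens (d b) (d c))" by blast
  then show ?case by (intro exI[of _ "(b, c) # xs"]) simp
qed

lemma wedge_rel: "rel 0 t \<Longrightarrow> wedge t = 0"
proof -
  assume "rel 0 t"
  then obtain xs where xs: "(\<Sum>(b, c)\<leftarrow>xs. lact b (d c)) = 0" "t = (\<Sum>(b, c)\<leftarrow>xs. tens (d b) (d c))"
    using rel_list by metis
  show "wedge t = 0"
    unfolding wedge_kernel by (rule sub_bimodule_gen.gen) (use xs in blast)
qed

lemmas wedge_add = additiveD[OF wedge_additive]

lemma wedge_lactT: "wedge t = 0 \<Longrightarrow> wedge (lactT b t) = 0"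
  and wedge_ractT: "wedge t = 0 \<Longrightarrow> wedge (ractT t b) = 0"
  unfolding wedge_kernel by (rule sub_bimodule_gen.lact sub_bimodule_gen.ract; assumption)+

lemma wedge_scT: "wedge t = 0 \<Longrightarrow> wedge (scT c t) = 0"
  unfolding scl_def by (rule wedge_lactT)

lemma wedge_on_legs: "(\<And>J. wedge (X J) = 0) \<Longrightarrow> wedge (on_legs scT M X I) = 0"
  unfolding on_legs_def wedge_add by (intro sum.neutral ballI wedge_scT)

lemma rel_add: "rel x t \<Longrightarrow> rel y u \<Longrightarrow> rel (x + y) (t + u)"
  by (induction rule: rel.induct) (simp_all add: add.assoc rel_step)

lemma d_one: "d 1 = 0"
  using dD(3)[of 1] by (simp add: complex_algebraD(1)[OF \<eta>_algebra])

lemma rel_d: "rel (d b) 0"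
  using rel_step[OF rel_zero, of 1 b] by (simp add: d_one tens_add' left_moduleD(3)[OF Omega_left])

text \<open>
  The additional term \<open>db \<otimes> x\<close> is the other half of the Leibniz rule for the products \<open>b b'\<close>.
\<close>

lemma rel_lact: "rel x t \<Longrightarrow> rel (lact b x) (tens (d b) x + lactT b t)"
proof (induction rule: rel.induct)
  case rel_zero
  show ?case using rel.rel_zero by (simp add: lact_add lactT_add tens_add)
next
  case (rel_step x t b' c)
  have "rel (lact (b * b') (d c) + lact b x) (tens (d (b * b')) (d c) + (tens (d b) x + lactT b t))"
    by (rule rel.rel_step[OF rel_step.IH])
  moreover have "lact (b * b') (d c) + lact b x = lact b (lact b' (d c) + x)" by (simp add: lact_mult lact_add)
  moreover have "tens (d (b * b')) (d c) + (tens (d b) x + lactT b t) = tens (d b) (lact b' (d c) + x) + lactT b (tens (d b') (d c) + t)"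
    by (simp add: dD(2) tens_add tens_add' tens_bal lactT_add lactT_tens algebra_simps)
  ultimately show ?case by simp
qed

text \<open>
  Here the Leibniz rule is used in the form \<open>(b' dc) b = b' d(c b) - (b' c) db\<close>.
\<close>

lemma rel_ract: "rel x t \<Longrightarrow> rel (ract x b) (ractT t b - tens x (d b))"
proof (induction rule: rel.induct)
  case rel_zero
  show ?case using rel.rel_zero by (simp add: ract_add ractT_add tens_add')
next
  case (rel_step x t b' c)
  have "rel (lact b' (d (c * b)) + (lact (- (b' * c)) (d b) + ract x b))
      (tens (d b') (d (c * b)) + (tens (d (- (b' * c))) (d b) + (ractT t b - tens x (d b))))"
    by (rule rel.rel_step[OF rel.rel_step[OF rel_step.IH]])
  moreover have "lact b' (d (c * b)) + (lact (- (b' * c)) (d b) + ract x b) = ract (lact b' (d c) + x) b"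
    by (simp add: dD(2) lact_add lact_add' lact_mult lact_ract ract_add)
  moreover have "d (- z) = - d z" for z using dD(6)[of 0 z] dD(3)[of 0] complex_algebraD(5)[OF \<eta>_algebra] by simp
  then have "tens (d b') (d (c * b)) + (tens (d (- (b' * c))) (d b) + (ractT t b - tens x (d b)))
    = ractT (tens (d b') (d c) + t) b - tens (lact b' (d c) + x) (d b)"
    by (simp add: dD(2) tens_add tens_add' tens_bal ractT_add ractT_tens algebra_simps)
  ultimately show ?case by simp
qed

lemma rel_scale: "rel x t \<Longrightarrow> rel (scO c x) (scT c t)"
  using rel_lact[of x t "\<eta> c"] by (simp add: scl_def dD(3) tens_add')

lemma rel_uminus: "rel x t \<Longrightarrow> rel (- x) (- t)"
proof -
  interpret O: complex_space scO by (rule csO)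
  interpret T: complex_space scT by (rule csT)
  show "rel x t \<Longrightarrow> rel (- x) (- t)" using rel_scale[of x t "-1"] by simp
qed

lemma rel_diff: "rel x t \<Longrightarrow> rel y u \<Longrightarrow> rel (x - y) (t - u)"
  using rel_add[OF _ rel_uminus] by fastforce

lemma rel_sum: "(\<And>i. i \<in> I \<Longrightarrow> rel (x i) (t i)) \<Longrightarrow> rel (sum x I) (sum t I)"
  by (induction I rule: infinite_finite_induct) (simp_all add: rel_zero rel_add)

lemma rel_on_legs: "(\<And>J. rel (X J) (Y J)) \<Longrightarrow> rel (on_legs scO M X I) (on_legs scT M Y I)"
  unfolding on_legs_def by (intro rel_sum rel_scale)

text \<open>
  By the contraction rules \<open>\<Sum> p dp\<close> over the inner index is the second one-form; the first one-form is its difference to \<open>dp\<close>,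
  which comes from \<open>rel_d\<close>.
\<close>

lemma rel_dp: "rel (dp (i, l)) (- (A (i, l) + G (i, l)))"
  and rel_dbp: "rel (dbp (i, l)) (A (i, l) + G (i, l))"
proof -
  have rel1: "rel (\<Sum>j\<in>UNIV. lact (p (i, j)) (d (p (j, l)))) (\<Sum>j\<in>UNIV. tens (d (p (i, j))) (d (p (j, l))))"
    by (rule rel_sum) (use rel_lact[OF rel_d] in \<open>simp add: lactT_add\<close>)
  have "(\<Sum>j\<in>UNIV. lact (p (i, j)) (d (p (j, l)))) = dbp (i, l)"
    by (simp add: d_def lact_add sum.distrib cap_p_dp cap_p_dbp)
  moreover have "(\<Sum>j\<in>UNIV. tens (d (p (i, j))) (d (p (j, l)))) = A (i, l) + G (i, l)"
    by (simp add: d_def tens_add tens_add' sum.distrib cap_dp_dp cap_dbp_dbp A_def G_def add.commute)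
  ultimately show "rel (dbp (i, l)) (A (i, l) + G (i, l))" using rel1 by simp
  then have "rel (d (p (i, l)) - dbp (i, l)) (0 - (A (i, l) + G (i, l)))" by (intro rel_diff rel_d)
  then show "rel (dp (i, l)) (- (A (i, l) + G (i, l)))" by (simp add: d_def)
qed

text \<open>
  The trace of the differentials of type \<open>-\<close> vanishes, so the second component of the trace of \<open>rel_dbp\<close> is a
  relation.
\<close>

lemma wedge_trace: "wedge (trace scT A + \<gamma>) = 0"
proof -
  interpret T: complex_space scT by (rule csT)
  have "rel (trace scO dbp) (trace scT (\<lambda>I. A I + G I))"
    unfolding trace_def[OF csO] trace_def[OF csT] by (intro rel_sum rel_scale rel_dbp)
  then have "wedge (trace scT (\<lambda>I. A I + G I)) = 0" unfolding trace_dbp by (rule wedge_rel)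
  then show ?thesis
    by (simp add: trace_def[OF csT] \<gamma>_def T.scale_right_distrib sum.distrib)
qed

text \<open>
  The relation by which a product of type \<open>-+\<close> is expressed by products of type \<open>+-\<close> in the two-forms. The
  terms with \<open>GP\<close> make \<open>y I\<close> equal to \<open>BD I + \<sigma> (BD I)\<close> up to \<open>p (trace A + \<gamma>) p\<close>, which is a relation by \<open>wedge_trace\<close>.
\<close>

definition y where
  "y I = BD I + scT (W^2 / Q^4) (on_legs scT Si (on_legs scT St DB) I) + scT (1 / Q^2 - 1) (GP I)"

lemma T_DB_parts:
  "on_legs scT T PA I = scT (W / Q^2) (on_legs scT St DB I)"
  "on_legs scT T GP I = GP I"
  "on_legs scT T y I = on_legs scT T BD I + scT (W^2 / Q^4) (on_legs scT St (on_legs scT St DB) I) + scT (1 / Q^2 - 1) (GP I)"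
proof -
  interpret complex_space scT by (rule csT)
  show "on_legs scT T PA I = scT (W / Q^2) (on_legs scT St DB I)"
    unfolding PA_DB[abs_def] on_legs_scale on_legs_T[OF csT] on_legs_commute(1)[OF csT, symmetric] on_legs_inverse[OF csT, abs_def] ..
  show gp: "on_legs scT T GP I = GP I" for I
    unfolding on_legs_T[OF csT] GP_St[abs_def] on_legs_scale GP_S using W_nz by simp
  have "on_legs scT T (on_legs scT Si (on_legs scT St DB)) I = on_legs scT St (on_legs scT St DB) I"
    unfolding on_legs_T[OF csT] on_legs_commute(1)[OF csT, symmetric] on_legs_inverse[OF csT, abs_def] ..
  then show "on_legs scT T y I = on_legs scT T BD I + scT (W^2 / Q^4) (on_legs scT St (on_legs scT St DB) I) + scT (1 / Q^2 - 1) (GP I)"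
    unfolding y_def[abs_def] on_legs_add on_legs_scale gp by simp
qed

text \<open>
  Both sides of the right module rule for \<open>\<partial>p\<close> come from pairs in \<open>rel\<close>; the difference of the second
  components is a relation.
\<close>

lemma wedge_plus: "wedge (DD I + scT (Q^2) (on_legs scT T DD I) + scT (Q^2) (on_legs scT T y I)) = 0"
proof -
  interpret complex_space scT by (rule csT)
  define t1 where "t1 J = - (AP J + GP J) - (DD J + DB J)" for J
  define t2 where "t2 J = DD J + BD J - (PA J + GP J)" for J
  have r1: "rel (dpp J) (t1 J)" for J
  proof -
    obtain i j k l where J: "J = (i, j, k, l)" by (cases J)
    show ?thesis
      using rel_ract[OF rel_dp, of i j "p (k, l)"] unfolding J t1_def fam_prod_def prod.case
      by (simp add: d_def ractT_add tens_add algebra_simps)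
  qed
  have r2: "rel (pd J) (t2 J)" for J
  proof -
    obtain i j k l where J: "J = (i, j, k, l)" by (cases J)
    have "rel (pd J) (DD J + BD J - (PA J + fam_prod lactT p G J))"
      using rel_lact[OF rel_dp, of "p (i, j)" k l] unfolding J fam_prod_def prod.case
      by (simp add: d_def lactT_add tens_add' algebra_simps)
    then show ?thesis unfolding t2_def PG_GP .
  qed
  have "rel (dpp I - scO (Q^2) (on_legs scO T pd I)) (t1 I - scT (Q^2) (on_legs scT T t2 I))"
    by (intro rel_diff r1 rel_scale rel_on_legs r2)
  then have "wedge (t1 I - scT (Q^2) (on_legs scT T t2 I)) = 0"
    unfolding Omega_plus_right qpow_values by (intro wedge_rel) simp
  moreover have "DD I + scT (Q^2) (on_legs scT T DD I) + scT (Q^2) (on_legs scT T y I) = - (t1 I - scT (Q^2) (on_legs scT T t2 I))"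
  proof -
    let ?v = "on_legs scT St DB I" and ?vv = "on_legs scT St (on_legs scT St DB) I"
    have f1: "scT (Q^2) (scT (W^2 / Q^4) ?vv) = scT E ?vv"
      unfolding scale_scale by (rule arg_cong[of _ _ "\<lambda>c. scT c ?vv"]) (use Q_nz in \<open>simp add: E_def power2_eq_square power4_eq_xxxx\<close>)
    have f2: "scT (Q^2) (scT (1 / Q^2 - 1) (GP I)) = GP I - scT (Q^2) (GP I)"
      unfolding scale_scale using Q_nz by (simp add: right_diff_distrib scale_left_diff_distrib)
    have f3: "scT (Q^2) (scT (W / Q^2) ?v) = scT (W / Q^2) ?v + scT D ?v"
      unfolding scale_scale scale_left_distrib[symmetric] using Q_nz by (simp add: D_def)
    have db: "DB I = scT D ?v + scT E ?vv"
      using on_legs_Hecke(2)[OF csT, of "on_legs scT St DB" I] unfolding on_legs_inverse[OF csT] .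
    show ?thesis
      unfolding t1_def t2_def[abs_def] on_legs_add on_legs_diff T_DB_parts AP_DB db scale_right_distrib scale_right_diff_distrib f1 f2 f3
      by (simp add: algebra_simps)
  qed
  ultimately show ?thesis by (simp add: wedge_add)
qed

lemma wedge_minus: "wedge (BB I + scT (1 / Q^2) (on_legs scT T BB I) + y I) = 0"
proof -
  interpret complex_space scT by (rule csT)
  define t1 where "t1 J = AP J + GP J - (BD J + BB J)" for J
  define t2 where "t2 J = DB J + BB J + (PA J + GP J)" for J
  have r1: "rel (dbpp J) (t1 J)" for J
  proof -
    obtain i j k l where J: "J = (i, j, k, l)" by (cases J)
    show ?thesis
      using rel_ract[OF rel_dbp, of i j "p (k, l)"] unfolding J t1_def fam_prod_def prod.case
      by (simp add: d_def ractT_add tens_add algebra_simps)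
  qed
  have r2: "rel (pdb J) (t2 J)" for J
  proof -
    obtain i j k l where J: "J = (i, j, k, l)" by (cases J)
    have "rel (pdb J) (DB J + BB J + (PA J + fam_prod lactT p G J))"
      using rel_lact[OF rel_dbp, of "p (i, j)" k l] unfolding J fam_prod_def prod.case
      by (simp add: d_def lactT_add tens_add' algebra_simps)
    then show ?thesis unfolding t2_def PG_GP .
  qed
  have "rel (dbpp I - scO (1 / Q^2) (on_legs scO T pdb I)) (t1 I - scT (1 / Q^2) (on_legs scT T t2 I))"
    by (intro rel_diff r1 rel_scale rel_on_legs r2)
  then have "wedge (t1 I - scT (1 / Q^2) (on_legs scT T t2 I)) = 0"
    unfolding Omega_minus_right qpow_values by (intro wedge_rel) simp
  moreover have "BB I + scT (1 / Q^2) (on_legs scT T BB I) + y I = - (t1 I - scT (1 / Q^2) (on_legs scT T t2 I))"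
  proof -
    let ?v = "on_legs scT St DB I" and ?u = "on_legs scT Si (on_legs scT St DB) I"
    have g1: "scT (1 / Q^2) (scT E ?u) = scT (W^2 / Q^4) ?u"
      unfolding scale_scale by (rule arg_cong[of _ _ "\<lambda>c. scT c ?u"]) (use Q_nz in \<open>simp add: E_def power2_eq_square power4_eq_xxxx\<close>)
    have g2: "scT (1 / Q^2 - 1) (GP I) = scT (1 / Q^2) (GP I) - GP I"
      by (simp add: scale_left_diff_distrib)
    have g3: "scT (1 / Q^2) (scT D ?v) = scT (W / Q^2) ?v - scT (1 / Q^2) (scT (W / Q^2) ?v)"
      unfolding scale_scale scale_left_diff_distrib[symmetric]
      by (rule arg_cong[of _ _ "\<lambda>c. scT c ?v"]) (simp add: D_def right_diff_distrib)
    have tdb: "on_legs scT T DB I = scT D ?v + scT E ?u"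
      unfolding on_legs_T[OF csT] by (rule on_legs_Hecke(1)[OF csT])
    show ?thesis
      unfolding t1_def t2_def[abs_def] y_def on_legs_add on_legs_diff T_DB_parts tdb AP_DB scale_right_distrib scale_right_diff_distrib g1 g2 g3
      by (simp add: algebra_simps)
  qed
  ultimately show ?thesis by (simp add: wedge_add)
qed

text \<open>
  Contraction with \<open>p\<close> from the left. It kills \<open>DD\<close> by \<open>cap_p_dp\<close> and fixes \<open>y\<close>.
\<close>

definition absorb where
  "absorb X = (\<lambda>(i, j, k, l). \<Sum>h\<in>UNIV. lactT (p (i, h)) (X (h, j, k, l)))"

lemma wedge_absorb: "(\<And>J. wedge (X J) = 0) \<Longrightarrow> wedge (absorb X I) = 0"
  by (cases I) (simp add: absorb_def wedge_add wedge_lactT)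

lemma absorb_add: "absorb (\<lambda>J. X J + Y J) I = absorb X I + absorb Y I"
  by (cases I) (simp add: absorb_def lactT_add sum.distrib)

lemma absorb_scale: "absorb (\<lambda>J. scT c (X J)) I = scT c (absorb X I)"
proof -
  interpret complex_space scT by (rule csT)
  show ?thesis by (cases I) (simp add: absorb_def lactT_scale scale_sum_right)
qed

lemma absorb_St: "absorb (on_legs scT St X) I = on_legs scT St (absorb X) I"
proof -
  interpret complex_space scT by (rule csT)
  obtain i j k l where I: "I = (i, j, k, l)" by (cases I)
  have "absorb (on_legs scT St X) I = (\<Sum>h\<in>UNIV. act3 scT St3 (\<lambda>x y z. lactT (p (i, h)) (X (h, x, y, z))) j k l)"
    by (simp only: I absorb_def prod.case on_legs_legs[OF csT] linear_act3[OF lactT_linear])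
  also have "\<dots> = on_legs scT St (absorb X) I"
    unfolding I on_legs_legs[OF csT] act3_sum[symmetric] by (simp only: absorb_def prod.case)
  finally show ?thesis .
qed

lemma pd_Sti_act3: "act3 scO St3i (\<lambda>x y z. lact (p (h, x)) (dp (y, z))) j k l = scO W (lact (p (h, j)) (dp (k, l)))"
proof -
  interpret complex_space scO by (rule csO)
  have "on_legs scO Sti (on_legs scO St pd) I = scO (1 / W) (on_legs scO Sti pd I)" for I
    unfolding pd_St[abs_def] on_legs_scale ..
  then have "scO W (pd I) = scO W (scO (1 / W) (on_legs scO Sti pd I))" for I
    unfolding on_legs_inverse[OF csO] by simp
  then have "on_legs scO Sti pd I = scO W (pd I)" for I using W_nz by simp
  from this[of "(h, j, k, l)"] show ?thesis
    unfolding on_legs_legs[OF csO] by (simp only: fam_prod_def prod.case)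
qed

text \<open>
  By \<open>act3_rotate\<close>, the contraction turns \<open>S\<close> into the inverse of \<open>St\<close> acting on \<open>p \<partial>p\<close>, where it is a scalar.
\<close>

lemma absorb_S:
  "absorb (on_legs scT S (fam_prod tens dp x)) (i, j, k, l) = scT W (lactT (p (i, j)) (\<Sum>c\<in>UNIV. tens (dp (k, c)) (x (c, l))))"
proof -
  interpret complex_space scT by (rule csT)
  have "absorb (on_legs scT S (fam_prod tens dp x)) (i, j, k, l)
      = (\<Sum>h\<in>UNIV. act3 scT S3 (\<lambda>u v c. lactT (p (i, h)) (tens (dp (u, v)) (x (c, l)))) h j k)"
    by (simp only: absorb_def prod.case on_legs_legs[OF csT] linear_act3[OF lactT_linear] fam_prod_def)
  also have "\<dots> = (\<Sum>c\<in>UNIV. act3 scT St3i (\<lambda>h u v. lactT (p (i, h)) (tens (dp (u, v)) (x (c, l)))) j k c)"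
    by (rule act3_rotate[OF csT, of "\<lambda>h u v c. lactT (p (i, h)) (tens (dp (u, v)) (x (c, l)))"])
  also have "\<dots> = (\<Sum>c\<in>UNIV. tens (scO W (lact (p (i, j)) (dp (k, c)))) (x (c, l)))"
    unfolding lactT_tens act3_tens[symmetric] pd_Sti_act3 ..
  also have "\<dots> = scT W (lactT (p (i, j)) (\<Sum>c\<in>UNIV. tens (dp (k, c)) (x (c, l))))"
    by (simp only: tens_scale lactT_tens[symmetric] lactT_add scale_sum_right)
  finally show ?thesis .
qed

lemma absorb_dp: "absorb (fam_prod tens dp x) I = 0"
proof -
  obtain i j k l where I: "I = (i, j, k, l)" by (cases I)
  have "absorb (fam_prod tens dp x) I = tens (\<Sum>h\<in>UNIV. lact (p (i, h)) (dp (h, j))) (x (k, l))"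
    by (simp only: I absorb_def fam_prod_def prod.case lactT_tens tens_add')
  then show ?thesis by (simp only: cap_p_dp tens_add')
qed

lemma absorb_y: "absorb y I = y I"
proof -
  interpret complex_space scT by (rule csT)
  have bd: "absorb BD I = BD I" for I
  proof -
    obtain i j k l where I: "I = (i, j, k, l)" by (cases I)
    have "absorb BD I = tens (\<Sum>h\<in>UNIV. lact (p (i, h)) (dbp (h, j))) (dp (k, l))"
      by (simp only: I absorb_def fam_prod_def prod.case lactT_tens tens_add')
    then show ?thesis by (simp only: cap_p_dbp I fam_prod_def prod.case)
  qed
  have gp: "absorb GP I = GP I" for I
  proof -
    obtain i j k l where I: "I = (i, j, k, l)" by (cases I)
    have "absorb GP I = ractT (\<Sum>h\<in>UNIV. lactT (p (i, h)) (G (h, j))) (p (k, l))"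
      by (simp only: I absorb_def fam_prod_def prod.case lactT_ractT ractT_add)
    then show ?thesis by (simp only: cap_p_G I fam_prod_def prod.case)
  qed
  have si: "absorb (on_legs scT Si DB) I = on_legs scT Si DB I" for I
  proof -
    obtain i j k l where I: "I = (i, j, k, l)" by (cases I)
    have "absorb (on_legs scT S DB) I = scT D (absorb DB I) + scT E (absorb (on_legs scT Si DB) I)"
      unfolding on_legs_Hecke(1)[OF csT, abs_def] absorb_add absorb_scale ..
    then have "scT E (absorb (on_legs scT Si DB) I) = absorb (on_legs scT S DB) I"
      by (simp add: absorb_dp)
    also have "\<dots> = scT W (PA I)"
      unfolding I absorb_S by (simp only: A_def fam_prod_def prod.case)
    also have "\<dots> = scT E (on_legs scT Si DB I)"
      unfolding PA_DB scale_scale by (simp add: E_def power2_eq_square)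
    finally show ?thesis using E_nz by simp
  qed
  have "absorb (on_legs scT Si (on_legs scT St DB)) I = on_legs scT Si (on_legs scT St DB) I"
    unfolding on_legs_commute(2)[OF csT, abs_def, symmetric] absorb_St si[abs_def] ..
  then show ?thesis
    unfolding y_def[abs_def] absorb_add absorb_scale bd gp by simp
qed

lemma S_T_BB: "on_legs scT S (on_legs scT T BB) I = scT W (on_legs scT T BB I)"
proof -
  interpret complex_space scT by (rule csT)
  have tb: "on_legs scT T BB I = scT W (on_legs scT St BB I)" for I
    unfolding on_legs_T[OF csT] on_legs_commute(1)[OF csT, symmetric] BB_S[abs_def] on_legs_scale ..
  have "on_legs scT S (on_legs scT T BB) I = scT W (on_legs scT S (on_legs scT St BB) I)"
    unfolding tb[abs_def] on_legs_scale ..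
  then show ?thesis unfolding on_legs_T[OF csT, of BB I] .
qed

text \<open>
  In \<open>wedge_minus\<close> the pure terms are multiplied by \<open>W\<close> under \<open>S\<close>, hence \<open>S y - W y\<close> is a relation. In \<open>wedge_plus\<close> this
  allows the replacement of \<open>T y\<close> by a multiple of \<open>St y\<close>, and then \<open>absorb\<close> removes the pure terms.
\<close>

lemma wedge_y: "wedge (y I) = 0"
proof -
  interpret complex_space scT by (rule csT)
  let ?Z = "\<lambda>I. BB I + scT (1 / Q^2) (on_legs scT T BB I) + y I"
  have Sy: "wedge (on_legs scT S y I - scT W (y I)) = 0" for I
  proof -
    have "wedge (on_legs scT S ?Z I - scT W (?Z I)) = 0"
      unfolding wedge_add using wedge_on_legs[OF wedge_minus] wedge_scT[OF wedge_minus] by simp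
    moreover have "on_legs scT S ?Z I - scT W (?Z I) = on_legs scT S y I - scT W (y I)"
      unfolding on_legs_add on_legs_scale BB_S S_T_BB scale_right_distrib by (simp add: mult.commute)
    ultimately show ?thesis by simp
  qed
  have Ty: "wedge (on_legs scT T y I - scT W (on_legs scT St y I)) = 0" for I
  proof -
    have "wedge (on_legs scT St (\<lambda>I. on_legs scT S y I - scT W (y I)) I) = 0"
      by (rule wedge_on_legs[OF Sy])
    then show ?thesis unfolding on_legs_diff on_legs_scale on_legs_T[OF csT] on_legs_commute(1)[OF csT] .
  qed
  let ?P = "\<lambda>I. DD I + scT (Q^2) (on_legs scT T DD I)"
  have X: "wedge (?P I + scT (Q^2 * W) (on_legs scT St y I)) = 0" for I
  proof -
    have "wedge (scT (Q^2) (on_legs scT T y I - scT W (on_legs scT St y I))) = 0" by (rule wedge_scT[OF Ty])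
    moreover have "?P I + scT (Q^2 * W) (on_legs scT St y I) = (?P I + scT (Q^2) (on_legs scT T y I))
        - scT (Q^2) (on_legs scT T y I - scT W (on_legs scT St y I))"
      by (simp add: scale_right_diff_distrib)
    ultimately show ?thesis using wedge_plus[of I] by (simp only: wedge_add) simp
  qed
  have "absorb ?P I = 0" for I
  proof -
    obtain i j k l where I: "I = (i, j, k, l)" by (cases I)
    have "on_legs scT T DD J = scT (1 / W) (on_legs scT S DD J)" for J
      unfolding on_legs_T[OF csT] DD_St[abs_def] on_legs_scale ..
    then have "on_legs scT T DD = (\<lambda>J. scT (1 / W) (on_legs scT S DD J))" by (rule ext)
    then have "absorb (on_legs scT T DD) I = scT (1 / W) (absorb (on_legs scT S DD) I)" by (simp only: absorb_scale)
    then have "absorb (on_legs scT T DD) I = 0"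
      unfolding I absorb_S cap_dp_dp by (simp add: lactT_add)
    then show ?thesis unfolding absorb_add absorb_scale absorb_dp by simp
  qed
  then have abs: "absorb (\<lambda>I. ?P I + scT (Q^2 * W) (on_legs scT St y I)) I = scT (Q^2 * W) (on_legs scT St y I)" for I
    unfolding absorb_add[of ?P] absorb_scale absorb_St absorb_y[abs_def] by simp
  have "wedge (scT (Q^2 * W) (on_legs scT St y I)) = 0" for I
    by (subst abs[symmetric], rule wedge_absorb, rule X)
  then have "wedge (scT (1 / (Q^2 * W)) (scT (Q^2 * W) (on_legs scT St y I))) = 0" for I
    by (rule wedge_scT)
  then have "wedge (on_legs scT St y I) = 0" for I using Q_nz W_nz by simp
  then have "wedge (on_legs scT Sti (on_legs scT St y) I) = 0" by (rule wedge_on_legs)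
  then show ?thesis unfolding on_legs_inverse[OF csT] .
qed

lemma wedge_DD: "wedge (DD I + scT (Q^2) (on_legs scT T DD I)) = 0"
proof -
  have "wedge (scT (Q^2) (on_legs scT T y I)) = 0" by (intro wedge_scT wedge_on_legs wedge_y)
  then show ?thesis using wedge_plus[of I] by (simp add: wedge_add)
qed

lemma wedge_BB: "wedge (BB I + scT (1 / Q^2) (on_legs scT T BB I)) = 0"
  using wedge_minus[of I] wedge_y[of I] by (simp add: wedge_add)

end

section \<open>Twisted derivations on one-forms\<close>

context HK_calculus
begin

abbreviation "Op \<equiv> Omega_part lact p del"
abbreviation "Om \<equiv> Omega_part lact p delbar"

lemma Omega_part_expansion:
  assumes "x \<in> Omega_part lact p \<delta>"
  shows "\<exists>c :: 'b^('n \<times> 'n). x = (\<Sum>I\<in>UNIV. lact (c $ I) (\<delta> (p I)))"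
  using assms unfolding Omega_part_def
proof induction
  case zero
  show ?case by (rule exI[of _ 0]) (simp add: lact_add')
next
  case (gen x)
  then obtain J where J: "x = \<delta> (p J)" by blast
  have "(\<Sum>I\<in>UNIV. lact (axis J 1 $ I) (\<delta> (p I))) = (\<Sum>I\<in>UNIV. if I = J then \<delta> (p I) else 0)"
    unfolding axis_def vec_lambda_beta by (intro sum.cong refl) (auto simp: lact_add' left_moduleD(3)[OF Omega_left])
  then show ?case by (intro exI[of _ "axis J 1"]) (simp add: J)
next
  case (add x y)
  then obtain c c' where "x = (\<Sum>I\<in>UNIV. lact (c $ I) (\<delta> (p I)))" "y = (\<Sum>I\<in>UNIV. lact (c' $ I) (\<delta> (p I)))" by blast
  then show ?case by (intro exI[of _ "c + c'"]) (simp add: lact_add' sum.distrib)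
next
  case (act x b)
  then obtain c where "x = (\<Sum>I\<in>UNIV. lact (c $ I) (\<delta> (p I)))" by blast
  then show ?case by (intro exI[of _ "b *s c"]) (simp add: lact_mult lact_add)
qed

lemma Omega_part_closed:
  "0 \<in> Omega_part lact p \<delta>" "x \<in> Omega_part lact p \<delta> \<Longrightarrow> y \<in> Omega_part lact p \<delta> \<Longrightarrow> x + y \<in> Omega_part lact p \<delta>"
  "x \<in> Omega_part lact p \<delta> \<Longrightarrow> lact b x \<in> Omega_part lact p \<delta>" "\<delta> (p I) \<in> Omega_part lact p \<delta>"
proof -
  show "0 \<in> Omega_part lact p \<delta>" unfolding Omega_part_def by (rule left_gen.zero)
  show "x \<in> Omega_part lact p \<delta> \<Longrightarrow> y \<in> Omega_part lact p \<delta> \<Longrightarrow> x + y \<in> Omega_part lact p \<delta>"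
    unfolding Omega_part_def by (rule left_gen.add)
  show "x \<in> Omega_part lact p \<delta> \<Longrightarrow> lact b x \<in> Omega_part lact p \<delta>"
    unfolding Omega_part_def by (rule left_gen.act)
  show "\<delta> (p I) \<in> Omega_part lact p \<delta>"
    unfolding Omega_part_def by (rule left_gen.gen) blast
qed

lemma Omega_part_sum: "(\<And>i. i \<in> I \<Longrightarrow> f i \<in> Omega_part lact p \<delta>) \<Longrightarrow> sum f I \<in> Omega_part lact p \<delta>"
  by (induction I rule: infinite_finite_induct) (simp_all add: Omega_part_closed)

lemma Omega_part_induct:
  assumes "x \<in> Omega_part lact p \<delta>" "P 0" "\<And>b I. P (lact b (\<delta> (p I)))" "\<And>x y. P x \<Longrightarrow> P y \<Longrightarrow> P (x + y)"
  shows "P x"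
proof -
  obtain c :: "'b^('n \<times> 'n)" where x: "x = (\<Sum>I\<in>UNIV. lact (c $ I) (\<delta> (p I)))"
    using Omega_part_expansion[OF assms(1)] by blast
  have "P (\<Sum>I\<in>A. lact (c $ I) (\<delta> (p I)))" if "finite A" for A
    using that by induction (simp_all add: assms)
  then show ?thesis unfolding x by simp
qed

lemma Omega_part_scale: "x \<in> Omega_part lact p \<delta> \<Longrightarrow> scO c x \<in> Omega_part lact p \<delta>"
  unfolding scl_def by (rule Omega_part_closed(3))

lemma Omega_part_on_legs:
  "on_legs scO K (fam_prod lact p (\<lambda>I. \<delta> (p I))) J \<in> Omega_part lact p \<delta>"
  unfolding on_legs_def scl_def
  by (intro Omega_part_sum Omega_part_closed(3)) (auto simp: fam_prod_def split_def intro!: Omega_part_closed)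

text \<open>
  The right module rule expresses \<open>\<delta>p p\<close> by \<open>p \<delta>p\<close>; the rest is induction on the element of the algebra.
\<close>

lemma Omega_part_ract:
  assumes right: "\<And>J. fam_prod ract (\<lambda>I. \<delta> (p I)) p J = scO c (on_legs scO T (fam_prod lact p (\<lambda>I. \<delta> (p I))) J)"
    and x: "x \<in> Omega_part lact p \<delta>"
  shows "ract x b \<in> Omega_part lact p \<delta>"
proof -
  have "\<forall>x\<in>Omega_part lact p \<delta>. ract x b \<in> Omega_part lact p \<delta>"
  proof (induction b rule: generator_induct)
    case (1 c)
    show ?case unfolding bimoduleD(4)[OF Omega_bimodule, symmetric] by (blast intro: Omega_part_closed)
  next
    case (2 I)
    show ?case
    proof
      fix x assume "x \<in> Omega_part lact p \<delta>"
      then show "ract x (p I) \<in> Omega_part lact p \<delta>"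
      proof (rule Omega_part_induct)
        fix b and J :: "'n \<times> 'n"
        obtain i j k l where "J = (i, j)" "I = (k, l)" by (cases J; cases I)
        then have "ract (\<delta> (p J)) (p I) = scO c (on_legs scO T (fam_prod lact p (\<lambda>I. \<delta> (p I))) (i, j, k, l))"
          using right[of "(i, j, k, l)"] by (simp add: fam_prod_def)
        then show "ract (lact b (\<delta> (p J))) (p I) \<in> Omega_part lact p \<delta>"
          by (simp only: lact_ract[symmetric]) (rule Omega_part_closed(3) Omega_part_scale Omega_part_on_legs)+
      qed (simp_all add: ract_add Omega_part_closed)
    qed
  next
    case (3 x y)
    then show ?case by (simp add: ract_add' Omega_part_closed)
  next
    case (4 x y)
    then show ?case by (simp add: ract_mult)
  qed
  then show ?thesis using x by blast
qed

lemmas Op_ract = Omega_part_ract[OF Omega_plus_right]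
lemmas Om_ract = Omega_part_ract[OF Omega_minus_right]

text \<open>
  The components of a one-form in the direct sum of the two types.
\<close>

definition split where
  "split \<omega> = (THE z. fst z \<in> Op \<and> snd z \<in> Om \<and> \<omega> = fst z + snd z)"

definition "proj_plus \<omega> = fst (split \<omega>)"
definition "proj_minus \<omega> = snd (split \<omega>)"

lemma split: "proj_plus \<omega> \<in> Op" "proj_minus \<omega> \<in> Om" "\<omega> = proj_plus \<omega> + proj_minus \<omega>"
  using theI'[OF Omega_direct_sum[of \<omega>]] unfolding proj_plus_def proj_minus_def split_def by blast+

lemma split_unique: "x \<in> Op \<Longrightarrow> y \<in> Om \<Longrightarrow> proj_plus (x + y) = x" "x \<in> Op \<Longrightarrow> y \<in> Om \<Longrightarrow> proj_minus (x + y) = y"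
proof -
  assume xy: "x \<in> Op" "y \<in> Om"
  have "(x, y) = (proj_plus (x + y), proj_minus (x + y))"
    using Omega_direct_sum[of "x + y"] xy split[of "x + y"] by (metis fst_conv snd_conv)
  then show "proj_plus (x + y) = x" "proj_minus (x + y) = y" by simp_all
qed

lemma proj_parts: "x \<in> Op \<Longrightarrow> proj_plus x = x" "x \<in> Op \<Longrightarrow> proj_minus x = 0"
  "x \<in> Om \<Longrightarrow> proj_plus x = 0" "x \<in> Om \<Longrightarrow> proj_minus x = x"
  using split_unique[of x 0] split_unique[of 0 x] Omega_part_closed(1)[of del] Omega_part_closed(1)[of delbar] by simp_all

lemma proj_add: "proj_plus (x + y) = proj_plus x + proj_plus y" "proj_minus (x + y) = proj_minus x + proj_minus y"
proof -
  have "x + y = (proj_plus x + proj_plus y) + (proj_minus x + proj_minus y)"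
    using split(3)[of x] split(3)[of y] by (metis add.assoc add.left_commute)
  then show "proj_plus (x + y) = proj_plus x + proj_plus y" "proj_minus (x + y) = proj_minus x + proj_minus y"
    using split_unique[of "proj_plus x + proj_plus y" "proj_minus x + proj_minus y"] split(1,2) Omega_part_closed(2) by metis+
qed

lemma proj_lact: "proj_plus (lact b x) = lact b (proj_plus x)" "proj_minus (lact b x) = lact b (proj_minus x)"
proof -
  have "lact b x = lact b (proj_plus x) + lact b (proj_minus x)"
    using split(3)[of x] lact_add(1) by metis
  then show "proj_plus (lact b x) = lact b (proj_plus x)" "proj_minus (lact b x) = lact b (proj_minus x)"
    using split_unique[of "lact b (proj_plus x)" "lact b (proj_minus x)"] split(1,2) Omega_part_closed(3) by metis+
qed

lemma proj_ract: "proj_plus (ract x b) = ract (proj_plus x) b" "proj_minus (ract x b) = ract (proj_minus x) b"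
proof -
  have "ract x b = ract (proj_plus x) b + ract (proj_minus x) b"
    using split(3)[of x] ract_add(1) by metis
  then show "proj_plus (ract x b) = ract (proj_plus x) b" "proj_minus (ract x b) = ract (proj_minus x) b"
    using split_unique[of "ract (proj_plus x) b" "ract (proj_minus x) b"] split(1,2) Op_ract Om_ract by metis+
qed

lemma proj_additive: "Modules.additive proj_plus" "Modules.additive proj_minus"
  by (simp_all add: Modules.additive_def proj_add)

lemma Omega_induct:
  assumes "\<And>b I. P (lact b (del_p I))" "\<And>b I. P (lact b (delbar_p I))" "\<And>x y. P x \<Longrightarrow> P y \<Longrightarrow> P (x + y)" "P 0"
  shows "P \<omega>"
proof -
  have "P (proj_plus \<omega>)" using split(1)[of \<omega>] by (rule Omega_part_induct) (simp_all add: assms)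
  moreover have "P (proj_minus \<omega>)" using split(2)[of \<omega>] by (rule Omega_part_induct) (simp_all add: assms)
  ultimately have "P (proj_plus \<omega> + proj_minus \<omega>)" by (rule assms(3))
  then show ?thesis by (simp only: split(3)[symmetric])
qed

context
  fixes lz :: "'b \<Rightarrow> 'z \<Rightarrow> 'z::ab_group_add" and rz :: "'z \<Rightarrow> 'b \<Rightarrow> 'z" and \<beta> :: "'o \<Rightarrow> 'o \<Rightarrow> 'z"
  assumes Z: "bimodule \<eta> lz rz"
    and \<beta>_add: "\<And>x. Modules.additive (\<beta> x)" "\<And>y. Modules.additive (\<lambda>x. \<beta> x y)"
    and \<beta>_lact: "\<And>b x y. \<beta> (lact b x) y = lz b (\<beta> x y)"
    and \<beta>_ract: "\<And>b x y. \<beta> x (ract y b) = rz (\<beta> x y) b"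
    and \<beta>_bal: "\<And>b x y. \<beta> (ract x b) y = \<beta> x (lact b y)"
begin

abbreviation (input) "scZ \<equiv> scl \<eta> lz"

text \<open>
  The formula defines a map on the free module. It is determined by its values on axes up to terms in \<beta>, hence it
  vanishes on the submodule generated by the relators once it vanishes on the relators, and so it descends to the
  presented module.
\<close>

lemma half_twisted_derivation:
  assumes pres: "left_module_presented lact g (Omega_relators K c)"
    and A1: "\<And>I. on_legs scZ K (\<lambda>(i, j, k, l). \<beta> (d (p (i, j))) (g (k, l)) + lz (p (i, j)) (u (k, l))) I =
      scZ c ((\<lambda>(i, j, k, l). \<beta> (d (p (i, j))) (g (k, l)) + lz (p (i, j)) (u (k, l))) I)"
    and A2: "contract12 scZ Ev' u = 0"
  obtains \<phi> where "\<And>c :: 'b^('n \<times> 'n). \<phi> (\<Sum>x\<in>UNIV. lact (c $ x) (g x)) = (\<Sum>x\<in>UNIV. \<beta> (d (c $ x)) (g x) + lz (c $ x) (u x))"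
proof -
  note zl = bimoduleD(1)[OF Z]
  note lz_add = additiveD[OF left_moduleD(1)[OF zl]] and lz_add' = additiveD[OF left_moduleD(2)[OF zl]] and lz_mult = left_moduleD(4)[OF zl]
  note \<beta>1 = additiveD[OF \<beta>_add(1)] and \<beta>2 = additiveD[OF \<beta>_add(2)]
  have d0: "d 0 = 0" using dD(3)[of 0] complex_algebraD(5)[OF \<eta>_algebra] by simp
  define ev where "ev v = (\<Sum>x\<in>UNIV. lact (v $ x) (g x))" for v :: "'b^('n \<times> 'n)"
  define \<Phi> where "\<Phi> v = (\<Sum>x\<in>UNIV. \<beta> (d (v $ x)) (g x) + lz (v $ x) (u x))" for v :: "'b^('n \<times> 'n)"
  have add: "\<Phi> (v + v') = \<Phi> v + \<Phi> v'" for v v'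
    by (simp add: \<Phi>_def dD(1) \<beta>2 lz_add' sum.distrib algebra_simps)
  have zero: "\<Phi> 0 = 0" by (simp add: \<Phi>_def d0 \<beta>2 lz_add')
  have diff: "\<Phi> (v - v') = \<Phi> v - \<Phi> v'" for v v' using add[of "v - v'" v'] by (simp add: algebra_simps)
  have act: "\<Phi> (b *s v) = \<beta> (d b) (ev v) + lz b (\<Phi> v)" for b v
    by (simp add: \<Phi>_def ev_def dD(2) \<beta>1 \<beta>2 \<beta>_bal \<beta>_lact lz_add lz_mult sum.distrib add.assoc)
  have scale: "\<Phi> (scl \<eta> (*s) z v) = scZ z (\<Phi> v)" for z v
    unfolding scl_def act dD(3) by (simp add: \<beta>2)
  have axis: "\<Phi> (axis J 1) = u J" for J
  proof -
    have "\<Phi> (axis J 1) = (\<Sum>x\<in>UNIV. if x = J then u x else 0)"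
      unfolding \<Phi>_def axis_def vec_lambda_beta
    proof (intro sum.cong refl)
      fix x show "\<beta> (d (if x = J then 1 else 0)) (g x) + lz (if x = J then 1 else 0) (u x) = (if x = J then u x else 0)"
        using dD(3)[of 1] complex_algebraD(1)[OF \<eta>_algebra] by (simp add: d0 \<beta>2 lz_add' left_moduleD(3)[OF zl])
    qed
    then show ?thesis by simp
  qed
  have ev_axis: "ev (axis J 1) = g J" for J
  proof -
    have "ev (axis J 1) = (\<Sum>x\<in>UNIV. if x = J then g x else 0)"
      unfolding ev_def axis_def vec_lambda_beta by (intro sum.cong refl) (auto simp: lact_add' left_moduleD(3)[OF Omega_left])
    then show ?thesis by simp
  qed
  have pe: "\<Phi> (fam_prod (*s) p (\<lambda>I. axis I 1) J) = (\<lambda>(i, j, k, l). \<beta> (d (p (i, j))) (g (k, l)) + lz (p (i, j)) (u (k, l))) J" for J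
    by (cases J) (simp add: fam_prod_def act axis ev_axis)
  have sum4: "\<Phi> (\<Sum>s\<in>A. h s) = (\<Sum>s\<in>A. \<Phi> (h s))" for h and A :: "('n \<times> 'n \<times> 'n \<times> 'n) set"
    by (induction A rule: infinite_finite_induct) (simp_all add: zero add)
  have sum2: "\<Phi> (\<Sum>s\<in>A. h s) = (\<Sum>s\<in>A. \<Phi> (h s))" for h and A :: "('n \<times> 'n) set"
    by (induction A rule: infinite_finite_induct) (simp_all add: zero add)
  have rel: "\<Phi> v = 0" if "v \<in> Omega_relators K c" for v
  proof -
    consider I where "v = on_legs (scl \<eta> (*s)) K (fam_prod (*s) p (\<lambda>I. axis I 1)) I - scl \<eta> (*s) c (fam_prod (*s) p (\<lambda>I. axis I 1) I)"
      | "v = contract12 (scl \<eta> (*s)) Ev' (\<lambda>I. axis I 1)"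
      using \<open>v \<in> Omega_relators K c\<close> unfolding Omega_relators_def Let_def by blast
    then show ?thesis
    proof cases
      case 1
      then show ?thesis using A1[of I] unfolding 1 diff on_legs_def sum4 scale pe by simp
    next
      case 2
      show ?thesis unfolding 2 contract12_def sum2 scale axis using A2 unfolding contract12_def .
    qed
  qed
  have ker: "\<Phi> v = 0" if "ev v = 0" for v
  proof -
    have "v \<in> left_gen (*s) (Omega_relators K c)" using pres that unfolding left_module_presented_def ev_def by blast
    then show ?thesis
    proof induction
      case (act v b)
      then have "ev v = 0" using pres unfolding left_module_presented_def ev_def by blast
      then show ?case using act by (simp add: \<open>\<And>b v. \<Phi> (b *s v) = \<beta> (d b) (ev v) + lz b (\<Phi> v)\<close> \<beta>1 lz_add)
    qed (simp_all add: zero add rel)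
  qed
  define \<phi> where "\<phi> x = \<Phi> (SOME v. ev v = x)" for x
  have "\<phi> (ev v) = \<Phi> v" for v
  proof -
    have "ev (SOME v'. ev v' = ev v) = ev v" by (rule someI[where x = v]) simp
    then have "ev ((SOME v'. ev v' = ev v) - v) = 0" by (simp add: ev_def lact_add' sum_subtractf)
    from ker[OF this] show ?thesis unfolding \<phi>_def diff by simp
  qed
  then show thesis using that unfolding ev_def \<Phi>_def by blast
qed

text \<open>
  The values of \<phi> on the generators extend to a map with the left rule, type by type, if they respect the relators
  (first four identities). The right rule holds for all elements if it holds for a generator times a generator, where
  the right module rule turns it into the last two identities.
\<close>

theorem twisted_derivation:
  fixes up um :: "'n \<times> 'n \<Rightarrow> 'z"
  defines "fp \<equiv> (\<lambda>(i, j, k, l). \<beta> (d (p (i, j))) (del_p (k, l)) + lz (p (i, j)) (up (k, l)))"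
    and "fm \<equiv> (\<lambda>(i, j, k, l). \<beta> (d (p (i, j))) (delbar_p (k, l)) + lz (p (i, j)) (um (k, l)))"
  assumes A1: "\<And>I. on_legs scZ St fp I = scZ (1 / W) (fp I)" and A2: "contract12 scZ Ev' up = 0"
    and A3: "\<And>I. on_legs scZ S fm I = scZ W (fm I)" and A4: "contract12 scZ Ev' um = 0"
    and B1: "\<And>i j k l. rz (up (i, j)) (p (k, l)) - \<beta> (del_p (i, j)) (d (p (k, l))) = scZ (Q^2) (on_legs scZ T fp (i, j, k, l))"
    and B2: "\<And>i j k l. rz (um (i, j)) (p (k, l)) - \<beta> (delbar_p (i, j)) (d (p (k, l))) = scZ (1 / Q^2) (on_legs scZ T fm (i, j, k, l))"
  obtains \<phi> where "Modules.additive \<phi>" "\<And>b x. \<phi> (lact b x) = \<beta> (d b) x + lz b (\<phi> x)"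
    "\<And>b x. \<phi> (ract x b) = rz (\<phi> x) b - \<beta> x (d b)" "\<And>I. \<phi> (del_p I) = up I" "\<And>I. \<phi> (delbar_p I) = um I"
proof -
  note zl = bimoduleD(1)[OF Z] and zr = bimoduleD(2)[OF Z]
  note lz_add = additiveD[OF left_moduleD(1)[OF zl]] and lz_add' = additiveD[OF left_moduleD(2)[OF zl]] and lz_mult = left_moduleD(4)[OF zl]
  note rz_add = additiveD[OF right_moduleD(1)[OF zr]] and rz_add' = additiveD[OF right_moduleD(2)[OF zr]] and rz_mult = right_moduleD(4)[OF zr]
  note \<beta>1 = additiveD[OF \<beta>_add(1)] and \<beta>2 = additiveD[OF \<beta>_add(2)]
  have d0: "d 0 = 0" using dD(3)[of 0] complex_algebraD(5)[OF \<eta>_algebra] by simp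
  have d1: "d 1 = 0" using dD(3)[of 1] complex_algebraD(1)[OF \<eta>_algebra] by simp
  obtain \<phi>p where \<phi>p: "\<And>c :: 'b^('n \<times> 'n). \<phi>p (\<Sum>x\<in>UNIV. lact (c $ x) (del_p x)) = (\<Sum>x\<in>UNIV. \<beta> (d (c $ x)) (del_p x) + lz (c $ x) (up x))"
    using half_twisted_derivation[OF Omega_plus_presented A1[unfolded fp_def, folded qpow_values] A2] by blast
  obtain \<phi>m where \<phi>m: "\<And>c :: 'b^('n \<times> 'n). \<phi>m (\<Sum>x\<in>UNIV. lact (c $ x) (delbar_p x)) = (\<Sum>x\<in>UNIV. \<beta> (d (c $ x)) (delbar_p x) + lz (c $ x) (um x))"
    using half_twisted_derivation[OF Omega_minus_presented A3[unfolded fm_def, folded qpow_values] A4] by blast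
  have half: "(\<forall>x\<in>Omega_part lact p \<delta>. \<forall>y\<in>Omega_part lact p \<delta>. \<psi> (x + y) = \<psi> x + \<psi> y)
      \<and> (\<forall>x\<in>Omega_part lact p \<delta>. \<forall>b. \<psi> (lact b x) = \<beta> (d b) x + lz b (\<psi> x)) \<and> (\<forall>I. \<psi> (\<delta> (p I)) = u I) \<and> \<psi> 0 = 0"
    if \<psi>: "\<And>c :: 'b^('n \<times> 'n). \<psi> (\<Sum>x\<in>UNIV. lact (c $ x) (\<delta> (p x))) = (\<Sum>x\<in>UNIV. \<beta> (d (c $ x)) (\<delta> (p x)) + lz (c $ x) (u x))" for \<psi> \<delta> u
  proof (intro conjI ballI allI)
    fix x y assume "x \<in> Omega_part lact p \<delta>" "y \<in> Omega_part lact p \<delta>"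
    then obtain c c' :: "'b^('n \<times> 'n)" where xy: "x = (\<Sum>I\<in>UNIV. lact (c $ I) (\<delta> (p I)))" "y = (\<Sum>I\<in>UNIV. lact (c' $ I) (\<delta> (p I)))"
      using Omega_part_expansion by meson
    have "x + y = (\<Sum>I\<in>UNIV. lact ((c + c') $ I) (\<delta> (p I)))" by (simp add: xy lact_add' sum.distrib)
    then show "\<psi> (x + y) = \<psi> x + \<psi> y"
      by (simp only: \<psi> xy) (simp add: dD(1) \<beta>2 lz_add' sum.distrib algebra_simps)
  next
    fix x b assume "x \<in> Omega_part lact p \<delta>"
    then obtain c :: "'b^('n \<times> 'n)" where x: "x = (\<Sum>I\<in>UNIV. lact (c $ I) (\<delta> (p I)))" using Omega_part_expansion by meson
    have "lact b x = (\<Sum>I\<in>UNIV. lact ((b *s c) $ I) (\<delta> (p I)))" by (simp add: x lact_add lact_mult)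
    then have "\<psi> (lact b x) = (\<Sum>I\<in>UNIV. \<beta> (d ((b *s c) $ I)) (\<delta> (p I)) + lz ((b *s c) $ I) (u I))" by (simp only: \<psi>)
    also have "\<dots> = \<beta> (d b) x + lz b (\<psi> x)"
      unfolding x \<psi> by (simp add: dD(2) \<beta>1 \<beta>2 \<beta>_bal \<beta>_lact lz_add lz_mult sum.distrib add.assoc)
    finally show "\<psi> (lact b x) = \<beta> (d b) x + lz b (\<psi> x)" .
  next
    fix J
    have "\<delta> (p J) = (\<Sum>x\<in>UNIV. if x = J then \<delta> (p x) else 0)" by simp
    also have "\<dots> = (\<Sum>x\<in>UNIV. lact (axis J 1 $ x) (\<delta> (p x)))"
      unfolding axis_def vec_lambda_beta by (intro sum.cong refl) (auto simp: lact_add' left_moduleD(3)[OF Omega_left])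
    finally have "\<psi> (\<delta> (p J)) = (\<Sum>x\<in>UNIV. \<beta> (d (axis J 1 $ x)) (\<delta> (p x)) + lz (axis J 1 $ x) (u x))" by (simp only: \<psi>)
    also have "\<dots> = (\<Sum>x\<in>UNIV. if x = J then u x else 0)"
      unfolding axis_def vec_lambda_beta by (intro sum.cong refl) (simp add: d0 d1 \<beta>2 lz_add' left_moduleD(3)[OF zl])
    finally show "\<psi> (\<delta> (p J)) = u J" by simp
  next
    have "\<psi> (\<Sum>x\<in>UNIV. lact ((0 :: 'b^('n \<times> 'n)) $ x) (\<delta> (p x))) = 0"
      unfolding \<psi> by (simp add: d0 \<beta>2 lz_add')
    then show "\<psi> 0 = 0" by (simp add: lact_add')
  qed
  note hp = half[OF \<phi>p] and hm = half[OF \<phi>m]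
  define \<phi> where "\<phi> x = \<phi>p (proj_plus x) + \<phi>m (proj_minus x)" for x
  have add: "\<phi> (x + y) = \<phi> x + \<phi> y" for x y
    using hp hm split(1,2) unfolding \<phi>_def proj_add by (simp add: algebra_simps)
  have \<phi>_add: "Modules.additive \<phi>" using add by (simp add: Modules.additive_def)
  note \<phi>D = additiveD[OF \<phi>_add]
  have lact: "\<phi> (lact b x) = \<beta> (d b) x + lz b (\<phi> x)" for b x
  proof -
    have "\<phi> (lact b x) = (\<beta> (d b) (proj_plus x) + \<beta> (d b) (proj_minus x)) + lz b (\<phi> x)"
      using hp hm split(1,2) unfolding \<phi>_def proj_lact by (simp add: lz_add algebra_simps)
    then show ?thesis by (simp only: \<beta>1[symmetric] split(3)[symmetric])
  qed
  have dp: "\<phi> (del_p I) = up I" for I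
    using hp[THEN conjunct2, THEN conjunct2, THEN conjunct1, THEN spec, of I] hm[THEN conjunct2, THEN conjunct2, THEN conjunct2]
    unfolding \<phi>_def proj_parts(1)[OF Omega_part_closed(4)] proj_parts(2)[OF Omega_part_closed(4)] by (simp only: add_0_right)
  have dbp: "\<phi> (delbar_p I) = um I" for I
    using hm[THEN conjunct2, THEN conjunct2, THEN conjunct1, THEN spec, of I] hp[THEN conjunct2, THEN conjunct2, THEN conjunct2]
    unfolding \<phi>_def proj_parts(3)[OF Omega_part_closed(4)] proj_parts(4)[OF Omega_part_closed(4)] by (simp only: add_0_left)
  have scale: "\<phi> (scO c x) = scZ c (\<phi> x)" for c x
    unfolding scl_def lact dD(3) by (simp add: \<beta>2)
  have legs: "\<phi> (on_legs scO K X J) = on_legs scZ K (\<lambda>I. \<phi> (X I)) J" for K X and J :: "'n \<times> 'n \<times> 'n \<times> 'n"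
    unfolding on_legs_def \<phi>D scale ..
  have pd: "(\<lambda>I. \<phi> (pd I)) = fp" and pdb: "(\<lambda>I. \<phi> (pdb I)) = fm"
    by (auto simp: fp_def fm_def fam_prod_def lact dp dbp)
  have ract: "\<forall>x. \<phi> (ract x b) = rz (\<phi> x) b - \<beta> x (d b)" for b
  proof (induction b rule: generator_induct)
    case (1 c)
    show ?case
      unfolding bimoduleD(4)[OF Omega_bimodule, symmetric] bimoduleD(4)[OF Z, symmetric] lact dD(3) by (simp add: \<beta>1 \<beta>2)
  next
    case (2 I)
    obtain k l where I: "I = (k, l)" by (cases I)
    have step: "\<phi> (ract (lact b x) (p I)) = rz (\<phi> (lact b x)) (p I) - \<beta> (lact b x) (d (p I))"
      if "\<phi> (ract x (p I)) = rz (\<phi> x) (p I) - \<beta> x (d (p I))" for b x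
    proof -
      have "\<phi> (ract (lact b x) (p I)) = \<beta> (d b) (ract x (p I)) + lz b (rz (\<phi> x) (p I) - \<beta> x (d (p I)))"
        unfolding lact_ract[symmetric] lact that ..
      then show ?thesis unfolding lact \<beta>_ract \<beta>_lact rz_add lz_add bimoduleD(3)[OF Z] by simp
    qed
    have gp: "\<phi> (ract (del_p J) (p I)) = rz (\<phi> (del_p J)) (p I) - \<beta> (del_p J) (d (p I))" for J
    proof -
      obtain i j where J: "J = (i, j)" by (cases J)
      have "ract (del_p J) (p I) = scO (Q^2) (on_legs scO T pd (i, j, k, l))"
        using Omega_plus_right[of "(i, j, k, l)"] unfolding qpow_values I J by (simp only: fam_prod_def prod.case)
      then show ?thesis unfolding dp I J B1 by (simp only: scale legs pd)
    qed
    have gm: "\<phi> (ract (delbar_p J) (p I)) = rz (\<phi> (delbar_p J)) (p I) - \<beta> (delbar_p J) (d (p I))" for J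
    proof -
      obtain i j where J: "J = (i, j)" by (cases J)
      have "ract (delbar_p J) (p I) = scO (1 / Q^2) (on_legs scO T pdb (i, j, k, l))"
        using Omega_minus_right[of "(i, j, k, l)"] unfolding qpow_values I J by (simp only: fam_prod_def prod.case)
      then show ?thesis unfolding dbp I J B2 by (simp only: scale legs pdb)
    qed
    show ?case
    proof
      fix x
      show "\<phi> (ract x (p I)) = rz (\<phi> x) (p I) - \<beta> x (d (p I))"
        by (induction x rule: Omega_induct) (simp_all add: step gp gm ract_add \<phi>D rz_add \<beta>2)
    qed
  next
    case (3 b c)
    then show ?case by (simp add: ract_add' \<phi>D rz_add' dD(1) \<beta>1)
  next
    case (4 b c)
    then show ?case by (simp add: ract_mult rz_mult rz_add dD(2) \<beta>1 \<beta>_bal \<beta>_ract)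
  qed
  show thesis by (rule that[of \<phi>]) (use \<phi>_add lact ract dp dbp in blast)+
qed

end

end

section \<open>Functionals vanishing on the relations of two-forms\<close>

context universal_two_forms
begin

text \<open>
  Since \<phi> kills every \<open>d b\<close>, the left rule gives \<open>\<phi> (\<Sum> b dc) = \<Sum> \<beta> (db, dc)\<close>. So the pairing vanishes on the
  generators of the relations; it is a bimodule map, and thus vanishes on all of them.
\<close>

theorem pairing_vanishes_on_relations:
  fixes lz :: "'b \<Rightarrow> 'z \<Rightarrow> 'z::ab_group_add" and rz :: "'z \<Rightarrow> 'b \<Rightarrow> 'z" and \<beta> :: "'o \<Rightarrow> 'o \<Rightarrow> 'z"
  assumes Z: "bimodule \<eta> lz rz"
    and \<beta>_add: "\<And>x. Modules.additive (\<beta> x)" "\<And>y. Modules.additive (\<lambda>x. \<beta> x y)"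
    and \<beta>_lact: "\<And>b x y. \<beta> (lact b x) y = lz b (\<beta> x y)"
    and \<beta>_ract: "\<And>b x y. \<beta> x (ract y b) = rz (\<beta> x y) b"
    and \<beta>_bal: "\<And>b x y. \<beta> (ract x b) y = \<beta> x (lact b y)"
    and \<phi>_add: "Modules.additive \<phi>" and \<phi>_lact: "\<And>b x. \<phi> (lact b x) = \<beta> (d b) x + lz b (\<phi> x)"
    and \<phi>_ract: "\<And>b x. \<phi> (ract x b) = rz (\<phi> x) b - \<beta> x (d b)"
    and \<phi>_d: "\<And>I. \<phi> (d (p I)) = 0"
  obtains h where "Modules.additive h" "\<And>x y. h (tens x y) = \<beta> x y" "\<And>t. wedge t = 0 \<Longrightarrow> h t = 0"
proof -
  note zl = bimoduleD(1)[OF Z] and zr = bimoduleD(2)[OF Z]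
  note lz_add = additiveD[OF left_moduleD(1)[OF zl]] and rz_add = additiveD[OF right_moduleD(1)[OF zr]]
  note \<phi>D = additiveD[OF \<phi>_add]
  obtain h where h: "Modules.additive h" "\<And>x y. h (tens x y) = \<beta> x y"
    by (rule tensor_lift[OF tensor_square zl, of \<beta>]) (simp_all add: \<beta>_add \<beta>_bal)
  note hD = additiveD[OF h(1)]
  have lact: "h (lactT b t) = lz b (h t)" for b t
    by (induction t rule: tensor_induct[OF tensor_square]) (simp_all add: lactT_add lactT_tens h(2) \<beta>_lact hD lz_add)
  have ract: "h (ractT t b) = rz (h t) b" for b t
    by (induction t rule: tensor_induct[OF tensor_square]) (simp_all add: ractT_add ractT_tens h(2) \<beta>_ract hD rz_add)
  have \<phi>_db: "\<phi> (d b) = 0" for b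
  proof (induction b rule: generator_induct)
    case (4 b c)
    then show ?case by (simp add: dD(2) \<phi>D \<phi>_ract \<phi>_lact rz_add lz_add)
  qed (simp_all add: dD \<phi>D \<phi>_d)
  have list: "\<phi> (\<Sum>(b, c)\<leftarrow>xs. lact b (d c)) = h (\<Sum>(b, c)\<leftarrow>xs. tens (d b) (d c))" for xs
    by (induction xs) (auto simp: \<phi>D hD h(2) \<phi>_lact \<phi>_db lz_add)
  have "h t = 0" if "wedge t = 0" for t
  proof -
    have "t \<in> sub_bimodule_gen lactT ractT {\<Sum>(x, y)\<leftarrow>xs. tens (d x) (d y) | xs. (\<Sum>(x, y)\<leftarrow>xs. lact x (d y)) = 0}"
      using that unfolding wedge_kernel .
    then show ?thesis
    proof induction
      case (gen t)
      then obtain xs where "t = (\<Sum>(x, y)\<leftarrow>xs. tens (d x) (d y))" "(\<Sum>(x, y)\<leftarrow>xs. lact x (d y)) = 0" by blast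
      then show ?case using list[of xs] by (simp add: \<phi>D)
    qed (simp_all add: hD lact ract lz_add rz_add)
  qed
  then show thesis using that h by blast
qed

end

context universal_two_forms
begin

text \<open>
  With opposite values \<open>u\<close> and \<open>- u\<close> on the generators of the two types, \<phi> kills \<open>d p\<close> and therefore every \<open>d b\<close>.
\<close>

theorem pairing_from_generators:
  fixes lz :: "'b \<Rightarrow> 'z \<Rightarrow> 'z::ab_group_add" and rz :: "'z \<Rightarrow> 'b \<Rightarrow> 'z" and \<beta> :: "'o \<Rightarrow> 'o \<Rightarrow> 'z" and u :: "'n \<times> 'n \<Rightarrow> 'z"
  defines "fp \<equiv> (\<lambda>(i, j, k, l). \<beta> (d (p (i, j))) (del_p (k, l)) + lz (p (i, j)) (u (k, l)))"
    and "fm \<equiv> (\<lambda>(i, j, k, l). \<beta> (d (p (i, j))) (delbar_p (k, l)) - lz (p (i, j)) (u (k, l)))"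
  assumes Z: "bimodule \<eta> lz rz"
    and \<beta>_add: "\<And>x. Modules.additive (\<beta> x)" "\<And>y. Modules.additive (\<lambda>x. \<beta> x y)"
    and \<beta>_lact: "\<And>b x y. \<beta> (lact b x) y = lz b (\<beta> x y)"
    and \<beta>_ract: "\<And>b x y. \<beta> x (ract y b) = rz (\<beta> x y) b"
    and \<beta>_bal: "\<And>b x y. \<beta> (ract x b) y = \<beta> x (lact b y)"
    and A1: "\<And>I. on_legs (scl \<eta> lz) St fp I = scl \<eta> lz (1 / W) (fp I)"
    and A2: "contract12 (scl \<eta> lz) Ev' u = 0"
    and A3: "\<And>I. on_legs (scl \<eta> lz) S fm I = scl \<eta> lz W (fm I)"
    and B1: "\<And>i j k l. rz (u (i, j)) (p (k, l)) - \<beta> (del_p (i, j)) (d (p (k, l))) = scl \<eta> lz (Q^2) (on_legs (scl \<eta> lz) T fp (i, j, k, l))"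
    and B2: "\<And>i j k l. - rz (u (i, j)) (p (k, l)) - \<beta> (delbar_p (i, j)) (d (p (k, l))) = scl \<eta> lz (1 / Q^2) (on_legs (scl \<eta> lz) T fm (i, j, k, l))"
  obtains h where "Modules.additive h" "\<And>x y. h (tens x y) = \<beta> x y" "\<And>t. wedge t = 0 \<Longrightarrow> h t = 0"
proof -
  note zl = bimoduleD(1)[OF Z] and zr = bimoduleD(2)[OF Z]
  note lz_add = additiveD[OF left_moduleD(1)[OF zl]] and rz_add = additiveD[OF right_moduleD(1)[OF zr]]
  let ?um = "\<lambda>I. - u I"
  have fm: "fm = (\<lambda>(i, j, k, l). \<beta> (d (p (i, j))) (delbar_p (k, l)) + lz (p (i, j)) (?um (k, l)))"
    by (auto simp: fm_def lz_add)
  have A4: "contract12 (scl \<eta> lz) Ev' ?um = 0"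
    using A2 unfolding contract12_def scl_def lz_add sum_negf by simp
  obtain \<phi> where \<phi>: "Modules.additive \<phi>" "\<And>b x. \<phi> (lact b x) = \<beta> (d b) x + lz b (\<phi> x)"
    "\<And>b x. \<phi> (ract x b) = rz (\<phi> x) b - \<beta> x (d b)" "\<And>I. \<phi> (del_p I) = u I" "\<And>I. \<phi> (delbar_p I) = - u I"
  proof (rule twisted_derivation[of lz rz \<beta> u ?um])
    show "bimodule \<eta> lz rz" by (rule Z)
    show "Modules.additive (\<beta> x)" for x by (rule \<beta>_add)
    show "Modules.additive (\<lambda>x. \<beta> x y)" for y by (rule \<beta>_add)
    show "\<beta> (lact b x) y = lz b (\<beta> x y)" for b x y by (rule \<beta>_lact)
    show "\<beta> x (ract y b) = rz (\<beta> x y) b" for b x y by (rule \<beta>_ract)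
    show "\<beta> (ract x b) y = \<beta> x (lact b y)" for b x y by (rule \<beta>_bal)
  qed (use A1 A2 A3 A4 B1 B2 in \<open>simp_all only: fm fp_def rz_add\<close>)
  show thesis
  proof (rule pairing_vanishes_on_relations[OF Z, of \<beta> \<phi>])
    show "Modules.additive (\<beta> x)" for x by (rule \<beta>_add)
    show "Modules.additive (\<lambda>x. \<beta> x v)" for v by (rule \<beta>_add)
    show "\<beta> (lact b x) v = lz b (\<beta> x v)" for b x v by (rule \<beta>_lact)
    show "\<beta> x (ract v b) = rz (\<beta> x v) b" for b x v by (rule \<beta>_ract)
    show "\<beta> (ract x b) v = \<beta> x (lact b v)" for b x v by (rule \<beta>_bal)
    show "Modules.additive \<phi>" by (rule \<phi>(1))
    show "\<phi> (lact b x) = \<beta> (d b) x + lz b (\<phi> x)" for b x by (rule \<phi>(2))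
    show "\<phi> (ract x b) = rz (\<phi> x) b - \<beta> x (d b)" for b x by (rule \<phi>(3))
    show "\<phi> (d (p I)) = 0" for I unfolding d_def additiveD(1)[OF \<phi>(1)] \<phi>(4,5) by simp
  qed (rule that)
qed

end

section \<open>The generalized braiding\<close>

context universal_two_forms
begin

lemma pgp_add: "pgp (g + g') I = pgp g I + pgp g' I"
  and pgp_scale: "pgp (scT c g) I = scT c (pgp g I)"
  by (cases I; simp add: pgp_def fam_prod_def lactT_add ractT_add lactT_scale ractT_scale)+

lemma wedge_pgp: "wedge g = 0 \<Longrightarrow> wedge (pgp g I) = 0"
  by (cases I) (simp add: pgp_def fam_prod_def wedge_lactT wedge_ractT)

lemma tensor_part_add: "t \<in> tensor_part tens M N \<Longrightarrow> u \<in> tensor_part tens M N \<Longrightarrow> t + u \<in> tensor_part tens M N"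
  unfolding tensor_part_def by (rule subgroup_gen.add)

lemma tensor_part_zero: "0 \<in> tensor_part tens M N"
  unfolding tensor_part_def by (rule subgroup_gen.zero)

lemma tensor_part_tens: "u \<in> M \<Longrightarrow> v \<in> N \<Longrightarrow> tens u v \<in> tensor_part tens M N"
  unfolding tensor_part_def by (rule subgroup_gen.gen) blast

lemma tensor_part_sum: "(\<And>i. i \<in> I \<Longrightarrow> f i \<in> tensor_part tens M N) \<Longrightarrow> sum f I \<in> tensor_part tens M N"
  by (induction I rule: infinite_finite_induct) (simp_all add: tensor_part_add tensor_part_zero)

lemma tensor_part_lact:
  assumes M: "\<And>b x. x \<in> M \<Longrightarrow> lact b x \<in> M" and "t \<in> tensor_part tens M N"
  shows "lactT b t \<in> tensor_part tens M N"
  using assms(2) unfolding tensor_part_def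
proof induction
  case (gen t)
  then obtain x y where "t = tens x y" "x \<in> M" "y \<in> N" by blast
  then show ?case unfolding tensor_part_def[symmetric] by (simp add: lactT_tens tensor_part_tens M)
qed (simp_all add: lactT_add subgroup_gen.intros)

lemma tensor_part_ract:
  assumes N: "\<And>b y. y \<in> N \<Longrightarrow> ract y b \<in> N" and "t \<in> tensor_part tens M N"
  shows "ractT t b \<in> tensor_part tens M N"
  using assms(2) unfolding tensor_part_def
proof induction
  case (gen t)
  then obtain x y where "t = tens x y" "x \<in> M" "y \<in> N" by blast
  then show ?case unfolding tensor_part_def[symmetric] by (simp add: ractT_tens tensor_part_tens N)
qed (simp_all add: ractT_add subgroup_gen.intros)

lemma tensor_part_scale: "(\<And>b x. x \<in> M \<Longrightarrow> lact b x \<in> M) \<Longrightarrow> t \<in> tensor_part tens M N \<Longrightarrow> scT c t \<in> tensor_part tens M N"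
  unfolding scl_def by (rule tensor_part_lact)

lemma tensor_part_on_legs:
  "(\<And>b x. x \<in> M \<Longrightarrow> lact b x \<in> M) \<Longrightarrow> (\<And>J. X J \<in> tensor_part tens M N) \<Longrightarrow> on_legs scT K X I \<in> tensor_part tens M N"
  unfolding on_legs_def by (intro tensor_part_sum tensor_part_scale)

lemma tensor_map:
  assumes f: "Modules.additive f" "\<And>b x. f (lact b x) = lact b (f x)" "\<And>b x. f (ract x b) = ract (f x) b"
    and g: "Modules.additive g" "\<And>b x. g (lact b x) = lact b (g x)"
  obtains h where "Modules.additive h" "\<And>x y. h (tens x y) = tens (f x) (g y)"
proof (rule tensor_lift[OF tensor_square T_left, of "\<lambda>x y. tens (f x) (g y)"])
  show "Modules.additive (\<lambda>y. tens (f x) (g y))" for x by (simp add: Modules.additive_def tens_add additiveD[OF g(1)])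
  show "Modules.additive (\<lambda>x. tens (f x) (g y))" for y by (simp add: Modules.additive_def tens_add' additiveD[OF f(1)])
  show "tens (f (ract x b)) (g y) = tens (f x) (g (lact b y))" for x b y by (simp add: f g tens_bal)
qed (use that in blast)

text \<open>
  The tensor product of the projections to the two types is the identity on one summand and zero on the other.
\<close>

lemma mixed_parts_disjoint:
  assumes "t + u = 0" "t \<in> tensor_part tens Op Om" "u \<in> tensor_part tens Om Op"
  shows "t = 0"
proof -
  obtain h where h: "Modules.additive h" "\<And>x y. h (tens x y) = tens (proj_plus x) (proj_minus y)"
    using tensor_map[of proj_plus proj_minus] proj_additive proj_lact proj_ract by metis
  have "h t = t" using assms(2) unfolding tensor_part_def
    by induction (auto simp: additiveD[OF h(1)] h(2) proj_parts)
  moreover have "h u = 0" using assms(3) unfolding tensor_part_def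
    by induction (auto simp: additiveD[OF h(1)] h(2) proj_parts tens_add)
  ultimately have "t = h (t + u)" by (simp add: additiveD[OF h(1)])
  then show ?thesis by (simp add: assms(1) additiveD[OF h(1)])
qed

end

context generalized_braiding
begin

lemmas \<sigma>_add = additiveD[OF sigma_additive]

lemma \<sigma>_scale: "\<sigma> (scT c t) = scT c (\<sigma> t)"
  unfolding scl_def by (rule sigma_left)

lemma \<sigma>_on_legs: "\<sigma> (on_legs scT K X I) = on_legs scT K (\<lambda>J. \<sigma> (X J)) I"
  unfolding on_legs_def \<sigma>_add \<sigma>_scale ..

lemma \<sigma>_DD: "\<sigma> (DD I) = scT (Q^2 / W) (on_legs scT S DD I)"
proof -
  interpret complex_space scT by (rule csT)
  show ?thesis
    unfolding sigma_pp T_def[symmetric] on_legs_T[OF csT] DD_St[abs_def] on_legs_scale qpow_values by simp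
qed

lemma \<sigma>_BB: "\<sigma> (BB I) = scT (W / Q^2) (on_legs scT St BB I)"
proof -
  interpret complex_space scT by (rule csT)
  show ?thesis
    unfolding sigma_mm T_def[symmetric] on_legs_T[OF csT] on_legs_commute(1)[OF csT, symmetric] BB_S[abs_def] on_legs_scale qpow_values by simp
qed

lemma \<sigma>_BD: "\<sigma> (BD I) = scT (W^2 / Q^4) (on_legs scT Si (on_legs scT St DB) I) + scT (1 - 1 / Q^2) (pgp (trace scT A) I)"
proof -
  interpret complex_space scT by (rule csT)
  show ?thesis
    unfolding sigma_mp matrix_inv_S on_legs_mult[symmetric] g_pm_A pgp_scale qpow_values using Q_nz by simp
qed

lemma \<sigma>_DB: "\<sigma> (DB I) = scT (Q^4 / W^2) (on_legs scT S (on_legs scT Sti BD) I) + scT ((1 - Q^2) * Q^2) (GP I)"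
proof -
  interpret complex_space scT by (rule csT)
  show ?thesis
    unfolding sigma_pm matrix_inv_S on_legs_mult[symmetric] g_mp_\<gamma> pgp_scale GP_\<gamma> qpow_values using Q_nz by simp
qed

text \<open>
  On \<open>DD\<close>, \<sigma> is a multiple of \<open>S\<close>, and the Hecke relation gives the eigenvalues -1 and \<open>Q^2\<close>.
\<close>

lemma \<sigma>_quadratic_DD: "\<sigma> (\<sigma> (DD I)) = scT (Q^2 - 1) (\<sigma> (DD I)) + scT (Q^2) (DD I)"
proof -
  interpret complex_space scT by (rule csT)
  let ?v = "on_legs scT S DD"
  have s: "on_legs scT S ?v I = scT D (?v I) + scT E (DD I)"
    using on_legs_Hecke(1)[OF csT, of ?v I] unfolding on_legs_inverse[OF csT] .
  have c1: "(Q^2 / W) * (Q^2 / W) * D = (Q^2 - 1) * (Q^2 / W)" and c2: "(Q^2 / W) * (Q^2 / W) * E = Q^2"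
    using Q_nz W_nz by (simp_all add: D_def E_def field_simps power2_eq_square)
  have "\<sigma> (\<sigma> (DD I)) = scT ((Q^2 / W) * (Q^2 / W)) (on_legs scT S ?v I)"
    unfolding \<sigma>_DD \<sigma>_scale \<sigma>_on_legs \<sigma>_DD[abs_def] on_legs_scale scale_scale ..
  also have "\<dots> = scT ((Q^2 - 1) * (Q^2 / W)) (?v I) + scT (Q^2) (DD I)"
    unfolding s scale_right_distrib scale_scale c1 c2 ..
  finally show ?thesis unfolding \<sigma>_DD scale_scale .
qed

lemma \<sigma>_quadratic_BB: "\<sigma> (\<sigma> (BB I)) = scT (1 / Q^2 - 1) (\<sigma> (BB I)) + scT (1 / Q^2) (BB I)"
proof -
  interpret complex_space scT by (rule csT)
  let ?v = "on_legs scT St BB"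
  have "BB I = scT D (?v I) + scT E (on_legs scT St ?v I)"
    using on_legs_Hecke(2)[OF csT, of ?v I] unfolding on_legs_inverse[OF csT] .
  then have "scT E (on_legs scT St ?v I) = BB I - scT D (?v I)" by simp
  then have "scT (1 / E) (scT E (on_legs scT St ?v I)) = scT (1 / E) (BB I - scT D (?v I))" by simp
  then have s: "on_legs scT St ?v I = scT (1 / E) (BB I) - scT (D / E) (?v I)"
    using E_nz by (simp add: scale_right_diff_distrib)
  have c1: "(W / Q^2) * (W / Q^2) * (D / E) = - ((1 / Q^2 - 1) * (W / Q^2))" and c2: "(W / Q^2) * (W / Q^2) * (1 / E) = 1 / Q^2"
    using Q_nz W_nz by (simp_all add: D_def E_def field_simps power2_eq_square)
  have "\<sigma> (\<sigma> (BB I)) = scT ((W / Q^2) * (W / Q^2)) (on_legs scT St ?v I)"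
    unfolding \<sigma>_BB \<sigma>_scale \<sigma>_on_legs \<sigma>_BB[abs_def] on_legs_scale scale_scale ..
  also have "\<dots> = scT ((1 / Q^2 - 1) * (W / Q^2)) (?v I) + scT (1 / Q^2) (BB I)"
    unfolding s scale_right_diff_distrib scale_scale c1 c2 by simp
  finally show ?thesis unfolding \<sigma>_BB scale_scale .
qed

text \<open>
  The pure types are \<open>wedge_DD\<close> and \<open>wedge_BB\<close>. Type \<open>-+\<close> is \<open>y\<close> plus a multiple of \<open>p (trace A + \<gamma>) p\<close>, a relation by
  \<open>wedge_trace\<close>; type \<open>+-\<close> is a multiple of \<open>S\<close> and the inverse of \<open>St\<close> applied to \<open>y\<close>.
\<close>

theorem wedge_sigma:
  "wedge (DD I + \<sigma> (DD I)) = 0" "wedge (BB I + \<sigma> (BB I)) = 0"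
  "wedge (BD I + \<sigma> (BD I)) = 0" "wedge (DB I + \<sigma> (DB I)) = 0"
proof -
  interpret complex_space scT by (rule csT)
  show "wedge (DD I + \<sigma> (DD I)) = 0"
    using wedge_DD[of I] unfolding sigma_pp T_def[symmetric] qpow_values .
  show "wedge (BB I + \<sigma> (BB I)) = 0"
    using wedge_BB[of I] unfolding sigma_mm T_def[symmetric] qpow_values .
  have "BD I + \<sigma> (BD I) = y I + scT (1 - 1 / Q^2) (pgp (trace scT A + \<gamma>) I)"
  proof -
    have e: "scT (1 / Q^2 - 1) (pgp \<gamma> I) = - scT (1 - 1 / Q^2) (pgp \<gamma> I)"
      unfolding scale_minus_left[symmetric] by simp
    show ?thesis unfolding \<sigma>_BD y_def GP_\<gamma> pgp_add scale_right_distrib e by simp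
  qed
  then show "wedge (BD I + \<sigma> (BD I)) = 0"
    by (simp add: wedge_add wedge_y wedge_scT[OF wedge_pgp[OF wedge_trace]])
  have sti: "on_legs scT Sti GP J = scT W (GP J)" for J
  proof -
    have "scT W (GP J) = scT W (on_legs scT Sti (on_legs scT St GP) J)" unfolding on_legs_inverse[OF csT] ..
    also have "\<dots> = on_legs scT Sti GP J" unfolding GP_St[abs_def] on_legs_scale using W_nz by simp
    finally show ?thesis ..
  qed
  have gp: "on_legs scT S (on_legs scT Sti GP) I = scT (W * W) (GP I)"
    unfolding sti[abs_def] on_legs_scale GP_S by simp
  have db: "on_legs scT S (on_legs scT Sti (on_legs scT Si (on_legs scT St DB))) I = DB I"
    unfolding on_legs_commute(3)[OF csT, symmetric] on_legs_inverse[OF csT, abs_def] ..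
  have c: "(Q^4 / W^2) * (W^2 / Q^4) = 1" "(Q^4 / W^2) * ((1 / Q^2 - 1) * (W * W)) = (1 - Q^2) * Q^2"
    using Q_nz W_nz by (simp_all add: field_simps power2_eq_square power4_eq_xxxx)
  have "DB I + \<sigma> (DB I) = scT (Q^4 / W^2) (on_legs scT S (on_legs scT Sti y) I)"
    unfolding \<sigma>_DB y_def[abs_def] on_legs_add on_legs_scale scale_right_distrib gp db scale_scale c by simp
  then show "wedge (DB I + \<sigma> (DB I)) = 0"
    by (simp add: wedge_scT[OF wedge_on_legs[OF wedge_on_legs[OF wedge_y]]])
qed

text \<open>
  The pairing is \<open>(\<sigma> - \<kappa>) (\<pi> x \<otimes> \<pi> y)\<close> with \<open>u = 0\<close>. The identities required of it say that on generators \<open>\<sigma> - \<kappa>\<close> commutes with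
  the relations of one-forms, and that it vanishes on \<open>t + \<sigma> t\<close>, which is the quadratic equation of \<sigma>.
\<close>

lemma sigma_eigen_on_relations:
  assumes \<pi>: "Modules.additive \<pi>" "\<And>b x. \<pi> (lact b x) = lact b (\<pi> x)" "\<And>b x. \<pi> (ract x b) = ract (\<pi> x) b"
    and gens: "(\<forall>I. \<pi> (dp I) = dp I \<and> \<pi> (dbp I) = 0 \<and> \<kappa> = Q^2) \<or> (\<forall>I. \<pi> (dp I) = 0 \<and> \<pi> (dbp I) = dbp I \<and> \<kappa> = 1 / Q^2)"
    and id: "\<And>x. x \<in> M \<Longrightarrow> \<pi> x = x" and t: "t \<in> tensor_part tens M M" "wedge t = 0"
  shows "\<sigma> t = scT \<kappa> t"
proof -
  interpret complex_space scT by (rule csT)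
  define F where "F t = \<sigma> t - scT \<kappa> t" for t
  have F: "Modules.additive F" "\<And>b t. F (lactT b t) = lactT b (F t)" "\<And>b t. F (ractT t b) = ractT (F t) b"
    "\<And>c t. F (scT c t) = scT c (F t)"
    by (simp_all add: F_def Modules.additive_def \<sigma>_add scale_right_distrib scale_right_diff_distrib sigma_left sigma_right
        lactT_add ractT_add lactT_scale ractT_scale \<sigma>_scale mult.commute)
  note FD = additiveD[OF F(1)] and \<pi>D = additiveD[OF \<pi>(1)]
  have legs: "on_legs scT K (\<lambda>J. F (X J)) I = F (on_legs scT K X I)" for K X I
    unfolding on_legs_def FD F(4) ..
  have F_pm: "F (X I + \<sigma> (X I)) = 0" if "\<And>J. \<sigma> (\<sigma> (X J)) = scT (\<kappa> - 1) (\<sigma> (X J)) + scT \<kappa> (X J)" for X and I :: "'n \<times> 'n \<times> 'n \<times> 'n"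
    unfolding F_def \<sigma>_add that by (simp add: scale_right_distrib scale_left_diff_distrib)
  let ?\<beta> = "\<lambda>x y. F (tens (\<pi> x) (\<pi> y))"
  obtain h where h: "Modules.additive h" "\<And>x y. h (tens x y) = ?\<beta> x y" "\<And>t. wedge t = 0 \<Longrightarrow> h t = 0"
  proof (rule pairing_from_generators[of lactT ractT ?\<beta> "\<lambda>_. 0"])
    show "bimodule \<eta> lactT ractT" by (rule T_bimodule)
    show "Modules.additive (\<lambda>y. ?\<beta> x y)" "Modules.additive (\<lambda>x. ?\<beta> x y)" for x y
      by (simp_all add: Modules.additive_def \<pi>D FD tens_add tens_add')
    show "?\<beta> (lact b x) y = lactT b (?\<beta> x y)" "?\<beta> x (ract y b) = ractT (?\<beta> x y) b"
      "?\<beta> (ract x b) y = ?\<beta> x (lact b y)" for b x y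
      by (simp_all add: \<pi> F lactT_tens[symmetric] ractT_tens[symmetric] tens_bal)
    show "contract12 scT Ev' (\<lambda>_. 0) = 0" by (simp add: contract12_def)
    note z = lactT_add ractT_add
    have F0: "on_legs scT K (\<lambda>I. 0) I = 0" for K I by (simp add: on_legs_def)
    have "(\<forall>I. on_legs scT St (\<lambda>(i, j, k, l). ?\<beta> (d (p (i, j))) (del_p (k, l)) + lactT (p (i, j)) 0) I
        = scT (1 / W) ((\<lambda>(i, j, k, l). ?\<beta> (d (p (i, j))) (del_p (k, l)) + lactT (p (i, j)) 0) I))
      \<and> (\<forall>I. on_legs scT S (\<lambda>(i, j, k, l). ?\<beta> (d (p (i, j))) (delbar_p (k, l)) - lactT (p (i, j)) 0) I
        = scT W ((\<lambda>(i, j, k, l). ?\<beta> (d (p (i, j))) (delbar_p (k, l)) - lactT (p (i, j)) 0) I))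
      \<and> (\<forall>i j k l. ractT 0 (p (k, l)) - ?\<beta> (del_p (i, j)) (d (p (k, l)))
        = scT (Q^2) (on_legs scT T (\<lambda>(i, j, k, l). ?\<beta> (d (p (i, j))) (del_p (k, l)) + lactT (p (i, j)) 0) (i, j, k, l)))
      \<and> (\<forall>i j k l. - ractT 0 (p (k, l)) - ?\<beta> (delbar_p (i, j)) (d (p (k, l)))
        = scT (1 / Q^2) (on_legs scT T (\<lambda>(i, j, k, l). ?\<beta> (d (p (i, j))) (delbar_p (k, l)) - lactT (p (i, j)) 0) (i, j, k, l)))"
      (is "?g1 \<and> ?g2 \<and> ?g3 \<and> ?g4")
      using gens
    proof (elim disjE)
      assume g: "\<forall>I. \<pi> (dp I) = dp I \<and> \<pi> (dbp I) = 0 \<and> \<kappa> = Q^2"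
      then have g': "\<pi> (dp I) = dp I" "\<pi> (dbp I) = 0" "\<kappa> = Q^2" for I by blast+
      have e: "(\<lambda>(i, j, k, l). ?\<beta> (d (p (i, j))) (del_p (k, l)) + lactT (p (i, j)) 0) = (\<lambda>I. F (DD I))"
        "(\<lambda>(i, j, k, l). ?\<beta> (d (p (i, j))) (delbar_p (k, l)) - lactT (p (i, j)) 0) = (\<lambda>I. 0)"
        by (auto simp: d_def \<pi>D g' z tens_add FD fam_prod_def)
      have q: "F (DD I) + scT (Q^2) (F (on_legs scT T DD I)) = 0" for I
        using F_pm[of DD I] \<sigma>_quadratic_DD unfolding g'(3) sigma_pp T_def[symmetric] qpow_values FD F(4) by blast
      have "?g1" unfolding e legs DD_St F(4) by blast
      moreover have "?g2" unfolding e F0 by simp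
      moreover have "?g3"
      proof (intro allI)
        fix i j k l
        have "ractT 0 (p (k, l)) - ?\<beta> (del_p (i, j)) (d (p (k, l))) = - F (DD (i, j, k, l))"
          by (simp add: d_def \<pi>D g' z tens_add FD fam_prod_def)
        then show "ractT 0 (p (k, l)) - ?\<beta> (del_p (i, j)) (d (p (k, l))) = scT (Q^2) (on_legs scT T (\<lambda>(i, j, k, l). ?\<beta> (d (p (i, j))) (del_p (k, l)) + lactT (p (i, j)) 0) (i, j, k, l))"
          unfolding e legs using q[of "(i, j, k, l)"] by (simp only: minus_unique)
      qed
      moreover have "?g4" unfolding e F0 by (simp add: g' z tens_add' FD)
      ultimately show ?thesis by blast
    next
      assume g: "\<forall>I. \<pi> (dp I) = 0 \<and> \<pi> (dbp I) = dbp I \<and> \<kappa> = 1 / Q^2"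
      then have g': "\<pi> (dp I) = 0" "\<pi> (dbp I) = dbp I" "\<kappa> = 1 / Q^2" for I by blast+
      have e: "(\<lambda>(i, j, k, l). ?\<beta> (d (p (i, j))) (del_p (k, l)) + lactT (p (i, j)) 0) = (\<lambda>I. 0)"
        "(\<lambda>(i, j, k, l). ?\<beta> (d (p (i, j))) (delbar_p (k, l)) - lactT (p (i, j)) 0) = (\<lambda>I. F (BB I))"
        by (auto simp: d_def \<pi>D g' z tens_add FD fam_prod_def)
      have q: "F (BB I) + scT (1 / Q^2) (F (on_legs scT T BB I)) = 0" for I
        using F_pm[of BB I] \<sigma>_quadratic_BB unfolding g'(3) sigma_mm T_def[symmetric] qpow_values FD F(4) by blast
      have "?g1" unfolding e F0 by simp
      moreover have "?g2" unfolding e legs BB_S F(4) by blast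
      moreover have "?g3" unfolding e F0 by (simp add: g' z tens_add' FD)
      moreover have "?g4"
      proof (intro allI)
        fix i j k l
        have "- ractT 0 (p (k, l)) - ?\<beta> (delbar_p (i, j)) (d (p (k, l))) = - F (BB (i, j, k, l))"
          by (simp add: d_def \<pi>D g' z tens_add FD fam_prod_def)
        then show "- ractT 0 (p (k, l)) - ?\<beta> (delbar_p (i, j)) (d (p (k, l))) = scT (1 / Q^2) (on_legs scT T (\<lambda>(i, j, k, l). ?\<beta> (d (p (i, j))) (delbar_p (k, l)) - lactT (p (i, j)) 0) (i, j, k, l))"
          unfolding e legs using q[of "(i, j, k, l)"] by (simp only: minus_unique)
      qed
      ultimately show ?thesis by blast
    qed
    then show "on_legs scT St (\<lambda>(i, j, k, l). ?\<beta> (d (p (i, j))) (del_p (k, l)) + lactT (p (i, j)) 0) I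
        = scT (1 / W) ((\<lambda>(i, j, k, l). ?\<beta> (d (p (i, j))) (del_p (k, l)) + lactT (p (i, j)) 0) I)"
      "on_legs scT S (\<lambda>(i, j, k, l). ?\<beta> (d (p (i, j))) (delbar_p (k, l)) - lactT (p (i, j)) 0) I
        = scT W ((\<lambda>(i, j, k, l). ?\<beta> (d (p (i, j))) (delbar_p (k, l)) - lactT (p (i, j)) 0) I)"
      "ractT 0 (p (k, l)) - ?\<beta> (del_p (i, j)) (d (p (k, l)))
        = scT (Q^2) (on_legs scT T (\<lambda>(i, j, k, l). ?\<beta> (d (p (i, j))) (del_p (k, l)) + lactT (p (i, j)) 0) (i, j, k, l))"
      "- ractT 0 (p (k, l)) - ?\<beta> (delbar_p (i, j)) (d (p (k, l)))
        = scT (1 / Q^2) (on_legs scT T (\<lambda>(i, j, k, l). ?\<beta> (d (p (i, j))) (delbar_p (k, l)) - lactT (p (i, j)) 0) (i, j, k, l))"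
      for I i j k l by blast+
  qed (use that in blast)
  have "h t = F t" using t(1) unfolding tensor_part_def
    by induction (auto simp: additiveD[OF h(1)] FD h(2) id)
  then show ?thesis using h(3)[OF t(2)] by (simp add: F_def)
qed

theorem sigma_on_relations:
  "t \<in> tensor_part tens Op Op \<Longrightarrow> wedge t = 0 \<Longrightarrow> \<sigma> t = scT (Q^2) t"
  "t \<in> tensor_part tens Om Om \<Longrightarrow> wedge t = 0 \<Longrightarrow> \<sigma> t = scT (1 / Q^2) t"
proof -
  show "\<sigma> t = scT (Q^2) t" if "t \<in> tensor_part tens Op Op" "wedge t = 0"
    by (rule sigma_eigen_on_relations[OF proj_additive(1) proj_lact(1) proj_ract(1) _ _ that])
      (simp_all add: proj_parts Omega_part_closed)
  show "\<sigma> t = scT (1 / Q^2) t" if "t \<in> tensor_part tens Om Om" "wedge t = 0"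
    by (rule sigma_eigen_on_relations[OF proj_additive(2) proj_lact(2) proj_ract(2) _ _ that])
      (simp_all add: proj_parts Omega_part_closed)
qed

end

section \<open>Columns of the braidings at the two highest weights\<close>

definition delta :: "'x \<Rightarrow> 'x \<Rightarrow> complex" where "delta J I = (if I = J then 1 else 0)"

lemma delta_pair: "delta (a, b) (c, e) = delta a c * delta b e"
  by (simp add: delta_def)

lemma sum_delta: "(\<Sum>K\<in>UNIV. f K * delta J K) = f (J :: 'x::finite)"
  "(\<Sum>K\<in>UNIV. f K * (x * delta J K + z * delta J' K)) = x * f J + z * f (J' :: 'x::finite)"
proof -
  show e: "(\<Sum>K\<in>UNIV. f K * delta J K) = f J" for f and J :: 'x
  proof -
    have "(\<Sum>K\<in>UNIV. f K * delta J K) = (\<Sum>K\<in>UNIV. if K = J then f K else 0)"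
      unfolding delta_def by (intro sum.cong refl) simp
    then show ?thesis by simp
  qed
  have "(\<Sum>K\<in>UNIV. f K * (x * delta J K + z * delta J' K)) = x * (\<Sum>K\<in>UNIV. f K * delta J K) + z * (\<Sum>K\<in>UNIV. f K * delta J' K)"
    by (simp add: sum_distrib_left sum.distrib distrib_left mult_ac)
  then show "(\<Sum>K\<in>UNIV. f K * (x * delta J K + z * delta J' K)) = x * f J + z * f J'" by (simp only: e)
qed

text \<open>
  A product of sparse matrices is computed column by column, each column being a combination of two \<open>delta\<close>'s.
\<close>

lemma mult_column:
  assumes "\<And>K. N $ K $ J = x * delta K1 K + z * delta K2 K"
  shows "(M ** N) $ I $ J = x * M $ I $ K1 + z * M $ I $ K2"
  unfolding matrix_matrix_mult_def vec_lambda_beta assms by (rule sum_delta)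

lemma leg_column:
  assumes "\<And>I. M $ I $ (a, b) = x * delta (a1, b1) I + z * delta (a2, b2) I"
  shows "leg12 M $ I $ (a, b, k, l) = x * delta (a1, b1, k, l) I + z * delta (a2, b2, k, l) I"
    "leg23 M $ I $ (i, a, b, l) = x * delta (i, a1, b1, l) I + z * delta (i, a2, b2, l) I"
    "leg34 M $ I $ (i, j, a, b) = x * delta (i, j, a1, b1) I + z * delta (i, j, a2, b2) I"
proof -
  obtain i1 j1 k1 l1 where I: "I = (i1, j1, k1, l1)" by (cases I)
  show "leg12 M $ I $ (a, b, k, l) = x * delta (a1, b1, k, l) I + z * delta (a2, b2, k, l) I"
    unfolding I leg_entries assms by (cases "k1 = k \<and> l1 = l") (auto simp: delta_pair delta_def[of k] delta_def[of l])
  show "leg23 M $ I $ (i, a, b, l) = x * delta (i, a1, b1, l) I + z * delta (i, a2, b2, l) I"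
    unfolding I leg_entries assms by (cases "i1 = i \<and> l1 = l") (auto simp: delta_pair delta_def[of i] delta_def[of l])
  show "leg34 M $ I $ (i, j, a, b) = x * delta (i, j, a1, b1) I + z * delta (i, j, a2, b2) I"
    unfolding I leg_entries assms by (cases "i1 = i \<and> j1 = j") (auto simp: delta_pair delta_def[of i] delta_def[of j])
qed

lemma if_delta: "(if c = b \<and> e = a then f a b else 0) = f e c * delta (e, c) (a, b)"
  by (auto simp: delta_def)

lemma Rsame_column: "Rsame P Q W $ I $ (c, e) = swap_coef W (W / Q) e c * delta (e, c) I + ext_coef P Q W e c * delta (c, e) I"
proof -
  obtain a b where I: "I = (a, b)" by (cases I)
  show ?thesis
    unfolding I Rsame_entry' if_delta[of c b e a "swap_coef W (W / Q)"] if_delta[of e b c a "\<lambda>a b. ext_coef P Q W b a", unfolded conj_commute[of "e = b"]] ..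
qed

lemma Rsame_inv_column: "Rsame_inv P Q W $ I $ (c, e) = swap_coef (1 / W) (Q / W) e c * delta (e, c) I + ext_coef_inv P Q W c e * delta (c, e) I"
proof -
  obtain a b where I: "I = (a, b)" by (cases I)
  show ?thesis
    unfolding I Rsame_inv_entry' if_delta[of c b e a "swap_coef (1 / W) (Q / W)"] if_delta[of e b c a "ext_coef_inv P Q W", unfolded conj_commute[of "e = b"]] ..
qed

context quantum_group_data
begin

context
  fixes h g :: 'n
  assumes h: "pos h = 1" and g: "pos g = 2"
begin

lemma hg: "h \<noteq> g" using h g by auto

lemma pos_eq: "pos x = 1 \<longleftrightarrow> x = h"
  using h injD[OF inj_pos, of x h] by auto

lemma coef_values:
  "ext_coef pos Q W h h = 0" "ext_coef pos Q W g g = 0" "ext_coef pos Q W h g = D" "ext_coef pos Q W g h = 0"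
  "ext_coef_inv (\<lambda>x. r + 2 - pos x) Q W h h = 0" "ext_coef_inv (\<lambda>x. r + 2 - pos x) Q W g g = 0"
  "ext_coef_inv (\<lambda>x. r + 2 - pos x) Q W g h = (1 - Q^2) / W" "ext_coef_inv (\<lambda>x. r + 2 - pos x) Q W h g = 0"
  "swap_coef u v h h = u" "swap_coef u v g g = u" "swap_coef u v h g = v" "swap_coef u v g h = v"
proof -
  have "r + 2 - 2 < r + 2 - (1::nat)" "\<not> r + 2 - 1 < r + 2 - (2::nat)" using r_ge_1 by auto
  then show "ext_coef_inv (\<lambda>x. r + 2 - pos x) Q W g h = (1 - Q^2) / W" "ext_coef_inv (\<lambda>x. r + 2 - pos x) Q W h g = 0"
    unfolding ext_coef_inv_def h g by (simp_all only: if_True if_False)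
qed (simp_all only: ext_coef_def ext_coef_inv_def swap_coef_def h g hg hg[symmetric] less_irrefl if_False if_True D_def simp_thms
      one_less_numeral_iff semiring_norm not_numeral_less_one)

lemma R_VV_column:
  "R_VV $ I $ (h, h) = W * delta (h, h) I + 0 * delta (h, h) I"
  "R_VV $ I $ (h, g) = W / Q * delta (g, h) I + 0 * delta (h, g) I"
  "R_VV $ I $ (g, h) = W / Q * delta (h, g) I + D * delta (g, h) I"
  unfolding R_VV_explicit Rsame_column coef_values by (rule refl)+

lemma R_DDi_column:
  "R_DDi $ I $ (h, h) = 1 / W * delta (h, h) I + 0 * delta (h, h) I"
  "R_DDi $ I $ (h, g) = Q / W * delta (g, h) I + 0 * delta (h, g) I"
  "R_DDi $ I $ (g, h) = Q / W * delta (h, g) I + (1 - Q^2) / W * delta (g, h) I"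
  unfolding R_DDi_def Rsame_inv_column coef_values by (rule refl)+

text \<open>
  Of the pairs of dual vectors in the first two positions, only the one in the second position is mixed with another pair, the
  one in the first position.
\<close>

lemma mixed_entry:
  assumes M: "\<And>c e. M $ (i, j) $ (c, e) = (if c = j \<and> e = i then swap_coef u v i j else 0) + (if i = j \<and> c = e then f i c else 0)"
    and f: "f i h = 0" "i \<noteq> h \<Longrightarrow> f i g = 0"
  shows "M $ (i, j) $ (h, h) = u * delta (h, h) (i, j) + 0 * delta (h, h) (i, j)"
    "M $ (i, j) $ (g, g) = u * delta (g, g) (i, j) + f h g * delta (h, h) (i, j)"
    "M $ (i, j) $ (h, g) = v * delta (g, h) (i, j) + 0 * delta (h, g) (i, j)"
    "M $ (i, j) $ (g, h) = v * delta (h, g) (i, j) + 0 * delta (g, h) (i, j)"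
proof -
  have m: "M $ (i, j) $ (c, e) = swap_coef u v e c * delta (e, c) (i, j) + (if i = j \<and> c = e then f i c else 0)" for c e
    unfolding M if_delta[of c j e i "swap_coef u v"] ..
  have gg: "(if i = j then f i g else 0) = f h g * delta (h, h) (i, j)"
    using f(2) by (cases "i = h") (auto simp: delta_def)
  show "M $ (i, j) $ (h, h) = u * delta (h, h) (i, j) + 0 * delta (h, h) (i, j)"
    unfolding m using f(1) by (cases "i = j") (simp_all add: coef_values)
  show "M $ (i, j) $ (g, g) = u * delta (g, g) (i, j) + f h g * delta (h, h) (i, j)"
    unfolding m by (simp add: coef_values gg)
  show "M $ (i, j) $ (h, g) = v * delta (g, h) (i, j) + 0 * delta (h, g) (i, j)"
    unfolding m using hg by (simp add: coef_values)
  show "M $ (i, j) $ (g, h) = v * delta (h, g) (i, j) + 0 * delta (g, h) (i, j)"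
    unfolding m using hg by (simp add: coef_values)
qed

lemma R_VD_column:
  "R_VD $ I $ (h, h) = 1 / W * delta (h, h) I + 0 * delta (h, h) I"
  "R_VD $ I $ (g, g) = 1 / W * delta (g, g) I + (1 - Q^2) / W / Q^2 * delta (h, h) I"
  "R_VD $ I $ (h, g) = Q / W * delta (g, h) I + 0 * delta (h, g) I"
  "R_VD $ I $ (g, h) = Q / W * delta (h, g) I + 0 * delta (g, h) I"
proof -
  obtain i j where I: "I = (i, j)" by (cases I)
  have m: "mix_coef pos Q W h g = (1 - Q^2) / W / Q^2" unfolding mix_coef_def h g by simp
  have m0: "mix_coef pos Q W x h = 0" for x unfolding mix_coef_def h using pos_range(1)[of x] by simp
  have m2: "x \<noteq> h \<Longrightarrow> mix_coef pos Q W x g = 0" for x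
    unfolding mix_coef_def g using pos_range(1)[of x] pos_eq[of x] by auto
  note e = mixed_entry[where M = "Rmix pos Q W" and f = "mix_coef pos Q W" and u = "1 / W" and v = "Q / W", OF Rmix_entry m0 m2, unfolded m]
  show "R_VD $ I $ (h, h) = 1 / W * delta (h, h) I + 0 * delta (h, h) I"
    "R_VD $ I $ (g, g) = 1 / W * delta (g, g) I + (1 - Q^2) / W / Q^2 * delta (h, h) I"
    "R_VD $ I $ (h, g) = Q / W * delta (g, h) I + 0 * delta (h, g) I"
    "R_VD $ I $ (g, h) = Q / W * delta (h, g) I + 0 * delta (g, h) I"
    unfolding I R_VD_explicit by (rule e; assumption)+
qed

lemma R_VDi_column:
  "R_VDi $ I $ (h, h) = W * delta (h, h) I + 0 * delta (h, h) I"
  "R_VDi $ I $ (g, g) = W * delta (g, g) I + D * delta (h, h) I"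
  "R_VDi $ I $ (h, g) = W / Q * delta (g, h) I + 0 * delta (h, g) I"
proof -
  obtain i j where I: "I = (i, j)" by (cases I)
  have m0: "ext_coef pos Q W x h = 0" for x unfolding ext_coef_def h using pos_range(1)[of x] by simp
  have m2: "x \<noteq> h \<Longrightarrow> ext_coef pos Q W x g = 0" for x
    unfolding ext_coef_def g using pos_range(1)[of x] pos_eq[of x] by auto
  note e = mixed_entry[where M = "Rmix_inv pos Q W" and f = "ext_coef pos Q W" and u = W and v = "W / Q", OF Rmix_inv_entry' m0 m2, unfolded coef_values]
  show "R_VDi $ I $ (h, h) = W * delta (h, h) I + 0 * delta (h, h) I"
    "R_VDi $ I $ (g, g) = W * delta (g, g) I + D * delta (h, h) I"
    "R_VDi $ I $ (h, g) = W / Q * delta (g, h) I + 0 * delta (h, g) I"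
    unfolding I R_VDi_def by (rule e; assumption)+
qed

lemma S_column:
  "S $ I $ (h, h, h, l) = W * delta (h, h, h, l) I"
  "S $ I $ (h, h, g, l) = W / Q^2 * delta (g, h, h, l) I"
  "S $ I $ (g, h, h, l) = W * delta (h, h, g, l) I + D * delta (g, h, h, l) I"
  "S $ I $ (h, g, g, l) = W * delta (g, g, h, l) I + D * delta (h, h, h, l) I"
proof -
  have assoc: "S = leg23 R_VD ** (leg12 R_VV ** leg23 R_VDi)" unfolding S_form matrix_mul_assoc ..
  note c = leg_column(1)[OF R_VV_column(1)] leg_column(1)[OF R_VV_column(2)] leg_column(1)[OF R_VV_column(3)]
  have w: "(leg12 R_VV ** leg23 R_VDi) $ K $ (h, h, h, l) = W * W * delta (h, h, h, l) K + 0 * delta (h, h, h, l) K"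
    "(leg12 R_VV ** leg23 R_VDi) $ K $ (h, h, g, l) = W / Q * (W / Q) * delta (g, h, h, l) K + 0 * delta (g, h, h, l) K"
    "(leg12 R_VV ** leg23 R_VDi) $ K $ (g, h, h, l) = W * (W / Q) * delta (h, g, h, l) K + W * D * delta (g, h, h, l) K"
    "(leg12 R_VV ** leg23 R_VDi) $ K $ (h, g, g, l) = W * (W / Q) * delta (g, h, g, l) K + D * W * delta (h, h, h, l) K" for K
    unfolding mult_column[OF leg_column(2)[OF R_VDi_column(1)]] mult_column[OF leg_column(2)[OF R_VDi_column(2)]] mult_column[OF leg_column(2)[OF R_VDi_column(3)]] c
    by (simp_all only: mult_zero_left add_0_right distrib_left mult.assoc)
  note e = leg_column(2)[OF R_VD_column(1)] leg_column(2)[OF R_VD_column(2)] leg_column(2)[OF R_VD_column(3)] leg_column(2)[OF R_VD_column(4)]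
  note nz = W_nz Q_nz
  show "S $ I $ (h, h, h, l) = W * delta (h, h, h, l) I"
    unfolding assoc mult_column[OF w(1)] e using nz by simp
  show "S $ I $ (h, h, g, l) = W / Q^2 * delta (g, h, h, l) I"
    unfolding assoc mult_column[OF w(2)] e using nz by (simp add: power2_eq_square)
  show "S $ I $ (g, h, h, l) = W * delta (h, h, g, l) I + D * delta (g, h, h, l) I"
    unfolding assoc mult_column[OF w(3)] e using nz by simp
  show "S $ I $ (h, g, g, l) = W * delta (g, g, h, l) I + D * delta (h, h, h, l) I"
    unfolding assoc mult_column[OF w(4)] e using nz by simp
qed

text \<open>
  Only for the last column do all three factors contribute columns with two entries.
\<close>

lemma St_column:
  "St $ I $ (i, h, h, h) = 1 / W * delta (i, h, h, h) I"
  "St $ I $ (i, h, g, h) = 1 / W * delta (i, h, g, h) I"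
  "St $ I $ (i, h, h, g) = Q^2 / W * delta (i, g, h, h) I"
  "St $ I $ (i, h, g, g) = 1 / W * delta (i, g, g, h) I + (1 - Q^2) / (W * Q^2) * delta (i, h, h, h) I"
  "St $ I $ (i, g, g, h) = Q^2 / W * delta (i, h, g, g) I + (1 - Q^2) / W * delta (i, g, g, h) I + (Q^2 - 1) / W * delta (i, h, h, h) I"
proof -
  have assoc: "St = leg23 R_VD ** (leg34 R_DDi ** leg23 R_VDi)" unfolding St_form matrix_mul_assoc ..
  note c = leg_column(3)[OF R_DDi_column(1)] leg_column(3)[OF R_DDi_column(2)] leg_column(3)[OF R_DDi_column(3)]
  note m = mult_column[OF leg_column(2)[OF R_VDi_column(1)]] mult_column[OF leg_column(2)[OF R_VDi_column(2)]] mult_column[OF leg_column(2)[OF R_VDi_column(3)]]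
  have w: "(leg34 R_DDi ** leg23 R_VDi) $ K $ (i, h, h, h) = W * (1 / W) * delta (i, h, h, h) K + 0 * delta (i, h, h, h) K"
    "(leg34 R_DDi ** leg23 R_VDi) $ K $ (i, h, g, h) = W / Q * (1 / W) * delta (i, g, h, h) K + 0 * delta (i, g, h, h) K"
    "(leg34 R_DDi ** leg23 R_VDi) $ K $ (i, h, h, g) = W * (Q / W) * delta (i, h, g, h) K + 0 * delta (i, h, g, h) K"
    "(leg34 R_DDi ** leg23 R_VDi) $ K $ (i, h, g, g) = W / Q * (Q / W) * delta (i, g, g, h) K + 0 * delta (i, g, g, h) K" for K
    unfolding m c by (simp_all only: mult_zero_left add_0_right distrib_left mult.assoc)
  have w': "(leg34 R_DDi ** leg23 R_VDi) $ K $ (i, g, g, h) = W * (Q / W * delta (i, g, h, g) K + (1 - Q^2) / W * delta (i, g, g, h) K) + D * (1 / W * delta (i, h, h, h) K)" for K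
    unfolding m c by (simp only: mult_zero_left add_0_right)
  note e = leg_column(2)[OF R_VD_column(1)] leg_column(2)[OF R_VD_column(2)] leg_column(2)[OF R_VD_column(3)] leg_column(2)[OF R_VD_column(4)]
  note nz = W_nz Q_nz
  show "St $ I $ (i, h, h, h) = 1 / W * delta (i, h, h, h) I"
    unfolding assoc mult_column[OF w(1)] e using nz by simp
  show "St $ I $ (i, h, g, h) = 1 / W * delta (i, h, g, h) I"
    unfolding assoc mult_column[OF w(2)] e using nz by simp
  show "St $ I $ (i, h, h, g) = Q^2 / W * delta (i, g, h, h) I"
    unfolding assoc mult_column[OF w(3)] e using nz by (simp add: power2_eq_square)
  show "St $ I $ (i, h, g, g) = 1 / W * delta (i, g, g, h) I + (1 - Q^2) / (W * Q^2) * delta (i, h, h, h) I"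
    unfolding assoc mult_column[OF w(4)] e using nz by simp
  have sum3: "(\<Sum>K\<in>UNIV. f K * (x * (x1 * delta J1 K + x2 * delta J2 K) + z * (x3 * delta J3 K))) = x * x1 * f J1 + x * x2 * f J2 + z * x3 * f J3"
    for f :: "'n \<times> 'n \<times> 'n \<times> 'n \<Rightarrow> complex" and x z x1 x2 x3 J1 J2 J3
  proof -
    have "(\<Sum>K\<in>UNIV. f K * (x * (x1 * delta J1 K + x2 * delta J2 K) + z * (x3 * delta J3 K)))
      = x * x1 * (\<Sum>K\<in>UNIV. f K * delta J1 K) + x * x2 * (\<Sum>K\<in>UNIV. f K * delta J2 K) + z * x3 * (\<Sum>K\<in>UNIV. f K * delta J3 K)"
      by (simp add: sum_distrib_left sum.distrib distrib_left mult_ac)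
    then show ?thesis by (simp only: sum_delta)
  qed
  \<comment> \<open>Two paths lead to the entry \<open>(i, h, h, h)\<close>: through the second entry of the last factor \<open>R_VD\<close>, and through that of \<open>R_VDi\<close>.\<close>
  have x: "W * ((1 - Q^2) / W) * ((1 - Q^2) / W / Q^2) + D * (1 / W) * (1 / W) = (Q^2 - 1) / W"
    using nz by (simp add: D_def field_simps power2_eq_square)
  have "St $ I $ (i, g, g, h) = W * (Q / W) * leg23 R_VD $ I $ (i, g, h, g) + W * ((1 - Q^2) / W) * leg23 R_VD $ I $ (i, g, g, h) + D * (1 / W) * leg23 R_VD $ I $ (i, h, h, h)"
    unfolding assoc matrix_matrix_mult_def[of "leg23 R_VD"] vec_lambda_beta w' by (rule sum3)
  also have "\<dots> = Q^2 / W * delta (i, h, g, g) I + (1 - Q^2) / W * delta (i, g, g, h) I + (W * ((1 - Q^2) / W) * ((1 - Q^2) / W / Q^2) + D * (1 / W) * (1 / W)) * delta (i, h, h, h) I"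
    unfolding e using nz by (simp add: distrib_left distrib_right power2_eq_square mult.assoc)
  finally show "St $ I $ (i, g, g, h) = Q^2 / W * delta (i, h, g, g) I + (1 - Q^2) / W * delta (i, g, g, h) I + (Q^2 - 1) / W * delta (i, h, h, h) I"
    unfolding x .
qed

end

end

section \<open>A two-form that does not vanish\<close>

lemma complex_algebra_complex: "complex_algebra (\<lambda>c :: complex. c)"
  by (simp add: complex_algebra_def)

lemma scl_complex: "scl (\<lambda>c :: complex. c) (*) = (*)"
  by (intro ext) (simp add: scl_def)

lemma complex_space_complex: "complex_space ((*) :: complex \<Rightarrow> complex \<Rightarrow> complex)"
  using scl_complex_space[OF complex_algebra_complex left_module_mult] unfolding scl_complex .

lemma on_legs_delta: "on_legs (*) M (delta J) I = M $ I $ J"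
  unfolding on_legs_def by (rule sum_delta)

lemma on_legs_delta3:
  "on_legs (*) M (\<lambda>I. x1 * delta J1 I + x2 * delta J2 I + x3 * delta J3 I) I = x1 * M $ I $ J1 + x2 * M $ I $ J2 + x3 * M $ I $ J3"
proof -
  interpret complex_space "(*) :: complex \<Rightarrow> complex \<Rightarrow> complex" by (rule complex_space_complex)
  show ?thesis unfolding on_legs_add on_legs_scale on_legs_delta ..
qed

context quantum_projective_space
begin

text \<open>
  The evaluation at the point of the projective space that belongs to the highest weight: sending \<open>p\<close> to the
  matrix unit at that weight respects the relators because the braidings are scalars, up to the flip, on tensor
  products of vectors of that weight.
\<close>

lemma character:
  assumes h: "pos h = 1" and g: "pos g = 2"
  obtains \<theta> :: "'b \<Rightarrow> complex" where "\<And>x y. \<theta> (x + y) = \<theta> x + \<theta> y" "\<And>x y. \<theta> (x * y) = \<theta> x * \<theta> y"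
    "\<And>c. \<theta> (\<eta> c) = c" "\<And>I. \<theta> (p I) = delta (h, h) I"
proof -
  note ca = complex_algebra_complex
  let ?e = "free_eval (\<lambda>c :: complex. c) (delta (h, h))"
  have pp: "(\<lambda>J. ?e (fam_prod (*) free_gen free_gen J)) = delta (h, h, h, h)"
    by (auto simp: fam_prod_def free_eval_mult[OF ca] free_eval_gen[OF ca] delta_pair)
  have ppJ: "?e (fam_prod (*) free_gen free_gen J) = delta (h, h, h, h) J" for J
    using pp by (rule fun_cong)
  have gen: "(\<lambda>I. ?e (free_gen I)) = delta (h, h)" by (simp add: free_eval_gen[OF ca])
  have ev: "contract12 (*) Ev' (delta (h, h)) = Q ^ r"
    unfolding contract12_def sum_delta weighted_cap by (simp add: level_def h)
  have rel: "?e f = 0" if "f \<in> B_relators" for f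
  proof -
    consider I where "f = on_legs (scl free_unit (*)) S (fam_prod (*) free_gen free_gen) I - scl free_unit (*) (qpow w) (fam_prod (*) free_gen free_gen I)"
      | I where "f = on_legs (scl free_unit (*)) St (fam_prod (*) free_gen free_gen) I - scl free_unit (*) (qpow (- w)) (fam_prod (*) free_gen free_gen I)"
      | "f = contract12 (scl free_unit (*)) Ev' free_gen - free_unit (qpow m)"
      using \<open>f \<in> B_relators\<close> unfolding B_relators_def Let_def by blast
    then show ?thesis
    proof cases
      case 1
      show ?thesis
        unfolding 1 diff_conv_add_uminus free_eval_add[OF ca] free_eval_uminus[OF ca] free_eval_on_legs[OF ca] pp ppJ scl_complex on_legs_delta
          scl_def[of free_unit] free_eval_mult[OF ca] free_eval_unit[OF ca] qpow_values S_column[OF h g] by simp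
    next
      case 2
      show ?thesis
        unfolding 2 diff_conv_add_uminus free_eval_add[OF ca] free_eval_uminus[OF ca] free_eval_on_legs[OF ca] pp ppJ scl_complex on_legs_delta
          scl_def[of free_unit] free_eval_mult[OF ca] free_eval_unit[OF ca] qpow_values St_column[OF h g] by simp
    next
      case 3
      show ?thesis
        unfolding 3 diff_conv_add_uminus free_eval_add[OF ca] free_eval_uminus[OF ca] free_eval_contract12[OF ca] gen scl_complex ev
          free_eval_unit[OF ca] qpow_values by simp
    qed
  qed
  have ker: "?e f = 0" if "free_eval \<eta> p f = 0" for f
    using B_presented that two_sided_ideal_gen_eval[OF ca rel] unfolding algebra_presented_def by blast
  define \<theta> where "\<theta> b = ?e (SOME f. free_eval \<eta> p f = b)" for b
  have \<theta>: "\<theta> (free_eval \<eta> p f) = ?e f" for f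
  proof -
    let ?f = "SOME f'. free_eval \<eta> p f' = free_eval \<eta> p f"
    have "free_eval \<eta> p ?f = free_eval \<eta> p f" by (rule someI[where x = f]) simp
    then have "free_eval \<eta> p (?f + - f) = 0"
      unfolding free_eval_add[OF \<eta>_algebra] free_eval_uminus[OF \<eta>_algebra] by simp
    then have "?e (?f + - f) = 0" by (rule ker)
    then show ?thesis unfolding \<theta>_def free_eval_add[OF ca] free_eval_uminus[OF ca] by simp
  qed
  have surj: "\<exists>f. b = free_eval \<eta> p f" for b using B_presented unfolding algebra_presented_def by (metis surjD)
  show thesis
  proof (rule that)
    fix b b'
    obtain f f' where f: "b = free_eval \<eta> p f" "b' = free_eval \<eta> p f'" using surj by metis
    show "\<theta> (b + b') = \<theta> b + \<theta> b'"
      unfolding f free_eval_add[OF \<eta>_algebra, symmetric] \<theta> free_eval_add[OF ca] ..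
    show "\<theta> (b * b') = \<theta> b * \<theta> b'"
      unfolding f free_eval_mult[OF \<eta>_algebra, symmetric] \<theta> free_eval_mult[OF ca] ..
  next
    show "\<theta> (\<eta> c) = c" for c
      using \<theta>[of "free_unit c"] unfolding free_eval_unit[OF \<eta>_algebra] free_eval_unit[OF ca] .
    show "\<theta> (p I) = delta (h, h) I" for I
      using \<theta>[of "free_gen I"] unfolding free_eval_gen[OF \<eta>_algebra] free_eval_gen[OF ca] .
  qed
qed

end

context universal_two_forms
begin

text \<open>
  At the point of the highest weight, \<open>fp\<close> and \<open>fm\<close> are the components of a one-form along \<open>\<partial>p\<close> and its conjugate at the
  neighbouring weight. They are twisted derivations for \<beta> = 0, and a q-deformed antisymmetrisation of their product
  vanishes on relations, but not on the given tensor.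
\<close>

theorem wedge_nonzero:
  assumes h: "pos h = 1" and g: "pos g = 2"
  shows "wedge (tens (dp (g, h)) (dbp (h, g))) \<noteq> 0"
proof -
  obtain \<theta> :: "'b \<Rightarrow> complex" where \<theta>: "\<And>x v. \<theta> (x + v) = \<theta> x + \<theta> v" "\<And>x v. \<theta> (x * v) = \<theta> x * \<theta> v"
    "\<And>c. \<theta> (\<eta> c) = c" "\<And>I. \<theta> (p I) = delta (h, h) I" using character[OF h g] by blast
  have \<theta>1: "\<theta> 1 = 1" using \<theta>(3)[of 1] complex_algebraD(1)[OF \<eta>_algebra] by simp
  define lz where "lz b z = \<theta> b * z" for b z
  define rz where "rz z b = z * \<theta> b" for b z
  have Z: "bimodule \<eta> lz rz"
    unfolding bimodule_def left_module_def right_module_def Modules.additive_def lz_def rz_def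
    by (simp add: \<theta> \<theta>1 distrib_left distrib_right mult_ac)
  have sZ: "scl \<eta> lz = (*)" by (intro ext) (simp add: scl_def lz_def \<theta>)
  note legT = on_legs_T[OF complex_space_complex] and legST = on_legs_commute(1)[OF complex_space_complex]
  interpret C: complex_space "(*) :: complex \<Rightarrow> complex \<Rightarrow> complex" by (rule complex_space_complex)
  note S = S_column[OF h g] and St = St_column[OF h g]
  note nz = W_nz Q_nz
  have hg: "h \<noteq> g" using h g by auto
  have zero: "on_legs (*) M (\<lambda>I. 0) I = (0::complex)" for M :: "complex^('n \<times> 'n \<times> 'n \<times> 'n)^('n \<times> 'n \<times> 'n \<times> 'n)" and I
    by (simp add: on_legs_def)
  have cap: "contract12 (*) Ev' (delta I) = Ev' I" for I
    unfolding contract12_def by (rule sum_delta)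
  obtain fp where fp: "Modules.additive fp" "\<And>b x. fp (lact b x) = lz b (fp x)" "\<And>b x. fp (ract x b) = rz (fp x) b"
    "\<And>I. fp (del_p I) = delta (g, h) I" "\<And>I. fp (delbar_p I) = 0"
  proof (rule twisted_derivation[of lz rz "\<lambda>_ _. 0" "delta (g, h)" "\<lambda>_. 0"])
    have e: "(\<lambda>(i, j, k, l). 0 + lz (p (i, j)) (delta (g, h) (k, l))) = delta (h, h, g, h)" "(\<lambda>(i, j, k, l). 0 + lz (p (i, j)) 0) = (\<lambda>_. 0)"
      by (auto simp: lz_def \<theta> delta_pair)
    show "bimodule \<eta> lz rz" by (rule Z)
    show "on_legs (scl \<eta> lz) St (\<lambda>(i, j, k, l). 0 + lz (p (i, j)) (delta (g, h) (k, l))) I = scl \<eta> lz (1 / W) ((\<lambda>(i, j, k, l). 0 + lz (p (i, j)) (delta (g, h) (k, l))) I)" for I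
      unfolding e sZ on_legs_delta St ..
    show "contract12 (scl \<eta> lz) Ev' (delta (g, h)) = 0"
      unfolding sZ cap weighted_cap using hg by simp
    show "on_legs (scl \<eta> lz) S (\<lambda>(i, j, k, l). 0 + lz (p (i, j)) 0) I = scl \<eta> lz W ((\<lambda>(i, j, k, l). 0 + lz (p (i, j)) 0) I)" for I
      unfolding e sZ zero by simp
    show "contract12 (scl \<eta> lz) Ev' (\<lambda>_. 0) = 0" by (simp add: contract12_def sZ)
    show "rz (delta (g, h) (i, j)) (p (k, l)) - 0 = scl \<eta> lz (Q^2) (on_legs (scl \<eta> lz) T (\<lambda>(i, j, k, l). 0 + lz (p (i, j)) (delta (g, h) (k, l))) (i, j, k, l))" for i j k l
    proof -
      have "on_legs (*) T (delta (h, h, g, h)) (i, j, k, l) = 1 / W * (W / Q^2 * delta (g, h, h, h) (i, j, k, l))"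
        unfolding legT unfolding on_legs_delta[abs_def] St C.on_legs_scale on_legs_delta S ..
      then show ?thesis unfolding e sZ using nz by (simp add: rz_def \<theta> delta_pair)
    qed
    show "rz 0 (p (k, l)) - 0 = scl \<eta> lz (1 / Q^2) (on_legs (scl \<eta> lz) T (\<lambda>(i, j, k, l). 0 + lz (p (i, j)) 0) (i, j, k, l))" for i j k l
      unfolding e sZ zero by (simp add: rz_def)
  qed (use that in \<open>simp_all add: Modules.additive_def lz_def rz_def\<close>)
  obtain fm where fm: "Modules.additive fm" "\<And>b x. fm (lact b x) = lz b (fm x)" "\<And>b x. fm (ract x b) = rz (fm x) b"
    "\<And>I. fm (del_p I) = 0" "\<And>I. fm (delbar_p I) = delta (h, g) I"
  proof (rule twisted_derivation[of lz rz "\<lambda>_ _. 0" "\<lambda>_. 0" "delta (h, g)"])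
    have e: "(\<lambda>(i, j, k, l). 0 + lz (p (i, j)) (delta (h, g) (k, l))) = delta (h, h, h, g)" "(\<lambda>(i, j, k, l). 0 + lz (p (i, j)) 0) = (\<lambda>_. 0)"
      by (auto simp: lz_def \<theta> delta_pair)
    show "bimodule \<eta> lz rz" by (rule Z)
    show "on_legs (scl \<eta> lz) St (\<lambda>(i, j, k, l). 0 + lz (p (i, j)) 0) I = scl \<eta> lz (1 / W) ((\<lambda>(i, j, k, l). 0 + lz (p (i, j)) 0) I)" for I
      unfolding e sZ zero by simp
    show "contract12 (scl \<eta> lz) Ev' (\<lambda>_. 0) = 0" by (simp add: contract12_def sZ)
    show "on_legs (scl \<eta> lz) S (\<lambda>(i, j, k, l). 0 + lz (p (i, j)) (delta (h, g) (k, l))) I = scl \<eta> lz W ((\<lambda>(i, j, k, l). 0 + lz (p (i, j)) (delta (h, g) (k, l))) I)" for I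
      unfolding e sZ on_legs_delta S ..
    show "contract12 (scl \<eta> lz) Ev' (delta (h, g)) = 0"
      unfolding sZ cap weighted_cap using hg by simp
    show "rz 0 (p (k, l)) - 0 = scl \<eta> lz (Q^2) (on_legs (scl \<eta> lz) T (\<lambda>(i, j, k, l). 0 + lz (p (i, j)) 0) (i, j, k, l))" for i j k l
      unfolding e sZ zero by (simp add: rz_def)
    show "rz (delta (h, g) (i, j)) (p (k, l)) - 0 = scl \<eta> lz (1 / Q^2) (on_legs (scl \<eta> lz) T (\<lambda>(i, j, k, l). 0 + lz (p (i, j)) (delta (h, g) (k, l))) (i, j, k, l))" for i j k l
    proof -
      have "on_legs (*) T (delta (h, h, h, g)) (i, j, k, l) = W * (Q^2 / W * delta (h, g, h, h) (i, j, k, l))"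
        unfolding legT legST[symmetric] unfolding on_legs_delta[abs_def] S C.on_legs_scale on_legs_delta St ..
      then show ?thesis unfolding e sZ using nz by (simp add: rz_def \<theta> delta_pair)
    qed
  qed (use that in \<open>simp_all add: Modules.additive_def lz_def rz_def\<close>)
  note fpD = additiveD[OF fp(1)] and fmD = additiveD[OF fm(1)]
  let ?\<beta> = "\<lambda>x v. fm x * fp v - Q^2 * (fp x * fm v)"
  \<comment> \<open>\<open>u\<close> is forced on the two diagonal entries: it has quantum trace zero, and it balances the pairing in the right module rule.\<close>
  let ?u = "\<lambda>I. Q^2 * delta (g, g) I - delta (h, h) I"
  \<comment> \<open>The families on which the relators act; the factor \<open>Q^2\<close> in \<open>?\<beta>\<close> and \<open>?u\<close> makes them eigenvectors of \<open>St\<close> and of \<open>S\<close>.\<close>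
  let ?Fp = "\<lambda>I. 1 * delta (h, g, g, h) I + Q^2 * delta (h, h, g, g) I + (- 1) * delta (h, h, h, h) I"
  let ?Fm = "\<lambda>I. (- (Q^2)) * delta (g, h, h, g) I + (- (Q^2)) * delta (h, h, g, g) I + 1 * delta (h, h, h, h) I"
  have fpd: "fp (d (p I)) = delta (g, h) I" "fm (d (p I)) = delta (h, g) I" for I
    by (simp_all add: d_def fpD fmD fp fm)
  have e: "(\<lambda>(i, j, k, l). ?\<beta> (d (p (i, j))) (del_p (k, l)) + lz (p (i, j)) (?u (k, l))) = ?Fp"
    "(\<lambda>(i, j, k, l). ?\<beta> (d (p (i, j))) (delbar_p (k, l)) - lz (p (i, j)) (?u (k, l))) = ?Fm"
    by (auto simp: fpd fp fm lz_def \<theta> delta_pair algebra_simps)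
  obtain \<Phi> where \<Phi>: "Modules.additive \<Phi>" "\<And>x v. \<Phi> (tens x v) = ?\<beta> x v" "\<And>t. wedge t = 0 \<Longrightarrow> \<Phi> t = 0"
  proof (rule pairing_from_generators[of lz rz ?\<beta> ?u])
    show "bimodule \<eta> lz rz" by (rule Z)
    show "Modules.additive (\<lambda>v. ?\<beta> x v)" "Modules.additive (\<lambda>x. ?\<beta> x v)" for x v
      by (simp_all add: Modules.additive_def fpD fmD algebra_simps)
    show "?\<beta> (lact b x) v = lz b (?\<beta> x v)" "?\<beta> x (ract v b) = rz (?\<beta> x v) b"
      "?\<beta> (ract x b) v = ?\<beta> x (lact b v)" for b x v
      by (simp_all add: fp fm lz_def rz_def algebra_simps)
    show "contract12 (scl \<eta> lz) Ev' ?u = 0"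
    proof -
      have "contract12 (*) Ev' ?u = Q^2 * contract12 (*) Ev' (delta (g, g)) - contract12 (*) Ev' (delta (h, h))"
        unfolding contract12_def by (simp add: sum_subtractf sum_distrib_left right_diff_distrib mult_ac)
      also have "\<dots> = 0" unfolding cap weighted_cap using nz by (simp add: level_def h g)
      finally show ?thesis unfolding sZ .
    qed
    have StF: "on_legs (*) St ?Fp I = 1 / W * ?Fp I" for I
      unfolding on_legs_delta3 St using nz by (simp add: field_simps power2_eq_square)
    have SF: "on_legs (*) S ?Fm I = W * ?Fm I" for I
      unfolding on_legs_delta3 S D_def using nz by (simp add: field_simps power2_eq_square)
    show "on_legs (scl \<eta> lz) St (\<lambda>(i, j, k, l). ?\<beta> (d (p (i, j))) (del_p (k, l)) + lz (p (i, j)) (?u (k, l))) I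
      = scl \<eta> lz (1 / W) ((\<lambda>(i, j, k, l). ?\<beta> (d (p (i, j))) (del_p (k, l)) + lz (p (i, j)) (?u (k, l))) I)" for I
      unfolding e sZ by (rule StF)
    show "on_legs (scl \<eta> lz) S (\<lambda>(i, j, k, l). ?\<beta> (d (p (i, j))) (delbar_p (k, l)) - lz (p (i, j)) (?u (k, l))) I
      = scl \<eta> lz W ((\<lambda>(i, j, k, l). ?\<beta> (d (p (i, j))) (delbar_p (k, l)) - lz (p (i, j)) (?u (k, l))) I)" for I
      unfolding e sZ by (rule SF)
    show "rz (?u (i, j)) (p (k, l)) - ?\<beta> (del_p (i, j)) (d (p (k, l)))
      = scl \<eta> lz (Q^2) (on_legs (scl \<eta> lz) T (\<lambda>(i, j, k, l). ?\<beta> (d (p (i, j))) (del_p (k, l)) + lz (p (i, j)) (?u (k, l))) (i, j, k, l))" for i j k l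
    proof -
      have "on_legs (*) T ?Fp I = 1 / W * on_legs (*) S ?Fp I" for I
        unfolding legT StF[abs_def] C.on_legs_scale ..
      moreover have "on_legs (*) S ?Fp I = W * (delta (g, g, h, h) I + delta (g, h, h, g) I - 1 / Q^2 * delta (h, h, h, h) I)" for I
        unfolding on_legs_delta3 S D_def using nz by (simp add: field_simps power2_eq_square)
      ultimately have t: "on_legs (*) T ?Fp I = delta (g, g, h, h) I + delta (g, h, h, g) I - 1 / Q^2 * delta (h, h, h, h) I" for I
        using nz by simp
      show ?thesis
        unfolding e sZ t using nz by (simp add: rz_def fpd fp fm \<theta> delta_pair algebra_simps)
    qed
    show "- rz (?u (i, j)) (p (k, l)) - ?\<beta> (delbar_p (i, j)) (d (p (k, l)))
      = scl \<eta> lz (1 / Q^2) (on_legs (scl \<eta> lz) T (\<lambda>(i, j, k, l). ?\<beta> (d (p (i, j))) (delbar_p (k, l)) - lz (p (i, j)) (?u (k, l))) (i, j, k, l))" for i j k l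
    proof -
      have "on_legs (*) T ?Fm I = W * on_legs (*) St ?Fm I" for I
        unfolding legT legST[symmetric] SF[abs_def] C.on_legs_scale ..
      moreover have "on_legs (*) St ?Fm I = 1 / W * (- (Q^4 * delta (g, g, h, h) I) - Q^2 * delta (h, g, g, h) I + Q^2 * delta (h, h, h, h) I)" for I
        unfolding on_legs_delta3 St using nz by (simp add: field_simps power2_eq_square power4_eq_xxxx)
      ultimately have t: "on_legs (*) T ?Fm I = - (Q^4 * delta (g, g, h, h) I) - Q^2 * delta (h, g, g, h) I + Q^2 * delta (h, h, h, h) I" for I
        using nz by simp
      show ?thesis
        unfolding e sZ t using nz by (simp add: rz_def fpd fp fm \<theta> delta_pair field_simps power2_eq_square power4_eq_xxxx)
    qed
  qed (use that in blast)
  have "\<Phi> (tens (dp (g, h)) (dbp (h, g))) = - (Q^2)"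
    unfolding \<Phi>(2) fp fm by (simp add: delta_def)
  then show ?thesis using \<Phi>(3) Q_nz by fastforce
qed

end

section \<open>Sections of the wedge product\<close>

context generalized_braiding
begin

text \<open>
  A coefficient in the second factor is moved to the first one, where it can be reordered by \<open>right\<close>; so
  the products of differentials generate the summand as a left module.
\<close>

lemma tensor_part_generators:
  assumes right: "\<And>b v. v \<in> Omega_part lact p \<delta> \<Longrightarrow> ract v b \<in> Omega_part lact p \<delta>"
    and t: "t \<in> tensor_part tens (Omega_part lact p \<delta>) (Omega_part lact p \<delta>')"
    and gen: "\<And>I. P (fam_prod tens (\<lambda>I. \<delta> (p I)) (\<lambda>I. \<delta>' (p I)) I)" and zero: "P 0"
    and add: "\<And>u v. P u \<Longrightarrow> P v \<Longrightarrow> P (u + v)" and minus: "\<And>u. P u \<Longrightarrow> P (- u)" and lact: "\<And>b u. P u \<Longrightarrow> P (lactT b u)"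
  shows "P t"
proof -
  have 1: "P (tens u (\<delta>' (p J)))" if "u \<in> Omega_part lact p \<delta>" for u J
    using that
  proof (rule Omega_part_induct)
    fix b and I :: "'n \<times> 'n"
    obtain i j k l where IJ: "I = (i, j)" "J = (k, l)" by (cases I; cases J)
    have "P (tens (\<delta> (p I)) (\<delta>' (p J)))" using gen[of "(i, j, k, l)"] by (simp add: fam_prod_def IJ)
    then show "P (tens (lact b (\<delta> (p I))) (\<delta>' (p J)))" unfolding lactT_tens[symmetric] by (rule lact)
  qed (simp_all add: tens_add' zero add)
  have 2: "P (tens u v)" if u: "u \<in> Omega_part lact p \<delta>" and v: "v \<in> Omega_part lact p \<delta>'" for u v
    using v
  proof (rule Omega_part_induct)
    fix b and J :: "'n \<times> 'n"
    show "P (tens u (lact b (\<delta>' (p J))))" unfolding tens_bal[symmetric] by (rule 1[OF right[OF u]])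
  qed (simp_all add: tens_add zero add)
  show ?thesis using t unfolding tensor_part_def
    by induction (auto intro: zero add minus 2)
qed

abbreviation "Tpp \<equiv> tensor_part tens Op Op"
abbreviation "Tmm \<equiv> tensor_part tens Om Om"
abbreviation "Tpm \<equiv> tensor_part tens Op Om"
abbreviation "Tmp \<equiv> tensor_part tens Om Op"

lemma fam_parts: "DD I \<in> Tpp" "BB I \<in> Tmm" "DB I \<in> Tpm" "BD I \<in> Tmp"
  by (cases I; simp add: fam_prod_def tensor_part_tens Omega_part_closed)+

lemma G_part: "G I \<in> Tmp" and A_part: "A I \<in> Tpm"
  by (cases I; auto simp: G_def A_def intro!: tensor_part_sum tensor_part_tens Omega_part_closed)+

lemma sigma_gen_parts: "\<sigma> (DD I) \<in> Tpp" "\<sigma> (BB I) \<in> Tmm" "\<sigma> (DB I) \<in> Tmp" "\<sigma> (BD I) \<in> Tpm"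
proof -
  note i = tensor_part_add tensor_part_scale tensor_part_on_legs tensor_part_lact tensor_part_ract fam_parts Omega_part_closed(3)
  show "\<sigma> (DD I) \<in> Tpp" "\<sigma> (BB I) \<in> Tmm" unfolding \<sigma>_DD \<sigma>_BB by (intro i; assumption)+
  have gp: "GP I \<in> Tmp" by (cases I) (auto simp: fam_prod_def intro!: tensor_part_ract Op_ract G_part)
  show "\<sigma> (DB I) \<in> Tmp" unfolding \<sigma>_DB by (intro i gp; assumption)
  have tr: "trace scT A \<in> Tpm" unfolding trace_def[OF csT] by (intro tensor_part_sum i A_part; assumption)
  have pg: "pgp (trace scT A) I \<in> Tpm"
    by (cases I) (auto simp: pgp_def fam_prod_def intro!: tensor_part_lact tensor_part_ract Om_ract Omega_part_closed(3) tr)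
  show "\<sigma> (BD I) \<in> Tpm" unfolding \<sigma>_BD by (intro i pg; assumption)
qed

lemma sigma_swaps_parts: "t \<in> Tpm \<Longrightarrow> \<sigma> t \<in> Tmp" "t \<in> Tmp \<Longrightarrow> \<sigma> t \<in> Tpm"
proof -
  have minus: "- u \<in> tensor_part tens M N" if "u \<in> tensor_part tens M N" for u M N
    using that unfolding tensor_part_def by (rule subgroup_gen.minus)
  show "\<sigma> t \<in> Tmp" if "t \<in> Tpm"
    by (rule tensor_part_generators[where P = "\<lambda>t. \<sigma> t \<in> Tmp", OF Op_ract that])
      (auto simp: \<sigma>_add sigma_left intro: sigma_gen_parts tensor_part_zero tensor_part_add minus tensor_part_lact Omega_part_closed(3))
  show "\<sigma> t \<in> Tpm" if "t \<in> Tmp"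
    by (rule tensor_part_generators[where P = "\<lambda>t. \<sigma> t \<in> Tpm", OF Om_ract that])
      (auto simp: \<sigma>_add sigma_left intro: sigma_gen_parts tensor_part_zero tensor_part_add minus tensor_part_lact Omega_part_closed(3))
qed

lemma wedge_scale_cancel: "wedge (scT z t) = 0 \<Longrightarrow> z \<noteq> 0 \<Longrightarrow> wedge t = 0"
proof -
  interpret complex_space scT by (rule csT)
  show "wedge (scT z t) = 0 \<Longrightarrow> z \<noteq> 0 \<Longrightarrow> wedge t = 0" using wedge_scT[of "scT z t" "1 / z"] by simp
qed

text \<open>
  In the two-forms \<sigma> is -1 at \<open>t\<close>, hence \<open>sw\<close> is multiplication by \<open>c + c'\<close>.
\<close>

lemma section_coefficients:
  assumes sw: "sw t = scT c t - scT c' (\<sigma> t)" and wedge_sw: "wedge (sw t) = wedge t" and ker: "wedge (t + \<sigma> t) = 0"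
  shows "c + c' = 1 \<or> wedge t = 0"
proof -
  interpret complex_space scT by (rule csT)
  have "scT (c + c' - 1) t = (sw t - t) + scT c' (t + \<sigma> t)"
    unfolding sw by (simp add: scale_left_distrib scale_left_diff_distrib scale_right_distrib)
  then have "wedge (scT (c + c' - 1) t) = 0" by (simp add: wedge_add wedge_sw wedge_scT[OF ker])
  then show ?thesis using wedge_scale_cancel[of "c + c' - 1" t] by auto
qed

text \<open>
  If \<open>wedge t = 0\<close> then both sides are zero. Otherwise \<open>c + c' = 1\<close>, and \<open>sw (t + \<sigma> t) = 0\<close> leaves
  two possibilities: the coefficients are the claimed ones, or \<open>\<sigma> t = - t\<close>, and then only \<open>c + c'\<close> matters.
\<close>

lemma section_same_sign:
  assumes sw: "Modules.additive sw" and descends: "\<And>t. wedge t = 0 \<Longrightarrow> sw t = 0" and wedge_sw: "\<And>t. wedge (sw t) = wedge t"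
    and t: "sw t = scT c t - scT c' (\<sigma> t)" "sw (\<sigma> t) = scT c (\<sigma> t) - scT c' (\<sigma> (\<sigma> t))"
    and ker: "wedge (t + \<sigma> t) = 0" and quad: "\<sigma> (\<sigma> t) = scT (\<kappa> - 1) (\<sigma> t) + scT \<kappa> t"
    and eig: "wedge t = 0 \<Longrightarrow> \<sigma> t = scT \<kappa> t" and \<kappa>: "\<kappa> \<noteq> 0" "\<kappa> + 1 \<noteq> 0"
  shows "sw t = scT (1 / (1 + 1 / \<kappa>)) (t - scT (1 / \<kappa>) (\<sigma> t))"
proof -
  interpret complex_space scT by (rule csT)
  have \<kappa>': "1 / (1 + 1 / \<kappa>) = \<kappa> / (\<kappa> + 1)" "1 / (1 + 1 / \<kappa>) * (1 / \<kappa>) = 1 / (\<kappa> + 1)" using \<kappa> by (simp_all add: field_simps)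
  show ?thesis
  proof (cases "wedge t = 0")
    case True
    then have "scT (1 / \<kappa>) (\<sigma> t) = t" using \<kappa> by (simp add: eig)
    then show ?thesis by (simp add: descends[OF True])
  next
    case False
    then have c: "c = 1 - c'" using section_coefficients[where sw = sw, OF t(1) wedge_sw ker] by (simp add: eq_diff_eq)
    have "scT (c - c' * \<kappa>) (t + \<sigma> t) = sw (t + \<sigma> t)"
      unfolding additiveD(1)[OF sw] t quad
      by (simp add: scale_left_distrib scale_left_diff_distrib scale_right_distrib scale_right_diff_distrib right_diff_distrib algebra_simps)
    also have "\<dots> = 0" by (rule descends[OF ker])
    finally consider "c = c' * \<kappa>" | "t + \<sigma> t = 0" by auto
    then show ?thesis
    proof cases
      case 1
      have "c' * (\<kappa> + 1) = 1" using c 1 by (simp add: algebra_simps)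
      then have "c' = 1 / (\<kappa> + 1)" using \<kappa>(2) by (simp add: field_simps)
      with 1 show ?thesis unfolding t(1) scale_right_diff_distrib scale_scale \<kappa>' using \<kappa>(1) by simp
    next
      case 2
      then have s: "\<sigma> t = - t" by (simp add: eq_neg_iff_add_eq_0 add.commute)
      have "\<kappa> / (\<kappa> + 1) + 1 / (\<kappa> + 1) = 1" using \<kappa>(2) by (simp add: field_simps)
      then have "scT (\<kappa> / (\<kappa> + 1)) t + scT (1 / (\<kappa> + 1)) t = t" unfolding scale_left_distrib[symmetric] by simp
      moreover have "scT c t + scT c' t = t" unfolding scale_left_distrib[symmetric] c by simp
      ultimately show ?thesis unfolding t(1) scale_right_diff_distrib scale_scale \<kappa>' s using \<kappa>(1) by simp
    qed
  qed
qed

text \<open>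
  The equation \<open>sw (t + \<sigma> t) = 0\<close> is sorted by type; in each summand a multiple of a single element remains.
\<close>

lemma section_mixed:
  assumes sw: "Modules.additive sw" and descends: "\<And>t. wedge t = 0 \<Longrightarrow> sw t = 0"
    and pm: "\<And>t. t \<in> Tpm \<Longrightarrow> sw t = scT cpm t - scT cpm' (\<sigma> t)"
    and mp: "\<And>t. t \<in> Tmp \<Longrightarrow> sw t = scT cmp t - scT cmp' (\<sigma> t)"
    and ker: "wedge (t + \<sigma> t) = 0"
  shows "t \<in> Tpm \<Longrightarrow> sw t = scT cpm t - scT cmp (\<sigma> t)" "t \<in> Tmp \<Longrightarrow> sw t = scT cmp t - scT cpm (\<sigma> t)"
proof -
  interpret complex_space scT by (rule csT)
  have minus: "- u \<in> tensor_part tens M N" if "u \<in> tensor_part tens M N" for u M N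
    using that unfolding tensor_part_def by (rule subgroup_gen.minus)
  note i = tensor_part_add minus tensor_part_scale sigma_swaps_parts Omega_part_closed(3)
  have sum: "sw t + sw (\<sigma> t) = 0" using descends[OF ker] unfolding additiveD(1)[OF sw] .
  show "sw t = scT cpm t - scT cmp (\<sigma> t)" if t: "t \<in> Tpm"
  proof -
    have "(scT cpm t + - scT cmp' (\<sigma> (\<sigma> t))) + (scT cmp (\<sigma> t) + - scT cpm' (\<sigma> t)) = 0"
      using sum unfolding pm[OF t] mp[OF sigma_swaps_parts(1)[OF t]] by (simp add: algebra_simps)
    moreover from this have "scT cpm t + - scT cmp' (\<sigma> (\<sigma> t)) = 0"
      by (rule mixed_parts_disjoint) (intro i t; assumption)+
    ultimately have "scT cpm' (\<sigma> t) = scT cmp (\<sigma> t)" by auto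
    then show ?thesis unfolding pm[OF t] by simp
  qed
  show "sw t = scT cmp t - scT cpm (\<sigma> t)" if t: "t \<in> Tmp"
  proof -
    have "(scT cpm (\<sigma> t) + - scT cmp' (\<sigma> t)) + (scT cmp t + - scT cpm' (\<sigma> (\<sigma> t))) = 0"
      using sum unfolding mp[OF t] pm[OF sigma_swaps_parts(2)[OF t]] by (simp add: algebra_simps)
    then have "scT cpm (\<sigma> t) + - scT cmp' (\<sigma> t) = 0"
      by (rule mixed_parts_disjoint) (intro i t; assumption)+
    then have "scT cmp' (\<sigma> t) = scT cpm (\<sigma> t)" by auto
    then show ?thesis unfolding mp[OF t] by simp
  qed
qed

theorem section_form:
  assumes sw: "Modules.additive sw" and descends: "\<And>t. wedge t = 0 \<Longrightarrow> sw t = 0" and wedge_sw: "\<And>t. wedge (sw t) = wedge t"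
    and pp: "\<And>t. t \<in> Tpp \<Longrightarrow> sw t = scT cpp t - scT cpp' (\<sigma> t)"
    and mm: "\<And>t. t \<in> Tmm \<Longrightarrow> sw t = scT cmm t - scT cmm' (\<sigma> t)"
    and pm: "\<And>t. t \<in> Tpm \<Longrightarrow> sw t = scT cpm t - scT cpm' (\<sigma> t)"
    and mp: "\<And>t. t \<in> Tmp \<Longrightarrow> sw t = scT cmp t - scT cmp' (\<sigma> t)"
  shows "sw (tens (dp I) (dp J)) = scT (1 / (1 + qpow (- a))) (tens (dp I) (dp J) - scT (qpow (- a)) (\<sigma> (tens (dp I) (dp J))))"
    "sw (tens (dbp I) (dbp J)) = scT (1 / (1 + qpow a)) (tens (dbp I) (dbp J) - scT (qpow a) (\<sigma> (tens (dbp I) (dbp J))))"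
    "sw (tens (dp I) (dbp J)) = scT cpm (tens (dp I) (dbp J)) - scT cmp (\<sigma> (tens (dp I) (dbp J)))"
    "sw (tens (dbp I) (dp J)) = scT cmp (tens (dbp I) (dp J)) - scT cpm (\<sigma> (tens (dbp I) (dp J)))"
    "cpm + cmp = 1"
proof -
  obtain i j k l where IJ: "I = (i, j)" "J = (k, l)" by (cases I; cases J)
  let ?K = "(i, j, k, l)"
  have fam: "fam_prod tens x v ?K = tens (x I) (v J)" for x v :: "'n \<times> 'n \<Rightarrow> 'o" by (simp add: fam_prod_def IJ)
  note parts = fam_parts[of ?K, unfolded fam] and sparts = sigma_gen_parts[of ?K, unfolded fam] and ker = wedge_sigma[of ?K, unfolded fam]
  have q1: "q^2 + 1 \<noteq> 0" using q_pos by (smt (verit) zero_le_power2)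
  have "Q^2 + 1 = of_real (q^2 + 1)" by (simp add: Q_def)
  then have Q1: "Q^2 + 1 \<noteq> 0" using q1 of_real_eq_0_iff by metis
  then have Q2: "1 / Q^2 + 1 \<noteq> 0" using Q_nz by (simp add: field_simps)
  have Q0: "Q^2 \<noteq> 0" "1 / Q^2 \<noteq> 0" using Q_nz by simp_all
  have inv: "1 / (1 / Q^2) = Q^2" by simp
  show "sw (tens (dp I) (dp J)) = scT (1 / (1 + qpow (- a))) (tens (dp I) (dp J) - scT (qpow (- a)) (\<sigma> (tens (dp I) (dp J))))"
    unfolding qpow_values
    by (rule section_same_sign[OF sw descends wedge_sw pp[OF parts(1)] pp[OF sparts(1)] ker(1) \<sigma>_quadratic_DD[of ?K, unfolded fam] sigma_on_relations(1)[OF parts(1)] Q0(1) Q1])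
  show "sw (tens (dbp I) (dbp J)) = scT (1 / (1 + qpow a)) (tens (dbp I) (dbp J) - scT (qpow a) (\<sigma> (tens (dbp I) (dbp J))))"
    unfolding qpow_values
    by (rule section_same_sign[OF sw descends wedge_sw mm[OF parts(2)] mm[OF sparts(2)] ker(2) \<sigma>_quadratic_BB[of ?K, unfolded fam] sigma_on_relations(2)[OF parts(2)] Q0(2) Q2, unfolded inv])
  show "sw (tens (dp I) (dbp J)) = scT cpm (tens (dp I) (dbp J)) - scT cmp (\<sigma> (tens (dp I) (dbp J)))"
    by (rule section_mixed(1)[OF sw descends pm mp ker(4) parts(3)])
  show "sw (tens (dbp I) (dp J)) = scT cmp (tens (dbp I) (dp J)) - scT cpm (\<sigma> (tens (dbp I) (dp J)))"
    by (rule section_mixed(2)[OF sw descends pm mp ker(3) parts(4)])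
  show "cpm + cmp = 1"
  proof -
    obtain h where h: "pos h = 1" using position_exists[OF bij_pos, of 1] by auto
    obtain g where g: "pos g = 2" using position_exists[OF bij_pos, of 2] r_ge_1 by auto
    let ?t = "tens (dp (g, h)) (dbp (h, g))"
    have t: "?t = DB (g, h, h, g)" by (simp add: fam_prod_def)
    have "sw ?t = scT cpm ?t - scT cmp (\<sigma> ?t)"
      unfolding t by (rule section_mixed(1)[OF sw descends pm mp wedge_sigma(4) fam_parts(3)])
    then show ?thesis using section_coefficients[where sw = sw, OF _ wedge_sw wedge_sigma(4)[of "(g, h, h, g)"], folded t] wedge_nonzero[OF h g] by blast
  qed
qed

end

theorem proposition4p1:
  fixes r s :: nat and q :: real and V :: "('n::finite) uq_module" and wt :: "'n \<Rightarrow> weight"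
    and \<eta> :: "complex \<Rightarrow> 'b::ring_1" and p :: "'n \<times> 'n \<Rightarrow> 'b"
    and lact :: "'b \<Rightarrow> 'o \<Rightarrow> 'o::ab_group_add" and ract :: "'o \<Rightarrow> 'b \<Rightarrow> 'o"
    and del delbar :: "'b \<Rightarrow> 'o"
    and tens :: "'o \<Rightarrow> 'o \<Rightarrow> 't::ab_group_add"
    and lactT :: "'b \<Rightarrow> 't \<Rightarrow> 't" and ractT :: "'t \<Rightarrow> 'b \<Rightarrow> 't"
    and wedge :: "'t \<Rightarrow> 'w::ab_group_add"
    and \<sigma> sw :: "'t \<Rightarrow> 't" and c c' :: "sign \<Rightarrow> sign \<Rightarrow> complex"
  defines "sc \<equiv> scl \<eta> lactT"
    and "D \<equiv> (\<lambda>x. case x of Pos \<Rightarrow> del | Neg \<Rightarrow> delbar)"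
    and "qa \<equiv> (\<lambda>x. complex_of_real (q powr x))"
    and "a \<equiv> form r (simple_root s) (simple_root s)"
  assumes setting:
      "generalized_braiding r s q V wt \<eta> p lact ract del delbar tens lactT ractT wedge \<sigma>"
    and sw_additive: "Modules.additive sw"
    and sw_form: "\<And>x y t. t \<in> tensor_part tens (Omega_part lact p (D x)) (Omega_part lact p (D y)) \<Longrightarrow>
      sw t = sc (c x y) t - sc (c' x y) (\<sigma> t)"
    and descends: "\<And>t. wedge t = 0 \<Longrightarrow> sw t = 0"
    and wedge_sw: "\<And>t. wedge (sw t) = wedge t"
  shows "(\<forall>I J. let t = tens (del (p I)) (del (p J)) in
            sw t = sc (1 / (1 + qa (- a))) (t - sc (qa (- a)) (\<sigma> t)))
       \<and> (\<forall>I J. let t = tens (delbar (p I)) (delbar (p J)) in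
            sw t = sc (1 / (1 + qa a)) (t - sc (qa a) (\<sigma> t)))
       \<and> (\<forall>I J. let t = tens (del (p I)) (delbar (p J)) in
            sw t = sc (c Pos Neg) t - sc (c Neg Pos) (\<sigma> t))
       \<and> (\<forall>I J. let t = tens (delbar (p I)) (del (p J)) in
            sw t = sc (c Neg Pos) t - sc (c Pos Neg) (\<sigma> t))
       \<and> c Pos Neg + c Neg Pos = 1"
proof -
  interpret B: generalized_braiding r s q V wt \<eta> p lact ract del delbar tens lactT ractT wedge \<sigma>
    by (rule setting)
  have D: "D Pos = del" "D Neg = delbar" by (simp_all add: D_def)
  have qa: "qa = B.qpow" and a: "a = B.a" by (auto simp: qa_def a_def B.qpow_def B.a_def)
  note form = sw_form[of _ Pos Pos, unfolded D] sw_form[of _ Neg Neg, unfolded D] sw_form[of _ Pos Neg, unfolded D] sw_form[of _ Neg Pos, unfolded D]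
  note result = B.section_form[OF sw_additive descends wedge_sw form[unfolded sc_def]]
  show ?thesis unfolding Let_def sc_def qa a using result by blast
qed

end
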